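(* Let $n\ge 2$, let $\theta$ be a real antisymmetric $n\times n$ matrix, and let $P\in\Psi^{-n}(\mathbb{T}^n_\theta)$. For every $a\in A_\theta$ the operator $aP$ is strongly measurable (as an operator in $\mathscr{L}^{1,\infty}(\mathscr{H}_\theta)$), and $$ \int\!\!\!\!\!\!-\, aP=\frac1n\tau(a\,c_P),\qquad c_P:=\int_{\mathbb{S}^{n-1}}\rho_{-n}(\xi)\,d^{n-1}\xi\in\mathscr{A}_\theta, $$ where $\rho_{-n}(\xi)$ is the symbol of degree $-n$ of $P$.
   Context: Noncommutative torus. Let $\theta_1,\dots,\theta_n$ be the columns of $\theta$, $\mathbb{T}^n=\mathbb{R}^n/2\pi\mathbb{Z}^n$, and let $L^2(\mathbb{T}^n)$ have inner product $(2\pi)^{-n}\int \xi\bar\eta\,dx$. Let $U_j$ be the unitaries $(U_j\xi)(x)=e^{ix_j}\xi(x+\pi\theta_j)$ on $L^2(\mathbb{T}^n)$, $U^k=U_1^{k_1}\cdots U_n^{k_n}$ for $k\in\mathbb{Z}^n$, and let $A_\theta$ be the $C^*$-algebra they generate. $\tau(T)=\langle T1|1\rangle$ is a tracial state on $A_\theta$ with $\tau(1)=1$, $\tau(U^k)=0$ for $k\ne0$. $\mathscr{H}_\theta$ is the Hilbert space completion of $A_\theta$ for $\langle u|v\rangle=\tau(uv^* )$; $(U^k)_{k\in\mathbb{Z}^n}$ is an orthonormal basis, and $A_\theta$ acts on $\mathscr{H}_\theta$ by left multiplication. $\mathscr{A}_\theta=\{\sum u_kU^k:\ (u_k)\text{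 rapidly decaying}\}$ is the smooth subalgebra of $A_\theta$, and $\delta_j$ are its derivations with $\delta_j(U^k)=k_jU^k$; $\delta^\alpha=\delta_1^{\alpha_1}\cdots\delta_n^{\alpha_n}$. $\mathscr{A}_\theta$ is a Fréchet $*$-algebra for the semi-norms $u\mapsto\|\delta^\alpha u\|$ ($\|\cdot\|$ the norm of $A_\theta$). Pseudodifferential operators. $S_q(\mathbb{R}^n;\mathscr{A}_\theta)$ is the space of $\rho\in C^\infty(\mathbb{R}^n\setminus0;\mathscr{A}_\theta)$ with $\rho(t\xi)=t^q\rho(\xi)$ for $t>0$. $S^q(\mathbb{R}^n;\mathscr{A}_\theta)$ is the space of $\rho\in C^\infty(\mathbb{R}^n;\mathscr{A}_\theta)$ with $\rho\sim\sum_{j\ge0}\rho_{q-j}$, $\rho_{q-j}\in S_{q-j}(\mathbb{R}^n;\mathscr{A}_\theta)$, meaning that for all $N\ge 0$ and multi-orders $\alpha,\beta$ there is $C_{N\alpha\beta}$ with $\|\delta^\alpha\partial_\xi^\beta(\rho-\sum_{j<N}\rho_{q-j})(\xi)\|\le C_{N\alpha\beta}|\xi|^{\Re q-N-|\beta|}$ for $|\xi|\ge1$. $\Psi^q(\mathbb{T}^n_\theta)$ is the set of operators $P_\rho:\mathscr{A}_\theta\to\mathscr{A}_\theta$, $P_\rho(\sum u_kU^k)=\sum_k u_k\rho(k)U^k$, with $\rho\in S^q(\mathbb{R}^n;\mathscr{A}_\theta)$. The homogeneous symbols $\rho_{q-j}$ are uniquely determined by $P=P_\rho$. Operators in $\Psi^{-n}(\mathbb{T}^n_\theta)$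 extend to operators in $\mathscr{L}^{1,\infty}(\mathscr{H}_\theta)$ and are identified with these extensions. Noncommutative integral. For a separable Hilbert space $\mathscr{H}$, $\mathscr{L}^{1,\infty}(\mathscr{H})$ is the ideal of compact operators $T$ whose singular values satisfy $\mu_k(T)=O(k^{-1})$. A trace on $\mathscr{L}^{1,\infty}$ is a linear form vanishing on all commutators $[A,T]$, $A\in\mathscr{L}(\mathscr{H})$, $T\in\mathscr{L}^{1,\infty}$. It is positive if it is non-negative on positive operators, and normalized if it takes the value $1$ on any positive operator with $\mu_k=(k+1)^{-1}$ for all $k\ge0$. $T\in\mathscr{L}^{1,\infty}$ is strongly measurable if there is $L\in\mathbb{C}$ with $\varphi(T)=L$ for every normalized positive trace $\varphi$; then $\int\!\!\!\!\!-\,T:=L$. *)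

theory Defs
  imports "HOL-Analysis.Analysis"
begin

section \<open>Complex Hilbert spaces and their bounded operators\<close>

class scaleC =
  fixes scaleC :: "complex \<Rightarrow> 'a \<Rightarrow> 'a" (infixr \<open>*\<^sub>C\<close> 75)

class cinner_space = real_inner + scaleC +
  fixes cinner :: "'a \<Rightarrow> 'a \<Rightarrow> complex"
  assumes scaleC_add_right: "c *\<^sub>C (x + y) = c *\<^sub>C x + c *\<^sub>C y"
    and scaleC_add_left: "(c + d) *\<^sub>C x = c *\<^sub>C x + d *\<^sub>C x"
    and scaleC_scaleC: "c *\<^sub>C d *\<^sub>C x = (c * d) *\<^sub>C x"
    and scaleC_of_real: "complex_of_real r *\<^sub>C x = r *\<^sub>R x"
    and cinner_add_left: "cinner (x + y) z = cinner x z + cinner y z"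
    and cinner_scaleC_left: "cinner (c *\<^sub>C x) y = c * cinner x y"
    and cinner_commute: "cinner x y = cnj (cinner y x)"
    and Re_cinner: "Re (cinner x y) = x \<bullet> y"

class chilbert_space = cinner_space + complete_space

lemma cinner_self: "cinner (x :: 'a::cinner_space) x = complex_of_real ((norm x)\<^sup>2)"
  using cinner_commute[of x x] Re_cinner[of x x]
  by (simp add: complex_eq_iff power2_norm_eq_inner)

lemma norm_scaleC: "norm (c *\<^sub>C (x :: 'a::cinner_space)) = cmod c * norm x"
proof -
  have "cinner (c *\<^sub>C x) (c *\<^sub>C x) = c * cnj c * cinner x x"
    using cinner_commute[of x "c *\<^sub>C x"] cinner_commute[of x x]
    by (simp add: cinner_scaleC_left)
  then have "complex_of_real ((norm (c *\<^sub>C x))\<^sup>2) = complex_of_real ((cmod c * norm x)\<^sup>2)"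
    unfolding cinner_self by (simp only: of_real_mult power_mult_distrib complex_norm_square)
  then show ?thesis
    by (metis of_real_eq_iff norm_ge_zero mult_nonneg_nonneg power2_eq_imp_eq)
qed

lemma scaleC_scaleR: "c *\<^sub>C (r *\<^sub>R (x :: 'a::cinner_space)) = r *\<^sub>R (c *\<^sub>C x)"
  by (simp add: scaleC_of_real[symmetric] scaleC_scaleC mult.commute)

instantiation blinfun :: (real_normed_vector, cinner_space) scaleC
begin

lift_definition scaleC_blinfun :: "complex \<Rightarrow> 'a \<Rightarrow>\<^sub>L 'b \<Rightarrow> 'a \<Rightarrow>\<^sub>L 'b"
  is "\<lambda>c T x. c *\<^sub>C T x"
proof -
  fix c and T :: "'a \<Rightarrow> 'b"
  assume "bounded_linear T"
  then interpret T: bounded_linear T .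
  obtain K where K: "\<And>x. norm (T x) \<le> norm x * K"
    using T.bounded by blast
  show "bounded_linear (\<lambda>x. c *\<^sub>C T x)"
  proof (rule bounded_linear_intro[where K = "cmod c * K"])
    fix x y r
    show "c *\<^sub>C T (x + y) = c *\<^sub>C T x + c *\<^sub>C T y"
      by (simp add: T.add scaleC_add_right)
    show "c *\<^sub>C T (r *\<^sub>R x) = r *\<^sub>R c *\<^sub>C T x"
      by (simp add: T.scaleR scaleC_scaleR)
    show "norm (c *\<^sub>C T x) \<le> norm x * (cmod c * K)"
      using mult_left_mono[OF K[of x] norm_ge_zero[of c]] by (simp add: norm_scaleC ac_simps)
  qed
qed

instance ..

end

text \<open>The type \<^typ>\<open>'a \<Rightarrow>\<^sub>L 'a\<close> consists of the \<^emph>\<open>real\<close>-linear bounded operators;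
  \<open>complex_ops\<close> cuts out the usual algebra of bounded operators.\<close>

definition complex_ops :: "('a::cinner_space \<Rightarrow>\<^sub>L 'a) set" where
  "complex_ops = {T. \<forall>c x. blinfun_apply T (c *\<^sub>C x) = c *\<^sub>C blinfun_apply T x}"

definition is_adjoint :: "('a::cinner_space \<Rightarrow>\<^sub>L 'a) \<Rightarrow> ('a \<Rightarrow>\<^sub>L 'a) \<Rightarrow> bool" where
  "is_adjoint T S \<longleftrightarrow>
    (\<forall>x y. cinner (blinfun_apply T x) y = cinner x (blinfun_apply S y))"

definition adj :: "('a::cinner_space \<Rightarrow>\<^sub>L 'a) \<Rightarrow> ('a \<Rightarrow>\<^sub>L 'a)" where
  "adj T = (THE S. is_adjoint T S)"

definition positive_op :: "('a::cinner_space \<Rightarrow>\<^sub>L 'a) \<Rightarrow> bool" where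
  "positive_op T \<longleftrightarrow> T \<in> complex_ops \<and> (\<forall>x. cinner (blinfun_apply T x) x \<in> \<real>\<^sub>\<ge>\<^sub>0)"

text \<open>The topology of \<^typ>\<open>'a \<Rightarrow>\<^sub>L 'a\<close> is that of the operator norm.\<close>

definition cstar_subalgebra :: "('a::cinner_space \<Rightarrow>\<^sub>L 'a) set \<Rightarrow> bool" where
  "cstar_subalgebra B \<longleftrightarrow> closed B \<and>
    (\<forall>S\<in>B. \<forall>T\<in>B. S + T \<in> B \<and> S o\<^sub>L T \<in> B) \<and>
    (\<forall>c. \<forall>T\<in>B. c *\<^sub>C T \<in> B) \<and>
    (\<forall>T\<in>B. \<forall>S. is_adjoint T S \<longrightarrow> S \<in> B)"

definition cstar_generated :: "('a::cinner_space \<Rightarrow>\<^sub>L 'a) set \<Rightarrow> ('a \<Rightarrow>\<^sub>L 'a) set" where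
  "cstar_generated G = \<Inter>{B. cstar_subalgebra B \<and> G \<subseteq> B}"


section \<open>The weak trace class and the noncommutative integral\<close>

definition compact_op :: "('h::chilbert_space \<Rightarrow>\<^sub>L 'h) \<Rightarrow> bool" where
  "compact_op T \<longleftrightarrow> T \<in> complex_ops \<and> compact (closure (blinfun_apply T ` cball 0 1))"

text \<open>For compact \<open>T\<close>, \<open>singular_value T k\<close> is the \<open>(k+1)\<close>-st largest eigenvalue, counted with
  multiplicity, of \<open>|T|\<close> (whose eigenvectors of eigenvalue \<open>s \<ge> 0\<close> are those of \<open>T\<^sup>*T\<close> of
  eigenvalue \<open>s\<^sup>2\<close>): the largest \<open>t\<close> such that there are \<open>k + 1\<close> orthonormal eigenvectors with
  eigenvalues \<open>\<ge> t\<close>, and \<open>0\<close> if there are none.\<close>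

definition singular_value :: "('h::chilbert_space \<Rightarrow>\<^sub>L 'h) \<Rightarrow> nat \<Rightarrow> real" where
  "singular_value T k = Sup (insert 0 {t. 0 \<le> t \<and>
     (\<exists>(e :: nat \<Rightarrow> 'h) (s :: nat \<Rightarrow> real).
        (\<forall>i\<le>k. \<forall>j\<le>k. cinner (e i) (e j) = (if i = j then 1 else 0)) \<and>
        (\<forall>i\<le>k. t \<le> s i \<and> blinfun_apply (adj T o\<^sub>L T) (e i) = (s i)\<^sup>2 *\<^sub>R e i))})"

definition weak_trace_class :: "('h::chilbert_space \<Rightarrow>\<^sub>L 'h) set" where
  "weak_trace_class =
    {T. compact_op T \<and> (\<lambda>k. singular_value T k) \<in> O(\<lambda>k. 1 / real k)}"

definition weak_trace :: "(('h::chilbert_space \<Rightarrow>\<^sub>L 'h) \<Rightarrow> complex) \<Rightarrow> bool" where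
  "weak_trace \<phi> \<longleftrightarrow>
    (\<forall>S\<in>weak_trace_class. \<forall>T\<in>weak_trace_class. \<phi> (S + T) = \<phi> S + \<phi> T) \<and>
    (\<forall>c. \<forall>T\<in>weak_trace_class. \<phi> (c *\<^sub>C T) = c * \<phi> T) \<and>
    (\<forall>A\<in>complex_ops. \<forall>T\<in>weak_trace_class. \<phi> ((A o\<^sub>L T) - (T o\<^sub>L A)) = 0)"

definition positive_trace :: "(('h::chilbert_space \<Rightarrow>\<^sub>L 'h) \<Rightarrow> complex) \<Rightarrow> bool" where
  "positive_trace \<phi> \<longleftrightarrow> weak_trace \<phi> \<and>
    (\<forall>T\<in>weak_trace_class. positive_op T \<longrightarrow> \<phi> T \<in> \<real>\<^sub>\<ge>\<^sub>0)"

definition normalized_trace :: "(('h::chilbert_space \<Rightarrow>\<^sub>L 'h) \<Rightarrow> complex) \<Rightarrow> bool" where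
  "normalized_trace \<phi> \<longleftrightarrow> weak_trace \<phi> \<and>
    (\<forall>T\<in>weak_trace_class. positive_op T \<and> (\<forall>k. singular_value T k = 1 / (real k + 1)) \<longrightarrow>
       \<phi> T = 1)"

text \<open>As with \<^const>\<open>has_integral\<close>: \<open>has_nc_integral T L\<close> says that \<open>T\<close> is strongly measurable
  and its noncommutative integral is \<open>L\<close>.\<close>

definition has_nc_integral :: "('h::chilbert_space \<Rightarrow>\<^sub>L 'h) \<Rightarrow> complex \<Rightarrow> bool" where
  "has_nc_integral T L \<longleftrightarrow> T \<in> weak_trace_class \<and>
    (\<forall>\<phi>. positive_trace \<phi> \<and> normalized_trace \<phi> \<longrightarrow> \<phi> T = L)"

definition strongly_measurable :: "('h::chilbert_space \<Rightarrow>\<^sub>L 'h) \<Rightarrow> bool" where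
  "strongly_measurable T \<longleftrightarrow> (\<exists>L. has_nc_integral T L)"


section \<open>The Hilbert space of square-integrable functions on the torus\<close>

text \<open>Functions on the torus are \<open>2\<pi>\<close>-periodic functions on \<open>\<real>\<^sup>n\<close>. The measure
  \<open>(2\<pi>)\<^sup>-\<^sup>n dx\<close> is realised on the fundamental domain \<open>[0, 2\<pi>]\<^sup>n\<close>; for periodic
  functions, equality a.e. there is equality a.e.\<close>

definition torus_measure :: "(real ^ 'n::finite) measure" where
  "torus_measure = uniform_measure lborel (cbox 0 (\<chi> i. 2 * pi))"

definition torus_square_integrable :: "(real ^ 'n::finite \<Rightarrow> complex) \<Rightarrow> bool" where
  "torus_square_integrable f \<longleftrightarrow>
    (\<forall>x i. f (x + (2 * pi) *\<^sub>R axis i 1) = f x) \<and>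
    f \<in> borel_measurable borel \<and>
    integrable torus_measure (\<lambda>x. (cmod (f x))\<^sup>2)"

definition torus_l2_rel ::
    "(real ^ 'n::finite \<Rightarrow> complex) \<Rightarrow> (real ^ 'n \<Rightarrow> complex) \<Rightarrow> bool" where
  "torus_l2_rel f g \<longleftrightarrow> torus_square_integrable f \<and> torus_square_integrable g \<and>
    (AE x in torus_measure. f x = g x)"

lemma space_torus_measure [simp]: "space torus_measure = UNIV"
  and sets_torus_measure [simp, measurable_cong]: "sets torus_measure = sets borel"
  by (simp_all add: torus_measure_def)

lemma emeasure_torus_measure_UNIV: "emeasure (torus_measure :: (real ^ 'n::finite) measure) UNIV = 1"
proof -
  let ?B = "cbox 0 (\<chi> i. 2 * pi) :: (real ^ 'n) set"
  have 0: "emeasure lborel ?B = ennreal ((2 * pi) ^ CARD('n))"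
    unfolding emeasure_lborel_cbox_eq
    by (simp add: Basis_vec_def inner_axis UNION_singleton_eq_range prod.reindex inj_on_def
        axis_eq_axis)
  show ?thesis
    unfolding torus_measure_def by (subst emeasure_uniform_measure) (simp_all add: 0 ennreal_divide_self)
qed

lemma torus_square_integrable_const: "torus_square_integrable (\<lambda>x. c)"
  unfolding torus_square_integrable_def
  by (auto simp: emeasure_torus_measure_UNIV intro!: finite_measure.integrable_const
      finite_measureI)

lemma torus_square_integrable_mult:
  assumes "torus_square_integrable f"
  shows "torus_square_integrable (\<lambda>x. c * f x)"
  using assms unfolding torus_square_integrable_def
  by (auto simp: norm_mult power_mult_distrib)

lemma torus_square_integrable_add:
  assumes "torus_square_integrable f" "torus_square_integrable g"
  shows "torus_square_integrable (\<lambda>x. f x + g x)"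
proof -
  have [measurable]: "f \<in> borel_measurable borel" "g \<in> borel_measurable borel"
    using assms by (auto simp: torus_square_integrable_def)
  have "integrable torus_measure (\<lambda>x. (cmod (f x + g x))\<^sup>2)"
  proof (rule Bochner_Integration.integrable_bound)
    show "integrable torus_measure (\<lambda>x. 2 * (cmod (f x))\<^sup>2 + 2 * (cmod (g x))\<^sup>2)"
      using assms by (auto simp: torus_square_integrable_def)
    have "(cmod (a + b))\<^sup>2 \<le> 2 * (cmod a)\<^sup>2 + 2 * (cmod b)\<^sup>2" for a b
    proof -
      have "(cmod (a + b))\<^sup>2 \<le> (cmod a + cmod b)\<^sup>2"
        by (simp add: norm_triangle_ineq power_mono)
      also have "\<dots> \<le> 2 * (cmod a)\<^sup>2 + 2 * (cmod b)\<^sup>2"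
        using sum_squares_bound[of "cmod a" "cmod b"] by (simp add: power2_sum)
      finally show ?thesis .
    qed
    then show "AE x in torus_measure. norm ((cmod (f x + g x))\<^sup>2)
        \<le> norm (2 * (cmod (f x))\<^sup>2 + 2 * (cmod (g x))\<^sup>2)"
      by auto
  qed measurable
  with assms show ?thesis
    by (auto simp: torus_square_integrable_def)
qed

lemma borel_measurable_cnj [measurable]: "cnj \<in> borel_measurable borel"
  by (intro borel_measurable_continuous_onI continuous_intros)

lemma torus_integrable_prod:
  assumes "torus_square_integrable f" "torus_square_integrable g"
  shows "integrable torus_measure (\<lambda>x. f x * cnj (g x))"
proof -
  have [measurable]: "f \<in> borel_measurable borel" "g \<in> borel_measurable borel"
    using assms by (auto simp: torus_square_integrable_def)
  show ?thesis
  proof (rule Bochner_Integration.integrable_bound)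
    show "integrable torus_measure (\<lambda>x. (cmod (f x))\<^sup>2 + (cmod (g x))\<^sup>2)"
      using assms by (auto simp: torus_square_integrable_def)
    have "cmod a * cmod b \<le> (cmod a)\<^sup>2 + (cmod b)\<^sup>2" for a b
      using sum_squares_bound[of "cmod a" "cmod b"]
        mult_nonneg_nonneg[OF norm_ge_zero[of a] norm_ge_zero[of b]]
      by linarith
    then show "AE x in torus_measure. norm (f x * cnj (g x))
        \<le> norm ((cmod (f x))\<^sup>2 + (cmod (g x))\<^sup>2)"
      by (auto simp: norm_mult)
  qed measurable
qed

quotient_type 'n torus_l2 =
  "real ^ ('n::finite) \<Rightarrow> complex" / partial: torus_l2_rel
proof (rule part_equivpI)
  show "\<exists>f :: real ^ 'n \<Rightarrow> complex. torus_l2_rel f f"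
    using torus_square_integrable_const[of 0] by (auto simp: torus_l2_rel_def)
  show "symp (torus_l2_rel :: (real ^ 'n \<Rightarrow> complex) \<Rightarrow> _)"
    by (auto simp: torus_l2_rel_def intro!: sympI elim: eventually_mono)
  show "transp (torus_l2_rel :: (real ^ 'n \<Rightarrow> complex) \<Rightarrow> _)"
    by (auto simp: torus_l2_rel_def intro!: transpI elim: eventually_elim2)
qed

instantiation torus_l2 :: (finite) cinner_space
begin

lift_definition zero_torus_l2 :: "'a torus_l2" is "\<lambda>_. 0"
  by (simp add: torus_l2_rel_def torus_square_integrable_const)

lift_definition plus_torus_l2 :: "'a torus_l2 \<Rightarrow> 'a torus_l2 \<Rightarrow> 'a torus_l2"
  is "\<lambda>f g x. f x + g x"
  by (auto simp: torus_l2_rel_def intro: torus_square_integrable_add elim: eventually_elim2)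

lift_definition scaleC_torus_l2 :: "complex \<Rightarrow> 'a torus_l2 \<Rightarrow> 'a torus_l2"
  is "\<lambda>c f x. c * f x"
  by (auto simp: torus_l2_rel_def intro: torus_square_integrable_mult elim: eventually_mono)

lift_definition cinner_torus_l2 :: "'a torus_l2 \<Rightarrow> 'a torus_l2 \<Rightarrow> complex"
  is "\<lambda>f g. integral\<^sup>L torus_measure (\<lambda>x. f x * cnj (g x))"
proof -
  fix f f' g g' :: "real ^ 'a \<Rightarrow> complex"
  assume *: "torus_l2_rel f f'" "torus_l2_rel g g'"
  then have [measurable]: "f \<in> borel_measurable borel" "g \<in> borel_measurable borel"
      "f' \<in> borel_measurable borel" "g' \<in> borel_measurable borel"
    by (auto simp: torus_l2_rel_def torus_square_integrable_def)
  show "integral\<^sup>L torus_measure (\<lambda>x. f x * cnj (g x)) =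
      integral\<^sup>L torus_measure (\<lambda>x. f' x * cnj (g' x))"
  proof (rule integral_cong_AE)
    show "AE x in torus_measure. f x * cnj (g x) = f' x * cnj (g' x)"
      using * by (auto simp: torus_l2_rel_def elim: eventually_elim2)
  qed measurable
qed

definition scaleR_torus_l2 :: "real \<Rightarrow> 'a torus_l2 \<Rightarrow> 'a torus_l2" where
  "scaleR_torus_l2 r f = complex_of_real r *\<^sub>C f"

definition uminus_torus_l2 :: "'a torus_l2 \<Rightarrow> 'a torus_l2" where
  "uminus_torus_l2 f = (-1) *\<^sub>C f"

definition minus_torus_l2 :: "'a torus_l2 \<Rightarrow> 'a torus_l2 \<Rightarrow> 'a torus_l2" where
  "minus_torus_l2 f g = f + - g"

definition inner_torus_l2 :: "'a torus_l2 \<Rightarrow> 'a torus_l2 \<Rightarrow> real" where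
  "inner_torus_l2 f g = Re (cinner f g)"

definition norm_torus_l2 :: "'a torus_l2 \<Rightarrow> real" where
  "norm_torus_l2 f = sqrt (f \<bullet> f)"

definition sgn_torus_l2 :: "'a torus_l2 \<Rightarrow> 'a torus_l2" where
  "sgn_torus_l2 f = inverse (norm f) *\<^sub>R f"

definition dist_torus_l2 :: "'a torus_l2 \<Rightarrow> 'a torus_l2 \<Rightarrow> real" where
  "dist_torus_l2 f g = norm (f - g)"

definition uniformity_torus_l2 :: "('a torus_l2 \<times> 'a torus_l2) filter" where
  "uniformity_torus_l2 = (INF e\<in>{0<..}. principal {(f, g). dist f g < e})"

definition open_torus_l2 :: "'a torus_l2 set \<Rightarrow> bool" where
  "open_torus_l2 U \<longleftrightarrow> (\<forall>f\<in>U. \<forall>\<^sub>F (f', g) in uniformity. f' = f \<longrightarrow> g \<in> U)"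

instance
proof
  fix f g h :: "'a torus_l2" and c d :: complex and r r' :: real
  note rel = torus_l2_rel_def torus_square_integrable_const torus_square_integrable_add
    torus_square_integrable_mult algebra_simps
  show "f + g + h = f + (g + h)" by transfer (auto simp: rel)
  show comm: "f + g = g + f" by transfer (auto simp: rel)
  show zero: "0 + f = f" for f :: "'a torus_l2" by transfer (auto simp: rel)
  show "- f + f = 0" unfolding uminus_torus_l2_def by transfer (auto simp: rel)
  show "f - g = f + - g" by (rule minus_torus_l2_def)
  show addr: "c *\<^sub>C (f + g) = c *\<^sub>C f + c *\<^sub>C g" for c by transfer (auto simp: rel)
  show addl: "(c + d) *\<^sub>C f = c *\<^sub>C f + d *\<^sub>C f" for c d by transfer (auto simp: rel)
  show assoc: "c *\<^sub>C d *\<^sub>C f = (c * d) *\<^sub>C f" for c d by transfer (auto simp: rel)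
  show "r *\<^sub>R (f + g) = r *\<^sub>R f + r *\<^sub>R g"
    unfolding scaleR_torus_l2_def by (rule addr)
  show "(r + r') *\<^sub>R f = r *\<^sub>R f + r' *\<^sub>R f"
    unfolding scaleR_torus_l2_def using addl by simp
  show "r *\<^sub>R r' *\<^sub>R f = (r * r') *\<^sub>R f"
    unfolding scaleR_torus_l2_def using assoc by simp
  show "1 *\<^sub>R f = f"
    unfolding scaleR_torus_l2_def by transfer (auto simp: rel)
  show "complex_of_real r *\<^sub>C f = r *\<^sub>R f" by (simp add: scaleR_torus_l2_def)
  show cadd: "cinner (f + g) h = cinner f h + cinner g h" for f g h :: "'a torus_l2"
    by transfer (auto simp: torus_l2_rel_def ring_distribs torus_integrable_prod)
  show cscale: "cinner (c *\<^sub>C f) g = c * cinner f g" for c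
    by transfer (auto simp: torus_l2_rel_def mult.assoc)
  show ccomm: "cinner f g = cnj (cinner g f)" for f g :: "'a torus_l2"
    by transfer (simp only: Bochner_Integration.integral_cnj[symmetric] complex_cnj_mult complex_cnj_cnj mult.commute)
  show "Re (cinner f g) = f \<bullet> g" by (simp add: inner_torus_l2_def)
  show "f \<bullet> g = g \<bullet> f" unfolding inner_torus_l2_def by (subst ccomm) simp
  show "(f + g) \<bullet> h = f \<bullet> h + g \<bullet> h" by (simp add: inner_torus_l2_def cadd)
  show "(r *\<^sub>R f) \<bullet> g = r * (f \<bullet> g)"
    by (simp add: inner_torus_l2_def scaleR_torus_l2_def cscale)
  have self: "f \<bullet> f = integral\<^sup>L torus_measure (\<lambda>x. (cmod (rep_torus_l2 f x))\<^sup>2)"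
    and sq: "torus_square_integrable (rep_torus_l2 f)"
  proof -
    show sq: "torus_square_integrable (rep_torus_l2 f)"
      using Quotient3_rep_reflp[OF Quotient3_torus_l2, of f] by (simp add: torus_l2_rel_def)
    show "f \<bullet> f = integral\<^sup>L torus_measure (\<lambda>x. (cmod (rep_torus_l2 f x))\<^sup>2)"
      unfolding inner_torus_l2_def cinner_torus_l2_def
      by (simp add: complex_norm_square[symmetric] del: of_real_power)
  qed
  show "0 \<le> f \<bullet> f" unfolding self by simp
  show "f \<bullet> f = 0 \<longleftrightarrow> f = 0"
  proof
    assume "f \<bullet> f = 0"
    then have "AE x in torus_measure. (cmod (rep_torus_l2 f x))\<^sup>2 = 0"
      unfolding self using sq
      by (subst (asm) integral_nonneg_eq_0_iff_AE) (auto simp: torus_square_integrable_def)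
    then have "torus_l2_rel (rep_torus_l2 f) (\<lambda>_. 0)"
      using sq by (auto simp: torus_l2_rel_def torus_square_integrable_const elim: eventually_mono)
    then show "f = 0"
      unfolding zero_torus_l2_def
      by (metis Quotient3_abs_rep Quotient3_rel_abs Quotient3_torus_l2)
  next
    show "f = 0 \<Longrightarrow> f \<bullet> f = 0"
      using cadd[of f f f] zero by (simp add: inner_torus_l2_def)
  qed
qed (auto simp: norm_torus_l2_def sgn_torus_l2_def dist_torus_l2_def uniformity_torus_l2_def
      open_torus_l2_def)

end

lift_definition torus_one :: "('n::finite) torus_l2" is "\<lambda>_. 1"
  by (simp add: torus_l2_rel_def torus_square_integrable_const)


section \<open>The noncommutative torus\<close>

(* Synonyms for real ^ 'n etc., which would force the sort finite on a bare 'n. *)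
type_synonym 'n rvec = "(real, 'n) vec"
type_synonym 'n ivec = "(int, 'n) vec"
type_synonym 'n rmat = "((real, 'n) vec, 'n) vec"

type_synonym 'n torus_op = "'n torus_l2 \<Rightarrow>\<^sub>L 'n torus_l2"

definition torus_U :: "('n::finite) rmat \<Rightarrow> 'n \<Rightarrow> 'n torus_op" where
  "torus_U \<theta> j = Blinfun (\<lambda>\<xi>. abs_torus_l2
     (\<lambda>x. exp (\<i> * complex_of_real (x $ j)) * rep_torus_l2 \<xi> (x + pi *\<^sub>R column j \<theta>)))"

text \<open>Integer powers of unitaries, whose inverse is the adjoint.\<close>

definition unitary_power :: "('a::cinner_space \<Rightarrow>\<^sub>L 'a) \<Rightarrow> int \<Rightarrow> ('a \<Rightarrow>\<^sub>L 'a)" where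
  "unitary_power T m =
    (((o\<^sub>L) (if 0 \<le> m then T else adj T)) ^^ nat \<bar>m\<bar>) id_blinfun"

text \<open>The coordinates are indexed by a linearly ordered finite type, which fixes the order of the
  factors in \<open>U\<^sub>1\<^bsup>k\<^sub>1\<^esup> \<cdots> U\<^sub>n\<^bsup>k\<^sub>n\<^esup>\<close>.\<close>

definition torus_Upow ::
    "'n rmat \<Rightarrow> 'n ivec \<Rightarrow> ('n::{finite,linorder}) torus_op" where
  "torus_Upow \<theta> k = foldr (\<lambda>j T. unitary_power (torus_U \<theta> j) (k $ j) o\<^sub>L T)
     (sorted_list_of_set UNIV) id_blinfun"

definition nc_torus :: "'n rmat \<Rightarrow> ('n::finite) torus_op set" where
  "nc_torus \<theta> = cstar_generated (range (torus_U \<theta>))"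

definition tau :: "('n::finite) torus_op \<Rightarrow> complex" where
  "tau T = cinner (blinfun_apply T torus_one) torus_one"

definition lattice_vec :: "('n::finite) ivec \<Rightarrow> 'n rvec" where
  "lattice_vec k = (\<chi> i. of_int (k $ i))"

definition rapidly_decaying :: "(('n::finite) ivec \<Rightarrow> complex) \<Rightarrow> bool" where
  "rapidly_decaying u \<longleftrightarrow>
    (\<forall>N::nat. \<exists>C. \<forall>k. (1 + norm (lattice_vec k)) ^ N * cmod (u k) \<le> C)"

definition torus_series ::
    "'n rmat \<Rightarrow> ('n ivec \<Rightarrow> complex) \<Rightarrow> ('n::{finite,linorder}) torus_op" where
  "torus_series \<theta> u = (\<Sum>\<^sub>\<infinity>k. u k *\<^sub>C torus_Upow \<theta> k)"

definition smooth_nc_torus :: "'n rmat \<Rightarrow> ('n::{finite,linorder}) torus_op set" where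
  "smooth_nc_torus \<theta> = torus_series \<theta> ` {u. rapidly_decaying u}"

definition torus_coeffs ::
    "'n rmat \<Rightarrow> ('n::{finite,linorder}) torus_op \<Rightarrow> 'n ivec \<Rightarrow> complex" where
  "torus_coeffs \<theta> T = (THE u. rapidly_decaying u \<and> torus_series \<theta> u = T)"

definition torus_deriv ::
    "'n rmat \<Rightarrow> 'n \<Rightarrow> ('n::{finite,linorder}) torus_op \<Rightarrow> 'n torus_op" where
  "torus_deriv \<theta> j T = torus_series \<theta> (\<lambda>k. of_int (k $ j) * torus_coeffs \<theta> T k)"

text \<open>\<open>multi_iterate D \<alpha> = D\<^sub>1\<^bsup>\<alpha>\<^sub>1\<^esup> \<cdots> D\<^sub>n\<^bsup>\<alpha>\<^sub>n\<^esup>\<close>\<close>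

definition multi_iterate ::
    "('n::{finite,linorder} \<Rightarrow> 'a \<Rightarrow> 'a) \<Rightarrow> ('n \<Rightarrow> nat) \<Rightarrow> 'a \<Rightarrow> 'a" where
  "multi_iterate D \<alpha> = foldr (\<lambda>j. D j ^^ \<alpha> j) (sorted_list_of_set UNIV)"

definition torus_seminorm ::
    "'n rmat \<Rightarrow> ('n \<Rightarrow> nat) \<Rightarrow> ('n::{finite,linorder}) torus_op \<Rightarrow> real" where
  "torus_seminorm \<theta> \<alpha> T = norm (multi_iterate (torus_deriv \<theta>) \<alpha> T)"


section \<open>Symbols and pseudodifferential operators\<close>

definition frechet_tendsto ::
    "'n rmat \<Rightarrow> ('a \<Rightarrow> ('n::{finite,linorder}) torus_op) \<Rightarrow> 'n torus_op \<Rightarrow> 'a filter \<Rightarrow> bool"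
where
  "frechet_tendsto \<theta> f l F \<longleftrightarrow> (\<forall>\<alpha>. ((\<lambda>x. torus_seminorm \<theta> \<alpha> (f x - l)) \<longlongrightarrow> 0) F)"

definition has_partial ::
    "'n rmat \<Rightarrow> 'n \<Rightarrow> ('n rvec \<Rightarrow> ('n::{finite,linorder}) torus_op) \<Rightarrow> 'n rvec \<Rightarrow>
      'n torus_op \<Rightarrow> bool" where
  "has_partial \<theta> j f \<xi> d \<longleftrightarrow> d \<in> smooth_nc_torus \<theta> \<and>
    frechet_tendsto \<theta> (\<lambda>h. (f (\<xi> + h *\<^sub>R axis j 1) - f \<xi>) /\<^sub>R h) d (at (0::real))"

definition partial_deriv ::
    "'n rmat \<Rightarrow> 'n \<Rightarrow> ('n rvec \<Rightarrow> ('n::{finite,linorder}) torus_op) \<Rightarrow>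
      'n rvec \<Rightarrow> 'n torus_op" where
  "partial_deriv \<theta> j f \<xi> = (THE d. has_partial \<theta> j f \<xi> d)"

text \<open>Smooth maps from an open set \<open>V\<close> to the Frechet space \<^term>\<open>smooth_nc_torus \<theta>\<close>:
  all iterated partial derivatives, in any order, exist and are continuous.\<close>

definition smooth_map ::
    "'n rmat \<Rightarrow> ('n rvec) set \<Rightarrow> ('n rvec \<Rightarrow> ('n::{finite,linorder}) torus_op) \<Rightarrow> bool"
where
  "smooth_map \<theta> V f \<longleftrightarrow> (\<forall>js. \<forall>\<xi>\<in>V.
     let g = foldr (partial_deriv \<theta>) js f in
       g \<xi> \<in> smooth_nc_torus \<theta> \<and> frechet_tendsto \<theta> g (g \<xi>) (at \<xi>) \<and>
       (\<forall>j. \<exists>d. has_partial \<theta> j g \<xi> d))"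

definition homogeneous_symbols ::
    "'n rmat \<Rightarrow> complex \<Rightarrow> ('n rvec \<Rightarrow> ('n::{finite,linorder}) torus_op) set" where
  "homogeneous_symbols \<theta> q = {\<rho>. smooth_map \<theta> (- {0}) \<rho> \<and>
     (\<forall>t>0. \<forall>\<xi>. \<xi> \<noteq> 0 \<longrightarrow> \<rho> (t *\<^sub>R \<xi>) = (complex_of_real t powr q) *\<^sub>C \<rho> \<xi>)}"

text \<open>\<open>symbol_expansion \<theta> q \<rho> r\<close>: \<open>\<rho>\<close> is a classical symbol of order \<open>q\<close> with
  \<open>\<rho> \<sim> \<Sum>\<^sub>j r j\<close>, where \<open>r j\<close> is homogeneous of degree \<open>q - j\<close>.\<close>

definition symbol_expansion ::
    "'n rmat \<Rightarrow> complex \<Rightarrow> ('n rvec \<Rightarrow> ('n::{finite,linorder}) torus_op) \<Rightarrow>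
      (nat \<Rightarrow> 'n rvec \<Rightarrow> 'n torus_op) \<Rightarrow> bool" where
  "symbol_expansion \<theta> q \<rho> r \<longleftrightarrow> smooth_map \<theta> UNIV \<rho> \<and>
    (\<forall>j. r j \<in> homogeneous_symbols \<theta> (q - of_nat j)) \<and>
    (\<forall>N \<alpha> \<beta>. \<exists>C. \<forall>\<xi>. 1 \<le> norm \<xi> \<longrightarrow>
       torus_seminorm \<theta> \<alpha>
         (multi_iterate (partial_deriv \<theta>) \<beta> (\<lambda>\<eta>. \<rho> \<eta> - (\<Sum>j<N. r j \<eta>)) \<xi>)
       \<le> C * norm \<xi> powr (Re q - real N - real (\<Sum>i\<in>UNIV. \<beta> i)))"

definition is_quantization ::
    "'n rmat \<Rightarrow> ('n rvec \<Rightarrow> ('n::{finite,linorder}) torus_op) \<Rightarrow>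
      ('n torus_op \<Rightarrow> 'n torus_op) \<Rightarrow> bool" where
  "is_quantization \<theta> \<rho> P \<longleftrightarrow> (\<forall>u. rapidly_decaying u \<longrightarrow>
     P (torus_series \<theta> u) =
       (\<Sum>\<^sub>\<infinity>k. u k *\<^sub>C (\<rho> (lattice_vec k) o\<^sub>L torus_Upow \<theta> k)))"

text \<open>\<open>psido_symbols \<theta> q P r\<close>: \<open>P\<close> is a pseudodifferential operator of order \<open>q\<close> whose
  homogeneous symbol of degree \<open>q - j\<close> is \<open>r j\<close>. Operators are total functions here, of which only
  the restriction to \<^term>\<open>smooth_nc_torus \<theta>\<close> matters; likewise \<open>r j\<close> matters only away
  from \<open>0\<close>.\<close>

definition psido_symbols ::
    "'n rmat \<Rightarrow> complex \<Rightarrow> (('n::{finite,linorder}) torus_op \<Rightarrow> 'n torus_op) \<Rightarrow>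
      (nat \<Rightarrow> 'n rvec \<Rightarrow> 'n torus_op) \<Rightarrow> bool" where
  "psido_symbols \<theta> q P r \<longleftrightarrow> (\<exists>\<rho>. symbol_expansion \<theta> q \<rho> r \<and> is_quantization \<theta> \<rho> P)"

definition psido ::
    "'n rmat \<Rightarrow> complex \<Rightarrow> (('n::{finite,linorder}) torus_op \<Rightarrow> 'n torus_op) set" where
  "psido \<theta> q = {P. \<exists>r. psido_symbols \<theta> q P r}"

text \<open>Integration over the unit sphere for its surface measure, in polar coordinates: the surface
  measure of a subset of the sphere is \<open>n\<close> times the volume of the cone over it in the unit ball.
  The integral is that of Henstock and Kurzweil, which applies to functions with values in
  nonseparable spaces; the value at the origin is irrelevant.\<close>

definition sphere_integral :: "(('n::finite) rvec \<Rightarrow> 'a::real_normed_vector) \<Rightarrow> 'a" where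
  "sphere_integral f =
    real CARD('n) *\<^sub>R integral (cball 0 1) (\<lambda>x :: 'n rvec. f (x /\<^sub>R norm x))"


section \<open>The Hilbert space of the noncommutative torus\<close>

text \<open>\<open>\<iota>\<close> exhibits the Hilbert space \<^typ>\<open>'h\<close> as the completion of the algebra for the inner
  product \<open>\<tau>(uv\<^sup>*)\<close>.\<close>

definition hilbert_completion ::
    "'n rmat \<Rightarrow> (('n::finite) torus_op \<Rightarrow> 'h::chilbert_space) \<Rightarrow> bool" where
  "hilbert_completion \<theta> \<iota> \<longleftrightarrow>
    (\<forall>u\<in>nc_torus \<theta>. \<forall>v\<in>nc_torus \<theta>. \<iota> (u + v) = \<iota> u + \<iota> v) \<and>
    (\<forall>c. \<forall>u\<in>nc_torus \<theta>. \<iota> (c *\<^sub>C u) = c *\<^sub>C \<iota> u) \<and>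
    (\<forall>u\<in>nc_torus \<theta>. \<forall>v\<in>nc_torus \<theta>. cinner (\<iota> u) (\<iota> v) = tau (u o\<^sub>L adj v)) \<and>
    closure (\<iota> ` nc_torus \<theta>) = UNIV"

definition left_mult ::
    "'n rmat \<Rightarrow> (('n::finite) torus_op \<Rightarrow> 'h::chilbert_space) \<Rightarrow> 'n torus_op \<Rightarrow> 'h \<Rightarrow>\<^sub>L 'h"
where
  "left_mult \<theta> \<iota> a = (THE L. \<forall>u\<in>nc_torus \<theta>. blinfun_apply L (\<iota> u) = \<iota> (a o\<^sub>L u))"

definition bounded_extension ::
    "'n rmat \<Rightarrow> (('n::{finite,linorder}) torus_op \<Rightarrow> 'h::chilbert_space) \<Rightarrow>
      ('n torus_op \<Rightarrow> 'n torus_op) \<Rightarrow> 'h \<Rightarrow>\<^sub>L 'h" where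
  "bounded_extension \<theta> \<iota> P = (THE T. \<forall>u\<in>smooth_nc_torus \<theta>. blinfun_apply T (\<iota> u) = \<iota> (P u))"

end

theory Submission
  imports Defs
begin

text \<open>Let \<open>D\<close> be the Fourier multiplier by \<open>|k|\<^sup>-\<^sup>n\<close>. Expanding the symbol in the \<open>U\<^sup>l\<close> gives
  \<open>P = (\<Sum>\<^sub>l U\<^sup>l w\<^sub>l) D\<close> with Fourier multipliers \<open>w\<^sub>l\<close> whose norms decay rapidly in \<open>l\<close>. For a positive
  trace \<open>\<phi>\<close> the functional \<open>B \<mapsto> \<phi> (B D)\<close> is norm continuous, so only \<open>\<phi> (U\<^sup>m w\<^sub>l D)\<close> has to be found. It
  vanishes for \<open>m \<noteq> 0\<close>, by conjugation with the unitaries that implement the dual torus action. For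
  \<open>m = 0\<close> the multiplier \<open>w\<^sub>l D\<close> is homogeneous of degree \<open>-n\<close> up to lower order. By linearity its
  homogeneous part may be taken positive, and then Weyl's law for its decreasing rearrangement,
  a count of lattice points in dilated star-shaped regions, gives the value \<open>1/n\<close> times the integral
  over the sphere for every normalized trace.\<close>

section \<open>Bounded operators on complex Hilbert spaces\<close>

text \<open>A \<open>weak_trace\<close> is a bare linear form: no continuity is assumed, and a
  normalized one is prescribed only on positive operators whose singular values are exactly 1/(k+1).
  Two devices bridge this gap. Continuity along \<open>D\<close> is extracted from positivity and
  cyclicity, through selfadjoint square roots. Values come from comparison: every positive
  multiplier gets its own enumeration of the basis, along which it differs from a multiple of the
  diagonal 1/(j+1) by o(1/j), and positivity forces such a difference to have trace zero. Singular
  values are defined through eigenvectors, from which sums and products are hard to control. The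
  proof therefore stays inside a smaller ideal, described by norms on subspaces of finite
  codimension, where additivity and cyclicity of the trace can be applied freely. The volumes that
  arise are integrals over the unit ball. The factor 1/n in the result is the ratio between such an
  integral and the integral over the sphere.\<close>

instance chilbert_space \<subseteq> banach ..

lemma cinner_add_right: "cinner x (y + z) = cinner x y + cinner x (z :: 'a::cinner_space)"
  by (metis cinner_add_left cinner_commute complex_cnj_add)

lemma cinner_scaleC_right: "cinner x (c *\<^sub>C y) = cnj c * cinner x (y :: 'a::cinner_space)"
  by (metis cinner_scaleC_left cinner_commute complex_cnj_mult)

lemma cinner_scaleR_left: "cinner (r *\<^sub>R x) y = r *\<^sub>R cinner x (y :: 'a::cinner_space)"
  by (metis cinner_scaleC_left scaleC_of_real scaleR_conv_of_real)

lemma cinner_scaleR_right: "cinner x (r *\<^sub>R y) = r *\<^sub>R cinner x (y :: 'a::cinner_space)"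
  by (metis cinner_scaleC_right scaleC_of_real scaleR_conv_of_real complex_cnj_complex_of_real)

text \<open>The phase \<open>u\<close> rotates \<open>x\<close> until the complex product is real
  and nonnegative. It then equals the real inner product, for which Cauchy-Schwarz is known.\<close>

lemma cmod_cinner_le: "cmod (cinner x y) \<le> norm x * norm (y :: 'a::cinner_space)"
proof -
  define u where "u = cnj (sgn (cinner x y))"
  have "complex_of_real (cmod (cinner x y)) = u * cinner x y"
    using complex_norm_square[of "cinner x y"] unfolding u_def
    by (cases "cinner x y = 0")
      (simp_all add: sgn_div_norm scaleR_conv_of_real field_simps power2_eq_square)
  also have "\<dots> = cinner (u *\<^sub>C x) y"
    by (simp add: cinner_scaleC_left)
  finally have "cmod (cinner x y) = (u *\<^sub>C x) \<bullet> y"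
    using Re_cinner by (metis Re_complex_of_real)
  also have "\<dots> \<le> norm (u *\<^sub>C x) * norm y"
    by (rule norm_cauchy_schwarz)
  also have "\<dots> \<le> norm x * norm y"
    by (intro mult_right_mono) (auto simp: norm_scaleC u_def norm_sgn)
  finally show ?thesis .
qed

interpretation cinner: bounded_bilinear "cinner :: 'a::cinner_space \<Rightarrow> 'a \<Rightarrow> complex"
  by standard
    (auto simp: cinner_add_left cinner_add_right cinner_scaleR_left cinner_scaleR_right
      intro!: exI[of _ 1] cmod_cinner_le)

interpretation scaleC: bounded_bilinear "scaleC :: complex \<Rightarrow> 'a::cinner_space \<Rightarrow> 'a"
proof
  fix r c and x :: 'a
  show "(r *\<^sub>R c) *\<^sub>C x = r *\<^sub>R c *\<^sub>C x"
    by (metis scaleC_of_real scaleC_scaleC scaleR_conv_of_real)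
qed (auto simp: scaleC_add_left scaleC_add_right scaleC_scaleR norm_scaleC intro!: exI[of _ 1])

lemma scaleC_one [simp]: "1 *\<^sub>C x = (x :: 'a::cinner_space)"
  using scaleC_of_real[of 1 x] by simp

lemma scaleC_minus_one: "(-1) *\<^sub>C x = - (x :: 'a::cinner_space)"
  using scaleC.minus_left[of 1 x] by simp

lemma cinner_ext:
  assumes "\<And>z. cinner x z = cinner y z"
  shows "x = (y :: 'a::cinner_space)"
proof -
  have "cinner (x - y) (x - y) = 0"
    using assms by (simp add: cinner.diff_left)
  then show ?thesis
    by (simp add: cinner_self)
qed

lemma cinner_ext_right:
  assumes "\<And>z. cinner z x = cinner z y"
  shows "x = (y :: 'a::cinner_space)"
  by (rule cinner_ext) (metis assms cinner_commute)

lemma scaleC_blinfun_apply [simp]: "blinfun_apply (c *\<^sub>C T) x = c *\<^sub>C blinfun_apply T x"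
  by (simp add: scaleC_blinfun.rep_eq)

lemma norm_scaleC_blinfun: "norm (c *\<^sub>C (T :: 'a::real_normed_vector \<Rightarrow>\<^sub>L 'b::cinner_space)) = cmod c * norm T"
proof -
  have le: "norm (c *\<^sub>C T) \<le> cmod c * norm T" for c and T :: "'a \<Rightarrow>\<^sub>L 'b"
    by (rule norm_blinfun_bound)
      (auto simp: norm_scaleC mult.assoc intro!: mult_left_mono norm_blinfun)
  show ?thesis
  proof (cases "c = 0")
    case True
    then show ?thesis using le[of c T] by simp
  next
    case False
    have "T = inverse c *\<^sub>C (c *\<^sub>C T)"
      using False by (intro blinfun_eqI) (simp add: scaleC_scaleC)
    then have "norm T \<le> cmod (inverse c) * norm (c *\<^sub>C T)"
      using le[of "inverse c" "c *\<^sub>C T"] by simp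
    also have "\<dots> = norm (c *\<^sub>C T) / cmod c"
      by (simp add: norm_inverse divide_inverse mult.commute)
    finally have "cmod c * norm T \<le> norm (c *\<^sub>C T)"
      using False by (simp add: field_simps)
    with le show ?thesis by (simp add: order_antisym)
  qed
qed

interpretation scaleC_blinfun: bounded_bilinear
  "scaleC :: complex \<Rightarrow> ('a::real_normed_vector \<Rightarrow>\<^sub>L 'b::cinner_space) \<Rightarrow> _"
  by standard
    (auto intro!: blinfun_eqI exI[of _ 1]
      simp: blinfun.add_left blinfun.scaleR_left scaleC_add_left scaleC_add_right
        scaleC.scaleR_left scaleC.scaleR_right norm_scaleC_blinfun)

lemma scaleC_blinfun_scaleC: "c *\<^sub>C d *\<^sub>C T = (c * d) *\<^sub>C (T :: 'a::real_normed_vector \<Rightarrow>\<^sub>L 'b::cinner_space)"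
  by (rule blinfun_eqI) (simp add: scaleC_scaleC)

lemma scaleC_blinfun_one [simp]: "1 *\<^sub>C T = (T :: 'a::real_normed_vector \<Rightarrow>\<^sub>L 'b::cinner_space)"
  by (rule blinfun_eqI) simp

lemma scaleC_blinfun_of_real:
  "complex_of_real r *\<^sub>C T = r *\<^sub>R (T :: 'a::real_normed_vector \<Rightarrow>\<^sub>L 'b::cinner_space)"
  by (rule blinfun_eqI) (simp add: scaleC_of_real blinfun.scaleR_left)

lemma scaleC_blinfun_minus_one: "(-1) *\<^sub>C T = - (T :: 'a::real_normed_vector \<Rightarrow>\<^sub>L 'b::cinner_space)"
  using scaleC_blinfun.minus_left[of 1 T] by simp

lemma blinfun_compose_assoc': "(S o\<^sub>L T) o\<^sub>L R = S o\<^sub>L (T o\<^sub>L R)"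
  by (rule blinfun_eqI) simp

lemma blinfun_compose_id [simp]: "id_blinfun o\<^sub>L T = T" "T o\<^sub>L id_blinfun = T"
  by (auto intro: blinfun_eqI)

lemma scaleC_compose_left: "(c *\<^sub>C S) o\<^sub>L T = c *\<^sub>C (S o\<^sub>L T)"
  for S :: "'b::real_normed_vector \<Rightarrow>\<^sub>L 'c::cinner_space"
  by (rule blinfun_eqI) simp

lemma scaleC_compose_right: "S \<in> complex_ops \<Longrightarrow> S o\<^sub>L (c *\<^sub>C T) = c *\<^sub>C (S o\<^sub>L T)"
  by (rule blinfun_eqI) (simp add: complex_ops_def)

lemma complex_opsD: "T \<in> complex_ops \<Longrightarrow> blinfun_apply T (c *\<^sub>C x) = c *\<^sub>C blinfun_apply T x"
  by (simp add: complex_ops_def)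

lemma complex_ops_0 [intro, simp]: "0 \<in> complex_ops"
  and complex_ops_id [intro, simp]: "id_blinfun \<in> complex_ops"
  by (auto simp: complex_ops_def scaleC.zero_right)

lemma complex_ops_add [intro]: "S \<in> complex_ops \<Longrightarrow> T \<in> complex_ops \<Longrightarrow> S + T \<in> complex_ops"
  and complex_ops_diff [intro]: "S \<in> complex_ops \<Longrightarrow> T \<in> complex_ops \<Longrightarrow> S - T \<in> complex_ops"
  and complex_ops_uminus [intro]: "T \<in> complex_ops \<Longrightarrow> - T \<in> complex_ops"
  and complex_ops_scaleC [intro]: "T \<in> complex_ops \<Longrightarrow> c *\<^sub>C T \<in> complex_ops"
  and complex_ops_scaleR [intro]: "T \<in> complex_ops \<Longrightarrow> r *\<^sub>R T \<in> complex_ops"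
  and complex_ops_compose [intro]: "S \<in> complex_ops \<Longrightarrow> T \<in> complex_ops \<Longrightarrow> S o\<^sub>L T \<in> complex_ops"
  by (auto simp: complex_ops_def blinfun.add_left blinfun.diff_left blinfun.minus_left
      blinfun.scaleR_left scaleC_add_right scaleC.diff_right scaleC.minus_right scaleC.scaleR_right
      scaleC_scaleC mult.commute)

lemma closed_complex_ops: "closed (complex_ops :: ('a::cinner_space \<Rightarrow>\<^sub>L 'a) set)"
proof -
  have "closed {T :: 'a \<Rightarrow>\<^sub>L 'a. blinfun_apply T (c *\<^sub>C x) = c *\<^sub>C blinfun_apply T x}" for c x
    by (intro closed_Collect_eq continuous_intros linear_continuous_on
        bounded_linear_compose[OF scaleC.bounded_linear_right] blinfun.bounded_linear_left)
  then have "closed (\<Inter>c. \<Inter>x. {T :: 'a \<Rightarrow>\<^sub>L 'a. blinfun_apply T (c *\<^sub>C x) = c *\<^sub>C blinfun_apply T x})"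
    by auto
  also have "(\<Inter>c. \<Inter>x. {T :: 'a \<Rightarrow>\<^sub>L 'a. blinfun_apply T (c *\<^sub>C x) = c *\<^sub>C blinfun_apply T x}) = complex_ops"
    by (auto simp: complex_ops_def)
  finally show ?thesis .
qed

lemma complex_ops_infsum:
  fixes f :: "'i \<Rightarrow> 'a::cinner_space \<Rightarrow>\<^sub>L 'a"
  assumes "\<And>i. f i \<in> complex_ops" "f summable_on UNIV"
  shows "infsum f UNIV \<in> complex_ops"
proof (rule Lim_in_closed_set[OF closed_complex_ops])
  have "sum f F \<in> complex_ops" for F
    using assms(1) by (induction F rule: infinite_finite_induct) auto
  then show "\<forall>\<^sub>F F in finite_subsets_at_top UNIV. sum f F \<in> complex_ops"
    by simp
  show "(sum f \<longlongrightarrow> infsum f UNIV) (finite_subsets_at_top UNIV)"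
    using assms(2) by (rule infsum_tendsto)
qed simp

subsection \<open>Adjoints\<close>

lemma parallelogram:
  "(norm (x - y))\<^sup>2 = 2 * (norm x)\<^sup>2 + 2 * (norm y)\<^sup>2 - (norm (x + y))\<^sup>2"
  for x y :: "'a::real_inner"
  by (simp add: power2_norm_eq_inner inner_diff inner_add inner_commute)

text \<open>The representing vector minimises \<open>\<parallel>x\<parallel>\<^sup>2 - 2 f x\<close>; by the parallelogram law every minimising
  sequence is Cauchy.\<close>

lemma riesz_real:
  fixes f :: "'a::{real_inner, complete_space} \<Rightarrow> real"
  assumes "bounded_linear f"
  shows "\<exists>v. \<forall>x. f x = x \<bullet> v"
proof -
  interpret f: bounded_linear f by fact
  obtain K where K: "\<And>x. norm (f x) \<le> norm x * K" and "K > 0"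
    using f.pos_bounded by blast
  define J where "J x = (norm x)\<^sup>2 - 2 * f x" for x
  have J_ge: "J x \<ge> - (K\<^sup>2)" for x
  proof -
    have "f x \<le> norm x * K" using K[of x] by simp
    moreover have "(norm x - K)\<^sup>2 \<ge> 0" by simp
    ultimately show ?thesis unfolding J_def power2_diff by simp
  qed
  define m where "m = Inf (range J)"
  have bdd: "bdd_below (range J)"
    using J_ge by (auto simp: bdd_below_def)
  have m_le: "m \<le> J x" for x
    unfolding m_def using bdd by (auto intro: cInf_lower)
  have "\<exists>x. J x < m + 1 / Suc k" for k
    using cInf_lessD[of "range J" "m + 1 / Suc k"] unfolding m_def by auto
  then obtain X where X: "\<And>k. J (X k) < m + 1 / Suc k" by metis
  have dist_le: "(norm (X j - X k))\<^sup>2 \<le> 2 / Suc j + 2 / Suc k" for j k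
  proof -
    have "(norm (X j - X k))\<^sup>2 = 2 * J (X j) + 2 * J (X k) - 4 * J ((1/2) *\<^sub>R (X j + X k))"
      unfolding J_def parallelogram[of "X j" "X k"] norm_scaleR f.scaleR f.add power_mult_distrib
      by (simp add: power2_eq_square field_simps)
    also have "\<dots> \<le> 2 * (m + 1 / Suc j) + 2 * (m + 1 / Suc k) - 4 * m"
      using X[of j] X[of k] m_le[of "(1/2) *\<^sub>R (X j + X k)"]
      by (intro diff_mono add_mono mult_left_mono) auto
    also have "\<dots> = 2 / Suc j + 2 / Suc k" by simp
    finally show ?thesis .
  qed
  have "Cauchy X"
  proof (rule metric_CauchyI)
    fix e :: real assume "e > 0"
    then obtain M :: nat where M: "4 / e\<^sup>2 < real M"
      using reals_Archimedean2 by blast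
    have "dist (X j) (X k) < e" if "j \<ge> M" "k \<ge> M" for j k
    proof -
      have "M > 0" using M \<open>e > 0\<close> by (metis gr0I divide_nonneg_nonneg less_le_not_le of_nat_0 zero_le_numeral zero_le_power2)
      have "2 / real (Suc j) \<le> 2 / real M" "2 / real (Suc k) \<le> 2 / real M"
        using that \<open>M > 0\<close> by (auto simp: frac_le)
      then have "(norm (X j - X k))\<^sup>2 \<le> 4 / real M"
        using dist_le[of j k] by simp
      also have "\<dots> < e\<^sup>2"
        using M \<open>e > 0\<close> \<open>M > 0\<close> by (simp add: field_simps)
      finally show ?thesis
        using \<open>e > 0\<close> by (simp add: dist_norm power2_less_imp_less)
    qed
    then show "\<exists>M. \<forall>j\<ge>M. \<forall>k\<ge>M. dist (X j) (X k) < e" by blast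
  qed
  then obtain v where v: "X \<longlonglongrightarrow> v"
    using Cauchy_convergent convergent_def by blast
  have "(\<lambda>k. J (X k)) \<longlonglongrightarrow> J v"
    unfolding J_def by (intro tendsto_intros v f.tendsto)
  moreover have "(\<lambda>k. m + 1 / Suc k) \<longlonglongrightarrow> m + 0"
    by (intro tendsto_intros LIMSEQ_Suc lim_1_over_n)
  ultimately have "J v \<le> m"
    using X by (intro LIMSEQ_le[of "\<lambda>k. J (X k)"]) (auto intro!: exI[of _ 0] less_imp_le)
  then have min: "J v \<le> J x" for x
    using m_le[of x] by linarith
  have "f x = x \<bullet> v" for x
  proof (rule ccontr)
    define d where "d = x \<bullet> v - f x"
    assume "f x \<noteq> x \<bullet> v"
    then have "d \<noteq> 0" by (simp add: d_def)
    then have "x \<noteq> 0" unfolding d_def by (auto simp: f.zero)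
    \<comment> \<open>The minimiser of the quadratic polynomial
      \<open>J v + 2 * t * d + t\<^sup>2 * (norm x)\<^sup>2\<close> in \<open>t\<close>.\<close>
    define t where "t = - d / (norm x)\<^sup>2"
    have "J (v + t *\<^sub>R x) = J v + 2 * t * d + t\<^sup>2 * (norm x)\<^sup>2"
      unfolding J_def d_def power2_norm_eq_inner
      by (simp add: f.add f.scaleR inner_add inner_commute algebra_simps power2_eq_square)
    also have "\<dots> = J v - d\<^sup>2 / (norm x)\<^sup>2"
      using \<open>x \<noteq> 0\<close> unfolding t_def by (simp add: field_simps power2_eq_square)
    also have "\<dots> < J v"
      using \<open>x \<noteq> 0\<close> \<open>d \<noteq> 0\<close> by simp
    finally show False using min[of "v + t *\<^sub>R x"] by simp
  qed
  then show ?thesis by blast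
qed

text \<open>The vector representing the real part of \<open>f\<close> represents \<open>f\<close>
  itself: complex linearity makes the imaginary part at \<open>x\<close> the negative of the real
  part at \<open>\<i> *\<^sub>C x\<close>.\<close>

lemma riesz:
  fixes f :: "'a::chilbert_space \<Rightarrow> complex"
  assumes "bounded_linear f" and cl: "\<And>c x. f (c *\<^sub>C x) = c * f x"
  shows "\<exists>v. \<forall>x. f x = cinner x v"
proof -
  have "bounded_linear (\<lambda>x. Re (f x))"
    by (rule bounded_linear_compose[OF bounded_linear_Re assms(1)])
  then obtain v where v: "\<And>x. Re (f x) = x \<bullet> v"
    using riesz_real by blast
  have "f x = cinner x v" for x
  proof (rule complex_eqI)
    show "Re (f x) = Re (cinner x v)" by (simp add: v Re_cinner)
    show "Im (f x) = Im (cinner x v)"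
      using v[of "\<i> *\<^sub>C x"] cl[of \<i> x] by (simp flip: Re_cinner add: cinner_scaleC_left)
  qed
  then show ?thesis by blast
qed

lemma is_adjoint_unique: "is_adjoint T S \<Longrightarrow> is_adjoint T S' \<Longrightarrow> S = S'"
  unfolding is_adjoint_def by (intro blinfun_eqI cinner_ext_right) metis

lemma adj_eqI: "is_adjoint T S \<Longrightarrow> adj T = S"
  unfolding adj_def by (rule the_equality) (auto intro: is_adjoint_unique)

text \<open>The description in \<open>adj\<close> denotes an adjoint once one exists. For each
  \<open>y\<close> the Riesz vector of the functional taking \<open>x\<close> to
  \<open>cinner (T x) y\<close> is the value of the adjoint at \<open>y\<close>.\<close>

lemma is_adjoint_adj:
  fixes T :: "'a::chilbert_space \<Rightarrow>\<^sub>L 'a"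
  assumes "T \<in> complex_ops"
  shows "is_adjoint T (adj T)"
proof -
  have "\<exists>v. \<forall>x. cinner (blinfun_apply T x) y = cinner x v" for y
    using assms
    by (intro riesz bounded_linear_compose[OF cinner.bounded_linear_left blinfun.bounded_linear_right])
      (simp add: complex_opsD cinner_scaleC_left)
  then obtain S where S: "\<And>x y. cinner (blinfun_apply T x) y = cinner x (S y)"
    by metis
  have "bounded_linear S"
  proof (rule bounded_linear_intro[where K = "norm T"])
    show "S (x + y) = S x + S y" for x y
      by (rule cinner_ext_right) (simp add: cinner_add_right flip: S)
    show "S (r *\<^sub>R x) = r *\<^sub>R S x" for r x
      by (rule cinner_ext_right) (simp add: cinner_scaleR_right flip: S)
    show "norm (S y) \<le> norm y * norm T" for y
    proof (cases "S y = 0")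
      case False
      have "(norm (S y))\<^sup>2 = cmod (cinner (S y) (S y))"
        by (simp add: cinner_self norm_power)
      also have "\<dots> = cmod (cinner (blinfun_apply T (S y)) y)"
        by (simp add: S)
      also have "\<dots> \<le> norm (blinfun_apply T (S y)) * norm y"
        by (rule cmod_cinner_le)
      also have "\<dots> \<le> norm T * norm (S y) * norm y"
        by (intro mult_right_mono norm_blinfun) auto
      finally show ?thesis
        using False by (simp add: power2_eq_square mult.commute mult.left_commute)
    qed simp
  qed
  then have "is_adjoint T (Blinfun S)"
    by (simp add: is_adjoint_def bounded_linear_Blinfun_apply S)
  then show ?thesis
    using adj_eqI by metis
qed

lemma cinner_adj:
  fixes T :: "'a::chilbert_space \<Rightarrow>\<^sub>L 'a"
  assumes "T \<in> complex_ops"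
  shows "\<And>x y. cinner (blinfun_apply T x) y = cinner x (blinfun_apply (adj T) y)"
    and "\<And>x y. cinner (blinfun_apply (adj T) x) y = cinner x (blinfun_apply T y)"
proof -
  show *: "cinner (blinfun_apply T x) y = cinner x (blinfun_apply (adj T) y)" for x y
    using is_adjoint_adj[OF assms] by (simp add: is_adjoint_def)
  show "cinner (blinfun_apply (adj T) x) y = cinner x (blinfun_apply T y)" for x y
    by (metis * cinner_commute)
qed

lemma is_adjoint_complex: "is_adjoint T S \<Longrightarrow> S \<in> complex_ops"
  unfolding complex_ops_def is_adjoint_def
  by clarify (rule cinner_ext_right, metis cinner_scaleC_right)

lemma adj_complex [intro]:
  "T \<in> complex_ops \<Longrightarrow> adj T \<in> complex_ops" for T :: "'a::chilbert_space \<Rightarrow>\<^sub>L 'a"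
  using is_adjoint_adj is_adjoint_complex by blast

lemma is_adjoint_sym: "is_adjoint T S \<Longrightarrow> is_adjoint S T"
  unfolding is_adjoint_def by (metis cinner_commute)

lemma is_adjoint_compose: "is_adjoint T T' \<Longrightarrow> is_adjoint S S' \<Longrightarrow> is_adjoint (S o\<^sub>L T) (T' o\<^sub>L S')"
  by (simp add: is_adjoint_def)

lemma is_adjoint_add: "is_adjoint T T' \<Longrightarrow> is_adjoint S S' \<Longrightarrow> is_adjoint (S + T) (S' + T')"
  by (simp add: is_adjoint_def blinfun.add_left cinner_add_left cinner_add_right)

lemma is_adjoint_diff: "is_adjoint T T' \<Longrightarrow> is_adjoint S S' \<Longrightarrow> is_adjoint (S - T) (S' - T')"
  by (simp add: is_adjoint_def blinfun.diff_left cinner.diff_left cinner.diff_right)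

lemma is_adjoint_scaleC: "is_adjoint T T' \<Longrightarrow> is_adjoint (c *\<^sub>C T) (cnj c *\<^sub>C T')"
  by (simp add: is_adjoint_def cinner_scaleC_left cinner_scaleC_right)

lemma is_adjoint_scaleR: "is_adjoint T T' \<Longrightarrow> is_adjoint (c *\<^sub>R T) (c *\<^sub>R T')"
  by (simp add: is_adjoint_def blinfun.scaleR_left cinner_scaleR_left cinner_scaleR_right)

lemma is_adjoint_id: "is_adjoint id_blinfun id_blinfun"
  by (simp add: is_adjoint_def)

lemma is_adjoint_norm_le: "is_adjoint T S \<Longrightarrow> norm S \<le> norm T"
proof (rule norm_blinfun_bound)
  fix y assume adj: "is_adjoint T S"
  show "norm (blinfun_apply S y) \<le> norm T * norm y"
  proof (cases "blinfun_apply S y = 0")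
    case False
    have "(norm (blinfun_apply S y))\<^sup>2 = cmod (cinner (blinfun_apply S y) (blinfun_apply S y))"
      by (simp add: cinner_self norm_power)
    also have "\<dots> = cmod (cinner (blinfun_apply T (blinfun_apply S y)) y)"
      using adj by (simp add: is_adjoint_def)
    also have "\<dots> \<le> norm (blinfun_apply T (blinfun_apply S y)) * norm y"
      by (rule cmod_cinner_le)
    also have "\<dots> \<le> norm T * norm (blinfun_apply S y) * norm y"
      by (intro mult_right_mono norm_blinfun) auto
    finally show ?thesis
      using False by (simp add: power2_eq_square mult.commute mult.left_commute)
  qed simp
qed simp

lemma is_adjoint_norm: "is_adjoint T S \<Longrightarrow> norm S = norm T"
  using is_adjoint_norm_le is_adjoint_sym by (metis order_antisym)

section \<open>A two-sided ideal inside the weak trace class\<close>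

text \<open>Gaussian elimination, by induction on the equations: a pivot \<open>j\<close> of the new
  equation \<open>w\<close> is eliminated from the others (coefficients \<open>b\<close>), and its
  unknown is afterwards solved for (solution \<open>d\<close>). An equation without pivot imposes
  nothing.\<close>

lemma homogeneous_system_nontrivial:
  fixes a :: "'v \<Rightarrow> 'i \<Rightarrow> 'k::field"
  assumes "finite K" "finite I" "card K < card I"
  shows "\<exists>c. (\<exists>i\<in>I. c i \<noteq> 0) \<and> (\<forall>v\<in>K. (\<Sum>i\<in>I. c i * a v i) = 0)"
  using assms
proof (induction K arbitrary: I a rule: finite_induct)
  case empty
  then obtain i where "i \<in> I" by (metis card.empty equals0I less_irrefl)
  then show ?case by (auto intro!: exI[of _ "\<lambda>_. 1"])
next
  case (insert w K)
  show ?case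
  proof (cases "\<forall>i\<in>I. a w i = 0")
    case True
    have "card K < card I" using insert by simp
    from insert.IH[OF \<open>finite I\<close> this, of a] True show ?thesis by auto
  next
    case False
    then obtain j where j: "j \<in> I" "a w j \<noteq> 0" by blast
    define b where "b v i = a v i - a v j * a w i / a w j" for v i
    have "card K < card (I - {j})" using insert j by simp
    then obtain c where c: "\<exists>i\<in>I - {j}. c i \<noteq> 0" "\<forall>v\<in>K. (\<Sum>i\<in>I - {j}. c i * b v i) = 0"
      using insert.IH[of "I - {j}" b] insert.prems by auto
    define d where "d = c(j := - (\<Sum>i\<in>I - {j}. c i * a w i) / a w j)"
    have split: "(\<Sum>i\<in>I. d i * a v i)
        = - (\<Sum>i\<in>I - {j}. c i * a w i) / a w j * a v j + (\<Sum>i\<in>I - {j}. c i * a v i)" for v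
      using \<open>finite I\<close> j(1) by (simp add: sum.remove[of I j] d_def)
    have "(\<Sum>i\<in>I. d i * a v i) = (\<Sum>i\<in>I - {j}. c i * b v i)" for v
      unfolding split b_def right_diff_distrib sum_subtractf
      by (simp add: sum_divide_distrib sum_distrib_left sum_distrib_right sum_negf mult.assoc mult.commute mult.left_commute)
    with c(2) have "\<forall>v\<in>K. (\<Sum>i\<in>I. d i * a v i) = 0" by simp
    moreover have "(\<Sum>i\<in>I. d i * a w i) = 0"
      unfolding split using j(2) by simp
    moreover have "\<exists>i\<in>I. d i \<noteq> 0"
      using c(1) by (auto simp: d_def)
    ultimately show ?thesis by auto
  qed
qed

lemma cinner_sum_orthonormal:
  fixes e :: "'i \<Rightarrow> 'a::cinner_space"
  assumes "finite I" "\<And>i j. i \<in> I \<Longrightarrow> j \<in> I \<Longrightarrow> cinner (e i) (e j) = (if i = j then 1 else 0)"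
  shows "cinner (\<Sum>i\<in>I. a i *\<^sub>C e i) (\<Sum>i\<in>I. b i *\<^sub>C e i) = (\<Sum>i\<in>I. a i * cnj (b i))"
proof -
  have "cinner (\<Sum>i\<in>I. a i *\<^sub>C e i) (\<Sum>i\<in>I. b i *\<^sub>C e i)
      = (\<Sum>i\<in>I. \<Sum>j\<in>I. a i * cnj (b j) * cinner (e i) (e j))"
    by (simp add: cinner.sum_left cinner.sum_right cinner_scaleC_left cinner_scaleC_right
        sum_distrib_left mult.assoc mult.left_commute) (rule sum.swap)
  also have "\<dots> = (\<Sum>i\<in>I. \<Sum>j\<in>I. if i = j then a i * cnj (b j) else 0)"
    using assms(2) by (intro sum.cong) auto
  also have "\<dots> = (\<Sum>i\<in>I. a i * cnj (b i))"
    using assms(1) by simp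
  finally show ?thesis .
qed

lemma norm_sum_orthonormal:
  fixes e :: "'i \<Rightarrow> 'a::cinner_space"
  assumes "finite I" "\<And>i j. i \<in> I \<Longrightarrow> j \<in> I \<Longrightarrow> cinner (e i) (e j) = (if i = j then 1 else 0)"
  shows "(norm (\<Sum>i\<in>I. a i *\<^sub>C e i))\<^sup>2 = (\<Sum>i\<in>I. (cmod (a i))\<^sup>2)"
proof -
  have "complex_of_real ((norm (\<Sum>i\<in>I. a i *\<^sub>C e i))\<^sup>2) = (\<Sum>i\<in>I. a i * cnj (a i))"
    unfolding cinner_self[symmetric] by (rule cinner_sum_orthonormal[OF assms])
  also have "\<dots> = complex_of_real (\<Sum>i\<in>I. (cmod (a i))\<^sup>2)"
    by (simp add: complex_norm_square[symmetric])
  finally show ?thesis using of_real_eq_iff by blast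
qed

text \<open>One half of the min-max principle. The span of \<open>k + 1\<close> eigenvectors
  contains a nonzero \<open>x\<close> orthogonal to the at most \<open>k\<close> vectors of
  \<open>K\<close>; for it \<open>t * norm x \<le> norm (T x) \<le> r * norm x\<close>.\<close>

lemma eigenvalue_le_on_complement:
  fixes T :: "'h::chilbert_space \<Rightarrow>\<^sub>L 'h" and e :: "nat \<Rightarrow> 'h"
  assumes T: "T \<in> complex_ops"
    and K: "finite K" "card K \<le> k" "\<And>x. (\<And>v. v \<in> K \<Longrightarrow> cinner x v = 0) \<Longrightarrow> norm (blinfun_apply T x) \<le> r * norm x"
    and e: "\<And>i j. i \<le> k \<Longrightarrow> j \<le> k \<Longrightarrow> cinner (e i) (e j) = (if i = j then 1 else 0)"
    and ev: "\<And>i. i \<le> k \<Longrightarrow> t \<le> s i \<and> blinfun_apply (adj T o\<^sub>L T) (e i) = (s i)\<^sup>2 *\<^sub>R e i"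
    and "0 \<le> t" "0 \<le> r"
  shows "t \<le> r"
proof -
  obtain c where c: "\<exists>i\<in>{..k}. c i \<noteq> 0" "\<forall>v\<in>K. (\<Sum>i\<in>{..k}. c i * cinner (e i) v) = 0"
    using homogeneous_system_nontrivial[of K "{..k}" "\<lambda>v i. cinner (e i) v"] K(1,2) by auto
  define x where "x = (\<Sum>i\<le>k. c i *\<^sub>C e i)"
  have "cinner x v = 0" if "v \<in> K" for v
    using c(2) that by (simp add: x_def cinner.sum_left cinner_scaleC_left)
  then have Tx: "norm (blinfun_apply T x) \<le> r * norm x" by (rule K(3))
  have nx: "(norm x)\<^sup>2 = (\<Sum>i\<le>k. (cmod (c i))\<^sup>2)"
    unfolding x_def using e by (intro norm_sum_orthonormal) auto
  from c(1) have "(norm x)\<^sup>2 > 0"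
    unfolding nx by (auto intro!: sum_pos2)
  have "complex_of_real ((norm (blinfun_apply T x))\<^sup>2) = cinner (blinfun_apply (adj T o\<^sub>L T) x) x"
    using cinner_adj(2)[OF T] by (simp add: cinner_self)
  also have "blinfun_apply (adj T o\<^sub>L T) x = (\<Sum>i\<le>k. c i *\<^sub>C blinfun_apply (adj T o\<^sub>L T) (e i))"
    using T complex_ops_compose[OF adj_complex[OF T] T] unfolding x_def
    by (simp only: blinfun.sum_right complex_opsD)
  also have "\<dots> = (\<Sum>i\<le>k. (c i * of_real ((s i)\<^sup>2)) *\<^sub>C e i)"
    using ev by (intro sum.cong) (auto simp: scaleC_of_real[symmetric] scaleC_scaleC)
  also have "cinner \<dots> x = (\<Sum>i\<le>k. c i * of_real ((s i)\<^sup>2) * cnj (c i))"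
    unfolding x_def using e by (intro cinner_sum_orthonormal) auto
  also have "\<dots> = complex_of_real (\<Sum>i\<le>k. (s i)\<^sup>2 * (cmod (c i))\<^sup>2)"
    by (auto simp: complex_norm_square simp del: of_real_power intro!: sum.cong)
  finally have "(norm (blinfun_apply T x))\<^sup>2 = (\<Sum>i\<le>k. (s i)\<^sup>2 * (cmod (c i))\<^sup>2)"
    using of_real_eq_iff by blast
  also have "\<dots> \<ge> (\<Sum>i\<le>k. t\<^sup>2 * (cmod (c i))\<^sup>2)"
    using ev \<open>0 \<le> t\<close> by (intro sum_mono mult_right_mono power_mono) auto
  finally have "t\<^sup>2 * (norm x)\<^sup>2 \<le> (norm (blinfun_apply T x))\<^sup>2"
    by (simp add: nx sum_distrib_left)
  also have "\<dots> \<le> r\<^sup>2 * (norm x)\<^sup>2"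
    using power_mono[OF Tx, of 2] by (simp add: power_mult_distrib)
  finally have "t\<^sup>2 \<le> r\<^sup>2"
    using \<open>(norm x)\<^sup>2 > 0\<close> by simp
  then show ?thesis
    using \<open>0 \<le> r\<close> power2_le_imp_le by blast
qed

lemma singular_value_le:
  fixes T :: "'h::chilbert_space \<Rightarrow>\<^sub>L 'h"
  assumes "T \<in> complex_ops" "finite K" "card K \<le> k" "0 \<le> r"
    and "\<And>x. (\<And>v. v \<in> K \<Longrightarrow> cinner x v = 0) \<Longrightarrow> norm (blinfun_apply T x) \<le> r * norm x"
  shows "singular_value T k \<le> r"
  unfolding singular_value_def
proof (rule cSup_least)
  show "t \<le> r" if "t \<in> insert 0 {t. 0 \<le> t \<and>
     (\<exists>(e :: nat \<Rightarrow> 'h) (s :: nat \<Rightarrow> real).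
        (\<forall>i\<le>k. \<forall>j\<le>k. cinner (e i) (e j) = (if i = j then 1 else 0)) \<and>
        (\<forall>i\<le>k. t \<le> s i \<and> blinfun_apply (adj T o\<^sub>L T) (e i) = (s i)\<^sup>2 *\<^sub>R e i))}" for t
  proof (cases "t = 0")
    case False
    with that obtain e s where es: "0 \<le> t"
      "\<And>i j. i \<le> k \<Longrightarrow> j \<le> k \<Longrightarrow> cinner (e i) (e j) = (if i = j then 1 else (0::complex))"
      "\<And>i. i \<le> k \<Longrightarrow> t \<le> s i \<and> blinfun_apply (adj T o\<^sub>L T) (e i) = (s i)\<^sup>2 *\<^sub>R e i"
      by blast
    show ?thesis
      using eigenvalue_le_on_complement[OF assms(1,2,3,5) es(2,3,1) assms(4)] by simp
  qed (use assms in simp)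
qed simp

text \<open>A supremum of reals is meaningful only for a set bounded above. The bound is the
  preceding principle with no constraints, \<open>K\<close> empty and
  \<open>r = norm T\<close>.\<close>

lemma bdd_above_singular_value:
  fixes T :: "'h::chilbert_space \<Rightarrow>\<^sub>L 'h"
  assumes "T \<in> complex_ops"
  shows "bdd_above (insert 0 {t. 0 \<le> t \<and>
     (\<exists>(e :: nat \<Rightarrow> 'h) (s :: nat \<Rightarrow> real).
        (\<forall>i\<le>k. \<forall>j\<le>k. cinner (e i) (e j) = (if i = j then 1 else 0)) \<and>
        (\<forall>i\<le>k. t \<le> s i \<and> blinfun_apply (adj T o\<^sub>L T) (e i) = (s i)\<^sup>2 *\<^sub>R e i))})"
    (is "bdd_above ?S")
proof (rule bdd_aboveI)
  show "t \<le> norm T" if "t \<in> ?S" for t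
  proof (cases "t = 0")
    case False
    with that obtain e s where es: "0 \<le> t"
      "\<And>i j. i \<le> k \<Longrightarrow> j \<le> k \<Longrightarrow> cinner (e i) (e j) = (if i = j then 1 else (0::complex))"
      "\<And>i. i \<le> k \<Longrightarrow> t \<le> s i \<and> blinfun_apply (adj T o\<^sub>L T) (e i) = (s i)\<^sup>2 *\<^sub>R e i"
      by blast
    show ?thesis
      by (rule eigenvalue_le_on_complement[OF assms finite.emptyI _ norm_blinfun es(2,3,1)]) auto
  qed simp
qed

lemma singular_value_ge:
  fixes T :: "'h::chilbert_space \<Rightarrow>\<^sub>L 'h" and e :: "nat \<Rightarrow> 'h"
  assumes "T \<in> complex_ops" "0 \<le> t"
    and "\<And>i j. i \<le> k \<Longrightarrow> j \<le> k \<Longrightarrow> cinner (e i) (e j) = (if i = j then 1 else 0)"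
    and "\<And>i. i \<le> k \<Longrightarrow> t \<le> s i \<and> blinfun_apply (adj T o\<^sub>L T) (e i) = (s i)\<^sup>2 *\<^sub>R e i"
  shows "t \<le> singular_value T k"
  unfolding singular_value_def
proof (rule cSup_upper)
  show "t \<in> insert 0 {t. 0 \<le> t \<and>
     (\<exists>(e :: nat \<Rightarrow> 'h) (s :: nat \<Rightarrow> real).
        (\<forall>i\<le>k. \<forall>j\<le>k. cinner (e i) (e j) = (if i = j then 1 else 0)) \<and>
        (\<forall>i\<le>k. t \<le> s i \<and> blinfun_apply (adj T o\<^sub>L T) (e i) = (s i)\<^sup>2 *\<^sub>R e i))}"
    using assms(2-) by blast
  show "bdd_above (insert 0 {t. 0 \<le> t \<and>
     (\<exists>(e :: nat \<Rightarrow> 'h) (s :: nat \<Rightarrow> real).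
        (\<forall>i\<le>k. \<forall>j\<le>k. cinner (e i) (e j) = (if i = j then 1 else 0)) \<and>
        (\<forall>i\<le>k. t \<le> s i \<and> blinfun_apply (adj T o\<^sub>L T) (e i) = (s i)\<^sup>2 *\<^sub>R e i))})"
    by (rule bdd_above_singular_value[OF assms(1)])
qed

lemma singular_value_nonneg:
  fixes T :: "'h::chilbert_space \<Rightarrow>\<^sub>L 'h"
  assumes "T \<in> complex_ops"
  shows "0 \<le> singular_value T k"
  unfolding singular_value_def
  by (rule cSup_upper[OF insertI1 bdd_above_singular_value[OF assms]])

text \<open>A bound \<open>C / (m + 1)\<close> for the Gelfand numbers of \<open>T\<close>: outside
  the span of \<open>m\<close> suitable vectors, that is on their orthogonal complement,
  \<open>T\<close> is that small. The indices start at 0, as in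
  \<open>singular_value\<close>.\<close>

definition gelfand_decay :: "('h::cinner_space \<Rightarrow>\<^sub>L 'h) \<Rightarrow> real \<Rightarrow> bool" where
  "gelfand_decay T C \<longleftrightarrow> (\<forall>m. \<exists>K. finite K \<and> card K \<le> m \<and>
     (\<forall>x. (\<forall>v\<in>K. cinner x v = 0) \<longrightarrow> norm (blinfun_apply T x) \<le> C / (real m + 1) * norm x))"

text \<open>A substitute for \<open>weak_trace_class\<close>. Closure under sums and products is
  elementary for Gelfand numbers, whereas for singular values given by eigenvectors it would need
  the spectral theorem. All operators whose trace is taken belong to it.\<close>

definition weak_ideal :: "('h::chilbert_space \<Rightarrow>\<^sub>L 'h) set" where
  "weak_ideal = {T. compact_op T \<and> (\<exists>C\<ge>0. gelfand_decay T C)}"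

lemma gelfand_decayE:
  assumes "gelfand_decay T C"
  obtains K where "finite K" "card K \<le> m"
    "\<And>x. (\<forall>v\<in>K. cinner x v = 0) \<Longrightarrow> norm (blinfun_apply T x) \<le> C / (real m + 1) * norm x"
proof -
  have "\<exists>K. finite K \<and> card K \<le> m \<and>
     (\<forall>x. (\<forall>v\<in>K. cinner x v = 0) \<longrightarrow> norm (blinfun_apply T x) \<le> C / (real m + 1) * norm x)"
    using assms unfolding gelfand_decay_def by (rule spec)
  then show ?thesis using that by blast
qed

lemma compact_opI:
  assumes "T \<in> complex_ops" "compact Z" "blinfun_apply T ` cball 0 1 \<subseteq> Z"
  shows "compact_op T"
proof -
  have "closure (blinfun_apply T ` cball 0 1) \<subseteq> Z"
    using assms by (simp add: closure_minimal compact_imp_closed)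
  then have "compact (closure (blinfun_apply T ` cball 0 1))"
    using compact_Int_closed[OF assms(2) closed_closure] by (metis Int_absorb1)
  with assms(1) show ?thesis by (simp add: compact_op_def)
qed

lemma compact_opD:
  assumes "compact_op T"
  obtains Z where "compact Z" "blinfun_apply T ` cball 0 1 \<subseteq> Z"
proof (rule that)
  show "compact (closure (blinfun_apply T ` cball 0 1))"
    using assms by (simp add: compact_op_def)
  show "blinfun_apply T ` cball 0 1 \<subseteq> closure (blinfun_apply T ` cball 0 1)"
    by (rule closure_subset)
qed

lemma weak_idealI: "compact_op T \<Longrightarrow> 0 \<le> C \<Longrightarrow> gelfand_decay T C \<Longrightarrow> T \<in> weak_ideal"
  by (auto simp: weak_ideal_def)

lemma weak_ideal_compactE:
  assumes "T \<in> weak_ideal"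
  obtains Z where "compact Z" "blinfun_apply T ` cball 0 1 \<subseteq> Z"
proof (rule compact_opD)
  show "compact_op T" using assms by (simp add: weak_ideal_def)
qed (rule that)

lemma weak_ideal_complex: "T \<in> weak_ideal \<Longrightarrow> T \<in> complex_ops"
  by (simp add: weak_ideal_def compact_op_def)

lemma weak_ideal_subset_weak_trace_class: "weak_ideal \<subseteq> weak_trace_class"
proof
  fix T :: "'a \<Rightarrow>\<^sub>L 'a"
  assume T: "T \<in> weak_ideal"
  then obtain C where "C \<ge> 0" and C: "gelfand_decay T C" by (auto simp: weak_ideal_def)
  have le: "singular_value T k \<le> C / (real k + 1)" for k
  proof -
    obtain K where "finite K" "card K \<le> k"
      "\<And>x. (\<forall>v\<in>K. cinner x v = 0) \<Longrightarrow> norm (blinfun_apply T x) \<le> C / (real k + 1) * norm x"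
      using C by (rule gelfand_decayE) blast
    then show ?thesis
      using \<open>C \<ge> 0\<close> weak_ideal_complex[OF T] by (intro singular_value_le[of T K]) auto
  qed
  have "(\<lambda>k. singular_value T k) \<in> O(\<lambda>k. 1 / real k)"
  proof (rule bigoI[of _ C], rule eventually_mono[OF eventually_gt_at_top[of 0]])
    fix k :: nat assume "0 < k"
    have "norm (singular_value T k) \<le> C / (real k + 1)"
      using le singular_value_nonneg[OF weak_ideal_complex[OF T]] by simp
    also have "\<dots> \<le> C * (1 / real k)"
      using \<open>C \<ge> 0\<close> \<open>0 < k\<close> by (simp add: frac_le)
    finally show "norm (singular_value T k) \<le> C * norm (1 / real k)" by simp
  qed
  with T show "T \<in> weak_trace_class"
    by (simp add: weak_trace_class_def weak_ideal_def)
qed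

text \<open>Half of the \<open>m\<close> constraints serve \<open>S\<close>, the other half
  \<open>T\<close>. The factor 2 in the new constant comes from
  \<open>m + 1 \<le> 2 * (m div 2 + 1)\<close>.\<close>

lemma weak_ideal_add:
  assumes "S \<in> weak_ideal" "T \<in> weak_ideal"
  shows "S + T \<in> weak_ideal"
proof -
  have SC: "S + T \<in> complex_ops"
    using assms weak_ideal_complex by blast
  obtain Y where Y: "compact Y" "blinfun_apply S ` cball 0 1 \<subseteq> Y"
    using assms(1) by (rule weak_ideal_compactE)
  obtain Z where Z: "compact Z" "blinfun_apply T ` cball 0 1 \<subseteq> Z"
    using assms(2) by (rule weak_ideal_compactE)
  note YZ = Y Z
  have "compact_op (S + T)"
  proof (rule compact_opI[OF SC compact_sums[OF YZ(1,3)]])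
    show "blinfun_apply (S + T) ` cball 0 1 \<subseteq> {x + y |x y. x \<in> Y \<and> y \<in> Z}"
      using YZ(2,4) unfolding blinfun.add_left by blast
  qed
  moreover obtain C D where C: "C \<ge> 0" "gelfand_decay S C" and D: "D \<ge> 0" "gelfand_decay T D"
    using assms by (auto simp: weak_ideal_def)
  have "gelfand_decay (S + T) (2 * (C + D))"
    unfolding gelfand_decay_def
  proof
    fix m :: nat
    obtain K where K: "finite K" "card K \<le> m div 2"
      "\<And>x. (\<forall>v\<in>K. cinner x v = 0) \<Longrightarrow> norm (blinfun_apply S x) \<le> C / (real (m div 2) + 1) * norm x"
      using C(2) by (rule gelfand_decayE) blast
    obtain L where L: "finite L" "card L \<le> m div 2"
      "\<And>x. (\<forall>v\<in>L. cinner x v = 0) \<Longrightarrow> norm (blinfun_apply T x) \<le> D / (real (m div 2) + 1) * norm x"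
      using D(2) by (rule gelfand_decayE) blast
    have half: "B / (real (m div 2) + 1) \<le> 2 * B / (real m + 1)" if "B \<ge> 0" for B
    proof -
      have "real (m + 1) \<le> real (2 * (m div 2 + 1))"
        unfolding of_nat_le_iff by presburger
      then have "B * (real m + 1) \<le> B * (2 * (real (m div 2) + 1))"
        using that by (intro mult_left_mono) auto
      then show ?thesis by (simp add: field_simps)
    qed
    have "norm (blinfun_apply (S + T) x) \<le> 2 * (C + D) / (real m + 1) * norm x"
      if "\<forall>v\<in>K \<union> L. cinner x v = 0" for x
    proof -
      have "norm (blinfun_apply (S + T) x) \<le> norm (blinfun_apply S x) + norm (blinfun_apply T x)"
        by (simp add: blinfun.add_left norm_triangle_ineq)
      also have "\<dots> \<le> C / (real (m div 2) + 1) * norm x + D / (real (m div 2) + 1) * norm x"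
        using K(3)[of x] L(3)[of x] that by (intro add_mono) blast+
      also have "\<dots> \<le> 2 * C / (real m + 1) * norm x + 2 * D / (real m + 1) * norm x"
        by (intro add_mono mult_right_mono half C D norm_ge_zero)
      also have "\<dots> = 2 * (C + D) / (real m + 1) * norm x"
        by (simp add: ring_distribs add_divide_distrib)
      finally show ?thesis .
    qed
    moreover have "finite (K \<union> L)" "card (K \<union> L) \<le> m"
      using K L card_Un_le[of K L] by auto
    ultimately show "\<exists>K. finite K \<and> card K \<le> m \<and>
      (\<forall>x. (\<forall>v\<in>K. cinner x v = 0) \<longrightarrow> norm (blinfun_apply (S + T) x) \<le> 2 * (C + D) / (real m + 1) * norm x)"
      by blast
  qed
  ultimately show ?thesis
    using C(1) D(1) by (intro weak_idealI[of _ "2 * (C + D)"]) auto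
qed

lemma weak_ideal_compose_left:
  assumes T: "T \<in> weak_ideal" and A: "A \<in> complex_ops"
  shows "A o\<^sub>L T \<in> weak_ideal"
proof -
  obtain Z where Z: "compact Z" "blinfun_apply T ` cball 0 1 \<subseteq> Z"
    using T by (rule weak_ideal_compactE)
  have "compact_op (A o\<^sub>L T)"
  proof (rule compact_opI)
    show "compact (blinfun_apply A ` Z)"
      by (intro compact_continuous_image Z linear_continuous_on blinfun.bounded_linear_right)
    show "A o\<^sub>L T \<in> complex_ops"
      using T A weak_ideal_complex by blast
    show "blinfun_apply (A o\<^sub>L T) ` cball 0 1 \<subseteq> blinfun_apply A ` Z"
      using Z(2) by auto
  qed
  moreover obtain C where C: "C \<ge> 0" "gelfand_decay T C"
    using T by (auto simp: weak_ideal_def)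
  have "norm (blinfun_apply (A o\<^sub>L T) x) \<le> norm A * C / (real m + 1) * norm x"
    if "norm (blinfun_apply T x) \<le> C / (real m + 1) * norm x" for x m
    using mult_left_mono[OF that norm_ge_zero[of A]] norm_blinfun[of A "blinfun_apply T x"] by simp
  then have "gelfand_decay (A o\<^sub>L T) (norm A * C)"
    unfolding gelfand_decay_def using C(2) by (metis gelfand_decayE)
  ultimately show ?thesis
    using C(1) by (intro weak_idealI[of _ "norm A * C"]) auto
qed

text \<open>Orthogonality of \<open>A x\<close> to \<open>v\<close> is orthogonality of
  \<open>x\<close> to \<open>adj A v\<close>, so the constraint set for the product is the image of
  \<open>K\<close> under the adjoint.\<close>

lemma weak_ideal_compose_right:
  fixes T :: "'h::chilbert_space \<Rightarrow>\<^sub>L 'h"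
  assumes T: "T \<in> weak_ideal" and A: "A \<in> complex_ops"
  shows "T o\<^sub>L A \<in> weak_ideal"
proof -
  obtain Z where Z: "compact Z" "blinfun_apply T ` cball 0 1 \<subseteq> Z"
    using T by (rule weak_ideal_compactE)
  \<comment> \<open>The image of the unit ball under \<open>A\<close> lies in the ball of radius
    \<open>M\<close>. Adding 1 keeps \<open>M\<close> invertible when \<open>A = 0\<close>.\<close>
  define M where "M = norm A + 1"
  have "M > 0" by (simp add: M_def add_nonneg_pos)
  have "compact_op (T o\<^sub>L A)"
  proof (rule compact_opI[OF _ compact_scaling[OF Z(1)]])
    show "blinfun_apply (T o\<^sub>L A) ` cball 0 1 \<subseteq> (*\<^sub>R) M ` Z"
    proof (rule image_subsetI)
      fix x :: 'h assume x: "x \<in> cball 0 1"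
      have "norm (blinfun_apply A x) \<le> norm A * norm x" by (rule norm_blinfun)
      also have "\<dots> \<le> norm A * 1" using x by (intro mult_left_mono) auto
      finally have "norm (blinfun_apply A x) \<le> M" by (simp add: M_def)
      then have "(1 / M) *\<^sub>R blinfun_apply A x \<in> cball 0 1"
        using \<open>M > 0\<close> by (simp add: field_simps)
      then have "blinfun_apply T ((1 / M) *\<^sub>R blinfun_apply A x) \<in> Z" using Z(2) by blast
      moreover have "blinfun_apply (T o\<^sub>L A) x = M *\<^sub>R blinfun_apply T ((1 / M) *\<^sub>R blinfun_apply A x)"
        using \<open>M > 0\<close> by (simp add: blinfun.scaleR_right)
      ultimately show "blinfun_apply (T o\<^sub>L A) x \<in> (*\<^sub>R) M ` Z" by blast
    qed
  qed (use T A weak_ideal_complex in auto)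
  moreover obtain C where C: "C \<ge> 0" "gelfand_decay T C"
    using T by (auto simp: weak_ideal_def)
  have "gelfand_decay (T o\<^sub>L A) (C * norm A)"
    unfolding gelfand_decay_def
  proof
    fix m :: nat
    obtain K where K: "finite K" "card K \<le> m"
      "\<And>x. (\<forall>v\<in>K. cinner x v = 0) \<Longrightarrow> norm (blinfun_apply T x) \<le> C / (real m + 1) * norm x"
      using C(2) by (rule gelfand_decayE) blast
    have "norm (blinfun_apply (T o\<^sub>L A) x) \<le> C * norm A / (real m + 1) * norm x"
      if "\<forall>v\<in>blinfun_apply (adj A) ` K. cinner x v = 0" for x
    proof -
      have "norm (blinfun_apply T (blinfun_apply A x)) \<le> C / (real m + 1) * norm (blinfun_apply A x)"
        using that by (intro K(3)) (simp add: cinner_adj(1)[OF A])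
      also have "\<dots> \<le> C / (real m + 1) * (norm A * norm x)"
        using C(1) by (intro mult_left_mono norm_blinfun) auto
      finally show ?thesis by simp
    qed
    moreover have "finite (blinfun_apply (adj A) ` K)" "card (blinfun_apply (adj A) ` K) \<le> m"
      using K card_image_le[of K "blinfun_apply (adj A)"] by auto
    ultimately show "\<exists>K. finite K \<and> card K \<le> m \<and>
      (\<forall>x. (\<forall>v\<in>K. cinner x v = 0) \<longrightarrow> norm (blinfun_apply (T o\<^sub>L A) x) \<le> C * norm A / (real m + 1) * norm x)"
      by blast
  qed
  ultimately show ?thesis
    using C(1) by (intro weak_idealI[of _ "C * norm A"]) auto
qed

lemma weak_ideal_scaleC:
  assumes "T \<in> weak_ideal"
  shows "c *\<^sub>C T \<in> weak_ideal"
  using weak_ideal_compose_left[OF assms complex_ops_scaleC[OF complex_ops_id, of c]]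
  by (simp add: scaleC_compose_left)

section \<open>Diagonal operators\<close>

text \<open>A Hilbert basis. Totality is stated as a trivial orthogonal complement, because vectors
  are compared coefficient by coefficient below.\<close>

locale onb =
  fixes e :: "'i \<Rightarrow> 'h::chilbert_space"
  assumes orth: "cinner (e i) (e j) = (if i = j then 1 else 0)"
    and total: "(\<And>i. cinner x (e i) = 0) \<Longrightarrow> x = 0"
begin

lemma coeff_eqI:
  assumes "\<And>i. cinner x (e i) = cinner y (e i)"
  shows "x = y"
  using total[of "x - y"] assms by (simp add: cinner.diff_left)

text \<open>The vector \<open>adj (S - T) y\<close> is orthogonal to the whole basis, since
  \<open>S - T\<close> kills the basis; hence it vanishes for every \<open>y\<close>, and so does
  \<open>S - T\<close>.\<close>

lemma ops_eqI:
  assumes S: "S \<in> complex_ops" and T: "T \<in> complex_ops"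
    and eq: "\<And>i. blinfun_apply S (e i) = blinfun_apply T (e i)"
  shows "S = T"
proof (intro blinfun_eqI cinner_ext)
  fix x y
  have D: "S - T \<in> complex_ops" using S T by blast
  have "blinfun_apply (adj (S - T)) y = 0"
    by (rule total) (simp add: cinner_adj(2)[OF D] blinfun.diff_left eq cinner.zero_right)
  then have "cinner (blinfun_apply (S - T) x) y = 0"
    by (simp add: cinner_adj(1)[OF D] cinner.zero_right)
  then show "cinner (blinfun_apply S x) y = cinner (blinfun_apply T x) y"
    by (simp add: blinfun.diff_left cinner.diff_left)
qed

lemma bessel:
  assumes "finite F"
  shows "(\<Sum>i\<in>F. (cmod (cinner x (e i)))\<^sup>2) \<le> (norm x)\<^sup>2"
proof -
  define y where "y = (\<Sum>i\<in>F. cinner x (e i) *\<^sub>C e i)"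
  have ny: "(norm y)\<^sup>2 = (\<Sum>i\<in>F. (cmod (cinner x (e i)))\<^sup>2)"
    unfolding y_def using assms orth by (intro norm_sum_orthonormal) auto
  have "cinner x y = (\<Sum>i\<in>F. cnj (cinner x (e i)) * cinner x (e i))"
    by (simp add: y_def cinner.sum_right cinner_scaleC_right)
  also have "\<dots> = complex_of_real (\<Sum>i\<in>F. (cmod (cinner x (e i)))\<^sup>2)"
    by (auto simp: complex_norm_square mult.commute simp del: of_real_power intro!: sum.cong)
  finally have "x \<bullet> y = (norm y)\<^sup>2"
    by (simp flip: Re_cinner add: ny del: of_real_sum)
  then have "(norm (x - y))\<^sup>2 = (norm x)\<^sup>2 - (norm y)\<^sup>2"
    by (simp add: power2_norm_eq_inner inner_diff inner_commute)
  then show ?thesis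
    unfolding ny[symmetric] by (metis diff_ge_0_iff_ge zero_le_power2)
qed

lemma sum_coeff_mult_le:
  assumes "finite F" "\<And>i. cmod (b i) \<le> M"
  shows "(\<Sum>i\<in>F. cmod (b i * cinner x (e i) * cinner y (e i))) \<le> M * norm x * norm y"
proof -
  have "M \<ge> 0" using order_trans[OF norm_ge_zero assms(2)] .
  have L2: "L2_set (\<lambda>i. cmod (cinner x (e i))) F \<le> norm x" for x
    unfolding L2_set_def using bessel[OF assms(1), of x] by (intro real_le_lsqrt) (auto intro: sum_nonneg)
  have "(\<Sum>i\<in>F. cmod (b i * cinner x (e i) * cinner y (e i)))
      \<le> (\<Sum>i\<in>F. M * (\<bar>cmod (cinner x (e i))\<bar> * \<bar>cmod (cinner y (e i))\<bar>))"
    using assms(2) by (intro sum_mono) (auto simp: norm_mult mult.assoc intro!: mult_right_mono)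
  also have "\<dots> \<le> M * (L2_set (\<lambda>i. cmod (cinner x (e i))) F * L2_set (\<lambda>i. cmod (cinner y (e i))) F)"
    unfolding sum_distrib_left[symmetric] using \<open>M \<ge> 0\<close> by (intro mult_left_mono L2_set_mult_ineq)
  also have "\<dots> \<le> M * (norm x * norm y)"
    using \<open>M \<ge> 0\<close> L2 by (intro mult_left_mono mult_mono) auto
  finally show ?thesis by (simp add: mult.assoc)
qed

text \<open>The image of \<open>x\<close> is not summed up from its coefficients but obtained by
  Riesz. The form \<open>f x y\<close> converges absolutely by Bessel and Cauchy-Schwarz and is
  linear in \<open>y\<close>; its representing vector \<open>S x\<close> has the coefficients
  \<open>b i * cinner x (e i)\<close>. The conjugates in \<open>f\<close> make \<open>S\<close>
  linear instead of antilinear.\<close>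

lemma ex_diag:
  assumes b: "\<And>i. cmod (b i) \<le> M"
  shows "\<exists>T\<in>complex_ops. (\<forall>i x. cinner (blinfun_apply T x) (e i) = b i * cinner x (e i)) \<and> norm T \<le> M"
proof -
  have "M \<ge> 0" using order_trans[OF norm_ge_zero b] .
  define f where "f x y = (\<Sum>\<^sub>\<infinity>i. cnj (b i) * cnj (cinner x (e i)) * cinner y (e i))" for x y
  have bound: "(\<Sum>i\<in>F. cmod (cnj (b i) * cnj (cinner x (e i)) * cinner y (e i))) \<le> M * norm x * norm y"
    if "finite F" for F x y
    using sum_coeff_mult_le[of F b M x y] that b by (simp add: norm_mult)
  have abs: "(\<lambda>i. cmod (cnj (b i) * cnj (cinner x (e i)) * cinner y (e i))) summable_on UNIV" for x y
    by (rule nonneg_bdd_above_summable_on) (auto intro!: bdd_aboveI[of _ "M * norm x * norm y"] bound)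
  have smm: "(\<lambda>i. cnj (b i) * cnj (cinner x (e i)) * cinner y (e i)) summable_on UNIV" for x y
    using abs by (rule abs_summable_summable)
  have f_le: "cmod (f x y) \<le> M * norm x * norm y" for x y
  proof -
    have "cmod (f x y) \<le> (\<Sum>\<^sub>\<infinity>i. cmod (cnj (b i) * cnj (cinner x (e i)) * cinner y (e i)))"
      unfolding f_def using abs by (rule norm_infsum_bound)
    also have "\<dots> \<le> M * norm x * norm y"
      using abs bound by (intro infsum_le_finite_sums) auto
    finally show ?thesis .
  qed
  have fC: "f x (c *\<^sub>C y) = c * f x y" for x y c
    unfolding f_def cinner_scaleC_left
    by (subst infsum_cmult_right'[symmetric]) (simp add: mult.commute mult.left_commute)
  have fe: "f x (e j) = cnj (b j) * cnj (cinner x (e j))" for x j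
  proof -
    have "f x (e j) = (\<Sum>\<^sub>\<infinity>i\<in>{j}. cnj (b i) * cnj (cinner x (e i)) * cinner (e j) (e i))"
      unfolding f_def by (rule infsum_cong_neutral) (auto simp: orth)
    then show ?thesis by (simp add: orth)
  qed
  have "bounded_linear (f x)" for x
  proof (rule bounded_linear_intro[where K = "M * norm x"])
    show "f x (y + z) = f x y + f x z" for y z
      unfolding f_def cinner_add_left ring_distribs by (intro infsum_add smm)
    show "f x (r *\<^sub>R y) = r *\<^sub>R f x y" for r y
      using fC[of x "of_real r" y] by (simp add: scaleC_of_real scaleR_conv_of_real)
    show "norm (f x y) \<le> norm y * (M * norm x)" for y
      using f_le[of x y] by (simp add: mult.commute)
  qed
  then have "\<exists>v. \<forall>y. f x y = cinner y v" for x
    using fC by (intro riesz) auto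
  then obtain S where S: "\<And>x y. f x y = cinner y (S x)" by metis
  have Se: "cinner (S x) (e j) = b j * cinner x (e j)" for x j
    using arg_cong[OF S[of x "e j"], of cnj] cinner_commute[of "S x" "e j"] by (simp add: fe)
  have "norm (S x) \<le> norm x * M" for x
  proof (cases "S x = 0")
    case False
    have "(norm (S x))\<^sup>2 = cmod (f x (S x))"
      by (simp add: S cinner_self norm_power)
    also have "\<dots> \<le> M * norm x * norm (S x)" by (rule f_le)
    finally show ?thesis using False by (simp add: power2_eq_square mult.commute)
  qed (use \<open>M \<ge> 0\<close> in simp)
  then have bl: "bounded_linear S"
    by (intro bounded_linear_intro[where K = M] coeff_eqI)
      (auto simp: Se cinner_add_left cinner_scaleR_left ring_distribs)
  have ap: "blinfun_apply (Blinfun S) = S"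
    by (rule bounded_linear_Blinfun_apply[OF bl])
  show ?thesis
  proof (intro bexI[of _ "Blinfun S"] conjI allI)
    show "Blinfun S \<in> complex_ops"
      unfolding complex_ops_def mem_Collect_eq ap
      by (intro allI coeff_eqI) (simp add: Se cinner_scaleC_left)
    show "norm (Blinfun S) \<le> M"
      using \<open>\<And>x. norm (S x) \<le> norm x * M\<close> \<open>M \<ge> 0\<close>
      by (intro norm_blinfun_bound) (auto simp: ap mult.commute)
  qed (simp add: ap Se)
qed

text \<open>A choice makes \<open>diag\<close> total in \<open>b\<close>. It is known to be the
  multiplication operator only for bounded \<open>b\<close>, whence the recurring hypothesis
  \<open>bounded (range b)\<close>.\<close>

definition diag :: "('i \<Rightarrow> complex) \<Rightarrow> 'h \<Rightarrow>\<^sub>L 'h" where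
  "diag b = (SOME T. T \<in> complex_ops \<and>
     (\<forall>i x. cinner (blinfun_apply T x) (e i) = b i * cinner x (e i)))"

lemma diag_props:
  assumes "bounded (range b)"
  shows diag_complex: "diag b \<in> complex_ops"
    and diag_coeff: "cinner (blinfun_apply (diag b) x) (e i) = b i * cinner x (e i)"
proof -
  obtain M where "\<And>i. cmod (b i) \<le> M"
    using assms by (auto simp: bounded_iff)
  then have "\<exists>T. T \<in> complex_ops \<and> (\<forall>i x. cinner (blinfun_apply T x) (e i) = b i * cinner x (e i))"
    using ex_diag[where b = b and M = M] by metis
  from someI_ex[OF this] show "diag b \<in> complex_ops" "cinner (blinfun_apply (diag b) x) (e i) = b i * cinner x (e i)"
    unfolding diag_def by blast+
qed

lemma diag_e: "bounded (range b) \<Longrightarrow> blinfun_apply (diag b) (e i) = b i *\<^sub>C e i"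
  by (rule coeff_eqI) (auto simp: diag_coeff cinner_scaleC_left orth)

lemma diag_eqI:
  assumes "bounded (range b)" "T \<in> complex_ops" "\<And>i. blinfun_apply T (e i) = b i *\<^sub>C e i"
  shows "T = diag b"
  using assms by (intro ops_eqI) (auto simp: diag_complex diag_e)

text \<open>The chosen operator agrees with the one of \<open>ex_diag\<close>, which comes with the
  norm bound, because the coefficients of all images agree.\<close>

lemma norm_diag_le:
  assumes "\<And>i. cmod (b i) \<le> M"
  shows "norm (diag b) \<le> M"
proof -
  have "bounded (range b)" using assms by (auto simp: bounded_iff)
  obtain T where T: "T \<in> complex_ops" "norm T \<le> M"
    "\<And>i x. cinner (blinfun_apply T x) (e i) = b i * cinner x (e i)"
    using ex_diag[where b = b and M = M, OF assms] by metis
  have "T = diag b"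
    using T \<open>bounded (range b)\<close> by (intro ops_eqI diag_complex coeff_eqI) (auto simp: diag_coeff)
  then show ?thesis using T by simp
qed

lemma bounded_range_mult: "bounded (range a) \<Longrightarrow> bounded (range b) \<Longrightarrow> bounded (range (\<lambda>i. a i * b i :: complex))"
proof -
  assume "bounded (range a)" "bounded (range b)"
  then obtain A B where "\<And>i. cmod (a i) \<le> A" "\<And>i. cmod (b i) \<le> B"
    unfolding bounded_iff by auto
  then have "cmod (a i * b i) \<le> A * B" for i
    unfolding norm_mult by (intro mult_mono') auto
  then show ?thesis unfolding bounded_iff by auto
qed

lemma diag_compose:
  assumes "bounded (range a)" "bounded (range b)"
  shows "diag a o\<^sub>L diag b = diag (\<lambda>i. a i * b i)"
  using assms by (intro diag_eqI bounded_range_mult)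
    (auto simp: diag_e diag_complex complex_opsD scaleC_scaleC mult.commute)

lemma bounded_range_add: "bounded (range a) \<Longrightarrow> bounded (range b) \<Longrightarrow> bounded (range (\<lambda>i. a i + b i :: complex))"
proof -
  assume "bounded (range a)" "bounded (range b)"
  then obtain A B where "\<And>i. cmod (a i) \<le> A" "\<And>i. cmod (b i) \<le> B"
    unfolding bounded_iff by auto
  then have "cmod (a i + b i) \<le> A + B" for i
    by (rule norm_triangle_mono)
  then show ?thesis unfolding bounded_iff by auto
qed

lemma bounded_range_cmult: "bounded (range a) \<Longrightarrow> bounded (range (\<lambda>i. c * a i :: complex))"
  by (rule bounded_range_mult) auto

lemma bounded_range_if: "bounded (range b) \<Longrightarrow> bounded (range (\<lambda>i. if P i then b i else 0 :: complex))"
proof -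
  assume "bounded (range b)"
  then obtain B where "\<And>i. cmod (b i) \<le> B"
    unfolding bounded_iff by auto
  then have "cmod (if P i then b i else 0) \<le> max 0 B" for i
    by (auto simp: le_max_iff_disj)
  then show ?thesis unfolding bounded_iff by blast
qed

lemma bounded_range_if_finite:
  assumes "finite F"
  shows "bounded (range (\<lambda>i. if i \<in> F then b i else 0 :: complex))"
proof (rule finite_imp_bounded, rule finite_subset)
  show "range (\<lambda>i. if i \<in> F then b i else 0) \<subseteq> insert 0 (b ` F)" by auto
qed (use assms in auto)

lemma bounded_range_cnj: "bounded (range a) \<Longrightarrow> bounded (range (\<lambda>i. cnj (a i)))"
  unfolding bounded_iff by auto

lemma diag_add:
  assumes "bounded (range a)" "bounded (range b)"
  shows "diag a + diag b = diag (\<lambda>i. a i + b i)"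
  using assms by (intro diag_eqI bounded_range_add)
    (auto simp: diag_e diag_complex complex_opsD scaleC_add_left blinfun.add_left)

lemma diag_scaleC:
  assumes "bounded (range b)"
  shows "c *\<^sub>C diag b = diag (\<lambda>i. c * b i)"
  using assms by (intro diag_eqI bounded_range_cmult)
    (auto simp: diag_e diag_complex scaleC_scaleC)

lemma diag_adjoint:
  assumes b: "bounded (range b)"
  shows "is_adjoint (diag b) (diag (\<lambda>i. cnj (b i)))"
proof -
  have "adj (diag b) = diag (\<lambda>i. cnj (b i))"
  proof (rule diag_eqI)
    show "blinfun_apply (adj (diag b)) (e i) = cnj (b i) *\<^sub>C e i" for i
      by (rule coeff_eqI)
        (auto simp: cinner_adj(2)[OF diag_complex[OF b]] diag_e[OF b] cinner_scaleC_left cinner_scaleC_right orth)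
  qed (use b bounded_range_cnj diag_complex in auto)
  then show ?thesis
    using is_adjoint_adj[OF diag_complex[OF b]] by simp
qed

text \<open>The diagonal of square roots \<open>s\<close> is selfadjoint and squares to
  \<open>diag b\<close>, so the quadratic form at \<open>x\<close> is the square of
  \<open>norm (diag s x)\<close>.\<close>

lemma diag_positive:
  assumes "bounded (range b)" "\<And>i. b i \<in> \<real>\<^sub>\<ge>\<^sub>0"
  shows "positive_op (diag b)"
proof -
  define s where "s i = complex_of_real (sqrt (Re (b i)))" for i
  obtain M where M: "\<And>i. cmod (b i) \<le> M" using assms(1) by (auto simp: bounded_iff)
  have "Re (b i) \<ge> 0" for i using assms(2)[of i] by (simp add: complex_nonneg_Reals_iff)
  then have "cmod (s i) \<le> sqrt M" for i
    using M[of i] abs_Re_le_cmod[of "b i"] by (auto simp: s_def)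
  then have s: "bounded (range s)" by (auto simp: bounded_iff)
  have "b i = s i * s i" for i
    using assms(2)[of i] by (auto simp: s_def complex_nonneg_Reals_iff complex_eq_iff)
  then have "b = (\<lambda>i. s i * s i)" by auto
  then have "diag b = diag s o\<^sub>L diag s"
    using s by (simp add: diag_compose)
  moreover have "is_adjoint (diag s) (diag s)"
    using diag_adjoint[OF s] unfolding s_def by simp
  ultimately have "cinner (blinfun_apply (diag b) x) x = complex_of_real ((norm (blinfun_apply (diag s) x))\<^sup>2)" for x
    by (simp add: is_adjoint_def cinner_self)
  then show ?thesis
    using assms(1) by (simp add: positive_op_def diag_complex del: of_real_power)
qed

section \<open>Compactness and decay of diagonal operators\<close>

lemma norm_diag_tail_le:
  assumes "bounded (range b)" "\<And>i. i \<in> F \<Longrightarrow> cinner x (e i) = 0" "\<And>i. i \<notin> F \<Longrightarrow> cmod (b i) \<le> \<epsilon>" "0 \<le> \<epsilon>"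
  shows "norm (blinfun_apply (diag b) x) \<le> \<epsilon> * norm x"
proof -
  define c where "c i = (if i \<in> F then 0 else b i)" for i
  have c_le: "cmod (c i) \<le> \<epsilon>" for i using assms by (simp add: c_def)
  then have c: "bounded (range c)" by (auto simp: bounded_iff)
  have "blinfun_apply (diag b) x = blinfun_apply (diag c) x"
    using assms(1,2) c by (intro coeff_eqI) (auto simp: diag_coeff c_def)
  also have "norm \<dots> \<le> norm (diag c) * norm x" by (rule norm_blinfun)
  also have "\<dots> \<le> \<epsilon> * norm x" using norm_diag_le[OF c_le] by (rule mult_right_mono) auto
  finally show ?thesis .
qed

lemma diag_finite_support_compact:
  assumes "finite F"
  shows "\<exists>Z. compact Z \<and> (\<forall>x\<in>cball 0 1. blinfun_apply (diag (\<lambda>i. if i \<in> F then b i else 0)) x \<in> Z)"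
  using assms
proof (induction F)
  case empty
  have "diag (\<lambda>i. 0) = 0"
    by (rule diag_eqI[symmetric]) (auto simp: bounded_iff scaleC.zero_left)
  then show ?case by (auto intro!: exI[of _ "{0}"])
next
  case (insert j F)
  then obtain Z where Z: "compact Z" "\<And>x. x \<in> cball 0 1 \<Longrightarrow> blinfun_apply (diag (\<lambda>i. if i \<in> F then b i else 0)) x \<in> Z"
    by auto
  define Y where "Y = (\<lambda>c. c *\<^sub>C e j) ` cball 0 (cmod (b j))"
  have Y: "compact Y"
    unfolding Y_def by (intro compact_continuous_image linear_continuous_on scaleC.bounded_linear_left compact_cball)
  have F: "bounded (range (\<lambda>i. if i \<in> F then b i else 0))" "bounded (range (\<lambda>i. if i = j then b i else 0))"
    and F': "bounded (range (\<lambda>i. if i \<in> insert j F then b i else 0))"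
    using bounded_range_if_finite[of F b] bounded_range_if_finite[of "{j}" b]
      bounded_range_if_finite[of "insert j F" b] insert.hyps by auto
  have eq: "diag (\<lambda>i. if i \<in> insert j F then b i else 0)
      = diag (\<lambda>i. if i = j then b i else 0) + diag (\<lambda>i. if i \<in> F then b i else 0)"
    using insert.hyps by (subst diag_add[OF F(2,1)]) (auto intro!: arg_cong[of _ _ diag])
  have "blinfun_apply (diag (\<lambda>i. if i = j then b i else 0)) x \<in> Y" if "x \<in> cball 0 1" for x
  proof -
    have "norm (e j) = 1"
      using orth[of j j] cinner_self[of "e j"] by (metis norm_eq_1 of_real_eq_1_iff power2_norm_eq_inner)
    then have "cmod (cinner x (e j)) \<le> 1"
      using cmod_cinner_le[of x "e j"] that by simp
    then have "b j * cinner x (e j) \<in> cball 0 (cmod (b j))"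
      by (simp add: norm_mult mult_left_le)
    moreover have "blinfun_apply (diag (\<lambda>i. if i = j then b i else 0)) x = (b j * cinner x (e j)) *\<^sub>C e j"
      by (rule coeff_eqI) (auto simp: diag_coeff[OF F(2)] cinner_scaleC_left orth)
    ultimately show ?thesis by (auto simp: Y_def)
  qed
  then have "\<forall>x\<in>cball 0 1. blinfun_apply (diag (\<lambda>i. if i \<in> insert j F then b i else 0)) x \<in> {y + z |y z. y \<in> Y \<and> z \<in> Z}"
    unfolding eq blinfun.add_left using Z(2) by blast
  then show ?case
    using compact_sums[OF Y Z(1)] by blast
qed

text \<open>Total boundedness. Entries below \<epsilon>/3 move points of the unit ball by at most
  \<epsilon>/3; the finitely many others map it into a compact set. An \<epsilon>/3-net of that set
  is a net of radius 2\<epsilon>/3 for the image, which leaves room to pass to the closure.\<close>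

lemma compact_diag:
  assumes "bounded (range b)" "\<And>\<epsilon>. 0 < \<epsilon> \<Longrightarrow> finite {i. \<epsilon> \<le> cmod (b i)}"
  shows "compact_op (diag b)"
  unfolding compact_op_def
proof
  let ?X = "blinfun_apply (diag b) ` cball 0 1"
  show "compact (closure ?X)"
    unfolding compact_eq_totally_bounded
  proof (intro conjI allI impI)
    show "complete (closure ?X)" by (simp add: complete_eq_closed)
    fix \<epsilon> :: real assume "0 < \<epsilon>"
    define F where "F = {i. \<epsilon> / 3 \<le> cmod (b i)}"
    have "finite F" unfolding F_def using \<open>0 < \<epsilon>\<close> by (intro assms) simp
    define c where "c i = (if i \<in> F then b i else 0)" for i
    obtain Z where Z: "compact Z" "\<And>x. x \<in> cball 0 1 \<Longrightarrow> blinfun_apply (diag c) x \<in> Z"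
      using diag_finite_support_compact[OF \<open>finite F\<close>, of b] unfolding c_def by blast
    obtain k where k: "finite k" "Z \<subseteq> (\<Union>z\<in>k. ball z (\<epsilon> / 3))"
      using Z(1) \<open>0 < \<epsilon>\<close> unfolding compact_eq_totally_bounded by (metis zero_less_divide_iff zero_less_numeral)
    have "?X \<subseteq> (\<Union>z\<in>k. cball z (2 * \<epsilon> / 3))"
    proof (rule image_subsetI)
      fix x :: 'h assume x: "x \<in> cball 0 1"
      then obtain z where z: "z \<in> k" "dist z (blinfun_apply (diag c) x) < \<epsilon> / 3"
        using Z(2) k(2) by fastforce
      define d where "d i = (if i \<notin> F then b i else 0)" for i
      have d_le: "cmod (d i) \<le> \<epsilon> / 3" for i using \<open>0 < \<epsilon>\<close> by (auto simp: d_def F_def)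
      have "bounded (range c)" "bounded (range d)"
        using bounded_range_if[OF assms(1), of "\<lambda>i. i \<in> F"] bounded_range_if[OF assms(1), of "\<lambda>i. i \<notin> F"]
        unfolding c_def d_def by simp_all
      then have "diag b = diag c + diag d"
        by (subst diag_add) (auto simp: c_def d_def intro!: arg_cong[of _ _ diag])
      then have "dist (blinfun_apply (diag c) x) (blinfun_apply (diag b) x) = norm (blinfun_apply (diag d) x)"
        by (simp add: blinfun.add_left dist_norm)
      also have "\<dots> \<le> norm (diag d) * norm x" by (rule norm_blinfun)
      also have "\<dots> \<le> \<epsilon> / 3 * 1"
        using norm_diag_le[OF d_le] x \<open>0 < \<epsilon>\<close> by (intro mult_mono) auto
      finally have "dist z (blinfun_apply (diag b) x) \<le> 2 * \<epsilon> / 3"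
        using z(2) dist_triangle[of z "blinfun_apply (diag b) x" "blinfun_apply (diag c) x"] by simp
      with z(1) show "blinfun_apply (diag b) x \<in> (\<Union>z\<in>k. cball z (2 * \<epsilon> / 3))" by auto
    qed
    then have "closure ?X \<subseteq> (\<Union>z\<in>k. cball z (2 * \<epsilon> / 3))"
      using k(1) by (intro closure_minimal closed_UN) auto
    also have "\<dots> \<subseteq> (\<Union>z\<in>k. ball z \<epsilon>)"
      using \<open>0 < \<epsilon>\<close> by auto
    finally show "\<exists>k. finite k \<and> closure ?X \<subseteq> (\<Union>z\<in>k. ball z \<epsilon>)"
      using k(1) by blast
  qed
qed (use assms diag_complex in blast)

lemma bounded_of_decay:
  fixes \<sigma> :: "nat \<Rightarrow> 'i"
  assumes "bij \<sigma>" "\<And>j. cmod (b (\<sigma> j)) \<le> C / (real j + 1)"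
  shows "bounded (range b)"
proof -
  have "C \<ge> 0" using order_trans[OF norm_ge_zero assms(2)[of 0]] by simp
  have "cmod (b i) \<le> C" for i
  proof -
    obtain j where "i = \<sigma> j" using bij_is_surj[OF assms(1)] by (rule surjE)
    then have "cmod (b i) \<le> C / (real j + 1)" using assms(2) by simp
    also have "\<dots> \<le> C / 1" using \<open>C \<ge> 0\<close> by (intro divide_left_mono) auto
    finally show ?thesis by simp
  qed
  then show ?thesis by (auto simp: bounded_iff)
qed

lemma diag_decay:
  fixes \<sigma> :: "nat \<Rightarrow> 'i"
  assumes "bij \<sigma>" "\<And>j. cmod (b (\<sigma> j)) \<le> C / (real j + 1)"
    and x: "\<forall>v\<in>e ` \<sigma> ` {..<m}. cinner x v = 0"
  shows "norm (blinfun_apply (diag b) x) \<le> C / (real m + 1) * norm x"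
proof (rule norm_diag_tail_le[of _ "\<sigma> ` {..<m}"])
  have "C \<ge> 0" using order_trans[OF norm_ge_zero assms(2)[of 0]] by simp
  then show "0 \<le> C / (real m + 1)" by simp
  show "bounded (range b)" using assms(1,2) by (rule bounded_of_decay)
  show "cmod (b i) \<le> C / (real m + 1)" if "i \<notin> \<sigma> ` {..<m}" for i
  proof -
    obtain j where j: "i = \<sigma> j" using bij_is_surj[OF assms(1)] by (rule surjE)
    with that have "j \<ge> m" by (auto simp: not_less[symmetric])
    have "cmod (b i) \<le> C / (real j + 1)" using assms(2) j by simp
    also have "\<dots> \<le> C / (real m + 1)" using \<open>C \<ge> 0\<close> \<open>j \<ge> m\<close> by (intro divide_left_mono) auto
    finally show ?thesis .
  qed
qed (use x in blast)

lemma diag_weak_ideal: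
  fixes \<sigma> :: "nat \<Rightarrow> 'i"
  assumes "bij \<sigma>" "\<And>j. cmod (b (\<sigma> j)) \<le> C / (real j + 1)"
  shows "diag b \<in> weak_ideal"
proof (rule weak_idealI)
  show "C \<ge> 0" using order_trans[OF norm_ge_zero assms(2)[of 0]] by simp
  show "compact_op (diag b)"
  proof (rule compact_diag[OF bounded_of_decay[OF assms]])
    fix \<epsilon> :: real assume "0 < \<epsilon>"
    obtain N :: nat where N: "C / \<epsilon> < real N" using reals_Archimedean2 by blast
    have "{i. \<epsilon> \<le> cmod (b i)} \<subseteq> \<sigma> ` {..<N}"
    proof
      fix i assume i: "i \<in> {i. \<epsilon> \<le> cmod (b i)}"
      obtain j where j: "i = \<sigma> j" using bij_is_surj[OF assms(1)] by (rule surjE)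
      have "\<epsilon> \<le> C / (real j + 1)" using i j assms(2)[of j] by simp
      then have "real j + 1 \<le> C / \<epsilon>" using \<open>0 < \<epsilon>\<close> by (simp add: field_simps)
      then show "i \<in> \<sigma> ` {..<N}" using N j by auto
    qed
    then show "finite {i. \<epsilon> \<le> cmod (b i)}" by (rule finite_subset) simp
  qed
  show "gelfand_decay (diag b) C"
    unfolding gelfand_decay_def
  proof
    fix m
    show "\<exists>K. finite K \<and> card K \<le> m \<and>
      (\<forall>x. (\<forall>v\<in>K. cinner x v = 0) \<longrightarrow> norm (blinfun_apply (diag b) x) \<le> C / (real m + 1) * norm x)"
      using diag_decay[OF assms] card_image_le[of "{..<m}" "\<lambda>j. e (\<sigma> j)"]
      by (intro exI[of _ "e ` \<sigma> ` {..<m}"]) (auto simp: image_image)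
  qed
qed

text \<open>The model on which a normalized trace is prescribed: its eigenvalues, in the order of
  \<open>\<sigma>\<close>, are exactly 1/(k+1). There is one model for each enumeration of the
  basis.\<close>

definition harmonic_diag :: "(nat \<Rightarrow> 'i) \<Rightarrow> 'h \<Rightarrow>\<^sub>L 'h" where
  "harmonic_diag \<sigma> = diag (\<lambda>i. of_real (1 / (real (inv \<sigma> i) + 1)))"

lemma harmonic_coeff_le:
  fixes \<sigma> :: "nat \<Rightarrow> 'i"
  assumes "bij \<sigma>"
  shows "cmod (of_real (1 / (real (inv \<sigma> (\<sigma> j)) + 1))) \<le> 1 / (real j + 1)"
  using assms by (simp add: bij_is_inj norm_divide del: of_real_add)

lemma harmonic_diag_weak_ideal: "bij \<sigma> \<Longrightarrow> harmonic_diag \<sigma> \<in> weak_ideal"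
  unfolding harmonic_diag_def by (rule diag_weak_ideal[OF _ harmonic_coeff_le])

text \<open>Orthogonality to the first \<open>k\<close> basis vectors gives the upper bound; the
  first \<open>k + 1\<close> of them are the eigenvectors that give the lower bound.\<close>

lemma singular_value_harmonic_diag:
  fixes \<sigma> :: "nat \<Rightarrow> 'i"
  assumes "bij \<sigma>"
  shows "singular_value (harmonic_diag \<sigma>) k = 1 / (real k + 1)"
proof (rule antisym)
  define b where "b i = complex_of_real (1 / (real (inv \<sigma> i) + 1))" for i
  have b_le: "cmod (b (\<sigma> j)) \<le> 1 / (real j + 1)" for j
    unfolding b_def by (rule harmonic_coeff_le[OF assms])
  have b: "bounded (range b)" by (rule bounded_of_decay[OF assms b_le])
  have D: "harmonic_diag \<sigma> = diag b" unfolding harmonic_diag_def b_def ..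
  have dc: "diag b \<in> complex_ops" using b by (rule diag_complex)
  show "singular_value (harmonic_diag \<sigma>) k \<le> 1 / (real k + 1)"
    unfolding D
  proof (rule singular_value_le[OF dc, of "e ` \<sigma> ` {..<k}"])
    show "card (e ` \<sigma> ` {..<k}) \<le> k"
      using card_image_le[of "{..<k}" "\<lambda>j. e (\<sigma> j)"] by (simp add: image_image)
    show "norm (blinfun_apply (diag b) x) \<le> 1 / (real k + 1) * norm x"
      if "\<And>v. v \<in> e ` \<sigma> ` {..<k} \<Longrightarrow> cinner x v = 0" for x
      by (rule diag_decay[OF assms b_le]) (use that in blast)
  qed auto
  have "cnj (b i) = b i" for i
    unfolding b_def by (rule complex_cnj_complex_of_real)
  then have "adj (diag b) = diag b"
    using diag_adjoint[OF b] by (intro adj_eqI) simp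
  moreover have "b (\<sigma> i) = of_real (1 / (real i + 1))" for i
    using assms by (simp add: b_def bij_is_inj)
  ultimately have "blinfun_apply (adj (diag b) o\<^sub>L diag b) (e (\<sigma> i)) = (1 / (real i + 1))\<^sup>2 *\<^sub>R e (\<sigma> i)" for i
    by (simp add: diag_e[OF b] complex_opsD[OF dc] scaleC_scaleC scaleC_of_real[symmetric] power2_eq_square)
  then show "1 / (real k + 1) \<le> singular_value (harmonic_diag \<sigma>) k"
    unfolding D using assms
    by (intro singular_value_ge[OF dc, of _ k "\<lambda>i. e (\<sigma> i)" "\<lambda>i. 1 / (real i + 1)"])
      (auto simp: orth bij_is_inj inj_eq frac_le)
qed

end

section \<open>Positive normalized traces on diagonal operators\<close>

text \<open>With \<open>X = 1 - Y\<close> the equation \<open>X\<^sup>2 = 1 - B\<close> becomes the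
  fixed point equation \<open>Y = (B + Y\<^sup>2) / 2\<close>. On the ball of radius 1/2 the
  right-hand side is a contraction with factor 1/2, and \<open>norm B \<le> 1/4\<close> keeps it
  inside. The selfadjoint operators form a closed set that it preserves, so the fixed point is
  selfadjoint.\<close>

lemma ex_selfadjoint_sqrt:
  fixes B :: "'h::chilbert_space \<Rightarrow>\<^sub>L 'h"
  assumes B: "B \<in> complex_ops" "is_adjoint B B" "norm B \<le> 1/4"
  shows "\<exists>X\<in>complex_ops. is_adjoint X X \<and> X o\<^sub>L X = id_blinfun - B"
proof -
  define s where "s = complex_ops \<inter> {Y :: 'h \<Rightarrow>\<^sub>L 'h. is_adjoint Y Y} \<inter> cball 0 (1/2)"
  define f where "f Y = (1/2) *\<^sub>R (B + (Y o\<^sub>L Y))" for Y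
  have "{Y :: 'h \<Rightarrow>\<^sub>L 'h. is_adjoint Y Y}
      = (\<Inter>x. \<Inter>y. {Y. cinner (blinfun_apply Y x) y = cinner x (blinfun_apply Y y)})"
    by (auto simp: is_adjoint_def)
  moreover have "closed {Y :: 'h \<Rightarrow>\<^sub>L 'h. cinner (blinfun_apply Y x) y = cinner x (blinfun_apply Y y)}" for x y
    by (intro closed_Collect_eq linear_continuous_on
        bounded_linear_compose[OF cinner.bounded_linear_left]
        bounded_linear_compose[OF cinner.bounded_linear_right] blinfun.bounded_linear_left)
  ultimately have "closed {Y :: 'h \<Rightarrow>\<^sub>L 'h. is_adjoint Y Y}"
    by (simp only:) (intro closed_INT ballI)
  then have "closed s"
    unfolding s_def by (intro closed_Int closed_complex_ops closed_cball)
  then have "complete s" by (simp add: complete_eq_closed)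
  moreover have "0 \<in> s"
    by (auto simp: s_def is_adjoint_def cinner.zero_left cinner.zero_right)
  moreover have "f ` s \<subseteq> s"
  proof (rule image_subsetI)
    fix Y assume Y: "Y \<in> s"
    then have "norm (Y o\<^sub>L Y) \<le> 1/2 * (1/2)"
      unfolding s_def by (intro order_trans[OF norm_blinfun_compose] mult_mono) auto
    then have "norm (f Y) \<le> 1/2"
      using B(3) norm_triangle_ineq[of B "Y o\<^sub>L Y"] by (simp add: f_def)
    then show "f Y \<in> s"
      using Y B unfolding s_def f_def
      by (auto intro!: is_adjoint_scaleR is_adjoint_add is_adjoint_compose)
  qed
  moreover have "dist (f Y) (f Z) \<le> 1/2 * dist Y Z" if YZ: "Y \<in> s" "Z \<in> s" for Y Z
  proof -
    have "f Y - f Z = (1/2) *\<^sub>R (((Y - Z) o\<^sub>L Y) + (Z o\<^sub>L (Y - Z)))"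
      by (rule blinfun_eqI)
        (simp add: f_def blinfun.diff_left blinfun.add_left blinfun.scaleR_left blinfun.diff_right algebra_simps)
    then have "dist (f Y) (f Z) = 1/2 * norm (((Y - Z) o\<^sub>L Y) + (Z o\<^sub>L (Y - Z)))"
      by (simp add: dist_norm)
    also have "\<dots> \<le> 1/2 * (norm (Y - Z) * (1/2) + 1/2 * norm (Y - Z))"
      using YZ unfolding s_def
      by (intro mult_left_mono order_trans[OF norm_triangle_ineq] add_mono
          order_trans[OF norm_blinfun_compose] mult_mono) auto
    finally show ?thesis by (simp add: dist_norm)
  qed
  ultimately have "\<exists>!Y. Y \<in> s \<and> f Y = Y"
    by (intro Banach_fix[of s "1/2"]) auto
  then obtain Y where Y: "Y \<in> s" "f Y = Y" by blast
  have "(id_blinfun - Y) o\<^sub>L (id_blinfun - Y) = id_blinfun - 2 *\<^sub>R Y + (Y o\<^sub>L Y)"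
    by (rule blinfun_eqI)
      (simp add: blinfun.diff_left blinfun.add_left blinfun.scaleR_left blinfun.diff_right scaleR_2)
  also have "2 *\<^sub>R Y = B + (Y o\<^sub>L Y)"
    using arg_cong[OF Y(2), of "\<lambda>Z. 2 *\<^sub>R Z"] unfolding f_def by simp
  finally have "(id_blinfun - Y) o\<^sub>L (id_blinfun - Y) = id_blinfun - B" by simp
  with Y(1) show ?thesis
    unfolding s_def by (intro bexI[of _ "id_blinfun - Y"]) (auto intro: is_adjoint_diff is_adjoint_id)
qed

section \<open>Norm estimates obtained from positivity of the trace\<close>

locale nc_trace =
  fixes \<phi> :: "('h::chilbert_space \<Rightarrow>\<^sub>L 'h) \<Rightarrow> complex"
  assumes positive: "positive_trace \<phi>" and normalized: "normalized_trace \<phi>"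
begin

lemma weak: "weak_trace \<phi>"
  using positive by (simp add: positive_trace_def)

lemma tr_add: "S \<in> weak_ideal \<Longrightarrow> T \<in> weak_ideal \<Longrightarrow> \<phi> (S + T) = \<phi> S + \<phi> T"
  using weak weak_ideal_subset_weak_trace_class unfolding weak_trace_def by blast

lemma tr_scaleC: "T \<in> weak_ideal \<Longrightarrow> \<phi> (c *\<^sub>C T) = c * \<phi> T"
  using weak weak_ideal_subset_weak_trace_class unfolding weak_trace_def by blast

lemma tr_uminus: "T \<in> weak_ideal \<Longrightarrow> \<phi> (- T) = - \<phi> T"
  using tr_scaleC[of T "-1"] by (simp add: scaleC_blinfun_minus_one)

lemma tr_diff: "S \<in> weak_ideal \<Longrightarrow> T \<in> weak_ideal \<Longrightarrow> \<phi> (S - T) = \<phi> S - \<phi> T"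
  using tr_add[of S "- T"] tr_uminus[of T] weak_ideal_scaleC[of T "-1"]
  by (simp add: scaleC_blinfun_minus_one)

lemma tr_comm:
  assumes "A \<in> complex_ops" "T \<in> weak_ideal"
  shows "\<phi> (A o\<^sub>L T) = \<phi> (T o\<^sub>L A)"
proof -
  have "T \<in> weak_trace_class" using assms(2) weak_ideal_subset_weak_trace_class by blast
  then have "\<phi> ((A o\<^sub>L T) - (T o\<^sub>L A)) = 0"
    using weak assms(1) unfolding weak_trace_def by blast
  then show ?thesis
    using assms by (simp add: tr_diff weak_ideal_compose_left weak_ideal_compose_right)
qed

lemma tr_nonneg: "T \<in> weak_ideal \<Longrightarrow> positive_op T \<Longrightarrow> \<phi> T \<in> \<real>\<^sub>\<ge>\<^sub>0"
  using positive weak_ideal_subset_weak_trace_class unfolding positive_trace_def by blast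

text \<open>For \<open>A\<close> selfadjoint of small norm, \<open>1 - A = X\<^sup>2\<close> and \<open>\<phi> ((1 - A) D) = \<phi> (X D X) \<ge> 0\<close>.\<close>

lemma tr_compose_selfadjoint_bound:
  assumes D: "D \<in> weak_ideal" "positive_op D"
    and B: "B \<in> complex_ops" "is_adjoint B B" "norm B \<le> 1/4"
  shows "cmod (\<phi> (B o\<^sub>L D)) \<le> Re (\<phi> D)"
proof -
  have nonneg: "\<phi> D - \<phi> (C o\<^sub>L D) \<in> \<real>\<^sub>\<ge>\<^sub>0"
    if C: "C \<in> complex_ops" "is_adjoint C C" "norm C \<le> 1/4" for C
  proof -
    obtain X where X: "X \<in> complex_ops" "is_adjoint X X" "X o\<^sub>L X = id_blinfun - C"
      using ex_selfadjoint_sqrt[OF C] by blast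
    have "\<phi> D - \<phi> (C o\<^sub>L D) = \<phi> (D - (C o\<^sub>L D))"
      using D C(1) by (simp add: tr_diff weak_ideal_compose_left)
    also have "D - (C o\<^sub>L D) = (X o\<^sub>L X) o\<^sub>L D"
      unfolding X(3) by (rule blinfun_eqI) (simp add: blinfun.diff_left)
    also have "\<phi> \<dots> = \<phi> ((X o\<^sub>L D) o\<^sub>L X)"
      unfolding blinfun_compose_assoc'
      using tr_comm[OF X(1) weak_ideal_compose_left[OF D(1) X(1)]] by (simp add: blinfun_compose_assoc')
    also have "\<dots> \<in> \<real>\<^sub>\<ge>\<^sub>0"
    proof (rule tr_nonneg)
      show "(X o\<^sub>L D) o\<^sub>L X \<in> weak_ideal"
        using D(1) X(1) by (intro weak_ideal_compose_left weak_ideal_compose_right)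
      show "positive_op ((X o\<^sub>L D) o\<^sub>L X)"
        using D(2) X(1,2) unfolding positive_op_def is_adjoint_def
        by (simp add: complex_ops_compose)
    qed
    finally show ?thesis .
  qed
  \<comment> \<open>The estimate for \<open>- B\<close> supplies the bound from the other side.
    Since the differences and \<open>\<phi> D\<close> are real, so is
    \<open>\<phi> (B D)\<close>.\<close>
  have "is_adjoint (- B) (- B)"
    using is_adjoint_scaleR[OF B(2), of "-1"] by simp
  then have "\<phi> D - \<phi> ((- B) o\<^sub>L D) \<in> \<real>\<^sub>\<ge>\<^sub>0"
    using B by (intro nonneg) auto
  moreover have "(- B) o\<^sub>L D = - (B o\<^sub>L D)"
    by (rule blinfun_eqI) (simp add: blinfun.minus_left)
  ultimately have "\<phi> D + \<phi> (B o\<^sub>L D) \<in> \<real>\<^sub>\<ge>\<^sub>0"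
    using D(1) B(1) by (simp add: tr_uminus weak_ideal_compose_left)
  moreover have "\<phi> D - \<phi> (B o\<^sub>L D) \<in> \<real>\<^sub>\<ge>\<^sub>0"
    by (rule nonneg[OF B])
  moreover have "\<phi> D \<in> \<real>\<^sub>\<ge>\<^sub>0"
    by (rule tr_nonneg[OF D])
  ultimately have "Im (\<phi> (B o\<^sub>L D)) = 0" "\<bar>Re (\<phi> (B o\<^sub>L D))\<bar> \<le> Re (\<phi> D)"
    unfolding complex_nonneg_Reals_iff by auto
  then show ?thesis
    by (simp add: cmod_def)
qed

lemma tr_compose_selfadjoint_bound':
  assumes D: "D \<in> weak_ideal" "positive_op D"
    and B: "B \<in> complex_ops" "is_adjoint B B"
  shows "cmod (\<phi> (B o\<^sub>L D)) \<le> 4 * norm B * Re (\<phi> D)"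
proof (cases "B = 0")
  case True
  then have "B o\<^sub>L D = 0 *\<^sub>C D"
    by (auto intro!: blinfun_eqI simp: scaleC.zero_left)
  then show ?thesis using True tr_scaleC[OF D(1), of 0] by simp
next
  case False
  \<comment> \<open>Dividing by \<open>c\<close> brings the norm down to 1/4, the range of the
    square root.\<close>
  define c where "c = 4 * norm B"
  have "c > 0" using False by (simp add: c_def)
  define A where "A = complex_of_real (1 / c) *\<^sub>C B"
  have "cmod (\<phi> (A o\<^sub>L D)) \<le> Re (\<phi> D)"
  proof (rule tr_compose_selfadjoint_bound[OF D])
    show "A \<in> complex_ops" unfolding A_def using B by blast
    show "is_adjoint A A" unfolding A_def using is_adjoint_scaleC[OF B(2)] by (metis complex_cnj_complex_of_real)
    show "norm A \<le> 1/4" using \<open>c > 0\<close> by (simp add: A_def norm_scaleC_blinfun norm_divide c_def)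
  qed
  moreover have "\<phi> (A o\<^sub>L D) = complex_of_real (1 / c) * \<phi> (B o\<^sub>L D)"
    unfolding A_def scaleC_compose_left using D B by (simp add: tr_scaleC weak_ideal_compose_left)
  ultimately show ?thesis
    using \<open>c > 0\<close> unfolding c_def[symmetric] by (simp add: norm_mult norm_divide field_simps)
qed

text \<open>The continuity of \<open>A \<mapsto> \<phi> (A D)\<close> on which all limits below
  rest. Write \<open>A = B + \<i> C\<close> with selfadjoint parts of norm at most
  \<open>norm A\<close>; each contributes the factor 4 of the selfadjoint case.\<close>

lemma tr_compose_bound:
  assumes D: "D \<in> weak_ideal" "positive_op D" and A: "A \<in> complex_ops"
  shows "cmod (\<phi> (A o\<^sub>L D)) \<le> 8 * norm A * Re (\<phi> D)"
proof -
  define B where "B = (1/2) *\<^sub>R (A + adj A)"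
  define C where "C = (1/2) *\<^sub>R ((\<i> *\<^sub>C adj A) - (\<i> *\<^sub>C A))"
  note adj = is_adjoint_adj[OF A] is_adjoint_sym[OF is_adjoint_adj[OF A]]
  have BC: "B \<in> complex_ops" "C \<in> complex_ops"
    using A by (auto simp: B_def C_def)
  have B: "is_adjoint B B"
    unfolding B_def using is_adjoint_scaleR[OF is_adjoint_add[OF adj]] by (simp add: add.commute)
  have "is_adjoint C ((1/2) *\<^sub>R ((cnj \<i> *\<^sub>C A) - (cnj \<i> *\<^sub>C adj A)))"
    unfolding C_def by (intro is_adjoint_scaleR is_adjoint_diff is_adjoint_scaleC adj)
  then have C: "is_adjoint C C"
    unfolding C_def by (simp add: scaleC_blinfun.minus_left)
  have "norm (adj A) = norm A" by (rule is_adjoint_norm[OF adj(1)])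
  then have "norm B \<le> norm A" "norm C \<le> norm A"
    using norm_triangle_ineq[of A "adj A"] norm_triangle_ineq4[of "\<i> *\<^sub>C adj A" "\<i> *\<^sub>C A"]
    by (auto simp: B_def C_def norm_scaleC_blinfun)
  moreover have "Re (\<phi> D) \<ge> 0"
    using tr_nonneg[OF D] by (simp add: complex_nonneg_Reals_iff)
  ultimately have le: "cmod (\<phi> (B o\<^sub>L D)) \<le> 4 * norm A * Re (\<phi> D)" "cmod (\<phi> (C o\<^sub>L D)) \<le> 4 * norm A * Re (\<phi> D)"
    using tr_compose_selfadjoint_bound'[OF D BC(1) B] tr_compose_selfadjoint_bound'[OF D BC(2) C]
    by (meson mult_left_mono mult_right_mono order_trans zero_le_numeral)+
  have "A = B + \<i> *\<^sub>C C"
  proof (rule blinfun_eqI)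
    fix x
    have "blinfun_apply (B + \<i> *\<^sub>C C) x = (1/2) *\<^sub>R (blinfun_apply A x + blinfun_apply A x)"
      by (simp add: B_def C_def blinfun.add_left blinfun.scaleR_left blinfun.diff_left scaleC.scaleR_right
          scaleC.diff_right scaleC_scaleC scaleC_minus_one scaleR_add_right scaleR_diff_right)
    then show "blinfun_apply A x = blinfun_apply (B + \<i> *\<^sub>C C) x"
      by (simp only: scaleR_half_double)
  qed
  then have "A o\<^sub>L D = (B o\<^sub>L D) + \<i> *\<^sub>C (C o\<^sub>L D)"
    by (auto intro!: blinfun_eqI simp: blinfun.add_left)
  then have "\<phi> (A o\<^sub>L D) = \<phi> (B o\<^sub>L D) + \<i> * \<phi> (C o\<^sub>L D)"
    using D BC by (simp add: tr_add tr_scaleC weak_ideal_compose_left weak_ideal_scaleC)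
  also have "cmod \<dots> \<le> 4 * norm A * Re (\<phi> D) + 4 * norm A * Re (\<phi> D)"
    using le by (intro order_trans[OF norm_triangle_ineq] add_mono) (auto simp: norm_mult)
  finally show ?thesis by simp
qed

end

text \<open>The enumeration is a parameter because it is chosen afresh for each multiplier, while
  the trace and the basis stay fixed.\<close>

locale onb_trace = onb e + nc_trace \<phi>
  for e :: "'i \<Rightarrow> 'h::chilbert_space" and \<phi> :: "('h \<Rightarrow>\<^sub>L 'h) \<Rightarrow> complex" +
  fixes \<sigma> :: "nat \<Rightarrow> 'i"
  assumes bij: "bij \<sigma>"
begin

abbreviation hwt :: "'i \<Rightarrow> real" where
  "hwt i \<equiv> 1 / (real (inv \<sigma> i) + 1)"

abbreviation proj :: "'i \<Rightarrow> 'h \<Rightarrow>\<^sub>L 'h" where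
  "proj j \<equiv> diag (\<lambda>i. if i = j then 1 else 0)"

lemma weak_ideal_diag_le_harm:
  assumes "\<And>i. cmod (b i) \<le> C * hwt i"
  shows "diag b \<in> weak_ideal"
proof (rule diag_weak_ideal[OF bij])
  show "cmod (b (\<sigma> j)) \<le> C / (real j + 1)" for j
    using assms[of "\<sigma> j"] bij by (simp add: bij_is_inj)
qed

lemma bounded_le_harm:
  assumes "\<And>i. cmod (b i) \<le> C * hwt i"
  shows "bounded (range b)"
proof (rule bounded_of_decay[OF bij])
  show "cmod (b (\<sigma> j)) \<le> C / (real j + 1)" for j
    using assms[of "\<sigma> j"] bij by (simp add: bij_is_inj)
qed

lemma finite_support_le_harm:
  fixes b :: "'i \<Rightarrow> complex"
  assumes "finite F"
  shows "\<exists>C. \<forall>i. cmod (if i \<in> F then b i else 0) \<le> C * hwt i"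
proof -
  define C where "C = (\<Sum>i\<in>F. cmod (b i) / hwt i)"
  have "cmod (if i \<in> F then b i else 0) \<le> C * hwt i" for i
  proof (cases "i \<in> F")
    case True
    then have "cmod (b i) / hwt i \<le> C"
      unfolding C_def using assms by (intro member_le_sum) auto
    then show ?thesis using True by (simp add: field_simps add_pos_nonneg)
  next
    case False
    then show ?thesis by (simp add: C_def sum_nonneg)
  qed
  then show ?thesis by blast
qed

lemma weak_ideal_diag_finite_support:
  "finite F \<Longrightarrow> diag (\<lambda>i. if i \<in> F then b i else 0) \<in> weak_ideal"
proof -
  assume "finite F"
  then obtain C where C: "\<forall>i. cmod (if i \<in> F then b i else 0) \<le> C * hwt i"
    using finite_support_le_harm[of F b] by blast
  show ?thesis
    by (rule weak_ideal_diag_le_harm[of _ C]) (rule C[rule_format])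
qed

lemma weak_ideal_proj: "proj j \<in> weak_ideal"
  using weak_ideal_diag_finite_support[of "{j}" "\<lambda>_. 1"] by simp

lemma bounded_proj: "bounded (range (\<lambda>i. if i = j then 1 else 0 :: complex))"
  by (rule bounded_range_if) simp

text \<open>The matrix units between \<open>e i\<close> and \<open>e j\<close> have the product
  \<open>proj j\<close> in one order and \<open>proj i\<close> in the other; cyclicity equates the
  traces.\<close>

lemma tr_proj_eq: "\<phi> (proj j) = \<phi> (proj i)"
proof -
  have bl: "bounded_linear (\<lambda>x. cinner x (e i) *\<^sub>C e j)" for i j
    by (intro bounded_linear_compose[OF scaleC.bounded_linear_left] cinner.bounded_linear_left)
  define A where "A i j = Blinfun (\<lambda>x. cinner x (e i) *\<^sub>C e j)" for i j
  have ap: "blinfun_apply (A i j) x = cinner x (e i) *\<^sub>C e j" for i j x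
    unfolding A_def by (simp add: bounded_linear_Blinfun_apply[OF bl])
  have A: "A i j \<in> complex_ops" for i j
    by (simp add: complex_ops_def ap cinner_scaleC_left scaleC_scaleC)
  \<comment> \<open>Factoring through a rank one projection places the matrix unit in the ideal, as
    cyclicity requires.\<close>
  have "A i j = A i j o\<^sub>L proj i"
    using A diag_complex[OF bounded_proj]
    by (intro ops_eqI complex_ops_compose) (auto simp: ap diag_e[OF bounded_proj] orth scaleC.zero_left cinner.zero_left)
  then have W: "A i j \<in> weak_ideal"
    using weak_ideal_compose_left[OF weak_ideal_proj A] by metis
  have p: "A i j o\<^sub>L A j i = proj j" for i j
    using A diag_complex[OF bounded_proj]
    by (intro ops_eqI complex_ops_compose)
      (auto simp: ap diag_e[OF bounded_proj] orth scaleC_scaleC scaleC.zero_left cinner_scaleC_left)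
  show ?thesis
    using tr_comm[OF A W, of j i] by (simp add: p)
qed

lemma tr_harmonic: "\<phi> (harmonic_diag \<sigma>) = 1"
proof -
  have "positive_op (harmonic_diag \<sigma>)"
    unfolding harmonic_diag_def
  proof (rule diag_positive)
    show "bounded (range (\<lambda>i. complex_of_real (hwt i)))"
      by (rule bounded_le_harm[of _ 1]) (simp add: norm_divide del: of_real_add)
  qed (simp add: complex_nonneg_Reals_iff)
  then show ?thesis
    using normalized harmonic_diag_weak_ideal[OF bij] weak_ideal_subset_weak_trace_class
      singular_value_harmonic_diag[OF bij]
    unfolding normalized_trace_def by blast
qed

lemma tr_diag_mono:
  assumes "\<And>i. 0 \<le> f i" "\<And>i. f i \<le> g i" "\<And>i. g i \<le> C * hwt i"
  shows "\<phi> (diag (\<lambda>i. of_real (g i))) - \<phi> (diag (\<lambda>i. of_real (f i))) \<in> \<real>\<^sub>\<ge>\<^sub>0"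
proof -
  have g: "cmod (of_real (g i)) \<le> C * hwt i" and f: "cmod (of_real (f i)) \<le> C * hwt i"
    and d: "cmod (of_real (g i - f i)) \<le> C * hwt i" for i
    using assms[of i] unfolding norm_of_real by linarith+
  have "diag (\<lambda>i. of_real (g i)) = diag (\<lambda>i. of_real (g i - f i)) + diag (\<lambda>i. of_real (f i))"
    by (subst diag_add[OF bounded_le_harm[OF d] bounded_le_harm[OF f]]) simp
  then have "\<phi> (diag (\<lambda>i. of_real (g i))) = \<phi> (diag (\<lambda>i. of_real (g i - f i))) + \<phi> (diag (\<lambda>i. of_real (f i)))"
    using weak_ideal_diag_le_harm[OF f] weak_ideal_diag_le_harm[OF d] by (metis tr_add)
  moreover have "\<phi> (diag (\<lambda>i. of_real (g i - f i))) \<in> \<real>\<^sub>\<ge>\<^sub>0"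
    using assms weak_ideal_diag_le_harm[OF d] bounded_le_harm[OF d]
    by (intro tr_nonneg diag_positive) (auto simp: complex_nonneg_Reals_iff)
  ultimately show ?thesis by simp
qed

lemma tr_diag_finite_sum:
  assumes "finite F"
  shows "\<phi> (diag (\<lambda>i. if i \<in> F then b i else 0)) = (\<Sum>i\<in>F. b i) * \<phi> (proj j)"
  using assms
proof (induction F)
  case empty
  have "diag (\<lambda>i. 0) = 0 *\<^sub>C proj j"
    by (subst diag_scaleC[OF bounded_proj]) simp
  then show ?case using tr_scaleC[OF weak_ideal_proj, of 0 j] by simp
next
  case (insert k F)
  have "diag (\<lambda>i. if i \<in> insert k F then b i else 0)
      = b k *\<^sub>C proj k + diag (\<lambda>i. if i \<in> F then b i else 0)"
    unfolding diag_scaleC[OF bounded_proj] using insert.hyps bounded_range_cmult[OF bounded_proj]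
    by (subst diag_add[OF _ bounded_range_if_finite]) (auto intro!: arg_cong[of _ _ diag])
  then have "\<phi> (diag (\<lambda>i. if i \<in> insert k F then b i else 0))
      = b k * \<phi> (proj k) + \<phi> (diag (\<lambda>i. if i \<in> F then b i else 0))"
    using insert.hyps weak_ideal_proj weak_ideal_diag_finite_support
    by (simp add: tr_add tr_scaleC weak_ideal_scaleC)
  then show ?case
    using insert tr_proj_eq[of k j] by (simp add: ring_distribs)
qed

text \<open>All basis projections share one trace \<open>c \<ge> 0\<close>. By monotonicity
  \<open>c\<close> times any partial sum of the harmonic series is at most the trace 1 of
  \<open>harmonic_diag\<close>, and the series diverges. Hence finitely many diagonal entries never
  influence a trace.\<close>

lemma tr_proj: "\<phi> (proj j) = 0"
proof (rule ccontr)
  define c where "c = Re (\<phi> (proj j))"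
  have "positive_op (proj j)"
    by (rule diag_positive[OF bounded_proj]) (auto simp: complex_nonneg_Reals_iff)
  then have nn: "\<phi> (proj j) \<in> \<real>\<^sub>\<ge>\<^sub>0"
    by (rule tr_nonneg[OF weak_ideal_proj])
  assume "\<phi> (proj j) \<noteq> 0"
  with nn have "c > 0" and pc: "\<phi> (proj j) = of_real c"
    by (auto simp: c_def complex_nonneg_Reals_iff complex_eq_iff order_less_le)
  have "(\<Sum>k<N. 1 / (real k + 1)) \<le> 1 / c" for N
  proof -
    let ?F = "\<sigma> ` {..<N}"
    have "\<phi> (diag (\<lambda>i. of_real (hwt i))) - \<phi> (diag (\<lambda>i. of_real (if i \<in> ?F then hwt i else 0))) \<in> \<real>\<^sub>\<ge>\<^sub>0"
      by (rule tr_diag_mono[of _ _ 1]) auto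
    moreover have "\<phi> (diag (\<lambda>i. of_real (hwt i))) = 1"
      using tr_harmonic by (simp only: harmonic_diag_def)
    moreover have "\<phi> (diag (\<lambda>i. of_real (if i \<in> ?F then hwt i else 0))) = (\<Sum>i\<in>?F. of_real (hwt i)) * of_real c"
      using tr_diag_finite_sum[of ?F "\<lambda>i. of_real (hwt i)" j] by (simp add: pc if_distrib cong: if_cong)
    moreover have "(\<Sum>i\<in>?F. complex_of_real (hwt i)) = (\<Sum>k<N. of_real (1 / (real k + 1)))"
      using bij by (subst sum.reindex) (auto simp: bij_is_inj inj_on_subset[OF bij_is_inj[OF bij]])
    ultimately have "(1 :: complex) - of_real ((\<Sum>k<N. 1 / (real k + 1)) * c) \<in> \<real>\<^sub>\<ge>\<^sub>0"
      by simp
    then have "(\<Sum>k<N. 1 / (real k + 1)) * c \<le> 1"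
      unfolding complex_nonneg_Reals_iff by simp
    then show ?thesis using \<open>c > 0\<close> by (simp add: field_simps)
  qed
  then have "summable (\<lambda>k. 1 / (real k + 1))"
    by (intro bounded_imp_summable[of _ "1 / c"]) (simp, simp only: lessThan_Suc_atMost[symmetric])
  then have "summable (\<lambda>k. inverse (of_nat (Suc k)) :: real)"
    by (simp add: inverse_eq_divide add.commute)
  then show False
    using not_summable_harmonic summable_Suc_iff by blast
qed

lemma tr_diag_finite_support:
  "finite F \<Longrightarrow> \<phi> (diag (\<lambda>i. if i \<in> F then b i else 0)) = 0"
  using tr_diag_finite_sum tr_proj by simp

text \<open>Discarding finitely many entries costs nothing. The remaining ones are at most
  \<open>\<epsilon> * hwt i\<close> in absolute value, so adding the diagonal to
  \<open>\<epsilon>\<close> times the model, or subtracting it, leaves a positive operator, and the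
  trace is at most \<open>\<epsilon>\<close> in modulus.\<close>

lemma tr_diag_limit_0:
  fixes h :: "'i \<Rightarrow> real"
  assumes lim: "(\<lambda>j. (real j + 1) * h (\<sigma> j)) \<longlonglongrightarrow> 0"
  shows "\<phi> (diag (\<lambda>i. of_real (h i))) = 0"
proof -
  have small: "cmod (\<phi> (diag (\<lambda>i. of_real (h i)))) \<le> \<epsilon>" if eps: "0 < \<epsilon>" for \<epsilon>
  proof -
    obtain N where N: "\<And>j. j \<ge> N \<Longrightarrow> \<bar>(real j + 1) * h (\<sigma> j)\<bar> < \<epsilon>"
      using LIMSEQ_D[OF lim eps] by auto
    define F where "F = \<sigma> ` {..<N}"
    have "finite F" by (simp add: F_def)
    define g where "g i = (if i \<in> F then 0 else h i)" for i
    have g_le: "\<bar>g i\<bar> \<le> \<epsilon> * hwt i" for i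
    proof (cases "i \<in> F")
      case False
      obtain j where j: "i = \<sigma> j" using bij_is_surj[OF bij] by (rule surjE)
      with False have "j \<ge> N" by (auto simp: F_def not_less[symmetric])
      then have "(real j + 1) * \<bar>h (\<sigma> j)\<bar> < \<epsilon>" using N[of j] by (simp add: abs_mult)
      moreover have "inv \<sigma> i = j" using bij j by (simp add: bij_is_inj)
      ultimately show ?thesis using False j by (simp add: g_def field_simps)
    qed (use eps in \<open>simp add: g_def\<close>)
    have p: "cmod (of_real (\<epsilon> * hwt i)) \<le> \<epsilon> * hwt i" for i
      using eps by (simp only: norm_of_real) simp
    have g_le': "cmod (of_real (g i)) \<le> \<epsilon> * hwt i" for i
      using g_le[of i] by simp
    have "diag (\<lambda>i. of_real (h i)) = diag (\<lambda>i. of_real (g i)) + diag (\<lambda>i. if i \<in> F then of_real (h i) else 0)"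
      using \<open>finite F\<close>
      by (subst diag_add[OF bounded_le_harm[OF g_le'] bounded_range_if_finite])
        (auto simp: g_def intro!: arg_cong[of _ _ diag])
    then have hg: "\<phi> (diag (\<lambda>i. of_real (h i))) = \<phi> (diag (\<lambda>i. of_real (g i)))"
      using tr_add[OF weak_ideal_diag_le_harm[OF g_le'] weak_ideal_diag_finite_support[OF \<open>finite F\<close>], of "\<lambda>i. of_real (h i)"]
        tr_diag_finite_support[OF \<open>finite F\<close>] by simp
    have "harmonic_diag \<sigma> \<in> weak_ideal" by (rule harmonic_diag_weak_ideal[OF bij])
    have bh: "bounded (range (\<lambda>i. complex_of_real (hwt i)))"
      by (rule bounded_le_harm[of _ 1]) (simp add: norm_divide del: of_real_add)
    have pos: "of_real \<epsilon> + c * \<phi> (diag (\<lambda>i. of_real (g i))) \<in> \<real>\<^sub>\<ge>\<^sub>0" if "c = 1 \<or> c = -1" for c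
    proof -
      have eq: "complex_of_real \<epsilon> *\<^sub>C harmonic_diag \<sigma> + c *\<^sub>C diag (\<lambda>i. of_real (g i))
          = diag (\<lambda>i. of_real \<epsilon> * of_real (hwt i) + c * of_real (g i))"
        unfolding harmonic_diag_def diag_scaleC[OF bh] diag_scaleC[OF bounded_le_harm[OF g_le']]
        by (rule diag_add[OF bounded_range_cmult[OF bh] bounded_range_cmult[OF bounded_le_harm[OF g_le']]])
      have "positive_op (diag (\<lambda>i. of_real \<epsilon> * of_real (hwt i) + c * of_real (g i)))"
      proof (rule diag_positive)
        show "bounded (range (\<lambda>i. of_real \<epsilon> * of_real (hwt i) + c * of_real (g i)))"
          by (rule bounded_range_add[OF bounded_range_cmult[OF bh] bounded_range_cmult[OF bounded_le_harm[OF g_le']]])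
        show "of_real \<epsilon> * of_real (hwt i) + c * of_real (g i) \<in> \<real>\<^sub>\<ge>\<^sub>0" for i
          using g_le[of i] that unfolding of_real_mult[symmetric]
          by (auto simp: complex_nonneg_Reals_iff abs_le_iff simp del: of_real_mult of_real_divide)
      qed
      then have "\<phi> (complex_of_real \<epsilon> *\<^sub>C harmonic_diag \<sigma> + c *\<^sub>C diag (\<lambda>i. of_real (g i))) \<in> \<real>\<^sub>\<ge>\<^sub>0"
        unfolding eq[symmetric] using harmonic_diag_weak_ideal[OF bij] weak_ideal_diag_le_harm[OF g_le']
        by (intro tr_nonneg weak_ideal_add weak_ideal_scaleC)
      then show ?thesis
        using harmonic_diag_weak_ideal[OF bij] weak_ideal_diag_le_harm[OF g_le']
        by (simp add: tr_add tr_scaleC weak_ideal_scaleC tr_harmonic)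
    qed
    have "Im (\<phi> (diag (\<lambda>i. of_real (g i)))) = 0" "\<bar>Re (\<phi> (diag (\<lambda>i. of_real (g i))))\<bar> \<le> \<epsilon>"
      using pos[of 1] pos[of "-1"] by (auto simp: complex_nonneg_Reals_iff)
    then show ?thesis unfolding hg by (simp add: cmod_def)
  qed
  then have "cmod (\<phi> (diag (\<lambda>i. of_real (h i)))) \<le> 0"
    by (rule field_le_epsilon[where y = 0, simplified]) 
  then show ?thesis by simp
qed

text \<open>Subtracting \<open>L\<close> times the model leaves entries of size o(1/j), whose real
  and imaginary parts \<open>u\<close> and \<open>v\<close> have trace zero. Boundedness and
  membership in the ideal hold because a convergent sequence is bounded.\<close>

lemma tr_diag_limit:
  assumes lim: "(\<lambda>j. (real j + 1) *\<^sub>R g (\<sigma> j)) \<longlonglongrightarrow> L"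
  shows "\<phi> (diag g) = L" and "diag g \<in> weak_ideal" and "bounded (range g)"
proof -
  have decay: "\<exists>C. \<forall>i. cmod (h i) \<le> C * hwt i" if lim_h: "(\<lambda>j. (real j + 1) *\<^sub>R h (\<sigma> j)) \<longlonglongrightarrow> l" for h l
  proof -
    obtain C where C: "\<And>j. norm ((real j + 1) *\<^sub>R h (\<sigma> j)) \<le> C"
      using convergent_imp_Bseq[OF convergentI[OF lim_h]] unfolding Bseq_def by blast
    have "cmod (h i) \<le> C * hwt i" for i
    proof -
      obtain j where j: "i = \<sigma> j" using bij_is_surj[OF bij] by (rule surjE)
      have "inv \<sigma> i = j" using bij j by (simp add: bij_is_inj)
      then show ?thesis using C[of j] j unfolding norm_scaleR by (simp add: field_simps)
    qed
    then show ?thesis by blast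
  qed
  obtain C where C: "\<And>i. cmod (g i) \<le> C * hwt i" using decay[OF lim] by blast
  show "diag g \<in> weak_ideal" "bounded (range g)"
    using weak_ideal_diag_le_harm[OF C] bounded_le_harm[OF C] by auto
  have bh: "bounded (range (\<lambda>i. complex_of_real (hwt i)))"
    by (rule bounded_le_harm[of _ 1]) (simp add: norm_divide del: of_real_add)
  define u where "u i = Re (g i - L * of_real (hwt i))" for i
  define v where "v i = Im (g i - L * of_real (hwt i))" for i
  have "(\<lambda>j. (real j + 1) *\<^sub>R g (\<sigma> j) - L) \<longlonglongrightarrow> L - L"
    by (intro tendsto_intros lim)
  moreover have "(real j + 1) *\<^sub>R g (\<sigma> j) - L = (real j + 1) *\<^sub>R (g (\<sigma> j) - L * of_real (hwt (\<sigma> j)))" for j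
  proof -
    have "(real j + 1) *\<^sub>R (L * of_real (hwt (\<sigma> j))) = L * of_real ((real j + 1) * hwt (\<sigma> j))"
      by (simp only: scaleR_conv_of_real of_real_mult mult.commute mult.left_commute)
    also have "(real j + 1) * hwt (\<sigma> j) = 1" using bij by (simp add: bij_is_inj)
    finally show ?thesis by (simp add: scaleR_diff_right)
  qed
  ultimately have lim0: "(\<lambda>j. (real j + 1) *\<^sub>R (g (\<sigma> j) - L * of_real (hwt (\<sigma> j)))) \<longlonglongrightarrow> 0" by simp
  from tendsto_Re[OF lim0] have lu: "(\<lambda>j. (real j + 1) * u (\<sigma> j)) \<longlonglongrightarrow> 0" by (simp add: u_def)
  from tendsto_Im[OF lim0] have lv: "(\<lambda>j. (real j + 1) * v (\<sigma> j)) \<longlonglongrightarrow> 0" by (simp add: v_def)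
  have lu': "(\<lambda>j. (real j + 1) *\<^sub>R complex_of_real (u (\<sigma> j))) \<longlonglongrightarrow> 0"
    and lv': "(\<lambda>j. (real j + 1) *\<^sub>R complex_of_real (v (\<sigma> j))) \<longlonglongrightarrow> 0"
    using tendsto_of_real[OF lu] tendsto_of_real[OF lv] by (simp_all add: scaleR_conv_of_real)
  obtain A where A: "\<And>i. cmod (of_real (u i)) \<le> A * hwt i" using decay[OF lu'] by blast
  obtain B where B: "\<And>i. cmod (of_real (v i)) \<le> B * hwt i" using decay[OF lv'] by blast
  have uv: "of_real (u i) + \<i> * of_real (v i) = g i - L * of_real (hwt i)" for i
    unfolding u_def v_def by (rule complex_eq[symmetric])
  have g_eq: "g = (\<lambda>i. of_real (u i) + \<i> * of_real (v i) + L * of_real (hwt i))"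
    by (rule ext) (simp only: uv diff_add_cancel)
  note bu = bounded_le_harm[OF A] and bv = bounded_range_cmult[OF bounded_le_harm[OF B]]
  have "diag g = diag (\<lambda>i. of_real (u i)) + \<i> *\<^sub>C diag (\<lambda>i. of_real (v i)) + L *\<^sub>C harmonic_diag \<sigma>"
    unfolding harmonic_diag_def diag_scaleC[OF bh] diag_scaleC[OF bounded_le_harm[OF B]] diag_add[OF bu bv]
      diag_add[OF bounded_range_add[OF bu bv] bounded_range_cmult[OF bh]]
    by (rule arg_cong[OF g_eq])
  then have "\<phi> (diag g) = \<phi> (diag (\<lambda>i. of_real (u i))) + \<i> * \<phi> (diag (\<lambda>i. of_real (v i))) + L * 1"
    using weak_ideal_diag_le_harm[OF A] weak_ideal_diag_le_harm[OF B] harmonic_diag_weak_ideal[OF bij]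
    by (simp add: tr_add tr_scaleC weak_ideal_scaleC weak_ideal_add tr_harmonic)
  then show "\<phi> (diag g) = L"
    by (simp add: tr_diag_limit_0[OF lu] tr_diag_limit_0[OF lv])
qed

end

section \<open>Counting lattice points in dilated star-shaped regions\<close>

subsection \<open>Half-open cubes\<close>

text \<open>Half open, so that the translates by the lattice of mesh \<open>t\<close> cover every
  point exactly once, without exceptional sets.\<close>

definition cell :: "real ^ 'n \<Rightarrow> real \<Rightarrow> (real ^ 'n) set" where
  "cell a t = {x. \<forall>i. a $ i \<le> x $ i \<and> x $ i < a $ i + t}"

lemma cell_borel [measurable]: "cell a t \<in> sets borel"
  unfolding cell_def by measurable

lemma box_subset_cell: "box a (a + (\<chi> i. t)) \<subseteq> cell a t"
  and cell_subset_cbox: "cell a t \<subseteq> cbox a (a + (\<chi> i. t))"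
  by (auto simp: cell_def mem_box_cart less_imp_le)

lemma measure_cell:
  fixes a :: "real ^ 'n"
  assumes "0 < t"
  shows "measure lborel (cell a t) = t ^ CARD('n)" and "emeasure lborel (cell a t) \<noteq> \<infinity>"
proof -
  have c: "emeasure lborel (cbox a (a + (\<chi> i. t))) = ennreal (t ^ CARD('n))"
    and b: "emeasure lborel (box a (a + (\<chi> i. t))) = ennreal (t ^ CARD('n))"
    unfolding emeasure_lborel_cbox_eq emeasure_lborel_box_eq using assms
    by (simp_all add: Basis_vec_def inner_axis UNION_singleton_eq_range prod.reindex inj_on_def axis_eq_axis)
  have "emeasure lborel (cell a t) = ennreal (t ^ CARD('n))"
    using emeasure_mono[OF box_subset_cell[of a t], of lborel] emeasure_mono[OF cell_subset_cbox[of a t], of lborel]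
    by (simp add: b c)
  then show "measure lborel (cell a t) = t ^ CARD('n)" "emeasure lborel (cell a t) \<noteq> \<infinity>"
    using assms by (simp_all add: measure_def)
qed

lemma AE_cell_iff_cbox: "AE x in lborel. x \<in> cell a t \<longleftrightarrow> x \<in> cbox a (a + (\<chi> i. t))"
proof -
  let ?N = "cbox a (a + (\<chi> i. t)) - box a (a + (\<chi> i. t))"
  have "negligible ?N" by (rule negligible_frontier_interval)
  then have "?N \<in> null_sets lborel"
    by (simp add: negligible_iff_null_sets null_sets_completion_iff)
  from AE_not_in[OF this] show ?thesis
    using box_subset_cell[of a t] cell_subset_cbox[of a t] by (auto elim!: eventually_mono)
qed

lemma lattice_vec_inject: "lattice_vec k = lattice_vec l \<longleftrightarrow> k = l"
  by (auto simp: lattice_vec_def vec_eq_iff)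

lemma lattice_vec_0 [simp]: "lattice_vec 0 = 0"
  by (simp add: lattice_vec_def vec_eq_iff)

lemma lattice_vec_eq_0_iff [simp]: "lattice_vec k = 0 \<longleftrightarrow> k = 0"
  using lattice_vec_inject[of k 0] by simp

lemma lattice_vec_nth [simp]: "lattice_vec k $ i = of_int (k $ i)"
  by (simp add: lattice_vec_def)

lemma finite_lattice_ball: "finite {k :: int ^ 'n. norm (lattice_vec k) \<le> R}"
proof (rule finite_subset)
  let ?M = "\<lceil>R\<rceil>"
  have "\<bar>k $ i\<bar> \<le> ?M" if "norm (lattice_vec k) \<le> R" for k :: "int ^ 'n" and i
    using component_le_norm_cart[of "lattice_vec k" i] that by (simp add: lattice_vec_def le_ceiling_iff)
  then show "{k :: int ^ 'n. norm (lattice_vec k) \<le> R} \<subseteq> vec_lambda ` (Pi\<^sub>E UNIV (\<lambda>_. {-?M..?M}))"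
  proof (intro subsetI)
    fix k :: "int ^ 'n" assume k: "k \<in> {k. norm (lattice_vec k) \<le> R}"
    have "k = vec_lambda (\<lambda>i. k $ i)" by simp
    moreover have "(\<lambda>i. k $ i) \<in> Pi\<^sub>E UNIV (\<lambda>_. {-?M..?M})"
      using \<open>\<And>k i. norm (lattice_vec k) \<le> R \<Longrightarrow> \<bar>k $ i\<bar> \<le> ?M\<close>[of k] k by (auto simp: PiE_def abs_le_iff minus_le_iff)
    ultimately show "k \<in> vec_lambda ` (Pi\<^sub>E UNIV (\<lambda>_. {-?M..?M}))" by blast
  qed
  show "finite (vec_lambda ` (Pi\<^sub>E UNIV (\<lambda>_ :: 'n. {-?M..?M})))"
    by (intro finite_imageI finite_PiE) auto
qed

subsection \<open>The lattice point count\<close>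

text \<open>The number of points of \<open>t\<^sup>-\<^sup>1 \<int>\<^sup>n\<close> in \<open>S\<close>, divided by \<open>t\<^sup>n\<close>, is the measure of the set of
  all \<open>x\<close> whose lower lattice corner lies in \<open>S\<close>; dominated convergence applies off the frontier.\<close>

lemma lattice_point_count:
  fixes S :: "(real ^ 'n) set"
  assumes S: "S \<in> sets borel" "bounded S" "negligible (frontier S)"
    and t: "filterlim t at_top sequentially" "\<And>j. 1 \<le> t j"
  shows "(\<lambda>j. real (card {k :: int ^ 'n. lattice_vec k /\<^sub>R t j \<in> S}) / t j ^ CARD('n)) \<longlonglongrightarrow> measure lborel S"
proof -
  define p where "p s x = (\<chi> i. real_of_int \<lfloor>s * x $ i\<rfloor>) /\<^sub>R s" for s and x :: "real ^ 'n"
  obtain R where R: "\<And>x. x \<in> S \<Longrightarrow> norm x \<le> R" using S(2) by (auto simp: bounded_iff)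
  have p_dist: "norm (p s x - x) \<le> real CARD('n) / s" if "s \<ge> 1" for s and x :: "real ^ 'n"
  proof -
    have "\<bar>(p s x - x) $ i\<bar> \<le> 1 / s" for i
    proof -
      have "\<bar>of_int \<lfloor>s * x $ i\<rfloor> - s * x $ i\<bar> \<le> 1" by linarith
      then have "\<bar>of_int \<lfloor>s * x $ i\<rfloor> - s * x $ i\<bar> / s \<le> 1 / s" using that by (intro divide_right_mono) auto
      moreover have "(p s x - x) $ i = (of_int \<lfloor>s * x $ i\<rfloor> - s * x $ i) / s"
        using that by (simp add: p_def field_simps)
      ultimately show ?thesis using that by simp
    qed
    then have "(\<Sum>i\<in>UNIV. \<bar>(p s x - x) $ i\<bar>) \<le> (\<Sum>i\<in>(UNIV :: 'n set). 1 / s)" by (intro sum_mono)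
    then show ?thesis using norm_le_l1_cart[of "p s x - x"] by simp
  qed
  have measp: "p s \<in> borel_measurable borel" for s
  proof (subst borel_measurable_euclidean_space, intro ballI)
    fix b :: "real ^ 'n" assume "b \<in> Basis"
    then obtain i where b: "b = axis i 1" by (auto simp: Basis_vec_def)
    have "(\<lambda>x :: real ^ 'n. real_of_int \<lfloor>s * x $ i\<rfloor> / s) \<in> borel_measurable borel" by measurable
    then show "(\<lambda>x. p s x \<bullet> b) \<in> borel_measurable borel"
      by (simp add: p_def b inner_axis divide_inverse_commute)
  qed
  have count: "measure lborel (p s -` S) = real (card {k :: int ^ 'n. lattice_vec k /\<^sub>R s \<in> S}) / s ^ CARD('n)"
    if "s \<ge> 1" for s
  proof -
    let ?K = "{k :: int ^ 'n. lattice_vec k /\<^sub>R s \<in> S}"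
    have "?K \<subseteq> {k. norm (lattice_vec k) \<le> R * s}"
      using R that by (force simp: field_simps)
    then have fin: "finite ?K" using finite_lattice_ball finite_subset by blast
    have cell_iff: "x \<in> cell (lattice_vec k /\<^sub>R s) (1 / s) \<longleftrightarrow> (\<forall>i. \<lfloor>s * x $ i\<rfloor> = k $ i)" for x :: "real ^ 'n" and k
    proof -
      have "(lattice_vec k /\<^sub>R s) $ i \<le> x $ i \<and> x $ i < (lattice_vec k /\<^sub>R s) $ i + 1 / s \<longleftrightarrow> \<lfloor>s * x $ i\<rfloor> = k $ i" for i
        using that by (simp add: floor_eq_iff field_simps)
      then show ?thesis by (simp add: cell_def)
    qed
    have "p s -` S = (\<Union>k\<in>?K. cell (lattice_vec k /\<^sub>R s) (1 / s))"
    proof (intro set_eqI iffI)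
      fix x assume "x \<in> p s -` S"
      moreover have "p s x = lattice_vec (\<chi> i. \<lfloor>s * x $ i\<rfloor>) /\<^sub>R s" by (simp add: p_def lattice_vec_def)
      ultimately show "x \<in> (\<Union>k\<in>?K. cell (lattice_vec k /\<^sub>R s) (1 / s))"
        by (intro UN_I[of "\<chi> i. \<lfloor>s * x $ i\<rfloor>"]) (auto simp: cell_iff)
    next
      fix x assume "x \<in> (\<Union>k\<in>?K. cell (lattice_vec k /\<^sub>R s) (1 / s))"
      then obtain k where k: "k \<in> ?K" "\<And>i. \<lfloor>s * x $ i\<rfloor> = k $ i" using cell_iff by blast
      then have "p s x = lattice_vec k /\<^sub>R s" by (simp add: p_def lattice_vec_def)
      with k(1) show "x \<in> p s -` S" by simp
    qed
    moreover have "disjoint_family_on (\<lambda>k. cell (lattice_vec k /\<^sub>R s) (1 / s)) ?K"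
      unfolding disjoint_family_on_def by (auto simp: cell_iff vec_eq_iff)
    ultimately have "measure lborel (p s -` S) = (\<Sum>k\<in>?K. measure lborel (cell (lattice_vec k /\<^sub>R s) (1 / s)))"
      using fin that measure_cell(2)[of "1 / s"] by (simp only:) (intro measure_finite_Union, auto)
    also have "\<dots> = real (card ?K) / s ^ CARD('n)"
      using that by (simp add: measure_cell power_divide)
    finally show ?thesis .
  qed
  have "(\<lambda>j. integral\<^sup>L lborel (\<lambda>x. indicator S (p (t j) x) :: real)) \<longlonglongrightarrow> integral\<^sup>L lborel (indicator S)"
  proof (rule integral_dominated_convergence)
    show "indicator S \<in> borel_measurable lborel" using S(1) by simp
    show "(\<lambda>x. indicator S (p (t j) x) :: real) \<in> borel_measurable lborel" for j
      using measp S(1) by measurable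
    show "integrable lborel (indicator (cball 0 (R + real CARD('n))) :: real ^ 'n \<Rightarrow> real)"
      by (rule integrable_real_indicator) (auto simp flip: infinity_ennreal_def intro: emeasure_lborel_cball_finite)
    show "AE x in lborel. norm (indicator S (p (t j) x) :: real) \<le> indicator (cball 0 (R + real CARD('n))) x" for j
    proof (rule AE_I2)
      fix x :: "real ^ 'n"
      have "norm x \<le> R + real CARD('n)" if "p (t j) x \<in> S"
      proof -
        have "norm x \<le> norm (p (t j) x) + norm (p (t j) x - x)"
          by (metis norm_minus_commute norm_triangle_sub)
        also have "\<dots> \<le> R + real CARD('n) / t j" using R[OF that] p_dist[OF t(2), of j x] by linarith
        also have "real CARD('n) / t j \<le> real CARD('n) / 1" using t(2)[of j] by (intro divide_left_mono) auto
        finally show ?thesis by simp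
      qed
      then show "norm (indicator S (p (t j) x) :: real) \<le> indicator (cball 0 (R + real CARD('n))) x"
        by (auto simp: indicator_def)
    qed
    have "frontier S \<in> null_sets lborel"
      using S(3) by (simp add: negligible_iff_null_sets null_sets_completion_iff)
    from AE_not_in[OF this]
    show "AE x in lborel. (\<lambda>j. indicator S (p (t j) x) :: real) \<longlonglongrightarrow> indicator S x"
    proof (rule eventually_mono)
      fix x assume x: "x \<notin> frontier S"
      have "(\<lambda>j. real CARD('n) / t j) \<longlonglongrightarrow> 0"
        by (rule real_tendsto_divide_at_top[OF tendsto_const t(1)])
      then have "(\<lambda>j. p (t j) x - x) \<longlonglongrightarrow> 0"
        by (rule Lim_null_comparison[rotated]) (use p_dist[OF t(2)] in auto)
      then have px: "(\<lambda>j. p (t j) x) \<longlonglongrightarrow> x" by (simp add: LIM_zero_iff)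
      have "isCont (indicator S :: real ^ 'n \<Rightarrow> real) x"
        using x by (simp add: isCont_indicator)
      then show "(\<lambda>j. indicator S (p (t j) x) :: real) \<longlonglongrightarrow> indicator S x"
        using px by (rule isCont_tendsto_compose)
    qed
  qed
  moreover have "integral\<^sup>L lborel (\<lambda>x. indicator S (p (t j) x) :: real) = measure lborel (p (t j) -` S)" for j
  proof -
    have "(\<lambda>x. indicator S (p (t j) x) :: real) = indicator (p (t j) -` S)" by (auto simp: indicator_def)
    then show ?thesis by simp
  qed
  ultimately show ?thesis
    using S(1) by (simp add: count[OF t(2)])
qed

subsection \<open>Enumerations by decreasing value\<close>

lemma ex_antitone_enumeration:
  fixes g :: "'a \<Rightarrow> real"
  assumes inf: "infinite (UNIV :: 'a set)" and pos: "\<And>a. 0 < g a"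
    and fin: "\<And>c. 0 < c \<Longrightarrow> finite {a. c \<le> g a}"
  shows "\<exists>\<sigma> :: nat \<Rightarrow> 'a. bij \<sigma> \<and> antimono (\<lambda>j. g (\<sigma> j))"
proof -
  have ex_max: "\<exists>a. a \<notin> A \<and> (\<forall>b. b \<notin> A \<longrightarrow> g b \<le> g a)" if fin_A: "finite A" for A
  proof -
    obtain a0 where a0: "a0 \<notin> A" using ex_new_if_finite[OF inf fin_A] by blast
    define B where "B = {a. g a0 \<le> g a} - A"
    have B: "finite B" "a0 \<in> B" using fin[OF pos, of a0] a0 by (auto simp: B_def)
    then have "Max (g ` B) \<in> g ` B" by (intro Max_in) auto
    then obtain a where a: "a \<in> B" "g a = Max (g ` B)" by (elim imageE) simp
    have "g b \<le> g a" if "b \<notin> A" for b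
    proof (cases "g a0 \<le> g b")
      case True
      then have "b \<in> B" using that by (simp add: B_def)
      then show ?thesis unfolding a(2) using B(1) by simp
    next
      case False
      then show ?thesis using a(1) by (simp add: B_def)
    qed
    then show ?thesis using a(1) by (auto simp: B_def)
  qed
  define nxt where "nxt A = (SOME a. a \<notin> A \<and> (\<forall>b. b \<notin> A \<longrightarrow> g b \<le> g a))" for A
  have nxt: "nxt A \<notin> A" "\<And>b. b \<notin> A \<Longrightarrow> g b \<le> g (nxt A)" if "finite A" for A
    using someI_ex[OF ex_max[OF that]] unfolding nxt_def by blast+
  define A where "A = rec_nat {} (\<lambda>_ B. insert (nxt B) B)"
  define \<sigma> where "\<sigma> j = nxt (A j)" for j
  have A_Suc: "A (Suc j) = insert (\<sigma> j) (A j)" and A_0: "A 0 = {}" for j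
    by (simp_all add: A_def \<sigma>_def)
  have A: "A j = \<sigma> ` {..<j}" for j
    by (induction j) (simp_all add: A_0 A_Suc lessThan_Suc)
  have new: "\<sigma> j \<notin> \<sigma> ` {..<j}" and mx: "\<And>b. b \<notin> \<sigma> ` {..<j} \<Longrightarrow> g b \<le> g (\<sigma> j)" for j
    using nxt[of "A j"] unfolding \<sigma>_def[symmetric] by (auto simp: A)
  have "inj \<sigma>"
  proof (rule linorder_injI)
    fix i j :: nat assume "i < j"
    then show "\<sigma> i \<noteq> \<sigma> j" using new[of j] by (metis imageI lessThan_iff)
  qed
  moreover have "surj \<sigma>"
  proof (rule ccontr)
    assume "\<not> surj \<sigma>"
    then obtain a where "a \<notin> range \<sigma>" by blast
    then have "g a \<le> g (\<sigma> j)" for j by (intro mx) auto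
    then have "range \<sigma> \<subseteq> {b. g a \<le> g b}" by auto
    then have "finite (range \<sigma>)" using fin[OF pos, of a] finite_subset by blast
    with \<open>inj \<sigma>\<close> show False using finite_imageD[of \<sigma> UNIV] infinite_UNIV_nat by blast
  qed
  moreover have "antimono (\<lambda>j. g (\<sigma> j))"
  proof (rule antimonoI)
    fix i j :: nat assume "i \<le> j"
    show "g (\<sigma> j) \<le> g (\<sigma> i)"
    proof (rule mx)
      show "\<sigma> j \<notin> \<sigma> ` {..<i}" using new[of j] \<open>i \<le> j\<close> by auto
    qed
  qed
  ultimately show ?thesis unfolding bij_def by blast
qed

text \<open>Inversion of a counting law. At least \<open>j + 1\<close> elements have value at least
  the \<open>j\<close>-th value \<open>l j\<close>; at most \<open>j\<close> have value at least
  \<open>l j * c\<close> when \<open>c > 1\<close>. Using the count at the levels \<open>l j\<close>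
  and \<open>l j * c\<close> squeezes the limit points between \<open>V / c\<close> and
  \<open>V\<close>. The margin \<open>c\<close> is what takes care of ties.\<close>

lemma antitone_enumeration_asymptotics:
  fixes g :: "'a \<Rightarrow> real" and \<sigma> :: "nat \<Rightarrow> 'a"
  assumes \<sigma>: "bij \<sigma>" "antimono (\<lambda>j. g (\<sigma> j))" and pos: "\<And>a. 0 < g a"
    and fin: "\<And>c. 0 < c \<Longrightarrow> finite {a. c \<le> g a}"
    and count: "\<And>c. (\<And>j. 0 < c j) \<Longrightarrow> c \<longlonglongrightarrow> 0 \<Longrightarrow> (\<lambda>j. c j * real (card {a. c j \<le> g a})) \<longlonglongrightarrow> V"
  shows "(\<lambda>j. (real j + 1) * g (\<sigma> j)) \<longlonglongrightarrow> V"
proof -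
  define l where "l j = g (\<sigma> j)" for j
  have l_pos: "0 < l j" for j using pos by (simp add: l_def)
  have l0: "l \<longlonglongrightarrow> 0"
  proof (rule LIMSEQ_I)
    fix \<epsilon> :: real assume "0 < \<epsilon>"
    have "finite (\<sigma> -` {a. \<epsilon> \<le> g a})"
      using fin[OF \<open>0 < \<epsilon>\<close>] \<sigma>(1) by (intro finite_vimageI bij_is_inj)
    from finite_nat_set_iff_bounded[THEN iffD1, OF this]
    obtain N where N: "\<forall>j\<in>\<sigma> -` {a. \<epsilon> \<le> g a}. j < N" by (rule exE)
    then have "norm (l j - 0) < \<epsilon>" if "j \<ge> N" for j
    proof -
      have "j \<notin> \<sigma> -` {a. \<epsilon> \<le> g a}"
        using N that by (auto simp: not_less[symmetric])
      then show ?thesis using l_pos[of j] by (simp add: l_def)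
    qed
    then show "\<exists>N. \<forall>j\<ge>N. norm (l j - 0) < \<epsilon>" by blast
  qed
  have upper: "(real j + 1) * l j \<le> l j * real (card {a. l j \<le> g a})" for j
  proof -
    have "\<sigma> ` {..j} \<subseteq> {a. l j \<le> g a}"
      using \<sigma>(2) by (auto simp: l_def antimono_def)
    then have "card (\<sigma> ` {..j}) \<le> card {a. l j \<le> g a}"
      using fin[OF l_pos] by (intro card_mono) auto
    moreover have "card (\<sigma> ` {..j}) = Suc j"
      using bij_is_inj[OF \<sigma>(1)] by (simp add: card_image inj_on_subset)
    ultimately have "real j + 1 \<le> real (card {a. l j \<le> g a})" by simp
    then show ?thesis using l_pos[of j] by (simp add: mult.commute mult_left_mono)
  qed
  have lower: "(l j * c) * real (card {a. l j * c \<le> g a}) / c \<le> (real j + 1) * l j" if "c > 1" for c j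
  proof -
    have "{a. l j * c \<le> g a} \<subseteq> \<sigma> ` {..<j}"
    proof
      fix a assume a: "a \<in> {a. l j * c \<le> g a}"
      obtain i where i: "a = \<sigma> i" using bij_is_surj[OF \<sigma>(1)] by (rule surjE)
      have "l j < l j * c" using l_pos[of j] that by simp
      then have "l j < l i" using a i by (simp add: l_def)
      have "i < j"
      proof (rule ccontr)
        assume "\<not> i < j"
        then have "l i \<le> l j" using antimonoD[OF \<sigma>(2), of j i] by (simp add: l_def)
        with \<open>l j < l i\<close> show False by simp
      qed
      then show "a \<in> \<sigma> ` {..<j}" using i by blast
    qed
    then have "card {a. l j * c \<le> g a} \<le> j"
      using card_mono[of "\<sigma> ` {..<j}" "{a. l j * c \<le> g a}"] card_image_le[of "{..<j}" \<sigma>] by simp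
    then have "l j * real (card {a. l j * c \<le> g a}) \<le> l j * (real j + 1)"
      using l_pos[of j] by (intro mult_left_mono) auto
    then show ?thesis using that by (simp add: mult.commute)
  qed
  have up_lim: "(\<lambda>j. l j * real (card {a. l j \<le> g a})) \<longlonglongrightarrow> V"
    by (rule count[OF l_pos l0])
  have low_lim: "(\<lambda>j. (l j * c) * real (card {a. l j * c \<le> g a}) / c) \<longlonglongrightarrow> V / c" if "c > 1" for c
  proof (intro tendsto_intros count)
    show "0 < l j * c" for j using l_pos[of j] that by simp
    show "(\<lambda>j. l j * c) \<longlonglongrightarrow> 0" using tendsto_mult_left_zero[OF l0] .
  qed (use that in simp)
  have "V \<ge> 0"
    by (rule LIMSEQ_le_const[OF up_lim]) (auto intro!: exI[of _ 0] mult_nonneg_nonneg less_imp_le[OF l_pos])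
  show ?thesis
  proof (rule order_tendstoI)
    fix a assume "V < a"
    show "\<forall>\<^sub>F j in sequentially. (real j + 1) * g (\<sigma> j) < a"
    proof (rule eventually_mono[OF order_tendstoD(2)[OF up_lim \<open>V < a\<close>]])
      fix j assume "l j * real (card {b. l j \<le> g b}) < a"
      then show "(real j + 1) * g (\<sigma> j) < a" using upper[of j] by (simp add: l_def)
    qed
  next
    fix a assume "a < V"
    \<comment> \<open>Any \<open>c\<close> strictly between 1 and \<open>V / a\<close> works for
      positive \<open>a\<close>, and the midpoint is taken. For \<open>a \<le> 0\<close> the choice
      2 suffices because \<open>V \<ge> 0\<close>.\<close>
    obtain c where c: "c > 1" "a < V / c"
    proof (cases "a \<le> 0")
      case True
      then show ?thesis using that[of 2] \<open>V \<ge> 0\<close> \<open>a < V\<close> by (cases "V = 0") auto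
    next
      case False
      have "(1 + V / a) / 2 > 1" using False \<open>a < V\<close> by (simp add: field_simps)
      moreover have "a < V / ((1 + V / a) / 2)"
      proof -
        have "a * ((1 + V / a) / 2) < V" using False \<open>a < V\<close> by (simp add: field_simps)
        then show ?thesis using \<open>(1 + V / a) / 2 > 1\<close> by (subst pos_less_divide_eq) auto
      qed
      ultimately show ?thesis by (rule that)
    qed
    show "\<forall>\<^sub>F j in sequentially. a < (real j + 1) * g (\<sigma> j)"
    proof (rule eventually_mono[OF order_tendstoD(1)[OF low_lim[OF c(1)] c(2)]])
      fix j assume "a < l j * c * real (card {b. l j * c \<le> g b}) / c"
      then show "a < (real j + 1) * g (\<sigma> j)" using lower[OF c(1), of j] by (simp add: l_def)
    qed
  qed
qed

section \<open>Square-integrable functions on the torus\<close>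

subsection \<open>Translation invariance\<close>

lemma periodic_lattice:
  fixes f :: "real ^ 'n \<Rightarrow> 'a"
  assumes per: "\<And>x i. f (x + (2 * pi) *\<^sub>R axis i 1) = f x"
  shows "f (x + (2 * pi) *\<^sub>R lattice_vec k) = f x"
proof -
  define P where "P = {v. \<forall>x. f (x + v) = f x}"
  have P0: "0 \<in> P" and Padd: "v \<in> P \<Longrightarrow> w \<in> P \<Longrightarrow> v + w \<in> P" for v w
    by (auto simp: P_def add.assoc[symmetric])
  have Pneg: "- v \<in> P" if "v \<in> P" for v
  proof -
    have "f (x - v) = f x" for x using that[unfolded P_def, simplified, rule_format, of "x - v"] by simp
    then show ?thesis by (simp add: P_def)
  qed
  have Pnat: "real m *\<^sub>R v \<in> P" if "v \<in> P" for v m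
    by (induction m) (auto simp: P0 Padd that scaleR_add_left)
  have Pint: "real_of_int m *\<^sub>R v \<in> P" if "v \<in> P" for v m
    using Pnat[OF that, of "nat \<bar>m\<bar>"] Pneg[OF Pnat[OF that, of "nat \<bar>m\<bar>"]] by (cases "m \<ge> 0") auto
  have Pax: "(2 * pi) *\<^sub>R axis i 1 \<in> P" for i
    by (simp add: P_def per)
  have Psum: "(\<Sum>i\<in>I. real_of_int (k $ i) *\<^sub>R ((2 * pi) *\<^sub>R axis i 1)) \<in> P" for I
    by (induction I rule: infinite_finite_induct)
      (auto simp: P0 simp del: scaleR_scaleR intro!: Padd Pint Pax)
  have "(2 * pi) *\<^sub>R lattice_vec k = (\<Sum>i\<in>UNIV. real_of_int (k $ i) *\<^sub>R ((2 * pi) *\<^sub>R axis i 1))"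
    by (simp add: vec_eq_iff axis_def if_distrib[of "\<lambda>z. _ * z"] cong: if_cong)
  with Psum[of UNIV] show ?thesis by (simp add: P_def)
qed

lemma ex_enumeration_lattice: "\<exists>\<sigma> :: nat \<Rightarrow> int ^ 'n. bij \<sigma>"
proof -
  have "infinite (UNIV :: (int ^ 'n) set)"
  proof
    assume "finite (UNIV :: (int ^ 'n) set)"
    then have "finite (range (\<lambda>m :: int. (\<chi> i. m) :: int ^ 'n))" by (rule finite_subset[rotated]) simp
    moreover have "inj (\<lambda>m :: int. (\<chi> i. m) :: int ^ 'n)" by (rule injI) (simp add: vec_eq_iff)
    ultimately show False using finite_imageD infinite_UNIV_int by blast
  qed
  then show ?thesis using bij_betw_from_nat_into[of "UNIV :: (int ^ 'n) set"] by auto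
qed

text \<open>Exactly one lattice translate of \<open>y\<close> lies in the half-open cube, the one
  whose coordinates are minus the floors of those of \<open>y / (2 * pi)\<close>. The sum follows an
  enumeration so that it can be exchanged with an integral.\<close>

lemma indicator_cell_translates:
  fixes y :: "real ^ 'n" and \<sigma> :: "nat \<Rightarrow> int ^ 'n"
  assumes "bij \<sigma>"
  shows "(\<Sum>j. indicator (cell 0 (2 * pi)) (y + (2 * pi) *\<^sub>R lattice_vec (\<sigma> j)) :: ennreal) = 1"
proof -
  have iff: "y + (2 * pi) *\<^sub>R lattice_vec k \<in> cell 0 (2 * pi) \<longleftrightarrow> k = (\<chi> i. - \<lfloor>y $ i / (2 * pi)\<rfloor>)" for k
  proof -
    have "0 \<le> y $ i + 2 * pi * of_int (k $ i) \<and> y $ i + 2 * pi * of_int (k $ i) < 2 * pi \<longleftrightarrow> k $ i = - \<lfloor>y $ i / (2 * pi)\<rfloor>" for i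
    proof -
      have "\<lfloor>y $ i / (2 * pi)\<rfloor> = - k $ i \<longleftrightarrow> - of_int (k $ i) \<le> y $ i / (2 * pi) \<and> y $ i / (2 * pi) < - of_int (k $ i) + 1"
        by (simp add: floor_eq_iff)
      also have "\<dots> \<longleftrightarrow> 0 \<le> y $ i + 2 * pi * of_int (k $ i) \<and> y $ i + 2 * pi * of_int (k $ i) < 2 * pi"
      proof -
        have "- of_int (k $ i) \<le> y $ i / (2 * pi) \<longleftrightarrow> - of_int (k $ i) * (2 * pi) \<le> y $ i"
          by (rule pos_le_divide_eq) simp
        moreover have "y $ i / (2 * pi) < - of_int (k $ i) + 1 \<longleftrightarrow> y $ i < (- of_int (k $ i) + 1) * (2 * pi)"
          by (rule pos_divide_less_eq) simp
        ultimately show ?thesis by (auto simp: algebra_simps)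
      qed
      finally show ?thesis by (auto simp: eq_neg_iff_add_eq_0 add.commute)
    qed
    then show ?thesis by (simp add: cell_def vec_eq_iff)
  qed
  obtain j0 where j0: "\<sigma> j0 = (\<chi> i. - \<lfloor>y $ i / (2 * pi)\<rfloor>)" using bij_is_surj[OF assms] by (metis surjE)
  have "(\<Sum>j. indicator (cell 0 (2 * pi)) (y + (2 * pi) *\<^sub>R lattice_vec (\<sigma> j)) :: ennreal)
      = (\<Sum>j\<in>{j0}. indicator (cell 0 (2 * pi)) (y + (2 * pi) *\<^sub>R lattice_vec (\<sigma> j)))"
    using bij_is_inj[OF assms] by (intro suminf_finite) (auto simp: indicator_def iff j0[symmetric] inj_eq)
  then show ?thesis by (simp add: indicator_def iff j0)
qed

text \<open>Trades the closed cube, whose translates overlap in null sets, for the half-open cell,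
  whose translates tile space exactly.\<close>

lemma nn_integral_torus_measure:
  fixes f :: "real ^ 'n \<Rightarrow> ennreal"
  assumes [measurable]: "f \<in> borel_measurable borel"
  shows "(\<integral>\<^sup>+x. f x \<partial>torus_measure) = (\<integral>\<^sup>+x. f x * indicator (cell 0 (2 * pi)) x \<partial>lborel) / ennreal ((2 * pi) ^ CARD('n))"
proof -
  have "emeasure lborel (cbox 0 (\<chi> i. 2 * pi) :: (real ^ 'n) set) = ennreal ((2 * pi) ^ CARD('n))"
    unfolding emeasure_lborel_cbox_eq
    by (simp add: Basis_vec_def inner_axis UNION_singleton_eq_range prod.reindex inj_on_def axis_eq_axis)
  moreover have "(\<integral>\<^sup>+x. f x * indicator (cbox 0 (\<chi> i. 2 * pi)) x \<partial>lborel) = (\<integral>\<^sup>+x. f x * indicator (cell 0 (2 * pi)) x \<partial>lborel)"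
    using AE_cell_iff_cbox[of 0 "2 * pi"] by (intro nn_integral_cong_AE) (auto simp: indicator_def elim!: eventually_mono)
  ultimately show ?thesis
    unfolding torus_measure_def by (subst nn_integral_uniform_measure) auto
qed

text \<open>Both sides are integrals over fundamental domains of the lattice \<open>2\<pi>\<int>\<^sup>n\<close>; cut one domain into
  its intersections with the lattice translates of the other and move the pieces.\<close>

lemma nn_integral_torus_shift:
  fixes f :: "real ^ 'n \<Rightarrow> ennreal"
  assumes [measurable]: "f \<in> borel_measurable borel"
    and per: "\<And>x i. f (x + (2 * pi) *\<^sub>R axis i 1) = f x"
  shows "(\<integral>\<^sup>+x. f (x + v) \<partial>torus_measure) = (\<integral>\<^sup>+x. f x \<partial>torus_measure)"
proof -
  obtain \<sigma> :: "nat \<Rightarrow> int ^ 'n" where \<sigma>: "bij \<sigma>" using ex_enumeration_lattice by blast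
  let ?Q = "cell 0 (2 * pi) :: (real ^ 'n) set"
  define s where "s j = (2 * pi) *\<^sub>R lattice_vec (\<sigma> j)" for j
  have shift: "(\<integral>\<^sup>+x. g (x + w) \<partial>lborel) = (\<integral>\<^sup>+x. g x \<partial>lborel)" if "g \<in> borel_measurable borel" for g w
    using that by (subst (2) lborel_distr_plus[of w, symmetric]) (simp add: nn_integral_distr add.commute)
  have "(\<integral>\<^sup>+x. f (x + v) * indicator ?Q x \<partial>lborel) = (\<integral>\<^sup>+y. f y * indicator ?Q (y - v) \<partial>lborel)"
    using shift[of "\<lambda>y. f y * indicator ?Q (y - v)" v] by simp
  also have "\<dots> = (\<integral>\<^sup>+y. (\<Sum>j. f y * indicator ?Q (y - v) * indicator ?Q (y + s j)) \<partial>lborel)"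
    using indicator_cell_translates[OF \<sigma>] by (simp add: s_def)
  also have "\<dots> = (\<Sum>j. \<integral>\<^sup>+y. f y * indicator ?Q (y - v) * indicator ?Q (y + s j) \<partial>lborel)"
    by (rule nn_integral_suminf) measurable
  also have "\<dots> = (\<Sum>j. \<integral>\<^sup>+z. f z * indicator ?Q z * indicator ?Q (z - v - s j) \<partial>lborel)"
  proof (rule suminf_cong)
    fix j
    have "f (z - s j) = f z" for z
      using periodic_lattice[OF per, of "z - s j" "\<sigma> j"] by (simp add: s_def)
    then show "(\<integral>\<^sup>+y. f y * indicator ?Q (y - v) * indicator ?Q (y + s j) \<partial>lborel)
        = (\<integral>\<^sup>+z. f z * indicator ?Q z * indicator ?Q (z - v - s j) \<partial>lborel)"
      using shift[of "\<lambda>z. f z * indicator ?Q (z - v) * indicator ?Q (z + s j)" "- s j"]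
      by (simp add: algebra_simps)
  qed
  also have "\<dots> = (\<integral>\<^sup>+z. (\<Sum>j. f z * indicator ?Q z * indicator ?Q (z - v - s j)) \<partial>lborel)"
    by (rule nn_integral_suminf[symmetric]) measurable
  also have "\<dots> = (\<integral>\<^sup>+z. f z * indicator ?Q z \<partial>lborel)"
  proof -
    \<comment> \<open>After the change of variables the shifts enter with the opposite sign, so the
      tiling is enumerated by \<open>- \<sigma>\<close>.\<close>
    have "bij (\<lambda>j. - \<sigma> j)" using bij_comp[OF \<sigma> bij_uminus] by (simp add: comp_def)
    moreover have "lattice_vec (- k) = - lattice_vec k" for k :: "int ^ 'n" by (simp add: lattice_vec_def vec_eq_iff)
    ultimately have "(\<Sum>j. indicator ?Q (y - s j) :: ennreal) = 1" for y
      using indicator_cell_translates[of "\<lambda>j. - \<sigma> j" y] by (simp add: s_def)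
    then show ?thesis by simp
  qed
  finally show ?thesis by (simp add: nn_integral_torus_measure)
qed

text \<open>Invariance for nonnegative functions, applied with \<open>h\<close> the absolute value,
  the identity and the negation, yields integrability and the positive and negative parts.\<close>

lemma integral_torus_shift_real:
  fixes f :: "real ^ 'n \<Rightarrow> real"
  assumes [measurable]: "f \<in> borel_measurable borel"
    and per: "\<And>x i. f (x + (2 * pi) *\<^sub>R axis i 1) = f x"
    and int: "integrable torus_measure f"
  shows "integrable torus_measure (\<lambda>x. f (x + v))"
    and "integral\<^sup>L torus_measure (\<lambda>x. f (x + v)) = integral\<^sup>L torus_measure f"
proof -
  have eq: "(\<integral>\<^sup>+x. ennreal (h (f (x + v))) \<partial>torus_measure) = (\<integral>\<^sup>+x. ennreal (h (f x)) \<partial>torus_measure)"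
    if [measurable]: "h \<in> borel_measurable borel" for h
    by (rule nn_integral_torus_shift[of "\<lambda>x. ennreal (h (f x))"]) (auto simp: per)
  show i: "integrable torus_measure (\<lambda>x. f (x + v))"
    using int eq[of "\<lambda>x. \<bar>x\<bar>"] by (simp add: integrable_iff_bounded)
  show "integral\<^sup>L torus_measure (\<lambda>x. f (x + v)) = integral\<^sup>L torus_measure f"
    unfolding real_lebesgue_integral_def[OF int] real_lebesgue_integral_def[OF i]
    using eq[of "\<lambda>x. x"] eq[of "\<lambda>x. - x"] by simp
qed

lemma integral_torus_shift:
  fixes f :: "real ^ 'n \<Rightarrow> complex"
  assumes [measurable]: "f \<in> borel_measurable borel"
    and per: "\<And>x i. f (x + (2 * pi) *\<^sub>R axis i 1) = f x"
    and int: "integrable torus_measure f"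
  shows "integral\<^sup>L torus_measure (\<lambda>x. f (x + v)) = integral\<^sup>L torus_measure f"
proof -
  have R: "integrable torus_measure (\<lambda>x. Re (f (x + v)))" "integral\<^sup>L torus_measure (\<lambda>x. Re (f (x + v))) = integral\<^sup>L torus_measure (\<lambda>x. Re (f x))"
    using integral_torus_shift_real[of "\<lambda>x. Re (f x)" v] per int by auto
  have I: "integrable torus_measure (\<lambda>x. Im (f (x + v)))" "integral\<^sup>L torus_measure (\<lambda>x. Im (f (x + v))) = integral\<^sup>L torus_measure (\<lambda>x. Im (f x))"
    using integral_torus_shift_real[of "\<lambda>x. Im (f x)" v] per int by auto
  have "integrable torus_measure (\<lambda>x. complex_of_real (Re (f (x + v))) + \<i> * complex_of_real (Im (f (x + v))))"
    using R(1) I(1) by (intro Bochner_Integration.integrable_add integrable_mult_right integrable_of_real)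
  then have "integrable torus_measure (\<lambda>x. f (x + v))"
    by (simp only: complex_eq[symmetric])
  then show ?thesis
    using R(2) I(2) int by (intro complex_eqI) (simp_all add: integral_Re integral_Im flip: integral_Re integral_Im)
qed

lemma AE_torus_shift:
  fixes P :: "real ^ 'n \<Rightarrow> bool"
  assumes [measurable]: "Measurable.pred borel P"
    and per: "\<And>x i. P (x + (2 * pi) *\<^sub>R axis i 1) = P x"
    and ae: "AE x in torus_measure. P x"
  shows "AE x in torus_measure. P (x + v)"
proof -
  have "(\<integral>\<^sup>+x. indicator {x. \<not> P x} (x + v) \<partial>(torus_measure :: (real ^ 'n) measure)) = (\<integral>\<^sup>+x. indicator {x. \<not> P x} x \<partial>torus_measure)"
    by (rule nn_integral_torus_shift) (auto simp: indicator_def per)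
  also have "\<dots> = 0"
    using ae by (subst nn_integral_0_iff_AE) (auto simp: indicator_def elim!: eventually_mono)
  finally show ?thesis
    by (subst (asm) nn_integral_0_iff_AE) (auto simp: indicator_def elim!: eventually_mono split: if_splits)
qed

lemma torus_square_integrable_mod_shift:
  assumes f: "torus_square_integrable f"
  shows "torus_square_integrable (\<lambda>x. exp (\<i> * of_real (lattice_vec k \<bullet> x)) * f (x + v))"
proof -
  have [measurable]: "f \<in> borel_measurable borel" and per: "f (x + (2 * pi) *\<^sub>R axis i 1) = f x" for x i
    using f by (auto simp: torus_square_integrable_def)
  have "integrable torus_measure (\<lambda>x. (cmod (f (x + v)))\<^sup>2)"
    using f by (intro integral_torus_shift_real(1)[of "\<lambda>x. (cmod (f x))\<^sup>2"])
      (auto simp: torus_square_integrable_def)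
  moreover have "exp (\<i> * of_real (lattice_vec k \<bullet> (x + (2 * pi) *\<^sub>R axis i 1))) = exp (\<i> * of_real (lattice_vec k \<bullet> x))" for x i
  proof -
    have "\<i> * of_real (lattice_vec k \<bullet> (x + (2 * pi) *\<^sub>R axis i 1))
        = \<i> * of_real (lattice_vec k \<bullet> x) + 2 * of_int (k $ i) * of_real pi * \<i>"
      by (simp add: inner_add_right inner_axis ring_distribs)
    then show ?thesis using exp_integer_2pi[OF Ints_of_int, of "k $ i"] by (simp add: exp_add)
  qed
  moreover have "f (x + (2 * pi) *\<^sub>R axis i 1 + v) = f (x + v)" for x i
    using per[of "x + v" i] by (simp add: ac_simps)
  moreover have "(\<lambda>x. exp (\<i> * of_real (lattice_vec k \<bullet> x)) * f (x + v)) \<in> borel_measurable borel"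
  proof -
    have "(\<lambda>x. exp (\<i> * of_real (lattice_vec k \<bullet> x))) \<in> borel_measurable borel"
      by (intro borel_measurable_continuous_onI continuous_intros)
    then show ?thesis by measurable
  qed
  ultimately show ?thesis
    by (simp add: torus_square_integrable_def norm_mult power_mult_distrib)
qed

subsection \<open>Translations composed with characters\<close>

text \<open>These operators form, up to phases, a group (a Weyl system) that contains the generators
  \<open>torus_U\<close>. The relations of the noncommutative torus all follow from one composition
  rule.\<close>

lift_definition mod_shift :: "int ^ 'n \<Rightarrow> real ^ 'n \<Rightarrow> ('n::finite) torus_l2 \<Rightarrow> 'n torus_l2"
  is "\<lambda>k v f x. exp (\<i> * of_real (lattice_vec k \<bullet> x)) * f (x + v)"
proof -
  fix k :: "int ^ 'n" and v and f g :: "real ^ 'n \<Rightarrow> complex"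
  assume fg: "torus_l2_rel f g"
  then have [measurable]: "f \<in> borel_measurable borel" "g \<in> borel_measurable borel"
    by (auto simp: torus_l2_rel_def torus_square_integrable_def)
  have "AE x in torus_measure. f (x + v) = g (x + v)"
    using fg by (intro AE_torus_shift[of "\<lambda>x. f x = g x"])
      (auto simp: torus_l2_rel_def torus_square_integrable_def)
  then show "torus_l2_rel (\<lambda>x. exp (\<i> * of_real (lattice_vec k \<bullet> x)) * f (x + v))
      (\<lambda>x. exp (\<i> * of_real (lattice_vec k \<bullet> x)) * g (x + v))"
    using fg by (auto simp: torus_l2_rel_def torus_square_integrable_mod_shift elim!: eventually_mono)
qed

lemma torus_l2_rel_refl: "torus_square_integrable f \<Longrightarrow> torus_l2_rel f f"
  by (simp add: torus_l2_rel_def)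

lemma mod_shift_add: "mod_shift k v (f + g) = mod_shift k v f + mod_shift k v g"
proof transfer
  fix k :: "int ^ 'a" and v and f g :: "real ^ 'a \<Rightarrow> complex"
  assume "torus_l2_rel f f" "torus_l2_rel g g"
  then have "torus_square_integrable (\<lambda>x. f x + g x)"
    by (simp add: torus_l2_rel_def torus_square_integrable_add)
  from torus_square_integrable_mod_shift[OF this, of k v]
  show "torus_l2_rel (\<lambda>x. exp (\<i> * of_real (lattice_vec k \<bullet> x)) * (f (x + v) + g (x + v)))
      (\<lambda>x. exp (\<i> * of_real (lattice_vec k \<bullet> x)) * f (x + v) + exp (\<i> * of_real (lattice_vec k \<bullet> x)) * g (x + v))"
    using torus_l2_rel_refl by (simp add: ring_distribs)
qed

lemma mod_shift_scaleC: "mod_shift k v (c *\<^sub>C f) = c *\<^sub>C mod_shift k v f"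
proof transfer
  fix k :: "int ^ 'a" and v c and f :: "real ^ 'a \<Rightarrow> complex"
  assume "torus_l2_rel f f"
  then have "torus_square_integrable (\<lambda>x. c * f x)"
    by (simp add: torus_l2_rel_def torus_square_integrable_mult)
  from torus_square_integrable_mod_shift[OF this, of k v]
  show "torus_l2_rel (\<lambda>x. exp (\<i> * of_real (lattice_vec k \<bullet> x)) * (c * f (x + v)))
      (\<lambda>x. c * (exp (\<i> * of_real (lattice_vec k \<bullet> x)) * f (x + v)))"
    using torus_l2_rel_refl by (simp add: mult.left_commute)
qed

lemma mod_shift_cinner: "cinner (mod_shift k v f) (mod_shift k v g) = cinner f g"
proof transfer
  fix k :: "int ^ 'a" and v and f g :: "real ^ 'a \<Rightarrow> complex"
  assume fg: "torus_l2_rel f f" "torus_l2_rel g g"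
  then have [measurable]: "f \<in> borel_measurable borel" "g \<in> borel_measurable borel"
    by (auto simp: torus_l2_rel_def torus_square_integrable_def)
  have u: "exp (\<i> * of_real t) * cnj (exp (\<i> * of_real t)) = 1" for t
    using complex_norm_square[of "exp (\<i> * of_real t)"] by simp
  have "exp (\<i> * of_real (lattice_vec k \<bullet> x)) * f (x + v) * cnj (exp (\<i> * of_real (lattice_vec k \<bullet> x)) * g (x + v))
      = f (x + v) * cnj (g (x + v))" for x
    using u[of "lattice_vec k \<bullet> x"] by (simp only: complex_cnj_mult) (metis (no_types, opaque_lifting) mult.assoc mult.commute mult.left_neutral)
  then have "integral\<^sup>L torus_measure (\<lambda>x. exp (\<i> * of_real (lattice_vec k \<bullet> x)) * f (x + v) * cnj (exp (\<i> * of_real (lattice_vec k \<bullet> x)) * g (x + v)))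
      = integral\<^sup>L torus_measure (\<lambda>x. f (x + v) * cnj (g (x + v)))"
    by (simp only:)
  also have "\<dots> = integral\<^sup>L torus_measure (\<lambda>x. f x * cnj (g x))"
    using fg by (intro integral_torus_shift[of "\<lambda>x. f x * cnj (g x)"])
      (auto simp: torus_l2_rel_def torus_square_integrable_def torus_integrable_prod)
  finally show "integral\<^sup>L torus_measure (\<lambda>x. exp (\<i> * of_real (lattice_vec k \<bullet> x)) * f (x + v) * cnj (exp (\<i> * of_real (lattice_vec k \<bullet> x)) * g (x + v)))
      = integral\<^sup>L torus_measure (\<lambda>x. f x * cnj (g x))" .
qed

lemma mod_shift_mod_shift:
  "mod_shift k v (mod_shift l w f) = exp (\<i> * of_real (lattice_vec l \<bullet> v)) *\<^sub>C mod_shift (k + l) (v + w) f"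
proof transfer
  fix k l :: "int ^ 'a" and v w and f :: "real ^ 'a \<Rightarrow> complex"
  assume f: "torus_l2_rel f f"
  have "lattice_vec (k + l) = lattice_vec k + lattice_vec l"
    by (simp add: lattice_vec_def vec_eq_iff)
  then have "exp (\<i> * of_real (lattice_vec k \<bullet> x)) * (exp (\<i> * of_real (lattice_vec l \<bullet> (x + v))) * f (x + v + w))
      = exp (\<i> * of_real (lattice_vec l \<bullet> v)) * (exp (\<i> * of_real (lattice_vec (k + l) \<bullet> x)) * f (x + (v + w)))" for x
    by (simp add: inner_add_left inner_add_right ring_distribs exp_add add.assoc)
  moreover have "torus_square_integrable (\<lambda>x. exp (\<i> * of_real (lattice_vec l \<bullet> v)) * (exp (\<i> * of_real (lattice_vec (k + l) \<bullet> x)) * f (x + (v + w))))"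
    using f by (intro torus_square_integrable_mult torus_square_integrable_mod_shift) (simp add: torus_l2_rel_def)
  ultimately show "torus_l2_rel (\<lambda>x. exp (\<i> * of_real (lattice_vec k \<bullet> x)) * (exp (\<i> * of_real (lattice_vec l \<bullet> (x + v))) * f (x + v + w)))
      (\<lambda>x. exp (\<i> * of_real (lattice_vec l \<bullet> v)) * (exp (\<i> * of_real (lattice_vec (k + l) \<bullet> x)) * f (x + (v + w))))"
    by (simp add: torus_l2_rel_refl)
qed

lemma mod_shift_0 [simp]: "mod_shift 0 0 f = f"
  by transfer (simp add: torus_l2_rel_def)

lemma mod_shift_one: "mod_shift 0 v torus_one = torus_one"
  by transfer (simp add: torus_l2_rel_def torus_square_integrable_const)

lemma cinner_torus_one: "cinner torus_one torus_one = 1"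
  by transfer (simp add: measure_def emeasure_torus_measure_UNIV)

subsection \<open>Completeness\<close>

lemma norm_abs_torus_l2:
  assumes "torus_square_integrable f"
  shows "(norm (abs_torus_l2 f))\<^sup>2 = integral\<^sup>L torus_measure (\<lambda>x. (cmod (f x))\<^sup>2)"
proof -
  have "complex_of_real ((norm (abs_torus_l2 f))\<^sup>2) = cinner (abs_torus_l2 f) (abs_torus_l2 f)"
    by (rule cinner_self[symmetric])
  also have "\<dots> = integral\<^sup>L torus_measure (\<lambda>x. f x * cnj (f x))"
    using assms by (intro cinner_torus_l2.abs_eq torus_l2_rel_refl)
  also have "\<dots> = complex_of_real (integral\<^sup>L torus_measure (\<lambda>x. (cmod (f x))\<^sup>2))"
    by (simp only: complex_norm_square[symmetric] integral_complex_of_real)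
  finally show ?thesis using of_real_eq_iff by blast
qed

lemma torus_square_integrable_diff:
  assumes "torus_square_integrable f" "torus_square_integrable g"
  shows "torus_square_integrable (\<lambda>x. f x - g x)"
  using torus_square_integrable_add[OF assms(1) torus_square_integrable_mult[OF assms(2), of "-1"]] by simp

lemma abs_torus_l2_diff:
  assumes "torus_square_integrable f" "torus_square_integrable g"
  shows "abs_torus_l2 f - abs_torus_l2 g = abs_torus_l2 (\<lambda>x. f x - g x)"
proof -
  have "abs_torus_l2 f - abs_torus_l2 g = abs_torus_l2 f + (-1) *\<^sub>C abs_torus_l2 g"
    by (simp add: scaleC_minus_one)
  also have "\<dots> = abs_torus_l2 f + abs_torus_l2 (\<lambda>x. (-1) * g x)"
    using assms by (simp only: scaleC_torus_l2.abs_eq torus_l2_rel_refl)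
  also have "\<dots> = abs_torus_l2 (\<lambda>x. f x + (-1) * g x)"
    using assms torus_square_integrable_mult[OF assms(2), of "-1"]
    by (simp only: plus_torus_l2.abs_eq torus_l2_rel_refl)
  finally show ?thesis by simp
qed

lemma rep_torus_l2_square_integrable: "torus_square_integrable (rep_torus_l2 f)"
  using Quotient3_rep_reflp[OF Quotient3_torus_l2, of f] by (simp add: torus_l2_rel_def)

lemma abs_rep_torus_l2: "abs_torus_l2 (rep_torus_l2 f) = f"
  by (rule Quotient3_abs_rep[OF Quotient3_torus_l2])

lemma nn_integral_square_torus_l2_diff:
  "(\<integral>\<^sup>+x. ennreal ((cmod (rep_torus_l2 f x - rep_torus_l2 g x))\<^sup>2) \<partial>torus_measure) = ennreal ((norm (f - g))\<^sup>2)"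
proof -
  note sq = rep_torus_l2_square_integrable
  have "(norm (f - g))\<^sup>2 = integral\<^sup>L torus_measure (\<lambda>x. (cmod (rep_torus_l2 f x - rep_torus_l2 g x))\<^sup>2)"
    using norm_abs_torus_l2[OF torus_square_integrable_diff[OF sq sq], of f g]
      abs_torus_l2_diff[OF sq sq, of f g] by (simp add: abs_rep_torus_l2)
  moreover have "integrable torus_measure (\<lambda>x. (cmod (rep_torus_l2 f x - rep_torus_l2 g x))\<^sup>2)"
    using torus_square_integrable_diff[OF sq sq, of f g] by (simp add: torus_square_integrable_def)
  ultimately show ?thesis by (simp add: nn_integral_eq_integral)
qed

text \<open>Riesz and Fischer: a sequence with \<open>\<parallel>f\<^sub>k\<^sub>+\<^sub>1 - f\<^sub>k\<parallel> \<le> 2\<^sup>-\<^sup>k\<close> converges almost everywhere, and in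
  the mean by Fatou's lemma. The limit function is set to \<open>0\<close> where the sequence diverges, which
  keeps it periodic.\<close>

lemma torus_l2_fast_cauchy_convergent:
  fixes Y :: "nat \<Rightarrow> ('n::finite) torus_l2"
  assumes fast: "\<And>k. norm (Y (Suc k) - Y k) \<le> (1/2) ^ k"
    and cau: "\<And>\<epsilon>. 0 < \<epsilon> \<Longrightarrow> \<exists>K. \<forall>m\<ge>K. \<forall>k\<ge>K. norm (Y m - Y k) \<le> \<epsilon>"
  shows "convergent Y"
proof -
  define F where "F k = rep_torus_l2 (Y k)" for k
  have sq: "torus_square_integrable (F k)" for k
    unfolding F_def by (rule rep_torus_l2_square_integrable)
  then have [measurable]: "F k \<in> borel_measurable borel" and per: "F k (x + (2 * pi) *\<^sub>R axis i 1) = F k x" for k x i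
    by (auto simp: torus_square_integrable_def)
  define d where "d k x = cmod (F (Suc k) x - F k x)" for k x
  have [measurable]: "d k \<in> borel_measurable borel" for k unfolding d_def by measurable
  have d_le: "(\<integral>\<^sup>+x. ennreal (d k x) \<partial>torus_measure) \<le> ennreal (2 * (1/2) ^ k)" for k
  proof -
    \<comment> \<open>The total mass is 1. The weight \<open>2 ^ k\<close> turns the mean square
      bound \<open>(1/2) ^ k\<close> into the bound \<open>2 * (1/2) ^ k\<close> for the mean of
      \<open>d k\<close>, which is summable.\<close>
    have amgm: "d k x \<le> 2 ^ k * (d k x)\<^sup>2 + (1/2) ^ k" for x
    proof -
      have "0 \<le> (2 ^ k * d k x - 1)\<^sup>2" by simp
      then have "2 * (2 ^ k * d k x) \<le> (2 ^ k * d k x)\<^sup>2 + 1" by (simp add: power2_diff)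
      moreover have "0 \<le> 2 ^ k * d k x" by (simp add: d_def)
      ultimately have "2 ^ k * d k x \<le> (2 ^ k * d k x)\<^sup>2 + 1" by linarith
      then have "d k x * 2 ^ k \<le> (2 ^ k * (d k x)\<^sup>2 + (1/2) ^ k) * 2 ^ k"
        by (simp add: power2_eq_square algebra_simps power_one_over)
      then show ?thesis by (subst (asm) mult_le_cancel_right) auto
    qed
    have "(\<integral>\<^sup>+x. ennreal (d k x) \<partial>torus_measure) \<le> (\<integral>\<^sup>+x. ennreal (2 ^ k) * ennreal ((d k x)\<^sup>2) + ennreal ((1/2) ^ k) \<partial>torus_measure)"
      using amgm by (intro nn_integral_mono) (simp add: ennreal_mult'[symmetric] flip: ennreal_plus)
    also have "\<dots> = ennreal (2 ^ k) * (\<integral>\<^sup>+x. ennreal ((d k x)\<^sup>2) \<partial>torus_measure) + ennreal ((1/2) ^ k)"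
      by (simp add: nn_integral_add nn_integral_cmult emeasure_torus_measure_UNIV)
    also have "(\<integral>\<^sup>+x. ennreal ((d k x)\<^sup>2) \<partial>torus_measure) = ennreal ((norm (Y (Suc k) - Y k))\<^sup>2)"
      unfolding d_def F_def by (rule nn_integral_square_torus_l2_diff)
    also have "ennreal (2 ^ k) * ennreal ((norm (Y (Suc k) - Y k))\<^sup>2) \<le> ennreal (2 ^ k) * ennreal (((1/2) ^ k)\<^sup>2)"
      using fast[of k] by (intro mult_left_mono ennreal_leI power_mono) auto
    also have "\<dots> = ennreal ((1/2) ^ k)"
      by (simp add: ennreal_mult'[symmetric] power2_eq_square power_one_over)
    finally show ?thesis by (simp add: add_right_mono flip: ennreal_plus)
  qed
  have "(\<integral>\<^sup>+x. (\<Sum>k. ennreal (d k x)) \<partial>torus_measure) = (\<Sum>k. \<integral>\<^sup>+x. ennreal (d k x) \<partial>torus_measure)"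
    by (rule nn_integral_suminf) measurable
  also have "\<dots> \<le> (\<Sum>k. ennreal (2 * (1/2) ^ k))"
    by (intro suminf_le d_le) auto
  also have "\<dots> = ennreal (\<Sum>k. 2 * (1/2) ^ k)"
    by (intro suminf_ennreal2 summable_mult) auto
  also have "\<dots> < \<infinity>" by simp
  finally have "AE x in torus_measure. (\<Sum>k. ennreal (d k x)) \<noteq> \<infinity>"
    by (intro nn_integral_PInf_AE) auto
  then have conv: "AE x in torus_measure. convergent (\<lambda>k. F k x)"
  proof (rule eventually_mono)
    fix x assume "(\<Sum>k. ennreal (d k x)) \<noteq> \<infinity>"
    then have "summable (\<lambda>k. d k x)"
      by (intro summable_suminf_not_top) (auto simp: d_def)
    then have "summable (\<lambda>k. F (Suc k) x - F k x)"
      unfolding d_def by (rule summable_norm_cancel)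
    then have "convergent (\<lambda>m. \<Sum>k<m. F (Suc k) x - F k x)"
      by (simp add: summable_iff_convergent)
    then have "convergent (\<lambda>m. F m x - F 0 x)"
      using sum_lessThan_telescope[of "\<lambda>k. F k x"] by simp
    then show "convergent (\<lambda>k. F k x)" by (simp add: convergent_diff_const_right_iff)
  qed
  define G where "G x = (if convergent (\<lambda>k. F k x) then lim (\<lambda>k. F k x) else 0)" for x
  have Gm [measurable]: "G \<in> borel_measurable borel"
    unfolding G_def[abs_def] Cauchy_convergent_iff[symmetric] by measurable
  have Gper: "G (x + (2 * pi) *\<^sub>R axis i 1) = G x" for x i
    by (simp add: G_def per)
  have lim: "AE x in torus_measure. (\<lambda>m. F m x) \<longlonglongrightarrow> G x"
    using conv by (rule eventually_mono) (simp add: G_def convergent_LIMSEQ_iff)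
  have fatou: "(\<integral>\<^sup>+x. ennreal ((cmod (G x - F k x))\<^sup>2) \<partial>torus_measure) \<le> ennreal (\<epsilon>\<^sup>2)"
    if K: "\<And>m k. m \<ge> K \<Longrightarrow> k \<ge> K \<Longrightarrow> norm (Y m - Y k) \<le> \<epsilon>" and "k \<ge> K" for k K \<epsilon>
  proof -
    have "(\<integral>\<^sup>+x. ennreal ((cmod (G x - F k x))\<^sup>2) \<partial>torus_measure)
        = (\<integral>\<^sup>+x. liminf (\<lambda>m. ennreal ((cmod (F m x - F k x))\<^sup>2)) \<partial>torus_measure)"
    proof (rule nn_integral_cong_AE, rule eventually_mono[OF lim])
      fix x assume "(\<lambda>m. F m x) \<longlonglongrightarrow> G x"
      then have "(\<lambda>m. ennreal ((cmod (F m x - F k x))\<^sup>2)) \<longlonglongrightarrow> ennreal ((cmod (G x - F k x))\<^sup>2)"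
        by (intro tendsto_intros)
      then show "ennreal ((cmod (G x - F k x))\<^sup>2) = liminf (\<lambda>m. ennreal ((cmod (F m x - F k x))\<^sup>2))"
        by (rule lim_imp_Liminf[OF trivial_limit_sequentially, symmetric])
    qed
    also have "\<dots> \<le> liminf (\<lambda>m. \<integral>\<^sup>+x. ennreal ((cmod (F m x - F k x))\<^sup>2) \<partial>torus_measure)"
      by (rule nn_integral_liminf) measurable
    also have "\<dots> \<le> ennreal (\<epsilon>\<^sup>2)"
    proof -
      have "(\<integral>\<^sup>+x. ennreal ((cmod (F m x - F k x))\<^sup>2) \<partial>torus_measure) \<le> ennreal (\<epsilon>\<^sup>2)" if "m \<ge> K" for m
        unfolding F_def nn_integral_square_torus_l2_diff
        using K[OF that \<open>k \<ge> K\<close>] by (intro ennreal_leI power_mono) auto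
      then have "\<forall>\<^sub>F m in sequentially. (\<integral>\<^sup>+x. ennreal ((cmod (F m x - F k x))\<^sup>2) \<partial>torus_measure) \<le> ennreal (\<epsilon>\<^sup>2)"
        by (auto simp: eventually_sequentially)
      then have "liminf (\<lambda>m. \<integral>\<^sup>+x. ennreal ((cmod (F m x - F k x))\<^sup>2) \<partial>torus_measure) \<le> liminf (\<lambda>m. ennreal (\<epsilon>\<^sup>2))"
        by (rule Liminf_mono)
      then show ?thesis by (simp add: Liminf_const)
    qed
    finally show ?thesis .
  qed
  \<comment> \<open>Square integrability of the limit \<open>G\<close> is obtained from that of
    \<open>G - F K1\<close>, which Fatou's lemma bounds with tolerance 1.\<close>
  obtain K1 where K1: "\<And>m k. m \<ge> K1 \<Longrightarrow> k \<ge> K1 \<Longrightarrow> norm (Y m - Y k) \<le> 1"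
    using cau[of 1] by auto
  have "(\<integral>\<^sup>+x. ennreal ((cmod (G x - F K1 x))\<^sup>2) \<partial>torus_measure) < \<infinity>"
    using fatou[OF K1 order_refl] by (rule le_less_trans) (auto simp: ennreal_less_top)
  then have sqD: "torus_square_integrable (\<lambda>x. G x - F K1 x)"
    by (simp add: torus_square_integrable_def Gper per integrable_iff_bounded)
  have sqG: "torus_square_integrable G"
    using torus_square_integrable_add[OF sqD sq[of K1]] by simp
  have "Y \<longlonglongrightarrow> abs_torus_l2 G"
  proof (rule LIMSEQ_I)
    fix r :: real assume "0 < r"
    then obtain K where K: "\<And>m k. m \<ge> K \<Longrightarrow> k \<ge> K \<Longrightarrow> norm (Y m - Y k) \<le> r / 2"
      using cau[of "r / 2"] by auto
    have "norm (Y k - abs_torus_l2 G) < r" if "k \<ge> K" for k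
    proof -
      have sqk: "torus_square_integrable (\<lambda>x. G x - F k x)"
        by (rule torus_square_integrable_diff[OF sqG sq])
      have "abs_torus_l2 G - Y k = abs_torus_l2 (\<lambda>x. G x - F k x)"
        using abs_torus_l2_diff[OF sqG sq[of k]] by (simp add: F_def abs_rep_torus_l2)
      then have "ennreal ((norm (abs_torus_l2 G - Y k))\<^sup>2) = (\<integral>\<^sup>+x. ennreal ((cmod (G x - F k x))\<^sup>2) \<partial>torus_measure)"
        using sqk by (simp add: norm_abs_torus_l2 nn_integral_eq_integral torus_square_integrable_def)
      also have "\<dots> \<le> ennreal ((r / 2)\<^sup>2)"
        by (rule fatou[OF K that])
      finally have "(norm (abs_torus_l2 G - Y k))\<^sup>2 \<le> (r / 2)\<^sup>2"
        by (simp add: ennreal_le_iff del: power_divide)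
      then have "norm (abs_torus_l2 G - Y k) \<le> r / 2"
        by (rule power2_le_imp_le) (use \<open>0 < r\<close> in simp)
      then show ?thesis using \<open>0 < r\<close> by (simp add: norm_minus_commute)
    qed
    then show "\<exists>K. \<forall>k\<ge>K. norm (Y k - abs_torus_l2 G) < r" by (intro exI[of _ K] allI impI)
  qed
  then show ?thesis by (rule convergentI)
qed

text \<open>Completeness provides adjoints on \<open>torus_l2\<close>, and with them the meaning of
  \<open>adj\<close> in the inner product of the completion. A Cauchy sequence converges once a
  rapidly converging subsequence does.\<close>

instance torus_l2 :: (finite) chilbert_space
proof
  fix X :: "nat \<Rightarrow> 'a torus_l2"
  assume X: "Cauchy X"
  have "\<exists>N. \<forall>m\<ge>N. \<forall>k\<ge>N. norm (X m - X k) < (1/2) ^ j" for j :: nat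
    using X by (simp add: Cauchy_iff)
  then obtain N where N: "\<And>j m k. m \<ge> N j \<Longrightarrow> k \<ge> N j \<Longrightarrow> norm (X m - X k) < (1/2) ^ j"
    by metis
  \<comment> \<open>Summing the thresholds makes \<open>r\<close> strictly increasing and keeps
    \<open>r j\<close> above \<open>N j\<close>.\<close>
  define r where "r j = (\<Sum>i\<le>j. N i) + j" for j
  have r: "strict_mono r" by (rule strict_monoI_Suc) (simp add: r_def)
  have rN: "N j \<le> r j" for j
    unfolding r_def by (rule trans_le_add1) (rule member_le_sum, auto)
  have "convergent (X \<circ> r)"
  proof (rule torus_l2_fast_cauchy_convergent)
    show "norm ((X \<circ> r) (Suc k) - (X \<circ> r) k) \<le> (1/2) ^ k" for k
    proof -
      have "r k \<le> r (Suc k)" by (simp add: r_def)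
      then show ?thesis using N[of k "r (Suc k)" "r k"] rN[of k] by (simp add: less_imp_le)
    qed
    fix \<epsilon> :: real assume "0 < \<epsilon>"
    then obtain M where M: "\<And>m k. m \<ge> M \<Longrightarrow> k \<ge> M \<Longrightarrow> norm (X m - X k) < \<epsilon>"
      using X unfolding Cauchy_iff by meson
    have "M \<le> r m" if "m \<ge> M" for m using that by (simp add: r_def)
    then show "\<exists>K. \<forall>m\<ge>K. \<forall>k\<ge>K. norm ((X \<circ> r) m - (X \<circ> r) k) \<le> \<epsilon>"
      using M by (intro exI[of _ M]) (auto intro: less_imp_le)
  qed
  then obtain L where "(X \<circ> r) \<longlonglongrightarrow> L" by (auto simp: convergent_def)
  from Cauchy_converges_subseq[OF X r this] show "convergent X" by (rule convergentI)
qed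

section \<open>Star-shaped regions and integration over the sphere\<close>

text \<open>The extension from the sphere that is constant along rays. At the origin
  \<open>x /\<^sub>R norm x\<close> is 0, where \<open>f\<close> is not controlled, hence the
  prescribed value.\<close>

definition radial :: "(real ^ 'n \<Rightarrow> 'a::zero) \<Rightarrow> real ^ 'n \<Rightarrow> 'a" where
  "radial f x = (if x = 0 then 0 else f (x /\<^sub>R norm x))"

lemma continuous_on_radial:
  fixes f :: "real ^ 'n \<Rightarrow> 'a::{topological_space, zero}"
  assumes "continuous_on (sphere 0 1) f"
  shows "continuous_on (- {0}) (radial f)"
proof -
  have "continuous_on (- {0}) (\<lambda>x :: real ^ 'n. f (x /\<^sub>R norm x))"
    by (rule continuous_on_compose2[OF assms])
      (auto intro!: continuous_intros, metis left_inverse norm_eq_zero)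
  then show ?thesis
    by (rule continuous_on_eq) (simp add: radial_def)
qed

lemma radial_borel_measurable:
  fixes f :: "real ^ 'n \<Rightarrow> 'a::{second_countable_topology, real_normed_vector}"
  assumes "continuous_on (sphere 0 1) f"
  shows "radial f \<in> borel_measurable borel"
proof -
  have "(\<lambda>x. if x \<in> - {0} then radial f x else 0) \<in> borel_measurable borel"
    by (rule borel_measurable_continuous_on_if)
      (use continuous_on_radial[OF assms] in auto)
  also have "(\<lambda>x. if x \<in> - {0} then radial f x else 0) = radial f"
    by (auto simp: radial_def)
  finally show ?thesis .
qed

lemma radial_scaleR: "0 < c \<Longrightarrow> radial f (c *\<^sub>R x) = radial f x"
proof -
  assume "0 < c"
  then have "(c *\<^sub>R x) /\<^sub>R norm (c *\<^sub>R x) = x /\<^sub>R norm x"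
    by (simp add: inverse_mult_distrib mult.commute[of _ c] mult.assoc[symmetric])
  with \<open>0 < c\<close> show ?thesis by (simp only: radial_def scaleR_eq_0_iff) simp
qed

text \<open>The set where the homogeneous function \<open>radial f x / norm x ^ CARD('n)\<close> of
  degree -n is at least 1. Its radius in direction \<omega> is the n-th root of
  \<open>f \<omega>\<close>, so in polar coordinates its volume is 1/n times the integral of
  \<open>f\<close> over the sphere.\<close>

definition star_region :: "(real ^ 'n \<Rightarrow> real) \<Rightarrow> (real ^ 'n) set" where
  "star_region f = {x. x = 0 \<or> norm x ^ CARD('n) \<le> radial f x}"

text \<open>Invariance of \<open>A\<close> under dilations identifies the left set with the dilate
  of the unit piece by the n-th root of \<open>c\<close>, and volume scales by the n-th
  power.\<close>

lemma measure_cone: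
  fixes A :: "(real ^ 'n) set"
  assumes A: "A \<in> sets borel" "0 \<notin> A" "\<And>c x. 0 < c \<Longrightarrow> c *\<^sub>R x \<in> A \<longleftrightarrow> x \<in> A" and "0 \<le> c"
  shows "measure lborel {x \<in> A. norm x ^ CARD('n) \<le> c} = c * measure lborel (A \<inter> cball 0 1)"
proof (cases "c = 0")
  case True
  have empty: "{x \<in> A. norm x ^ CARD('n) \<le> 0} = {}"
    using A(2) by (auto simp: power_le_zero_eq)
  show ?thesis unfolding True empty by simp
next
  case False
  define s where "s = root CARD('n) c"
  have s: "s > 0" "s ^ CARD('n) = c"
    using False \<open>0 \<le> c\<close> by (auto simp: s_def real_root_pow_pos2)
  have "{x \<in> A. norm x ^ CARD('n) \<le> c} = (\<lambda>x. s *\<^sub>R x + 0) ` (A \<inter> cball 0 1)"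
  proof (intro set_eqI iffI)
    fix x assume x: "x \<in> {x \<in> A. norm x ^ CARD('n) \<le> c}"
    then have "norm x \<le> s"
      using s power_strict_mono[of s "norm x" "CARD('n)"] by (cases "norm x \<le> s") auto
    then have "(1 / s) *\<^sub>R x \<in> A \<inter> cball 0 1"
      using x s A(3)[of "1 / s" x] by (simp add: field_simps)
    moreover have "x = s *\<^sub>R ((1 / s) *\<^sub>R x) + 0" using s by simp
    ultimately show "x \<in> (\<lambda>x. s *\<^sub>R x + 0) ` (A \<inter> cball 0 1)" by blast
  next
    fix x assume "x \<in> (\<lambda>x. s *\<^sub>R x + 0) ` (A \<inter> cball 0 1)"
    then obtain y where "x = s *\<^sub>R y + 0" "y \<in> A \<inter> cball 0 1" by (rule imageE)
    then have y: "x = s *\<^sub>R y" "y \<in> A" "norm y \<le> 1" by simp_all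
    have "norm x ^ CARD('n) = c * norm y ^ CARD('n)"
      using y(1) s by (simp add: power_mult_distrib)
    also have "\<dots> \<le> c * 1"
      using y(3) \<open>0 \<le> c\<close> by (intro mult_left_mono power_le_one) auto
    finally show "x \<in> {x \<in> A. norm x ^ CARD('n) \<le> c}"
      using y A(3)[OF s(1)] by simp
  qed
  moreover have "{x \<in> A. norm x ^ CARD('n) \<le> c} \<in> sets borel"
    using A(1) by measurable
  moreover have "A \<inter> cball 0 1 \<in> sets borel"
    using A(1) by measurable
  ultimately show ?thesis
    using measure_lebesgue_affine[of s 0 "A \<inter> cball 0 1"] s by (simp add: measure_completion)
qed

section \<open>Star-shaped regions of positive continuous functions and their lattice points\<close>

locale positive_on_sphere =
  fixes f :: "real ^ 'n \<Rightarrow> real"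
  assumes cont: "continuous_on (sphere 0 1) f" and pos: "\<And>x. norm x = 1 \<Longrightarrow> 0 < f x"
begin

text \<open>The cap \<open>m \<le> 1\<close> ensures \<open>m ^ CARD('n) \<le> m\<close>, which puts
  the ball of radius \<open>m\<close> inside the star region.\<close>

lemma bounds: "\<exists>m M. 0 < m \<and> m \<le> 1 \<and> (\<forall>x. x \<noteq> 0 \<longrightarrow> m \<le> radial f x \<and> radial f x \<le> M)"
proof -
  have ne: "sphere (0 :: real ^ 'n) 1 \<noteq> {}" by simp
  obtain a where a: "a \<in> sphere 0 1" "\<And>x. x \<in> sphere 0 1 \<Longrightarrow> f a \<le> f x"
    using continuous_attains_inf[OF compact_sphere ne cont] by blast
  obtain b where b: "b \<in> sphere 0 1" "\<And>x. x \<in> sphere 0 1 \<Longrightarrow> f x \<le> f b"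
    using continuous_attains_sup[OF compact_sphere ne cont] by blast
  have "f a \<le> radial f x \<and> radial f x \<le> f b" if "x \<noteq> 0" for x
    using that a(2)[of "x /\<^sub>R norm x"] b(2)[of "x /\<^sub>R norm x"] by (simp add: radial_def)
  then show ?thesis
    using pos[of a] a(1)
    by (intro exI[where P = "\<lambda>m. \<exists>M. _ m M" and x = "min 1 (f a)"] exI[where x = "f b"])
      (auto simp: min_le_iff_disj)
qed

lemma radial_measurable [measurable]: "radial f \<in> borel_measurable borel"
  by (rule radial_borel_measurable[OF cont])

lemma star_region_borel: "star_region f \<in> sets borel"
  unfolding star_region_def by measurable

lemma star_region_bounded: "bounded (star_region f)"
proof -
  obtain M where M: "\<And>x. x \<noteq> 0 \<Longrightarrow> radial f x \<le> M" using bounds by blast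
  have "norm x \<le> max 1 M" if "x \<in> star_region f" for x
  proof (cases "x = 0 \<or> norm x \<le> 1")
    case False
    then have "norm x \<le> norm x ^ CARD('n)" by (intro self_le_power) auto
    also have "\<dots> \<le> M" using that False M[of x] by (auto simp: star_region_def)
    finally show ?thesis by simp
  qed auto
  then show ?thesis by (auto simp: bounded_iff)
qed

text \<open>Near the origin \<open>radial f\<close> is discontinuous, but there the region contains
  a ball. Outside this ball the frontier lies in the closed set \<open>Z\<close> where equality
  holds in the defining inequality. Each ray meets \<open>Z\<close> at most once, so
  \<open>Z\<close> is negligible.\<close>

lemma star_region_frontier: "negligible (frontier (star_region f))"
proof -
  obtain m where m: "0 < m" "m \<le> 1" "\<And>x. x \<noteq> 0 \<Longrightarrow> m \<le> radial f x" using bounds by blast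
  have pm: "m ^ CARD('n) \<le> m" using m power_decreasing[of 1 "CARD('n)" m] by simp
  define F where "F x = radial f x - norm x ^ CARD('n)" for x
  have contF: "continuous_on (- {0}) F"
    unfolding F_def by (intro continuous_intros continuous_on_radial cont)
  have small: "0 < F x" if "x \<noteq> 0" "norm x < m" for x
  proof -
    have "norm x ^ CARD('n) < m ^ CARD('n)" using that by (intro power_strict_mono) auto
    then show ?thesis using m(3)[OF that(1)] pm by (simp add: F_def)
  qed
  have closed: "closed {x. m \<le> norm x}"
    by (intro closed_Collect_le continuous_intros)
  have contF': "continuous_on {x. m \<le> norm x} F"
    by (rule continuous_on_subset[OF contF]) (use m(1) in auto)
  have "closed ({x. m \<le> norm x} \<inter> F -` {0..})"
    by (rule continuous_closed_preimage[OF contF' closed]) simp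
  moreover have "star_region f = cball 0 m \<union> ({x. m \<le> norm x} \<inter> F -` {0..})"
  proof (intro set_eqI iffI)
    fix x assume "x \<in> star_region f"
    then show "x \<in> cball 0 m \<union> ({x. m \<le> norm x} \<inter> F -` {0..})"
      using m(1) by (auto simp: star_region_def F_def)
  next
    fix x assume x: "x \<in> cball 0 m \<union> ({x. m \<le> norm x} \<inter> F -` {0..})"
    show "x \<in> star_region f"
    proof (cases "x = 0")
      case False
      have "norm x ^ CARD('n) \<le> m ^ CARD('n)" if "norm x \<le> m" using that by (intro power_mono) auto
      then show ?thesis using False x m(3)[OF False] pm by (auto simp: star_region_def F_def)
    qed (simp add: star_region_def)
  qed
  ultimately have "closed (star_region f)" by (simp add: closed_Un)
  have "open (- {0} \<inter> F -` {0<..})"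
    by (rule continuous_open_preimage[OF contF]) auto
  moreover have "- {0} \<inter> F -` {0<..} \<subseteq> star_region f"
    by (auto simp: star_region_def F_def)
  ultimately have int1: "- {0} \<inter> F -` {0<..} \<subseteq> interior (star_region f)"
    by (rule interior_maximal[rotated])
  have "ball 0 m \<subseteq> star_region f"
  proof
    fix x :: "real ^ 'n" assume "x \<in> ball 0 m"
    then show "x \<in> star_region f"
      using small[of x] by (cases "x = 0") (auto simp: star_region_def F_def)
  qed
  then have int2: "ball 0 m \<subseteq> interior (star_region f)"
    by (simp add: interior_maximal)
  define Z where "Z = {x. m \<le> norm x} \<inter> F -` {0}"
  have "frontier (star_region f) \<subseteq> Z"
  proof
    fix x assume "x \<in> frontier (star_region f)"
    then have x: "x \<in> star_region f" "x \<notin> interior (star_region f)"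
      using \<open>closed (star_region f)\<close> by (auto simp: frontier_def)
    then have "m \<le> norm x" using int2 by (auto simp: subset_iff not_less[symmetric])
    moreover have "x \<noteq> 0" using \<open>m \<le> norm x\<close> m(1) by auto
    moreover have "F x \<ge> 0" using x(1) \<open>x \<noteq> 0\<close> by (simp add: star_region_def F_def)
    moreover have "\<not> F x > 0" using int1 x(2) \<open>x \<noteq> 0\<close> by auto
    ultimately show "x \<in> Z" by (simp add: Z_def)
  qed
  moreover have "negligible Z"
  proof (rule starlike_negligible[where a = 0])
    show "closed Z"
      unfolding Z_def
      by (rule continuous_closed_preimage[OF contF' closed]) simp
    fix c and x :: "real ^ 'n" assume c: "0 + c *\<^sub>R x \<in> Z" "0 \<le> c" "0 + x \<in> Z"
    then have "x \<noteq> 0" "c \<noteq> 0" using m(1) by (auto simp: Z_def)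
    with c have "c > 0" by simp
    have "norm x ^ CARD('n) = radial f x" "c ^ CARD('n) * norm x ^ CARD('n) = radial f x"
      using c \<open>c > 0\<close> by (auto simp: Z_def F_def radial_scaleR power_mult_distrib)
    then have "c ^ CARD('n) = 1" using \<open>x \<noteq> 0\<close> by (metis mult_cancel_right2 norm_eq_zero power_not_zero)
    then show "c = 1" using power_eq_imp_eq_base[of c "CARD('n)" 1] \<open>c > 0\<close> by simp
  qed
  ultimately show ?thesis by (rule negligible_subset[rotated])
qed

text \<open>On the cone where \<open>f\<close> takes values in \<open>[j\<epsilon>, (j+1)\<epsilon>)\<close> both sides lie between the measure of the
  cone's part of the unit ball times \<open>j\<epsilon>\<close> and times \<open>(j+1)\<epsilon>\<close>.\<close>

lemma measure_star_region:
  "measure lborel (star_region f) = integral\<^sup>L lborel (\<lambda>x. indicator (cball 0 1) x * radial f x)"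
proof -
  obtain M where M: "\<And>x. x \<noteq> 0 \<Longrightarrow> 0 < radial f x \<and> radial f x \<le> M"
    using bounds by (metis less_le_trans)
  let ?B = "cball 0 1 :: (real ^ 'n) set"
  have fin_B: "emeasure lborel (A \<inter> ?B) < \<infinity>" for A
    using emeasure_mono[of "A \<inter> ?B" ?B lborel] emeasure_lborel_cball_finite[of 0 1]
    by (metis Int_lower2 lborelD le_less_trans closed_cball borel_closed sets_lborel)
  have fin_S: "emeasure lborel (A \<inter> star_region f) < \<infinity>" for A
  proof -
    obtain R where R: "star_region f \<subseteq> cball 0 R"
      using star_region_bounded by (auto simp: bounded_iff subset_iff)
    then have "emeasure lborel (A \<inter> star_region f) \<le> emeasure lborel (cball (0 :: real ^ 'n) R)" by (intro emeasure_mono) auto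
    then show ?thesis using emeasure_lborel_cball_finite by (rule le_less_trans)
  qed
  have approx: "\<bar>measure lborel (star_region f) - integral\<^sup>L lborel (\<lambda>x. indicator ?B x * radial f x)\<bar>
      \<le> \<epsilon> * measure lborel ?B" if "\<epsilon> > 0" for \<epsilon>
  proof -
    define A where "A j = {x. x \<noteq> 0 \<and> nat \<lfloor>radial f x / \<epsilon>\<rfloor> = j}" for j
    have Ab [measurable]: "A j \<in> sets borel" for j unfolding A_def by measurable
    have Asc: "c *\<^sub>R x \<in> A j \<longleftrightarrow> x \<in> A j" if "0 < c" for c x j
      using that by (simp add: A_def radial_scaleR)
    have Av: "real j * \<epsilon> \<le> radial f x" "radial f x \<le> (real j + 1) * \<epsilon>" if "x \<in> A j" for x j
    proof -
      have "radial f x / \<epsilon> > 0" using that M[of x] \<open>\<epsilon> > 0\<close> by (auto simp: A_def)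
      then have "real j = of_int \<lfloor>radial f x / \<epsilon>\<rfloor>" using that by (auto simp: A_def)
      then have "real j \<le> radial f x / \<epsilon>" "radial f x / \<epsilon> \<le> real j + 1" by linarith+
      then show "real j * \<epsilon> \<le> radial f x" "radial f x \<le> (real j + 1) * \<epsilon>"
        using \<open>\<epsilon> > 0\<close> by (simp_all add: field_simps)
    qed
    define J where "J = nat \<lfloor>M / \<epsilon>\<rfloor>"
    have AJ: "\<exists>j\<le>J. x \<in> A j" if "x \<noteq> 0" for x
      using that M[OF that] \<open>\<epsilon> > 0\<close> unfolding A_def J_def
      by (auto intro!: nat_mono floor_mono divide_right_mono)
    have disj: "disjoint_family_on A {..J}" by (auto simp: disjoint_family_on_def A_def)
    define b where "b j = measure lborel (A j \<inter> ?B)" for j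
    define v where "v j = measure lborel (A j \<inter> star_region f)" for j
    define w where "w j = integral\<^sup>L lborel (\<lambda>x. indicator (A j \<inter> ?B) x * radial f x)" for j
    have star [measurable]: "star_region f \<in> sets borel" by (rule star_region_borel)
    have ballm [measurable]: "?B \<in> sets borel" by simp
    \<comment> \<open>The cones \<open>A j\<close> leave out the origin, which has measure
      zero.\<close>
    have null0: "measure lborel (X - {0}) = measure lborel X" if "X \<in> sets borel" for X :: "(real ^ 'n) set"
      using that by (intro measure_Diff_null_set) (auto simp: null_sets_def)
    have v_sum: "measure lborel (star_region f) = (\<Sum>j\<le>J. v j)"
    proof -
      have "(\<Union>j\<le>J. A j \<inter> star_region f) = star_region f - {0}" using AJ by (auto simp: A_def)
      moreover have "measure lborel (\<Union>j\<le>J. A j \<inter> star_region f) = (\<Sum>j\<le>J. v j)"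
        unfolding v_def using fin_S disj
        by (intro measure_finite_Union) (auto simp: disjoint_family_on_def less_top[symmetric])
      ultimately show ?thesis using null0[OF star] by simp
    qed
    have b_sum: "measure lborel ?B = (\<Sum>j\<le>J. b j)"
    proof -
      have "(\<Union>j\<le>J. A j \<inter> ?B) = ?B - {0}" using AJ by (auto simp: A_def)
      moreover have "measure lborel (\<Union>j\<le>J. A j \<inter> ?B) = (\<Sum>j\<le>J. b j)"
        unfolding b_def using fin_B disj
        by (intro measure_finite_Union) (auto simp: disjoint_family_on_def less_top[symmetric])
      ultimately show ?thesis using null0[OF ballm] by simp
    qed
    have ind_int: "integrable lborel (\<lambda>x. indicator (A j \<inter> ?B) x * c)" for j and c :: real
      using fin_B by (intro integrable_mult_left integrable_real_indicator) auto
    have w_int: "integrable lborel (\<lambda>x. indicator (A j \<inter> ?B) x * radial f x)" for j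
    proof (rule Bochner_Integration.integrable_bound[OF ind_int[of j "(real j + 1) * \<epsilon>"]])
      show "AE x in lborel. norm (indicator (A j \<inter> ?B) x * radial f x) \<le> norm (indicator (A j \<inter> ?B) x * ((real j + 1) * \<epsilon>))"
      proof (rule AE_I2)
        fix x
        show "norm (indicator (A j \<inter> ?B) x * radial f x) \<le> norm (indicator (A j \<inter> ?B) x * ((real j + 1) * \<epsilon>))"
        proof (cases "x \<in> A j")
          case True
          then have "0 < radial f x" using M by (auto simp: A_def)
          then show ?thesis using Av(2)[OF True] by (auto simp: indicator_def)
        qed (simp add: indicator_def)
      qed
    qed measurable
    have w_sum: "integral\<^sup>L lborel (\<lambda>x. indicator ?B x * radial f x) = (\<Sum>j\<le>J. w j)"
    proof -
      have "indicator ?B x * radial f x = (\<Sum>j\<le>J. indicator (A j \<inter> ?B) x * radial f x)" for x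
      proof (cases "x = 0")
        case False
        then obtain j where j: "j \<le> J" "x \<in> A j" using AJ by blast
        have "(\<Sum>i\<le>J. indicator (A i \<inter> ?B) x * radial f x) = (\<Sum>i\<le>J. if i = j then indicator ?B x * radial f x else 0)"
          using j by (intro sum.cong) (auto simp: indicator_def A_def)
        also have "\<dots> = indicator ?B x * radial f x" using j(1) by simp
        finally show ?thesis by (rule sym)
      qed (simp add: radial_def)
      then have "integral\<^sup>L lborel (\<lambda>x. indicator ?B x * radial f x) = integral\<^sup>L lborel (\<lambda>x. \<Sum>j\<le>J. indicator (A j \<inter> ?B) x * radial f x)"
        by (simp only:)
      also have "\<dots> = (\<Sum>j\<le>J. w j)"
        unfolding w_def by (intro Bochner_Integration.integral_sum w_int)
      finally show ?thesis .
    qed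
    have w_bounds: "real j * \<epsilon> * b j \<le> w j" "w j \<le> (real j + 1) * \<epsilon> * b j" for j
    proof -
      have ic: "integral\<^sup>L lborel (\<lambda>x. indicator (A j \<inter> ?B) x * c) = c * b j" for c
        unfolding b_def by (simp add: mult.commute)
      show "real j * \<epsilon> * b j \<le> w j"
        unfolding ic[symmetric] w_def using Av(1)
        by (intro integral_mono ind_int w_int) (auto simp: indicator_def)
      show "w j \<le> (real j + 1) * \<epsilon> * b j"
        unfolding ic[symmetric] w_def using Av(2)
        by (intro integral_mono ind_int w_int) (auto simp: indicator_def)
    qed
    have cone: "measure lborel {x \<in> A j. norm x ^ CARD('n) \<le> c} = c * b j" if "0 \<le> c" for c j
      unfolding b_def by (rule measure_cone[OF Ab _ Asc that]) (auto simp: A_def)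
    have fin_cone: "emeasure lborel {x \<in> A j. norm x ^ CARD('n) \<le> c} < \<infinity>" for c j
    proof -
      have "{x \<in> A j. norm x ^ CARD('n) \<le> c} \<subseteq> cball 0 (max 1 c)"
      proof
        fix x assume x: "x \<in> {x \<in> A j. norm x ^ CARD('n) \<le> c}"
        show "x \<in> cball 0 (max 1 c)"
        proof (cases "norm x \<le> 1")
          case False
          then have "norm x \<le> norm x ^ CARD('n)" by (intro self_le_power) auto
          then show ?thesis using x by auto
        qed auto
      qed
      then have "emeasure lborel {x \<in> A j. norm x ^ CARD('n) \<le> c} \<le> emeasure lborel (cball (0 :: real ^ 'n) (max 1 c))"
        by (intro emeasure_mono) auto
      then show ?thesis using emeasure_lborel_cball_finite by (rule le_less_trans)
    qed
    have v_bounds: "real j * \<epsilon> * b j \<le> v j" "v j \<le> (real j + 1) * \<epsilon> * b j" for j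
    proof -
      have j0: "0 \<le> real j * \<epsilon>" "0 \<le> (real j + 1) * \<epsilon>" using \<open>\<epsilon> > 0\<close> by auto
      have coneb: "{x \<in> A j. norm x ^ CARD('n) \<le> c} \<in> sets lborel" for c by measurable
      show "real j * \<epsilon> * b j \<le> v j"
        unfolding cone[OF j0(1), symmetric] v_def using fin_S[of "A j"]
      proof (intro measure_mono_fmeasurable coneb)
        show "{x \<in> A j. norm x ^ CARD('n) \<le> real j * \<epsilon>} \<subseteq> A j \<inter> star_region f"
          using Av(1) by (force simp: star_region_def)
      qed (auto simp: fmeasurable_def)
      show "v j \<le> (real j + 1) * \<epsilon> * b j"
        unfolding cone[OF j0(2), symmetric] v_def using fin_cone[of j "(real j + 1) * \<epsilon>"] coneb
      proof (intro measure_mono_fmeasurable)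
        show "A j \<inter> star_region f \<subseteq> {x \<in> A j. norm x ^ CARD('n) \<le> (real j + 1) * \<epsilon>}"
          using Av(2) by (force simp: star_region_def A_def)
      qed (auto simp: fmeasurable_def)
    qed
    have "\<bar>v j - w j\<bar> \<le> \<epsilon> * b j" for j
      using v_bounds[of j] w_bounds[of j] by (simp add: algebra_simps abs_le_iff)
    then have "\<bar>\<Sum>j\<le>J. v j - w j\<bar> \<le> (\<Sum>j\<le>J. \<epsilon> * b j)"
      by (intro order_trans[OF sum_abs] sum_mono)
    then show ?thesis
      unfolding v_sum w_sum b_sum by (simp add: sum_subtractf sum_distrib_left)
  qed
  have "\<bar>measure lborel (star_region f) - integral\<^sup>L lborel (\<lambda>x. indicator ?B x * radial f x)\<bar> \<le> 0"
  proof (rule field_le_epsilon)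
    fix e :: real assume "0 < e"
    define c where "c = measure lborel ?B + 1"
    have "c > 0" by (simp add: c_def add_nonneg_pos)
    have "e / c * measure lborel ?B \<le> e / c * c" using \<open>0 < e\<close> \<open>c > 0\<close> by (intro mult_left_mono) (auto simp: c_def)
    then show "\<bar>measure lborel (star_region f) - integral\<^sup>L lborel (\<lambda>x. indicator ?B x * radial f x)\<bar> \<le> 0 + e"
      using approx[of "e / c"] \<open>0 < e\<close> \<open>c > 0\<close> by simp
  qed
  then show ?thesis by simp
qed

text \<open>Passes from the Lebesgue integral to the Henstock-Kurzweil one used by
  \<open>sphere_integral\<close>, and from \<open>radial f\<close> to the integrand there, from
  which it differs at the origin only.\<close>

lemma has_integral_radial:
  "((\<lambda>x. f (x /\<^sub>R norm x)) has_integral measure lborel (star_region f)) (cball 0 1)"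
proof -
  obtain M where M: "\<And>x. x \<noteq> 0 \<Longrightarrow> 0 < radial f x \<and> radial f x \<le> M"
    using bounds by (metis less_le_trans)
  have "set_integrable lborel (cball 0 1) (radial f)"
    unfolding set_integrable_def
  proof (rule Bochner_Integration.integrable_bound)
    show "integrable lborel (\<lambda>x. indicator (cball (0 :: real ^ 'n) 1) x * max 0 M :: real)"
      using emeasure_lborel_cball_finite[of "0 :: real ^ 'n" 1]
      by (intro integrable_mult_left integrable_real_indicator) auto
    show "AE x in lborel. norm (indicator (cball 0 1) x *\<^sub>R radial f x) \<le> norm (indicator (cball 0 1) x * max 0 M)"
    proof (rule AE_I2)
      show "norm (indicator (cball 0 1) x *\<^sub>R radial f x) \<le> norm (indicator (cball 0 1) x * max 0 M)" for x
        using M[of x] by (cases "x = 0") (auto simp: indicator_def radial_def)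
    qed
    show "(\<lambda>x. indicator (cball 0 1) x *\<^sub>R radial f x) \<in> borel_measurable lborel"
      using radial_measurable by (intro borel_measurable_scaleR borel_measurable_indicator) auto
  qed
  note int = set_borel_integral_eq_integral[OF this]
  have "(radial f has_integral measure lborel (star_region f)) (cball 0 1)"
    using int unfolding measure_star_region set_lebesgue_integral_def
    by (simp add: has_integral_iff)
  then show ?thesis
    by (rule has_integral_spike[OF negligible_sing[of 0], rotated]) (simp add: radial_def)
qed

text \<open>The value at 0 keeps the function positive, so that it can be enumerated by decreasing
  values. Being 1, it also satisfies the description of superlevel sets at all levels
  \<open>c \<le> 1\<close>.\<close>

definition lattice_symbol :: "int ^ 'n \<Rightarrow> real" where
  "lattice_symbol k = (if k = 0 then 1 else f (lattice_vec k /\<^sub>R norm (lattice_vec k)) / norm (lattice_vec k) ^ CARD('n))"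

lemma lattice_symbol_pos: "0 < lattice_symbol k"
  using pos[of "lattice_vec k /\<^sub>R norm (lattice_vec k)"] by (simp add: lattice_symbol_def)

text \<open>Homogeneity of degree -n: lowering the level from 1 to \<open>c\<close> dilates the
  region by the n-th root of \<open>1 / c\<close>.\<close>

lemma lattice_symbol_ge_iff:
  assumes "0 < c" "c \<le> 1"
  shows "c \<le> lattice_symbol k \<longleftrightarrow> lattice_vec k /\<^sub>R root CARD('n) (1 / c) \<in> star_region f"
proof (cases "k = 0")
  case True
  then show ?thesis using assms by (simp add: lattice_symbol_def star_region_def)
next
  case False
  define t where "t = root CARD('n) (1 / c)"
  have t: "t > 0" "t ^ CARD('n) = 1 / c"
    using assms by (auto simp: t_def real_root_pow_pos2)
  have "norm (lattice_vec k /\<^sub>R t) ^ CARD('n) = c * norm (lattice_vec k) ^ CARD('n)"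
    using t by (simp add: power_mult_distrib power_inverse)
  moreover have "radial f (lattice_vec k /\<^sub>R t) = f (lattice_vec k /\<^sub>R norm (lattice_vec k))"
    using radial_scaleR[of "inverse t" f "lattice_vec k"] t(1) False by (simp add: radial_def)
  ultimately show ?thesis
    using False t(1) unfolding t_def[symmetric]
    by (simp add: lattice_symbol_def star_region_def pos_le_divide_eq)
qed

lemma lattice_symbol_count:
  assumes "\<And>j. 0 < c j" "c \<longlonglongrightarrow> 0"
  shows "(\<lambda>j. c j * real (card {k. c j \<le> lattice_symbol k})) \<longlonglongrightarrow> measure lborel (star_region f)"
proof -
  \<comment> \<open>The lattice point count wants dilation factors at least 1. Since
    \<open>c\<close> tends to 0 the maximum is eventually the root.\<close>
  define t where "t j = max 1 (root CARD('n) (1 / c j))" for j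
  have "filterlim (\<lambda>j. 1 / c j) at_top sequentially"
    using filterlim_inverse_at_top[OF assms(2)] assms(1) by (simp add: inverse_eq_divide)
  then have "filterlim (\<lambda>j. root CARD('n) (1 / c j)) at_top sequentially"
    unfolding filterlim_at_top
  proof (intro allI)
    fix Z :: real assume "\<forall>Z. \<forall>\<^sub>F j in sequentially. Z \<le> 1 / c j"
    then have "\<forall>\<^sub>F j in sequentially. max 0 Z ^ CARD('n) \<le> 1 / c j" by blast
    then show "\<forall>\<^sub>F j in sequentially. Z \<le> root CARD('n) (1 / c j)"
    proof (rule eventually_mono)
      fix j assume "max 0 Z ^ CARD('n) \<le> 1 / c j"
      then have "root CARD('n) (max 0 Z ^ CARD('n)) \<le> root CARD('n) (1 / c j)" by simp
      then show "Z \<le> root CARD('n) (1 / c j)" by (simp add: real_root_power_cancel)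
    qed
  qed
  then have t: "filterlim t at_top sequentially"
    by (rule filterlim_at_top_mono) (simp add: t_def)
  have "(\<lambda>j. real (card {k :: int ^ 'n. lattice_vec k /\<^sub>R t j \<in> star_region f}) / t j ^ CARD('n)) \<longlonglongrightarrow> measure lborel (star_region f)"
    by (rule lattice_point_count[OF star_region_borel star_region_bounded star_region_frontier t]) (simp add: t_def)
  moreover have "\<forall>\<^sub>F j in sequentially. real (card {k :: int ^ 'n. lattice_vec k /\<^sub>R t j \<in> star_region f}) / t j ^ CARD('n)
      = c j * real (card {k. c j \<le> lattice_symbol k})"
  proof (rule eventually_mono[OF order_tendstoD(2)[OF assms(2), of 1]])
    fix j assume "c j < 1"
    then have "1 \<le> root CARD('n) (1 / c j)"
      using assms(1)[of j] by simp
    then have tj: "t j = root CARD('n) (1 / c j)" by (simp add: t_def)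
    have "t j ^ CARD('n) = 1 / c j"
      unfolding tj using assms(1)[of j] by (simp add: real_root_pow_pos2)
    then show "real (card {k :: int ^ 'n. lattice_vec k /\<^sub>R t j \<in> star_region f}) / t j ^ CARD('n)
      = c j * real (card {k. c j \<le> lattice_symbol k})"
      using lattice_symbol_ge_iff[OF assms(1)[of j]] \<open>c j < 1\<close> by (simp add: tj)
  qed simp
  ultimately show ?thesis by (rule Lim_transform_eventually)
qed

lemma finite_lattice_symbol_ge:
  assumes "0 < c"
  shows "finite {k. c \<le> lattice_symbol k}"
proof -
  define d where "d = min c 1"
  have d: "0 < d" "d \<le> 1" using assms by (auto simp: d_def)
  obtain R where R: "\<And>x. x \<in> star_region f \<Longrightarrow> norm x \<le> R"
    using star_region_bounded by (auto simp: bounded_iff)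
  have "{k. c \<le> lattice_symbol k} \<subseteq> {k. d \<le> lattice_symbol k}" by (auto simp: d_def)
  also have "\<dots> \<subseteq> {k. norm (lattice_vec k) \<le> R * root CARD('n) (1 / d)}"
  proof
    fix k assume "k \<in> {k. d \<le> lattice_symbol k}"
    then have "norm (lattice_vec k /\<^sub>R root CARD('n) (1 / d)) \<le> R"
      using lattice_symbol_ge_iff[OF d] by (intro R) simp
    moreover have "root CARD('n) (1 / d) > 0" using d by simp
    ultimately show "k \<in> {k. norm (lattice_vec k) \<le> R * root CARD('n) (1 / d)}"
      by (simp add: field_simps)
  qed
  finally show ?thesis using finite_lattice_ball finite_subset by blast
qed

theorem ex_weyl_enumeration:
  "\<exists>\<sigma>. bij \<sigma> \<and> (\<lambda>j. (real j + 1) * lattice_symbol (\<sigma> j)) \<longlonglongrightarrow> measure lborel (star_region f)"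
proof -
  obtain \<tau> :: "nat \<Rightarrow> int ^ 'n" where "bij \<tau>" using ex_enumeration_lattice by blast
  then have "infinite (UNIV :: (int ^ 'n) set)"
    using bij_betw_finite infinite_UNIV_nat by blast
  then have "\<exists>\<sigma> :: nat \<Rightarrow> int ^ 'n. bij \<sigma> \<and> antimono (\<lambda>j. lattice_symbol (\<sigma> j))"
    by (rule ex_antitone_enumeration[OF _ lattice_symbol_pos]) (rule finite_lattice_symbol_ge)
  then obtain \<sigma> :: "nat \<Rightarrow> int ^ 'n" where \<sigma>: "bij \<sigma>" "antimono (\<lambda>j. lattice_symbol (\<sigma> j))" by blast
  have "(\<lambda>j. (real j + 1) * lattice_symbol (\<sigma> j)) \<longlonglongrightarrow> measure lborel (star_region f)"
    by (rule antitone_enumeration_asymptotics[OF \<sigma> lattice_symbol_pos])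
      (rule finite_lattice_symbol_ge, assumption, rule lattice_symbol_count)
  with \<sigma>(1) show ?thesis by blast
qed

end

section \<open>The algebra of the noncommutative torus\<close>

subsection \<open>Twisted translations\<close>

interpretation ocomp: bounded_bilinear "(o\<^sub>L) :: ('b::real_normed_vector \<Rightarrow>\<^sub>L 'c::real_normed_vector) \<Rightarrow> ('a::real_normed_vector \<Rightarrow>\<^sub>L 'b) \<Rightarrow> _"
  by (rule bounded_bilinear_blinfun_compose)

definition mshift :: "int ^ 'n \<Rightarrow> real ^ 'n \<Rightarrow> ('n::finite) torus_op" where
  "mshift k v = Blinfun (mod_shift k v)"

lemma norm_mod_shift: "norm (mod_shift k v f) = norm f"
proof -
  have "complex_of_real ((norm (mod_shift k v f))\<^sup>2) = complex_of_real ((norm f)\<^sup>2)"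
    unfolding cinner_self[symmetric] by (rule mod_shift_cinner)
  then have "(norm (mod_shift k v f))\<^sup>2 = (norm f)\<^sup>2" by (simp only: of_real_eq_iff)
  then show ?thesis by simp
qed

lemma mshift_apply [simp]: "blinfun_apply (mshift k v) = mod_shift k v"
  unfolding mshift_def
proof (rule bounded_linear_Blinfun_apply, rule bounded_linear_intro[where K = 1])
  show "mod_shift k v (r *\<^sub>R f) = r *\<^sub>R mod_shift k v f" for r f
    using mod_shift_scaleC[of k v "of_real r" f] by (simp add: scaleC_of_real)
qed (simp_all add: mod_shift_add norm_mod_shift)

lemma mshift_complex [simp]: "mshift k v \<in> complex_ops"
  by (simp add: complex_ops_def mod_shift_scaleC)

lemma mshift_compose: "mshift k v o\<^sub>L mshift l w = exp (\<i> * of_real (lattice_vec l \<bullet> v)) *\<^sub>C mshift (k + l) (v + w)"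
  by (rule blinfun_eqI) (simp add: mod_shift_mod_shift)

lemma mshift_0 [simp]: "mshift 0 0 = id_blinfun"
  by (rule blinfun_eqI) simp

lemma lattice_vec_uminus: "lattice_vec (- k) = - lattice_vec k"
  and lattice_vec_add: "lattice_vec (k + l) = lattice_vec k + lattice_vec l"
  by (simp_all add: lattice_vec_def vec_eq_iff)

text \<open>An isometry with a right inverse \<open>?S\<close> satisfies
  \<open>cinner (V x) y = cinner (V x) (V (?S y)) = cinner x (?S y)\<close>. The phase cancels the
  one from the composition rule.\<close>

lemma mshift_adjoint: "is_adjoint (mshift k v) (exp (\<i> * of_real (lattice_vec k \<bullet> v)) *\<^sub>C mshift (- k) (- v))"
  (is "is_adjoint _ ?S")
proof -
  have "mshift k v o\<^sub>L ?S = id_blinfun"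
    unfolding scaleC_compose_right[OF mshift_complex] mshift_compose scaleC_blinfun_scaleC
    by (simp add: lattice_vec_uminus flip: exp_add)
  from arg_cong[OF this, of "\<lambda>T. blinfun_apply T y" for y]
  have inv: "mod_shift k v (blinfun_apply ?S y) = y" for y
    by simp
  show ?thesis
    unfolding is_adjoint_def
  proof (intro allI)
    fix x y
    show "cinner (blinfun_apply (mshift k v) x) y = cinner x (blinfun_apply ?S y)"
      using mod_shift_cinner[of k v x "blinfun_apply ?S y"] inv[of y] by simp
  qed
qed

text \<open>Orthogonality of characters without evaluating an integral. Translation by
  \<open>w\<close>, chosen with \<open>lattice_vec k \<bullet> w = pi\<close>, is unitary, fixes the
  constant function and multiplies the character \<open>x\<close> by -1, so the product equals its
  own negative.\<close>

lemma cinner_mod_shift_one: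
  "cinner (mod_shift k v torus_one) torus_one = (if k = 0 then 1 else 0)"
proof (cases "k = 0")
  case True
  then show ?thesis by (simp add: mod_shift_one cinner_torus_one)
next
  case False
  define x where "x = mod_shift k v torus_one"
  define w where "w = (pi / (lattice_vec k \<bullet> lattice_vec k)) *\<^sub>R lattice_vec k"
  have kw: "lattice_vec k \<bullet> w = pi" using False by (simp add: w_def)
  have "mod_shift 0 w x = exp (\<i> * of_real (lattice_vec k \<bullet> w)) *\<^sub>C mod_shift k (w + v) torus_one"
    unfolding x_def by (simp add: mod_shift_mod_shift)
  also have "mod_shift k (w + v) torus_one = x"
  proof -
    have "mod_shift k 0 (mod_shift 0 u torus_one) = mod_shift k u torus_one" for u
      by (simp add: mod_shift_mod_shift)
    from this[of "w + v"] this[of v] show ?thesis by (simp add: x_def mod_shift_one)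
  qed
  finally have "cinner x torus_one = exp (\<i> * of_real pi) * cinner x torus_one"
    using mod_shift_cinner[of 0 w x torus_one] unfolding mod_shift_one kw by (simp add: cinner_scaleC_left)
  then have "cinner x torus_one = 0" by simp
  then show ?thesis using False by (simp add: x_def)
qed

section \<open>Monomials, their relations and the trace \<open>tau\<close>\<close>

locale nc_torus_params =
  fixes \<theta> :: "('n::{finite,linorder}) rmat"
  assumes antisymmetric: "transpose \<theta> = - \<theta>"
begin

text \<open>A normalisation of the monomials that does not depend on the order of the factors. It
  differs from \<open>U k\<close> by a phase, and antisymmetry of \<open>\<theta>\<close> makes
  \<open>W (- k)\<close> its exact adjoint. Facts on \<open>U\<close> up to phase are read off from
  \<open>W\<close>.\<close>

definition W :: "'n ivec \<Rightarrow> 'n torus_op" where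
  "W k = mshift k (pi *\<^sub>R (\<theta> *v lattice_vec k))"

abbreviation U :: "'n ivec \<Rightarrow> 'n torus_op" where
  "U \<equiv> torus_Upow \<theta>"

abbreviation A :: "'n torus_op set" where
  "A \<equiv> nc_torus \<theta>"

lemma inner_theta_self: "x \<bullet> (\<theta> *v x) = 0"
proof -
  have "x \<bullet> (\<theta> *v x) = (transpose \<theta> *v x) \<bullet> x"
    by (simp add: dot_lmul_matrix[symmetric] transpose_matrix_vector)
  also have "\<dots> = - ((\<theta> *v x) \<bullet> x)"
    by (simp add: antisymmetric matrix_vector_mult_def inner_vec_def sum_negf)
  finally show ?thesis by (simp add: inner_commute)
qed

lemma W_complex [simp]: "W k \<in> complex_ops"
  by (simp add: W_def)

lemma W_0: "W 0 = id_blinfun"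
  by (simp add: W_def)

lemma W_compose: "W k o\<^sub>L W l = exp (\<i> * of_real (pi * (lattice_vec l \<bullet> (\<theta> *v lattice_vec k)))) *\<^sub>C W (k + l)"
  unfolding W_def mshift_compose
  by (simp add: lattice_vec_add matrix_vector_right_distrib scaleR_add_right)

lemma W_adjoint: "is_adjoint (W k) (W (- k))"
proof -
  have "\<theta> *v (- x) = - (\<theta> *v x)" for x
    using matrix_vector_mult_scaleR[of \<theta> "-1" x] by simp
  then show ?thesis
    using mshift_adjoint[of k "pi *\<^sub>R (\<theta> *v lattice_vec k)"]
    by (simp add: W_def inner_theta_self lattice_vec_uminus)
qed

lemma torus_U_eq_W: "torus_U \<theta> j = W (axis j 1)"
proof -
  have l: "lattice_vec (axis j 1) = axis j 1"
    by (simp add: lattice_vec_def vec_eq_iff axis_def)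
  have "mod_shift (axis j 1) (pi *\<^sub>R column j \<theta>) \<xi> = abs_torus_l2
     (\<lambda>x. exp (\<i> * complex_of_real (x $ j)) * rep_torus_l2 \<xi> (x + pi *\<^sub>R column j \<theta>))" for \<xi>
    unfolding mod_shift_def by (simp add: l inner_axis inner_commute[of "axis j 1"])
  then have "(\<lambda>\<xi>. abs_torus_l2 (\<lambda>x. exp (\<i> * complex_of_real (x $ j)) * rep_torus_l2 \<xi> (x + pi *\<^sub>R column j \<theta>)))
      = mod_shift (axis j 1) (pi *\<^sub>R column j \<theta>)"
    by (intro ext) (rule sym)
  then show ?thesis
    unfolding torus_U_def W_def mshift_def l by (simp only: matrix_vector_mult_basis)
qed

text \<open>No phases accumulate: they involve the antisymmetric form of \<open>\<theta>\<close> on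
  two multiples of the same axis vector, which is zero.\<close>

lemma W_axis_power: "((o\<^sub>L) (W (axis j s)) ^^ m) id_blinfun = W (axis j (int m * s))"
proof (induction m)
  case 0
  have "axis j 0 = (0 :: 'n ivec)" by (simp add: vec_eq_iff axis_def)
  then have "W (axis j 0) = id_blinfun" by (simp only: W_0)
  then show ?case by simp
next
  case (Suc m)
  have "lattice_vec (axis j (int m * s)) = real m *\<^sub>R lattice_vec (axis j s)"
    by (simp add: lattice_vec_def vec_eq_iff axis_def)
  then have "lattice_vec (axis j (int m * s)) \<bullet> (\<theta> *v lattice_vec (axis j s)) = 0"
    by (simp add: inner_theta_self)
  moreover have "axis j s + axis j (int m * s) = axis j (int (Suc m) * s)"
    by (simp add: vec_eq_iff axis_def algebra_simps)
  ultimately show ?case using Suc by (simp add: W_compose)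
qed

lemma uminus_axis: "- axis j s = (axis j (- s) :: 'n ivec)"
  by (simp add: vec_eq_iff axis_def)

lemma unitary_power_torus_U: "unitary_power (torus_U \<theta> j) m = W (axis j m)"
proof -
  have "adj (W (axis j 1)) = W (axis j (-1))"
    using adj_eqI[OF W_adjoint[of "axis j 1"]] unfolding uminus_axis .
  then show ?thesis
    unfolding unitary_power_def torus_U_eq_W using W_axis_power[where j = j and s = 1 and m = "nat \<bar>m\<bar>"]
      W_axis_power[where j = j and s = "-1" and m = "nat \<bar>m\<bar>"]
    by (cases "0 \<le> m") simp_all
qed

lemma U_eq_W: "\<exists>c. cmod c = 1 \<and> U k = c *\<^sub>C W k"
proof -
  have "\<exists>c. cmod c = 1 \<and> foldr (\<lambda>j T. unitary_power (torus_U \<theta> j) (k $ j) o\<^sub>L T) xs id_blinfun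
      = c *\<^sub>C W (\<Sum>j\<in>set xs. axis j (k $ j))" if "distinct xs" for xs
    using that
  proof (induction xs)
    case Nil
    have "W 0 = id_blinfun" by (simp add: W_def)
    then show ?case by (intro exI[of _ 1]) simp
  next
    case (Cons j xs)
    then obtain c where c: "cmod c = 1"
      "foldr (\<lambda>j T. unitary_power (torus_U \<theta> j) (k $ j) o\<^sub>L T) xs id_blinfun = c *\<^sub>C W (\<Sum>j\<in>set xs. axis j (k $ j))"
      by auto
    have "foldr (\<lambda>j T. unitary_power (torus_U \<theta> j) (k $ j) o\<^sub>L T) (j # xs) id_blinfun
        = c *\<^sub>C (W (axis j (k $ j)) o\<^sub>L W (\<Sum>j\<in>set xs. axis j (k $ j)))"
      unfolding foldr.simps comp_apply c(2) by (simp add: unitary_power_torus_U scaleC_compose_right)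
    then show ?case
      using Cons.prems c(1) unfolding W_compose scaleC_blinfun_scaleC
      by (intro exI conjI) (auto simp: norm_mult)
  qed
  from this[of "sorted_list_of_set UNIV"] obtain c where c: "cmod c = 1"
    "U k = c *\<^sub>C W (\<Sum>j\<in>UNIV. axis j (k $ j))"
    by (auto simp: torus_Upow_def)
  moreover have "(\<Sum>j\<in>UNIV. axis j (k $ j)) = k"
    by (simp add: vec_eq_iff axis_def if_distrib cong: if_cong)
  ultimately show ?thesis by auto
qed

lemma W_eq_U: "\<exists>c. cmod c = 1 \<and> W k = c *\<^sub>C U k"
proof -
  obtain c where c: "cmod c = 1" "U k = c *\<^sub>C W k" using U_eq_W by blast
  then have "c \<noteq> 0" by auto
  then have "W k = inverse c *\<^sub>C U k" by (simp add: c(2) scaleC_blinfun_scaleC)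
  then show ?thesis using c(1) by (intro exI[of _ "inverse c"]) (simp add: norm_inverse)
qed

lemma U_complex [simp]: "U k \<in> complex_ops"
  using U_eq_W[of k] complex_ops_scaleC[OF W_complex[of k]] by auto

lemma U_compose: "\<exists>c. cmod c = 1 \<and> U k o\<^sub>L U l = c *\<^sub>C U (k + l)"
proof -
  obtain a b c where "cmod a = 1" "U k = a *\<^sub>C W k" "cmod b = 1" "U l = b *\<^sub>C W l"
    "cmod c = 1" "W (k + l) = c *\<^sub>C U (k + l)"
    using U_eq_W[of k] U_eq_W[of l] W_eq_U[of "k + l"] by metis
  then show ?thesis
    by (intro exI[of _ "a * b * exp (\<i> * of_real (pi * (lattice_vec l \<bullet> (\<theta> *v lattice_vec k)))) * c"])
      (simp add: scaleC_compose_left scaleC_compose_right W_compose scaleC_blinfun_scaleC norm_mult mult.assoc)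
qed

lemma U_0 [simp]: "U 0 = id_blinfun"
proof -
  have "foldr (\<lambda>j T. unitary_power (torus_U \<theta> j) ((0 :: 'n ivec) $ j) o\<^sub>L T) xs id_blinfun = id_blinfun" for xs
    by (induction xs) (simp_all add: unitary_power_def)
  then show ?thesis by (simp add: torus_Upow_def)
qed

lemma U_adjoint: "\<exists>c. cmod c = 1 \<and> is_adjoint (U k) (c *\<^sub>C U (- k))"
proof -
  obtain a b where "cmod a = 1" "U k = a *\<^sub>C W k" "cmod b = 1" "W (- k) = b *\<^sub>C U (- k)"
    using U_eq_W[of k] W_eq_U[of "- k"] by blast
  then show ?thesis
    using is_adjoint_scaleC[OF W_adjoint[of k], of a]
    by (intro exI[of _ "cnj a * b"]) (simp add: norm_mult scaleC_blinfun_scaleC)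
qed

lemma tau_W: "tau (W k) = (if k = 0 then 1 else 0)"
  by (simp add: tau_def W_def cinner_mod_shift_one)

lemma bounded_linear_tau: "bounded_linear tau"
  unfolding tau_def[abs_def]
  by (intro bounded_linear_compose[OF cinner.bounded_linear_left] blinfun.bounded_linear_left)

lemma tau_scaleC: "tau (c *\<^sub>C T) = c * tau T"
  by (simp add: tau_def cinner_scaleC_left)

lemma tau_U: "tau (U k) = (if k = 0 then 1 else 0)"
proof (cases "k = 0")
  case True
  then show ?thesis using tau_W[of 0] by (simp add: W_0)
next
  case False
  then show ?thesis using U_eq_W[of k] by (auto simp: tau_scaleC tau_W)
qed

lemma norm_U_le: "norm (U k) \<le> 1"
proof -
  obtain c where "cmod c = 1" "U k = c *\<^sub>C W k" using U_eq_W by blast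
  moreover have "norm (W k) \<le> 1"
    unfolding W_def by (rule norm_blinfun_bound) (simp_all add: norm_mod_shift)
  ultimately show ?thesis by (simp add: norm_scaleC_blinfun)
qed

lemma U_unitary: "adj (U k) o\<^sub>L U k = id_blinfun" "U k o\<^sub>L adj (U k) = id_blinfun"
proof -
  obtain c where c: "cmod c = 1" "U k = c *\<^sub>C W k" using U_eq_W by blast
  have "adj (U k) = cnj c *\<^sub>C W (- k)"
    unfolding c(2) by (intro adj_eqI is_adjoint_scaleC W_adjoint)
  moreover have "cnj c * c = 1" using c(1) complex_norm_square[of c] by (simp add: mult.commute)
  moreover have "W (- k) o\<^sub>L W k = id_blinfun" "W k o\<^sub>L W (- k) = id_blinfun"
    using matrix_vector_mult_scaleR[of \<theta> "-1" "lattice_vec k"]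
    by (simp_all add: W_compose W_0 lattice_vec_uminus inner_theta_self)
  ultimately show "adj (U k) o\<^sub>L U k = id_blinfun" "U k o\<^sub>L adj (U k) = id_blinfun"
    by (simp_all add: c(2) scaleC_compose_left scaleC_compose_right scaleC_blinfun_scaleC mult.commute)
qed

lemma tau_U_adj: "tau (U k o\<^sub>L adj (U l)) = (if k = l then 1 else 0)"
proof (cases "k = l")
  case True
  then show ?thesis using tau_U[of 0] by (simp add: U_unitary)
next
  case False
  obtain c where c: "is_adjoint (U l) (c *\<^sub>C U (- l))" using U_adjoint by blast
  obtain d where d: "U k o\<^sub>L U (- l) = d *\<^sub>C U (k - l)" using U_compose[of k "- l"] by auto
  show ?thesis
    using False by (simp add: adj_eqI[OF c] scaleC_compose_right d tau_scaleC tau_U)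
qed

subsection \<open>Trigonometric polynomials are dense\<close>

inductive_set trig :: "'n torus_op set" where
  monomial: "c *\<^sub>C U k \<in> trig"
| add: "S \<in> trig \<Longrightarrow> T \<in> trig \<Longrightarrow> S + T \<in> trig"

lemma trig_complex: "T \<in> trig \<Longrightarrow> T \<in> complex_ops"
  by (induction rule: trig.induct) auto

lemma trig_scaleC: "T \<in> trig \<Longrightarrow> c *\<^sub>C T \<in> trig"
  by (induction rule: trig.induct)
    (auto simp: scaleC_blinfun_scaleC scaleC_blinfun.add_right intro: trig.intros)

lemma trig_compose:
  assumes "S \<in> trig" "T \<in> trig"
  shows "S o\<^sub>L T \<in> trig"
  using assms
proof (induction rule: trig.induct)
  case (monomial c k)
  from monomial show ?case
  proof (induction rule: trig.induct)
    case (monomial d l)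
    obtain b where "U k o\<^sub>L U l = b *\<^sub>C U (k + l)" using U_compose by blast
    then show ?case
      by (simp add: scaleC_compose_left scaleC_compose_right scaleC_blinfun_scaleC trig.monomial)
  next
    case (add S T)
    then show ?case by (auto simp: ocomp.add_right intro: trig.add)
  qed
next
  case (add S T)
  then show ?case by (simp add: ocomp.add_left trig.add)
qed

lemma trig_adjoint: "T \<in> trig \<Longrightarrow> \<exists>S\<in>trig. is_adjoint T S"
proof (induction rule: trig.induct)
  case (monomial c k)
  obtain d where "is_adjoint (U k) (d *\<^sub>C U (- k))" using U_adjoint by blast
  from is_adjoint_scaleC[OF this, of c] show ?case
    using trig_scaleC[OF trig.monomial] by blast
qed (blast intro: is_adjoint_add trig.add)

lemma closure_trigI: "(\<And>n :: nat. s n \<in> trig) \<Longrightarrow> s \<longlonglongrightarrow> S \<Longrightarrow> S \<in> closure trig"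
  unfolding closure_sequential by (intro exI[of _ s]) simp

lemma closure_trigE:
  assumes "S \<in> closure trig"
  obtains s :: "nat \<Rightarrow> 'n torus_op" where "\<And>n. s n \<in> trig" "s \<longlonglongrightarrow> S"
proof -
  from assms obtain s where "(\<forall>n. s n \<in> trig) \<and> s \<longlonglongrightarrow> S"
    unfolding closure_sequential by (rule exE)
  then show ?thesis by (intro that[of s]) simp_all
qed

lemma cstar_subalgebra_closure_trig: "cstar_subalgebra (closure trig)"
  unfolding cstar_subalgebra_def
proof (intro conjI ballI allI impI)
  fix S T assume S: "S \<in> closure trig" and T: "T \<in> closure trig"
  obtain s where s: "\<And>n. s n \<in> trig" "s \<longlonglongrightarrow> S" using S by (rule closure_trigE) (rule that)
  obtain t where t: "\<And>n. t n \<in> trig" "t \<longlonglongrightarrow> T" using T by (rule closure_trigE) (rule that)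
  show "S + T \<in> closure trig"
    by (rule closure_trigI[of "\<lambda>n. s n + t n"]) (intro trig.add s t tendsto_add)+
  show "S o\<^sub>L T \<in> closure trig"
    by (rule closure_trigI[of "\<lambda>n. s n o\<^sub>L t n"]) (intro trig_compose s t ocomp.tendsto)+
next
  fix c T assume "T \<in> closure trig"
  then obtain t where t: "\<And>n. t n \<in> trig" "t \<longlonglongrightarrow> T" by (rule closure_trigE) (rule that)
  have "(\<lambda>n. c *\<^sub>C t n) \<longlonglongrightarrow> c *\<^sub>C T" by (intro scaleC_blinfun.tendsto tendsto_const t)
  then show "c *\<^sub>C T \<in> closure trig"
    by (rule closure_trigI[rotated]) (intro trig_scaleC t)
next
  fix T S assume T: "T \<in> closure trig" and TS: "is_adjoint T S"
  obtain t where t: "\<And>n. t n \<in> trig" "t \<longlonglongrightarrow> T" using T by (rule closure_trigE) (rule that)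
  obtain s where s: "\<And>n. s n \<in> trig" "\<And>n. is_adjoint (t n) (s n)" using trig_adjoint[OF t(1)] by metis
  \<comment> \<open>Taking adjoints is isometric, so the adjoints converge along with the
    operators.\<close>
  have "norm (s n - S) = norm (t n - T)" for n
    by (rule is_adjoint_norm[OF is_adjoint_diff[OF TS s(2)]])
  then have "s \<longlonglongrightarrow> S"
    using t(2) by (simp add: tendsto_iff dist_norm)
  then show "S \<in> closure trig" by (rule closure_trigI[rotated]) (rule s)
qed simp

text \<open>One inclusion is minimality of the generated algebra. For the other, a C*-subalgebra
  with the generators contains their adjoints, then the unit, the axis powers and all monomials, and
  it is closed.\<close>

lemma nc_torus_eq: "A = closure trig"
proof
  have "torus_U \<theta> j \<in> trig" for j
    using W_eq_U[of "axis j 1"] unfolding torus_U_eq_W by (auto intro: trig.monomial)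
  then show "A \<subseteq> closure trig"
    unfolding nc_torus_def cstar_generated_def using cstar_subalgebra_closure_trig closure_subset[of trig] by (intro Inter_lower) auto
  show "closure trig \<subseteq> A"
    unfolding nc_torus_def cstar_generated_def
  proof (rule Inter_greatest)
    fix B assume "B \<in> {B. cstar_subalgebra B \<and> range (torus_U \<theta>) \<subseteq> B}"
    then have B: "cstar_subalgebra B" and UB: "\<And>j. torus_U \<theta> j \<in> B" by auto
    have clB: "closed B" and addB: "\<And>S T. S \<in> B \<Longrightarrow> T \<in> B \<Longrightarrow> S + T \<in> B"
      and compB: "\<And>S T. S \<in> B \<Longrightarrow> T \<in> B \<Longrightarrow> S o\<^sub>L T \<in> B"
      and scB: "\<And>c T. T \<in> B \<Longrightarrow> c *\<^sub>C T \<in> B"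
      and adB: "\<And>T S. T \<in> B \<Longrightarrow> is_adjoint T S \<Longrightarrow> S \<in> B"
      using B unfolding cstar_subalgebra_def by auto
    have WB: "W (axis j 1) \<in> B" "W (axis j (-1)) \<in> B" for j
    proof -
      show "W (axis j 1) \<in> B" using UB[of j] by (simp add: torus_U_eq_W)
      from adB[OF this W_adjoint] show "W (axis j (-1)) \<in> B" unfolding uminus_axis .
    qed
    \<comment> \<open>\<open>cstar_subalgebra\<close> does not demand a unit. The unit is a phase
      times the product of a generator and its adjoint; some coordinate \<open>j\<close> exists
      because types are nonempty.\<close>
    have idB: "id_blinfun \<in> B"
    proof -
      fix j :: 'n
      have "axis j 1 + axis j (-1) = (0 :: 'n ivec)" by (simp add: vec_eq_iff axis_def)
      then have "W (axis j 1) o\<^sub>L W (axis j (-1)) = exp (\<i> * of_real (pi * (lattice_vec (axis j (-1)) \<bullet> (\<theta> *v lattice_vec (axis j 1))))) *\<^sub>C id_blinfun"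
        by (simp add: W_compose W_0)
      then have "id_blinfun = inverse (exp (\<i> * of_real (pi * (lattice_vec (axis j (-1)) \<bullet> (\<theta> *v lattice_vec (axis j 1)))))) *\<^sub>C (W (axis j 1) o\<^sub>L W (axis j (-1)))"
        by (simp add: scaleC_blinfun_scaleC)
      also have "\<dots> \<in> B" by (intro scB compB WB)
      finally show ?thesis .
    qed
    have pw: "((o\<^sub>L) (W (axis j s)) ^^ m) id_blinfun \<in> B" if "s = 1 \<or> s = -1" for j s m
      using that by (induction m) (auto intro: compB WB idB)
    have Wm: "W (axis j m) \<in> B" for j m
      using pw[where j = j and s = 1 and m = "nat \<bar>m\<bar>"] pw[where j = j and s = "-1" and m = "nat \<bar>m\<bar>"] unfolding W_axis_power by (cases "m \<ge> 0") auto
    have "foldr (\<lambda>j T. unitary_power (torus_U \<theta> j) (k $ j) o\<^sub>L T) xs id_blinfun \<in> B" for k xs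
      by (induction xs) (auto simp: unitary_power_torus_U idB intro: compB Wm)
    then have UB': "U k \<in> B" for k by (simp add: torus_Upow_def)
    have "trig \<subseteq> B"
    proof
      fix T assume "T \<in> trig"
      then show "T \<in> B" by induction (auto intro: scB addB UB')
    qed
    then show "closure trig \<subseteq> B" using clB by (rule closure_minimal)
  qed
qed

lemma cstar_A: "cstar_subalgebra A"
  unfolding nc_torus_eq by (rule cstar_subalgebra_closure_trig)

lemma A_closed: "closed A"
  and A_add: "S \<in> A \<Longrightarrow> T \<in> A \<Longrightarrow> S + T \<in> A"
  and A_compose: "S \<in> A \<Longrightarrow> T \<in> A \<Longrightarrow> S o\<^sub>L T \<in> A"
  and A_scaleC: "T \<in> A \<Longrightarrow> c *\<^sub>C T \<in> A"
  and A_adjoint: "T \<in> A \<Longrightarrow> is_adjoint T S \<Longrightarrow> S \<in> A"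
  using cstar_A unfolding cstar_subalgebra_def by auto

lemma A_diff: "S \<in> A \<Longrightarrow> T \<in> A \<Longrightarrow> S - T \<in> A"
  using A_add[of S "- T"] A_scaleC[of T "-1"] by (simp add: scaleC_blinfun_minus_one)

lemma trig_subset_A: "trig \<subseteq> A"
  unfolding nc_torus_eq by (rule closure_subset)

lemma U_in_A [simp]: "U k \<in> A"
  using trig.monomial[of 1 k] trig_subset_A by auto

lemma A_0 [simp]: "0 \<in> A"
  using A_scaleC[OF U_in_A, of 0] by (simp add: scaleC_blinfun.zero_left)

lemma A_sum: "(\<And>i. i \<in> F \<Longrightarrow> f i \<in> A) \<Longrightarrow> sum f F \<in> A"
  by (induction F rule: infinite_finite_induct) (auto intro: A_add)

lemma A_complex: "T \<in> A \<Longrightarrow> T \<in> complex_ops"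
  unfolding nc_torus_eq
  by (rule subsetD[OF closure_minimal[OF _ closed_complex_ops]]) (auto intro: trig_complex)

lemma A_adj: "T \<in> A \<Longrightarrow> adj T \<in> A"
  using A_adjoint is_adjoint_adj[OF A_complex] by blast

lemma closed_property_A:
  assumes "closed {T. P T}" "\<And>c k. P (c *\<^sub>C U k)" "\<And>S T. P S \<Longrightarrow> P T \<Longrightarrow> P (S + T)" "T \<in> A"
  shows "P T"
proof -
  have "P T" if "T \<in> trig" for T
    using that by induction (auto intro: assms)
  then have "closure trig \<subseteq> {T. P T}" using assms(1) by (intro closure_minimal) auto
  then show ?thesis using assms(4) by (auto simp: nc_torus_eq)
qed

text \<open>By linearity and continuity in each argument only monomials matter. For these both
  traces vanish unless \<open>l = - k\<close>, in which case \<open>U l\<close> is a phase times the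
  adjoint of the unitary \<open>U k\<close> and both products are the same multiple of the
  identity.\<close>

lemma tau_commute:
  assumes "S \<in> A" "T \<in> A"
  shows "tau (S o\<^sub>L T) = tau (T o\<^sub>L S)"
proof -
  interpret tau: bounded_linear tau by (rule bounded_linear_tau)
  have cl: "closed {S. tau (S o\<^sub>L T) = tau (T o\<^sub>L S)}" for T
    by (intro closed_Collect_eq linear_continuous_on bounded_linear_compose[OF bounded_linear_tau]
        ocomp.bounded_linear_left ocomp.bounded_linear_right)
  have UU: "tau (U k o\<^sub>L U l) = tau (U l o\<^sub>L U k)" for k l
  proof (cases "k + l = 0")
    case True
    then have l: "l = - k" by (simp add: eq_neg_iff_add_eq_0 add.commute)
    obtain c where c: "cmod c = 1" "is_adjoint (U k) (c *\<^sub>C U (- k))" using U_adjoint by blast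
    have "c * tau (U k o\<^sub>L U l) = tau (U k o\<^sub>L adj (U k))" "c * tau (U l o\<^sub>L U k) = tau (adj (U k) o\<^sub>L U k)"
      by (simp_all add: l adj_eqI[OF c(2)] scaleC_compose_left scaleC_compose_right tau_scaleC)
    then have "c * tau (U k o\<^sub>L U l) = c * tau (U l o\<^sub>L U k)" by (simp add: U_unitary)
    then show ?thesis using c(1) by auto
  next
    case False
    obtain c d where "U k o\<^sub>L U l = c *\<^sub>C U (k + l)" "U l o\<^sub>L U k = d *\<^sub>C U (k + l)"
      using U_compose[of k l] U_compose[of l k] by (auto simp: add.commute)
    then show ?thesis using False by (simp add: tau_scaleC tau_U)
  qed
  have SU: "tau (S o\<^sub>L U l) = tau (U l o\<^sub>L S)" if "S \<in> A" for S l
    using cl _ _ that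
  proof (rule closed_property_A)
    show "tau ((c *\<^sub>C U k) o\<^sub>L U l) = tau (U l o\<^sub>L (c *\<^sub>C U k))" for c k
      by (simp add: scaleC_compose_left scaleC_compose_right tau_scaleC UU)
  qed (simp add: ocomp.add_left ocomp.add_right tau.add)
  show ?thesis
    using cl[of T] _ _ assms(1)
  proof (rule closed_property_A)
    show "tau ((c *\<^sub>C U k) o\<^sub>L T) = tau (T o\<^sub>L (c *\<^sub>C U k))" for c k
      using SU[OF assms(2), of k] A_complex[OF assms(2)]
      by (simp add: scaleC_compose_left scaleC_compose_right tau_scaleC)
  qed (simp add: ocomp.add_left ocomp.add_right tau.add)
qed

end

section \<open>The representation on the Hilbert space completion\<close>

text \<open>\<open>R\<close> is the closure of the set of pairs \<open>(\<iota> u, f u)\<close>. The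
  bound makes images of converging sequences Cauchy, so \<open>R\<close> is defined everywhere, and
  makes it single valued, even though \<open>\<iota>\<close> is not assumed injective.\<close>

lemma dense_extension:
  fixes \<iota> f :: "'u::{plus, scaleC} \<Rightarrow> 'h::chilbert_space"
  assumes add: "\<And>u v. u \<in> A \<Longrightarrow> v \<in> A \<Longrightarrow> u + v \<in> A \<and> \<iota> (u + v) = \<iota> u + \<iota> v \<and> f (u + v) = f u + f v"
    and scale: "\<And>c u. u \<in> A \<Longrightarrow> c *\<^sub>C u \<in> A \<and> \<iota> (c *\<^sub>C u) = c *\<^sub>C \<iota> u \<and> f (c *\<^sub>C u) = c *\<^sub>C f u"
    and bound: "\<And>u. u \<in> A \<Longrightarrow> norm (f u) \<le> C * norm (\<iota> u)" and "0 \<le> C"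
    and dense: "closure (\<iota> ` A) = UNIV"
  shows "\<exists>L\<in>complex_ops. (\<forall>u\<in>A. blinfun_apply L (\<iota> u) = f u) \<and> norm L \<le> C"
proof -
  have dist_le: "norm (f u - f v) \<le> C * norm (\<iota> u - \<iota> v)" if uv: "u \<in> A" "v \<in> A" for u v
    using bound[of "u + (-1) *\<^sub>C v"] add[OF uv(1), of "(-1) *\<^sub>C v"] scale[OF uv(2), of "-1"]
    by (simp add: scaleC_minus_one)
  define R where "R x y \<longleftrightarrow> (\<exists>u :: nat \<Rightarrow> 'u. (\<forall>n. u n \<in> A) \<and> (\<lambda>n. \<iota> (u n)) \<longlonglongrightarrow> x \<and> (\<lambda>n. f (u n)) \<longlonglongrightarrow> y)" for x y
  have R_ex: "\<exists>y. R x y" for x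
  proof -
    have "x \<in> closure (\<iota> ` A)" by (simp add: dense)
    then obtain z where z: "\<And>n. z n \<in> \<iota> ` A" "z \<longlonglongrightarrow> x"
      unfolding closure_sequential by auto
    have "\<exists>u. u \<in> A \<and> \<iota> u = z n" for n using z(1)[of n] by auto
    then obtain u where u: "\<And>n. u n \<in> A" "\<And>n. \<iota> (u n) = z n" by metis
    have "Cauchy z" using z(2) by (rule LIMSEQ_imp_Cauchy)
    have "Cauchy (\<lambda>n. f (u n))"
    proof (rule metric_CauchyI)
      fix \<epsilon> :: real assume "0 < \<epsilon>"
      then have "0 < \<epsilon> / (C + 1)" using \<open>0 \<le> C\<close> by simp
      then obtain M where M: "\<forall>m\<ge>M. \<forall>n\<ge>M. dist (z m) (z n) < \<epsilon> / (C + 1)"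
        using metric_CauchyD[OF \<open>Cauchy z\<close>] by blast
      have "dist (f (u m)) (f (u n)) < \<epsilon>" if "m \<ge> M" "n \<ge> M" for m n
      proof -
        have "dist (f (u m)) (f (u n)) \<le> C * dist (z m) (z n)"
          using dist_le[OF u(1) u(1), of m n] by (simp add: dist_norm u(2))
        also have "\<dots> \<le> (C + 1) * dist (z m) (z n)" by (simp add: mult_right_mono)
        also have "\<dots> < \<epsilon>" using M that \<open>0 \<le> C\<close> by (simp add: field_simps)
        finally show ?thesis .
      qed
      then show "\<exists>M. \<forall>m\<ge>M. \<forall>n\<ge>M. dist (f (u m)) (f (u n)) < \<epsilon>" by (intro exI[of _ M] allI impI)
    qed
    then obtain y where "(\<lambda>n. f (u n)) \<longlonglongrightarrow> y" using Cauchy_convergent convergent_def by blast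
    then show ?thesis unfolding R_def using u z(2) by (intro exI[of _ y] exI[of _ u]) simp
  qed
  have R_le: "norm y \<le> C * norm x" if R1: "R x y" for x y
  proof -
    obtain u where u: "\<forall>n. u n \<in> A" "(\<lambda>n. \<iota> (u n)) \<longlonglongrightarrow> x" "(\<lambda>n. f (u n)) \<longlonglongrightarrow> y"
      using R1 unfolding R_def by (elim exE conjE)
    show ?thesis
    proof (rule LIMSEQ_le)
      show "(\<lambda>n. norm (f (u n))) \<longlonglongrightarrow> norm y" using u(3) by (rule tendsto_norm)
      show "(\<lambda>n. C * norm (\<iota> (u n))) \<longlonglongrightarrow> C * norm x" using u(2) by (intro tendsto_intros)
    qed (use u(1) bound in auto)
  qed
  have R_add: "R (x + x') (y + y')" if R1: "R x y" and R2: "R x' y'" for x y x' y'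
  proof -
    obtain u where u: "\<forall>n. u n \<in> A" "(\<lambda>n. \<iota> (u n)) \<longlonglongrightarrow> x" "(\<lambda>n. f (u n)) \<longlonglongrightarrow> y"
      using R1 unfolding R_def by (elim exE conjE)
    obtain v where v: "\<forall>n. v n \<in> A" "(\<lambda>n. \<iota> (v n)) \<longlonglongrightarrow> x'" "(\<lambda>n. f (v n)) \<longlonglongrightarrow> y'"
      using R2 unfolding R_def by (elim exE conjE)
    show ?thesis
      unfolding R_def using tendsto_add[OF u(2) v(2)] tendsto_add[OF u(3) v(3)] u(1) v(1) add
      by (intro exI[of _ "\<lambda>n. u n + v n"]) simp
  qed
  have R_scale: "R (c *\<^sub>C x) (c *\<^sub>C y)" if R1: "R x y" for c x y
  proof -
    obtain u where u: "\<forall>n. u n \<in> A" "(\<lambda>n. \<iota> (u n)) \<longlonglongrightarrow> x" "(\<lambda>n. f (u n)) \<longlonglongrightarrow> y"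
      using R1 unfolding R_def by (elim exE conjE)
    show ?thesis
      unfolding R_def using scaleC.tendsto[OF tendsto_const u(2), of c] scaleC.tendsto[OF tendsto_const u(3), of c] u(1) scale
      by (intro exI[of _ "\<lambda>n. c *\<^sub>C u n"]) simp
  qed
  have R_unique: "y = y'" if "R x y" "R x y'" for x y y'
  proof -
    have "R (x + (-1) *\<^sub>C x) (y + (-1) *\<^sub>C y')" by (rule R_add[OF that(1) R_scale[OF that(2)]])
    from R_le[OF this] show ?thesis by (simp add: scaleC_minus_one)
  qed
  obtain g where g: "\<And>x. R x (g x)" using R_ex by metis
  have g_scale: "g (c *\<^sub>C x) = c *\<^sub>C g x" for c x by (rule R_unique[OF g R_scale[OF g]])
  have bl: "bounded_linear g"
  proof (rule bounded_linear_intro[where K = C])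
    show "g (x + y) = g x + g y" for x y by (rule R_unique[OF g R_add[OF g g]])
    show "g (r *\<^sub>R x) = r *\<^sub>R g x" for r x using g_scale[of "of_real r" x] by (simp add: scaleC_of_real)
    show "norm (g x) \<le> norm x * C" for x using R_le[OF g] by (simp add: mult.commute)
  qed
  have ap: "blinfun_apply (Blinfun g) = g" by (rule bounded_linear_Blinfun_apply[OF bl])
  have "R (\<iota> u) (f u)" if "u \<in> A" for u
    unfolding R_def using that by (intro exI[of _ "\<lambda>_. u"]) simp
  then have "g (\<iota> u) = f u" if "u \<in> A" for u using R_unique[OF g] that by blast
  moreover have "Blinfun g \<in> complex_ops" by (simp add: complex_ops_def ap g_scale)
  moreover have "norm (Blinfun g) \<le> C" using R_le[OF g] \<open>0 \<le> C\<close> by (intro norm_blinfun_bound) (simp_all add: ap)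
  ultimately show ?thesis by (intro bexI[of _ "Blinfun g"]) (simp_all add: ap)
qed

section \<open>The completion, its Fourier basis and left multiplication\<close>

locale gns = nc_torus_params \<theta> for \<theta> :: "('n::{finite,linorder}) rmat" +
  fixes \<iota> :: "'n torus_op \<Rightarrow> 'h::chilbert_space"
  assumes completion: "hilbert_completion \<theta> \<iota>"
begin

lemma iota_add: "u \<in> A \<Longrightarrow> v \<in> A \<Longrightarrow> \<iota> (u + v) = \<iota> u + \<iota> v"
  and iota_scaleC: "u \<in> A \<Longrightarrow> \<iota> (c *\<^sub>C u) = c *\<^sub>C \<iota> u"
  and cinner_iota: "u \<in> A \<Longrightarrow> v \<in> A \<Longrightarrow> cinner (\<iota> u) (\<iota> v) = tau (u o\<^sub>L adj v)"
  and iota_dense: "closure (\<iota> ` A) = UNIV"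
  using completion unfolding hilbert_completion_def by auto

lemma iota_diff: "u \<in> A \<Longrightarrow> v \<in> A \<Longrightarrow> \<iota> (u - v) = \<iota> u - \<iota> v"
  using iota_add[of u "(-1) *\<^sub>C v"] iota_scaleC[of v "-1"] A_scaleC[of v "-1"]
  by (simp add: scaleC_blinfun_minus_one scaleC_minus_one)

lemma norm_torus_one: "norm (torus_one :: 'n torus_l2) = 1"
  using cinner_self[of "torus_one :: 'n torus_l2"] cinner_torus_one
  by (metis norm_eq_1 of_real_eq_1_iff power2_norm_eq_inner)

text \<open>The norm is given by the trace property of \<open>\<tau>\<close>: \<open>\<tau>(uu\<^sup>*) = \<tau>(u\<^sup>*u) = \<parallel>u1\<parallel>\<^sup>2\<close>.\<close>

lemma norm_iota:
  assumes u: "u \<in> A"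
  shows "norm (\<iota> u) = norm (blinfun_apply u torus_one)"
proof -
  have "complex_of_real ((norm (\<iota> u))\<^sup>2) = tau (adj u o\<^sub>L u)"
    using cinner_iota[OF u u] tau_commute[OF u A_adj[OF u]] by (simp add: cinner_self)
  also have "\<dots> = complex_of_real ((norm (blinfun_apply u torus_one))\<^sup>2)"
    by (simp add: tau_def cinner_adj(2)[OF A_complex[OF u]] cinner_self)
  finally have "(norm (\<iota> u))\<^sup>2 = (norm (blinfun_apply u torus_one))\<^sup>2" by (simp only: of_real_eq_iff)
  then show ?thesis by simp
qed

lemma norm_iota_le: "u \<in> A \<Longrightarrow> norm (\<iota> u) \<le> norm u"
  using norm_iota norm_blinfun[of u torus_one] by (simp add: norm_torus_one)

lemma iota_tendsto:
  assumes "\<And>i. u i \<in> A" "v \<in> A" "(u \<longlongrightarrow> v) F"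
  shows "((\<lambda>i. \<iota> (u i)) \<longlongrightarrow> \<iota> v) F"
proof (rule LIM_zero_cancel, rule tendsto_norm_zero_cancel)
  show "((\<lambda>i. norm (\<iota> (u i) - \<iota> v)) \<longlongrightarrow> 0) F"
  proof (rule tendsto_sandwich[OF _ _ tendsto_const])
    show "((\<lambda>i. norm (u i - v)) \<longlongrightarrow> 0) F"
      using assms(3) by (intro tendsto_norm_zero LIM_zero)
    show "\<forall>\<^sub>F i in F. norm (\<iota> (u i) - \<iota> v) \<le> norm (u i - v)"
      using norm_iota_le[OF A_diff[OF assms(1,2)]] by (simp add: iota_diff assms(1,2))
  qed simp
qed

abbreviation e :: "'n ivec \<Rightarrow> 'h" where
  "e k \<equiv> \<iota> (U k)"

lemma iota_trig_orthogonal: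
  assumes x: "\<And>k. cinner x (e k) = 0" and "T \<in> trig"
  shows "cinner x (\<iota> T) = 0"
  using assms(2)
proof induction
  case (monomial c k)
  then show ?case by (simp add: iota_scaleC cinner_scaleC_right x)
next
  case (add S T)
  then have "S \<in> A" "T \<in> A" using trig_subset_A by auto
  with add show ?case by (simp add: iota_add cinner_add_right)
qed

text \<open>A vector orthogonal to all \<open>e k\<close> is orthogonal to the image of the
  trigonometric polynomials, by continuity to the image of \<open>A\<close>, by density to every
  vector, and so to itself.\<close>

lemma onb_e: "onb e"
proof
  show "cinner (e k) (e l) = (if k = l then 1 else 0)" for k l
    by (simp add: cinner_iota tau_U_adj)
  fix x assume x: "\<And>k. cinner x (e k) = 0"
  have "cinner x (\<iota> u) = 0" if "u \<in> A" for u
  proof -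
    have "u \<in> closure trig" using that by (simp add: nc_torus_eq)
    then obtain s where s: "\<And>n. s n \<in> trig" "s \<longlonglongrightarrow> u" by (rule closure_trigE) (rule that)
    have "(\<lambda>n. \<iota> (s n)) \<longlonglongrightarrow> \<iota> u"
      using s(1) trig_subset_A \<open>u \<in> A\<close> s(2) by (intro iota_tendsto) auto
    then have "(\<lambda>n. cinner x (\<iota> (s n))) \<longlonglongrightarrow> cinner x (\<iota> u)"
      by (intro cinner.tendsto tendsto_const)
    then show ?thesis
      using iota_trig_orthogonal[OF x s(1)] by (simp add: LIMSEQ_const_iff)
  qed
  moreover have "closed {y. cinner x y = 0}"
    by (intro closed_Collect_eq linear_continuous_on cinner.bounded_linear_right continuous_on_const)
  ultimately have "closure (\<iota> ` A) \<subseteq> {y. cinner x y = 0}"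
    by (intro closure_minimal) auto
  then have "cinner x x = 0" by (auto simp: iota_dense)
  then show "x = 0" by (simp add: cinner_self)
qed

sublocale onb e by (rule onb_e)

lemma blinfun_eq_dense:
  fixes S T :: "'h \<Rightarrow>\<^sub>L 'h"
  assumes "closure D = UNIV" "\<And>x. x \<in> D \<Longrightarrow> blinfun_apply S x = blinfun_apply T x"
  shows "S = T"
proof (rule blinfun_eqI)
  fix x
  have "closed {x. blinfun_apply S x = blinfun_apply T x}"
    by (intro closed_Collect_eq linear_continuous_on blinfun.bounded_linear_right)
  then have "closure D \<subseteq> {x. blinfun_apply S x = blinfun_apply T x}"
    using assms(2) by (intro closure_minimal) auto
  then show "blinfun_apply S x = blinfun_apply T x" using assms(1) by auto
qed

abbreviation L :: "'n torus_op \<Rightarrow> 'h \<Rightarrow>\<^sub>L 'h" where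
  "L \<equiv> left_mult \<theta> \<iota>"

lemma left_mult_unique:
  assumes "a \<in> A" "\<And>u. u \<in> A \<Longrightarrow> blinfun_apply S (\<iota> u) = \<iota> (a o\<^sub>L u)"
  shows "L a = S"
  unfolding left_mult_def
proof (rule the_equality)
  show "\<forall>u\<in>A. blinfun_apply S (\<iota> u) = \<iota> (a o\<^sub>L u)" using assms(2) by simp
  show "T = S" if "\<forall>u\<in>A. blinfun_apply T (\<iota> u) = \<iota> (a o\<^sub>L u)" for T
    by (rule blinfun_eq_dense[OF iota_dense]) (use assms(2) that in auto)
qed

text \<open>By \<open>norm_iota\<close> the inequality to be extended compares the vector
  \<open>u\<close> applied to \<open>torus_one\<close> with its image under \<open>a\<close>, and is
  the definition of the operator norm.\<close>

lemma left_mult_props: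
  assumes a: "a \<in> A"
  shows left_mult_complex: "L a \<in> complex_ops"
    and left_mult_iota: "\<And>u. u \<in> A \<Longrightarrow> blinfun_apply (L a) (\<iota> u) = \<iota> (a o\<^sub>L u)"
    and norm_left_mult_le: "norm (L a) \<le> norm a"
proof -
  have "\<exists>S\<in>complex_ops. (\<forall>u\<in>A. blinfun_apply S (\<iota> u) = \<iota> (a o\<^sub>L u)) \<and> norm S \<le> norm a"
  proof (rule dense_extension[OF _ _ _ _ iota_dense])
    show "u + v \<in> A \<and> \<iota> (u + v) = \<iota> u + \<iota> v \<and> \<iota> (a o\<^sub>L (u + v)) = \<iota> (a o\<^sub>L u) + \<iota> (a o\<^sub>L v)"
      if "u \<in> A" "v \<in> A" for u v
      using that a by (simp add: A_add A_compose iota_add ocomp.add_right)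
    show "c *\<^sub>C u \<in> A \<and> \<iota> (c *\<^sub>C u) = c *\<^sub>C \<iota> u \<and> \<iota> (a o\<^sub>L (c *\<^sub>C u)) = c *\<^sub>C \<iota> (a o\<^sub>L u)"
      if "u \<in> A" for c u
      using that a by (simp add: A_scaleC A_compose iota_scaleC scaleC_compose_right A_complex)
    show "norm (\<iota> (a o\<^sub>L u)) \<le> norm a * norm (\<iota> u)" if "u \<in> A" for u
      using that a norm_blinfun[of a "blinfun_apply u torus_one"] by (simp add: norm_iota A_compose)
  qed simp
  then obtain S where S: "S \<in> complex_ops" "\<forall>u\<in>A. blinfun_apply S (\<iota> u) = \<iota> (a o\<^sub>L u)" "norm S \<le> norm a"
    by (elim bexE conjE)
  have "L a = S" by (rule left_mult_unique[OF a]) (use S(2) in auto)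
  then show "L a \<in> complex_ops" "\<And>u. u \<in> A \<Longrightarrow> blinfun_apply (L a) (\<iota> u) = \<iota> (a o\<^sub>L u)" "norm (L a) \<le> norm a"
    using S by auto
qed

lemma left_mult_add: "a \<in> A \<Longrightarrow> b \<in> A \<Longrightarrow> L (a + b) = L a + L b"
  by (rule left_mult_unique) (simp_all add: A_add A_compose left_mult_iota blinfun.add_left iota_add ocomp.add_left)

lemma left_mult_scaleC: "a \<in> A \<Longrightarrow> L (c *\<^sub>C a) = c *\<^sub>C L a"
  by (rule left_mult_unique) (simp_all add: A_scaleC A_compose left_mult_iota iota_scaleC scaleC_compose_left)

lemma left_mult_diff: "a \<in> A \<Longrightarrow> b \<in> A \<Longrightarrow> L (a - b) = L a - L b"
  by (rule left_mult_unique) (simp_all add: A_diff A_compose left_mult_iota blinfun.diff_left iota_diff ocomp.diff_left)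

lemma left_mult_compose: "a \<in> A \<Longrightarrow> b \<in> A \<Longrightarrow> L (a o\<^sub>L b) = L a o\<^sub>L L b"
  by (rule left_mult_unique) (simp_all add: A_compose left_mult_iota blinfun_compose_assoc')

lemma left_mult_id: "L id_blinfun = id_blinfun"
  using U_in_A[of 0] by (intro left_mult_unique) auto

lemma left_mult_U_e: "\<exists>c. cmod c = 1 \<and> blinfun_apply (L (U l)) (e k) = c *\<^sub>C e (l + k)"
proof -
  obtain c where "cmod c = 1" "U l o\<^sub>L U k = c *\<^sub>C U (l + k)" using U_compose by blast
  then show ?thesis by (intro exI[of _ c]) (simp add: left_mult_iota iota_scaleC)
qed

end

section \<open>Rapidly decaying series\<close>

text \<open>The eigenvalues of \<open>D\<close>. The value 1 at the origin keeps them positive, so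
  symbols may be divided by them.\<close>

definition weight :: "'n::finite ivec \<Rightarrow> real" where
  "weight k = (if k = 0 then 1 else 1 / norm (lattice_vec k) ^ CARD('n))"

lemma norm_lattice_vec_ge_1: "k \<noteq> 0 \<Longrightarrow> 1 \<le> norm (lattice_vec k)"
proof -
  assume "k \<noteq> 0"
  then obtain i where "k $ i \<noteq> 0" by (auto simp: vec_eq_iff)
  then have "1 \<le> \<bar>real_of_int (k $ i)\<bar>" by linarith
  also have "\<dots> \<le> norm (lattice_vec k)" using component_le_norm_cart[of "lattice_vec k" i] by simp
  finally show ?thesis .
qed

lemma weight_pos: "0 < weight k" and weight_le_1: "weight k \<le> 1"
  using norm_lattice_vec_ge_1[of k] by (auto simp: weight_def one_le_power)

text \<open>Weyl's law for the constant function 1 on the sphere.\<close>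

lemma ex_weight_enumeration:
  "\<exists>\<sigma> V. bij \<sigma> \<and> (\<lambda>j. (real j + 1) * weight (\<sigma> j :: 'n::finite ivec)) \<longlonglongrightarrow> V"
proof -
  interpret positive_on_sphere "\<lambda>_ :: 'n rvec. 1 :: real" by standard auto
  have "lattice_symbol = weight" by (auto simp: lattice_symbol_def weight_def)
  then show ?thesis using ex_weyl_enumeration by auto
qed

lemma ex_weight_decay:
  "\<exists>\<sigma> C. bij \<sigma> \<and> (\<forall>j. weight (\<sigma> j :: 'n::finite ivec) \<le> C / (real j + 1))"
proof -
  obtain \<sigma> V where \<sigma>: "bij \<sigma>" "(\<lambda>j. (real j + 1) * weight (\<sigma> j :: 'n ivec)) \<longlonglongrightarrow> V"
    using ex_weight_enumeration by blast
  obtain C where C: "\<And>j. norm ((real j + 1) * weight (\<sigma> j)) \<le> C"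
    using convergent_imp_Bseq[OF convergentI[OF \<sigma>(2)]] unfolding Bseq_def by blast
  have "weight (\<sigma> j) \<le> C / (real j + 1)" for j
    using C[of j] weight_pos[of "\<sigma> j"] by (simp add: field_simps abs_mult)
  then show ?thesis using \<sigma>(1) by blast
qed

text \<open>Along the enumeration of \<open>ex_weight_decay\<close> the terms are O(1/j^2). Lattice
  sums are thereby reduced to the counting already done.\<close>

lemma weight_square_summable: "(\<lambda>k :: 'n::finite ivec. (weight k)\<^sup>2) summable_on UNIV"
proof -
  obtain \<sigma> C where \<sigma>: "bij \<sigma>" "\<And>j. weight (\<sigma> j :: 'n ivec) \<le> C / (real j + 1)"
    using ex_weight_decay by blast
  have "summable (\<lambda>j. C\<^sup>2 * inverse (real (Suc j) ^ 2))"
    using inverse_power_summable[of 2, where 'a = real] by (intro summable_mult) (subst summable_Suc_iff, simp)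
  then have "summable (\<lambda>j. (weight (\<sigma> j))\<^sup>2)"
  proof (rule summable_comparison_test[rotated], intro exI allI impI)
    fix j :: nat
    have "(weight (\<sigma> j))\<^sup>2 \<le> (C / (real j + 1))\<^sup>2"
      using \<sigma>(2)[of j] weight_pos[of "\<sigma> j"] by (intro power_mono) auto
    then show "norm ((weight (\<sigma> j))\<^sup>2) \<le> C\<^sup>2 * inverse (real (Suc j) ^ 2)"
      by (simp add: power_divide divide_inverse add.commute power_mult_distrib power_inverse)
  qed
  then have "(\<lambda>j. (weight (\<sigma> j))\<^sup>2) summable_on UNIV"
    by (subst summable_on_UNIV_nonneg_real_iff) auto
  then show ?thesis
    using summable_on_reindex_bij_betw[OF \<sigma>(1), of "\<lambda>k. (weight k)\<^sup>2"] by simp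
qed

lemma inverse_power_le_weight_square:
  "1 / (1 + norm (lattice_vec (k :: 'n::finite ivec))) ^ (2 * CARD('n)) \<le> (weight k)\<^sup>2"
proof (cases "k = 0")
  case False
  have "norm (lattice_vec k) ^ (2 * CARD('n)) \<le> (1 + norm (lattice_vec k)) ^ (2 * CARD('n))"
    by (intro power_mono) auto
  then show ?thesis using False norm_lattice_vec_ge_1[OF False]
    by (simp add: weight_def power_divide power_mult[symmetric] mult.commute frac_le)
qed (simp add: weight_def)

text \<open>The exponent is twice the dimension because the comparison series is that of the squares
  of \<open>weight\<close>.\<close>

lemma summable_on_decay:
  fixes u :: "'n::finite ivec \<Rightarrow> 'a::banach"
  assumes "\<And>k. (1 + norm (lattice_vec k)) ^ (2 * CARD('n)) * norm (u k) \<le> C"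
  shows "(\<lambda>k. norm (u k)) summable_on UNIV"
proof (rule summable_on_comparison_test)
  show "(\<lambda>k :: 'n ivec. C * (weight k)\<^sup>2) summable_on UNIV"
    by (intro summable_on_cmult_right weight_square_summable)
  fix k :: "'n ivec"
  have p: "0 < (1 + norm (lattice_vec k)) ^ (2 * CARD('n))" by (simp add: add_pos_nonneg)
  have "0 \<le> C" using order_trans[OF _ assms[of k]] by simp
  have "norm (u k) \<le> C * (1 / (1 + norm (lattice_vec k)) ^ (2 * CARD('n)))"
    using assms[of k] p by (simp add: field_simps)
  also have "\<dots> \<le> C * (weight k)\<^sup>2"
    using \<open>0 \<le> C\<close> by (intro mult_left_mono inverse_power_le_weight_square)
  finally show "norm (u k) \<le> C * (weight k)\<^sup>2" .
qed simp

lemma rapidly_decaying_summable: "rapidly_decaying u \<Longrightarrow> (\<lambda>k. cmod (u k)) summable_on UNIV"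
proof -
  assume "rapidly_decaying u"
  then obtain C where "\<forall>k. (1 + norm (lattice_vec k)) ^ (2 * CARD('a)) * cmod (u k) \<le> C"
    unfolding rapidly_decaying_def by (elim allE[of _ "2 * CARD('a)"] exE)
  then show ?thesis by (intro summable_on_decay[of u C]) simp
qed

lemma rapidly_decaying_add:
  assumes "rapidly_decaying u" "rapidly_decaying v"
  shows "rapidly_decaying (\<lambda>k. u k + v k)"
  unfolding rapidly_decaying_def
proof
  fix N
  obtain C where C: "\<forall>k. (1 + norm (lattice_vec k)) ^ N * cmod (u k) \<le> C"
    using assms(1) unfolding rapidly_decaying_def by (elim allE[of _ N] exE)
  obtain D where D: "\<forall>k. (1 + norm (lattice_vec k)) ^ N * cmod (v k) \<le> D"
    using assms(2) unfolding rapidly_decaying_def by (elim allE[of _ N] exE)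
  have "(1 + norm (lattice_vec k)) ^ N * cmod (u k + v k) \<le> C + D" for k
  proof -
    have "(1 + norm (lattice_vec k)) ^ N * cmod (u k + v k) \<le> (1 + norm (lattice_vec k)) ^ N * (cmod (u k) + cmod (v k))"
      by (intro mult_left_mono norm_triangle_ineq) simp
    then show ?thesis using spec[OF C, of k] spec[OF D, of k] by (simp add: ring_distribs)
  qed
  then show "\<exists>C. \<forall>k. (1 + norm (lattice_vec k)) ^ N * cmod (u k + v k) \<le> C" by blast
qed

lemma rapidly_decaying_cmult:
  assumes "rapidly_decaying u"
  shows "rapidly_decaying (\<lambda>k. c * u k)"
  unfolding rapidly_decaying_def
proof
  fix N
  obtain C where C: "\<forall>k. (1 + norm (lattice_vec k)) ^ N * cmod (u k) \<le> C"
    using assms unfolding rapidly_decaying_def by (elim allE[of _ N] exE)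
  have "(1 + norm (lattice_vec k)) ^ N * cmod (c * u k) \<le> cmod c * C" for k
    using mult_left_mono[OF spec[OF C, of k] norm_ge_zero[of c]] by (simp add: norm_mult mult.left_commute)
  then show "\<exists>C. \<forall>k. (1 + norm (lattice_vec k)) ^ N * cmod (c * u k) \<le> C" by blast
qed

lemma rapidly_decaying_component:
  assumes "rapidly_decaying u"
  shows "rapidly_decaying (\<lambda>k. of_int (k $ j) * u k)"
  unfolding rapidly_decaying_def
proof
  fix N
  obtain C where C: "\<forall>k. (1 + norm (lattice_vec k)) ^ Suc N * cmod (u k) \<le> C"
    using assms unfolding rapidly_decaying_def by (elim allE[of _ "Suc N"] exE)
  have "(1 + norm (lattice_vec k)) ^ N * cmod (of_int (k $ j) * u k) \<le> C" for k
  proof -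
    have "\<bar>real_of_int (k $ j)\<bar> \<le> 1 + norm (lattice_vec k)"
      using component_le_norm_cart[of "lattice_vec k" j] by simp
    then have "(1 + norm (lattice_vec k)) ^ N * (\<bar>real_of_int (k $ j)\<bar> * cmod (u k)) \<le> (1 + norm (lattice_vec k)) ^ N * ((1 + norm (lattice_vec k)) * cmod (u k))"
      by (intro mult_left_mono mult_right_mono) auto
    then show ?thesis using spec[OF C, of k] by (simp add: norm_mult mult.assoc mult.left_commute)
  qed
  then show "\<exists>C. \<forall>k. (1 + norm (lattice_vec k)) ^ N * cmod (of_int (k $ j) * u k) \<le> C" by blast
qed

section \<open>Fourier coefficients and seminorms on the smooth subalgebra\<close>

context nc_torus_params
begin

abbreviation smooth :: "'n torus_op set" where
  "smooth \<equiv> smooth_nc_torus \<theta>"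

text \<open>Agrees with \<open>torus_coeffs\<close> on smooth elements, but is a bounded linear
  functional on all operators, so it can be exchanged with limits, sums and integrals.\<close>

definition coeff :: "'n ivec \<Rightarrow> 'n torus_op \<Rightarrow> complex" where
  "coeff l T = tau (T o\<^sub>L adj (U l))"

lemma bounded_linear_coeff: "bounded_linear (coeff l)"
  unfolding coeff_def[abs_def]
  by (intro bounded_linear_compose[OF bounded_linear_tau] ocomp.bounded_linear_left)

lemmas coeff_add = bounded_linear.linear[OF bounded_linear_coeff, THEN linear_add]
lemmas coeff_diff = bounded_linear.linear[OF bounded_linear_coeff, THEN linear_diff]

lemma coeff_scaleC: "coeff l (c *\<^sub>C T) = c * coeff l T"
  by (simp add: coeff_def scaleC_compose_left tau_scaleC)

lemma cmod_tau_le: "cmod (tau T) \<le> norm (T :: 'n torus_op)"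
proof -
  have n1: "norm (torus_one :: 'n torus_l2) = 1"
    using cinner_self[of "torus_one :: 'n torus_l2"] cinner_torus_one
    by (metis norm_eq_1 of_real_eq_1_iff power2_norm_eq_inner)
  show ?thesis
    using cmod_cinner_le[of "blinfun_apply T torus_one" torus_one] norm_blinfun[of T torus_one]
    by (simp add: tau_def n1)
qed

lemma cmod_coeff_le: "cmod (coeff l T) \<le> norm T"
proof -
  have "norm (adj (U l)) \<le> 1"
    using norm_U_le[of l] is_adjoint_norm_le[OF is_adjoint_adj[OF U_complex[of l]]] by simp
  then have "norm T * norm (adj (U l)) \<le> norm T" by (simp add: mult_left_le)
  then show ?thesis
    unfolding coeff_def using cmod_tau_le[of "T o\<^sub>L adj (U l)"] norm_blinfun_compose[of T "adj (U l)"] by linarith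
qed

lemma coeff_U: "coeff l (U k) = (if k = l then 1 else 0)"
  by (simp add: coeff_def tau_U_adj)

lemma series_abs_summable:
  assumes "(\<lambda>k. cmod (u k)) summable_on UNIV"
  shows "(\<lambda>k. norm (u k *\<^sub>C U k)) summable_on UNIV"
proof (rule summable_on_comparison_test[OF assms])
  show "norm (u k *\<^sub>C U k) \<le> cmod (u k)" for k
    using norm_U_le[of k] by (simp add: norm_scaleC_blinfun mult_left_le)
qed simp

lemma series_has_sum:
  assumes "(\<lambda>k. cmod (u k)) summable_on UNIV"
  shows "((\<lambda>k. u k *\<^sub>C U k) has_sum torus_series \<theta> u) UNIV"
  unfolding torus_series_def
  by (rule has_sum_infsum, rule abs_summable_summable, rule series_abs_summable[OF assms])

lemma has_sum_in_A:
  assumes "(f has_sum T) UNIV" "\<And>i. f i \<in> A"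
  shows "T \<in> A"
  by (rule Lim_in_closed_set[OF A_closed _ _ assms(1)[unfolded has_sum_def]]) (auto intro: A_sum assms(2))

lemma series_in_A: "(\<lambda>k. cmod (u k)) summable_on UNIV \<Longrightarrow> torus_series \<theta> u \<in> A"
  by (rule has_sum_in_A[OF series_has_sum]) (auto intro: A_scaleC)

lemma coeff_series:
  assumes "(\<lambda>k. cmod (u k)) summable_on UNIV"
  shows "coeff l (torus_series \<theta> u) = u l"
proof -
  have "((\<lambda>k. coeff l (u k *\<^sub>C U k)) has_sum coeff l (torus_series \<theta> u)) UNIV"
    by (rule has_sum_bounded_linear[OF bounded_linear_coeff series_has_sum[OF assms]])
  moreover have "((\<lambda>k. coeff l (u k *\<^sub>C U k)) has_sum u l) UNIV"
    by (rule has_sum_finite_neutralI[of "{l}"]) (auto simp: coeff_scaleC coeff_U)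
  ultimately show ?thesis by (rule has_sum_unique)
qed

lemma smoothI: "rapidly_decaying u \<Longrightarrow> torus_series \<theta> u \<in> smooth"
  by (simp add: smooth_nc_torus_def)

lemma smoothD:
  assumes "T \<in> smooth"
  shows "rapidly_decaying (\<lambda>l. coeff l T)" and "torus_series \<theta> (\<lambda>l. coeff l T) = T"
proof -
  obtain u where u: "rapidly_decaying u" "T = torus_series \<theta> u"
    using assms by (auto simp: smooth_nc_torus_def)
  have "(\<lambda>l. coeff l T) = u"
    unfolding u(2) using coeff_series[OF rapidly_decaying_summable[OF u(1)]] by (rule ext)
  then show "rapidly_decaying (\<lambda>l. coeff l T)" "torus_series \<theta> (\<lambda>l. coeff l T) = T"
    using u by auto
qed

lemma smooth_summable: "T \<in> smooth \<Longrightarrow> (\<lambda>l. cmod (coeff l T)) summable_on UNIV"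
  by (rule rapidly_decaying_summable[OF smoothD(1)])

lemma smooth_subset_A: "T \<in> smooth \<Longrightarrow> T \<in> A"
  using series_in_A[OF smooth_summable] by (simp add: smoothD(2))

lemma torus_coeffs_eq: "T \<in> smooth \<Longrightarrow> torus_coeffs \<theta> T = (\<lambda>l. coeff l T)"
  unfolding torus_coeffs_def
  by (rule the_equality) (auto simp: smoothD coeff_series[OF rapidly_decaying_summable])

lemma smooth_eqI:
  assumes "S \<in> smooth" "T \<in> smooth" "\<And>l. coeff l S = coeff l T"
  shows "S = T"
proof -
  have "S = torus_series \<theta> (\<lambda>l. coeff l S)" by (rule smoothD(2)[OF assms(1), symmetric])
  also have "\<dots> = torus_series \<theta> (\<lambda>l. coeff l T)" by (simp only: assms(3))
  also have "\<dots> = T" by (rule smoothD(2)[OF assms(2)])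
  finally show ?thesis .
qed

lemma smooth_of_coeffs:
  assumes "((\<lambda>k. u k *\<^sub>C U k) has_sum T) UNIV" "rapidly_decaying u"
  shows "T \<in> smooth"
  using has_sum_unique[OF assms(1) series_has_sum[OF rapidly_decaying_summable[OF assms(2)]]] smoothI[OF assms(2)] by simp

lemma smooth_has_sum:
  assumes "T \<in> smooth"
  shows "((\<lambda>k. coeff k T *\<^sub>C U k) has_sum T) UNIV"
  using series_has_sum[OF smooth_summable[OF assms]] unfolding smoothD(2)[OF assms] .

lemma smooth_add:
  assumes "S \<in> smooth" "T \<in> smooth"
  shows "S + T \<in> smooth"
proof (rule smooth_of_coeffs)
  show "((\<lambda>k. (coeff k S + coeff k T) *\<^sub>C U k) has_sum (S + T)) UNIV"
    unfolding scaleC_blinfun.add_left by (intro has_sum_add smooth_has_sum assms)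
qed (intro rapidly_decaying_add smoothD assms)

lemma smooth_scaleC:
  assumes "T \<in> smooth"
  shows "c *\<^sub>C T \<in> smooth"
proof (rule smooth_of_coeffs)
  show "((\<lambda>k. (c * coeff k T) *\<^sub>C U k) has_sum (c *\<^sub>C T)) UNIV"
    unfolding scaleC_blinfun_scaleC[symmetric]
    by (intro has_sum_bounded_linear[OF scaleC_blinfun.bounded_linear_right] smooth_has_sum assms)
qed (intro rapidly_decaying_cmult smoothD assms)

lemma smooth_diff: "S \<in> smooth \<Longrightarrow> T \<in> smooth \<Longrightarrow> S - T \<in> smooth"
  using smooth_add[of S "(-1) *\<^sub>C T"] smooth_scaleC[of T "-1"] by (simp add: scaleC_blinfun_minus_one)

lemma torus_deriv_smooth:
  assumes "T \<in> smooth"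
  shows "torus_deriv \<theta> j T \<in> smooth" and "coeff l (torus_deriv \<theta> j T) = of_int (l $ j) * coeff l T"
proof -
  have r: "rapidly_decaying (\<lambda>k. of_int (k $ j) * coeff k T)"
    by (intro rapidly_decaying_component smoothD assms)
  show "torus_deriv \<theta> j T \<in> smooth" "coeff l (torus_deriv \<theta> j T) = of_int (l $ j) * coeff l T"
    unfolding torus_deriv_def torus_coeffs_eq[OF assms]
    using smoothI[OF r] coeff_series[OF rapidly_decaying_summable[OF r]] by auto
qed

lemma torus_deriv_power_smooth:
  assumes "T \<in> smooth"
  shows "(torus_deriv \<theta> j ^^ m) T \<in> smooth \<and> coeff l ((torus_deriv \<theta> j ^^ m) T) = of_int (l $ j) ^ m * coeff l T"
  by (induction m) (simp_all add: assms torus_deriv_smooth)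

lemma multi_iterate_smooth:
  assumes "T \<in> smooth"
  shows "multi_iterate (torus_deriv \<theta>) \<alpha> T \<in> smooth"
    and "coeff l (multi_iterate (torus_deriv \<theta>) \<alpha> T) = (\<Prod>j\<in>UNIV. of_int (l $ j) ^ \<alpha> j) * coeff l T"
proof -
  have "foldr (\<lambda>j. torus_deriv \<theta> j ^^ \<alpha> j) xs T \<in> smooth \<and>
      coeff l (foldr (\<lambda>j. torus_deriv \<theta> j ^^ \<alpha> j) xs T) = (\<Prod>j\<in>set xs. of_int (l $ j) ^ \<alpha> j) * coeff l T"
    if "distinct xs" for xs
    using that by (induction xs) (simp_all add: assms torus_deriv_power_smooth mult.assoc)
  from this[of "sorted_list_of_set UNIV"]
  show "multi_iterate (torus_deriv \<theta>) \<alpha> T \<in> smooth"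
    "coeff l (multi_iterate (torus_deriv \<theta>) \<alpha> T) = (\<Prod>j\<in>UNIV. of_int (l $ j) ^ \<alpha> j) * coeff l T"
    by (simp_all add: multi_iterate_def)
qed

lemma seminorm_add_le:
  assumes "S \<in> smooth" "T \<in> smooth"
  shows "torus_seminorm \<theta> \<alpha> (S + T) \<le> torus_seminorm \<theta> \<alpha> S + torus_seminorm \<theta> \<alpha> T"
proof -
  have "multi_iterate (torus_deriv \<theta>) \<alpha> (S + T) = multi_iterate (torus_deriv \<theta>) \<alpha> S + multi_iterate (torus_deriv \<theta>) \<alpha> T"
    by (rule smooth_eqI) (simp_all add: assms smooth_add multi_iterate_smooth coeff_add ring_distribs)
  then show ?thesis by (simp add: torus_seminorm_def norm_triangle_ineq)
qed

lemma seminorm_scaleC: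
  assumes "T \<in> smooth"
  shows "torus_seminorm \<theta> \<alpha> (c *\<^sub>C T) = cmod c * torus_seminorm \<theta> \<alpha> T"
proof -
  have "multi_iterate (torus_deriv \<theta>) \<alpha> (c *\<^sub>C T) = c *\<^sub>C multi_iterate (torus_deriv \<theta>) \<alpha> T"
    by (rule smooth_eqI) (simp_all add: assms smooth_scaleC multi_iterate_smooth coeff_scaleC)
  then show ?thesis by (simp add: torus_seminorm_def norm_scaleC_blinfun)
qed

lemma seminorm_0: "torus_seminorm \<theta> (\<lambda>_. 0) T = norm T"
proof -
  have "foldr (\<lambda>j. torus_deriv \<theta> j ^^ 0) xs T = T" for xs by (induction xs) auto
  then show ?thesis by (simp add: torus_seminorm_def multi_iterate_def)
qed

text \<open>Pure derivatives of order \<open>N\<close>, one for each coordinate, together with the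
  norm: finitely many seminorms that already control the decay of order \<open>N\<close> of the
  coefficients.\<close>

definition decay_norm :: "nat \<Rightarrow> 'n torus_op \<Rightarrow> real" where
  "decay_norm N T = norm T + (\<Sum>j\<in>UNIV. torus_seminorm \<theta> (\<lambda>i. if i = j then N else 0) T)"

lemma decay_norm_add_le: "S \<in> smooth \<Longrightarrow> T \<in> smooth \<Longrightarrow> decay_norm N (S + T) \<le> decay_norm N S + decay_norm N T"
proof -
  assume ST: "S \<in> smooth" "T \<in> smooth"
  have "(\<Sum>j\<in>UNIV. torus_seminorm \<theta> (\<lambda>i. if i = j then N else 0) (S + T))
      \<le> (\<Sum>j\<in>UNIV. torus_seminorm \<theta> (\<lambda>i. if i = j then N else 0) S + torus_seminorm \<theta> (\<lambda>i. if i = j then N else 0) T)"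
    by (intro sum_mono seminorm_add_le ST)
  then show ?thesis
    unfolding decay_norm_def sum.distrib using norm_triangle_ineq[of S T] by linarith
qed

lemma decay_norm_scaleC: "T \<in> smooth \<Longrightarrow> decay_norm N (c *\<^sub>C T) = cmod c * decay_norm N T"
  by (simp add: decay_norm_def seminorm_scaleC norm_scaleC_blinfun ring_distribs sum_distrib_left)

text \<open>Let \<open>m\<close> be the maximum of 1 and the absolute coordinates of
  \<open>l\<close>; then \<open>1 + norm (lattice_vec l) \<le> 2 * CARD('n) * m\<close>. If
  \<open>m = 1\<close> the operator norm bounds the coefficient; otherwise \<open>m\<close> is
  attained at a coordinate \<open>j\<close>, and the \<open>N\<close>-th derivative in that
  coordinate multiplies the coefficient by \<open>m ^ N\<close> in modulus.\<close>

lemma coeff_decay: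
  assumes T: "T \<in> smooth"
  shows "(1 + norm (lattice_vec l)) ^ N * cmod (coeff l T) \<le> (2 * real CARD('n)) ^ N * decay_norm N T"
proof -
  define m where "m = Max (insert 1 (range (\<lambda>j. \<bar>real_of_int (l $ j)\<bar>)))"
  have m1: "1 \<le> m" and mj: "\<bar>real_of_int (l $ j)\<bar> \<le> m" for j
    unfolding m_def by (intro Max_ge; auto)+
  have "norm (lattice_vec l) \<le> (\<Sum>j\<in>UNIV. \<bar>lattice_vec l $ j\<bar>)" by (rule norm_le_l1_cart)
  also have "\<dots> \<le> (\<Sum>j\<in>(UNIV :: 'n set). m)" using mj by (intro sum_mono) simp
  finally have "norm (lattice_vec l) \<le> real CARD('n) * m" by simp
  moreover have "1 \<le> real CARD('n) * m"
    using mult_mono[of 1 "real CARD('n)" 1 m] m1 by simp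
  ultimately have "1 + norm (lattice_vec l) \<le> 2 * real CARD('n) * m" by linarith
  then have "(1 + norm (lattice_vec l)) ^ N \<le> (2 * real CARD('n) * m) ^ N" by (intro power_mono) auto
  also have "\<dots> = (2 * real CARD('n)) ^ N * m ^ N" by (simp add: power_mult_distrib)
  finally have step: "(1 + norm (lattice_vec l)) ^ N * cmod (coeff l T) \<le> (2 * real CARD('n)) ^ N * (m ^ N * cmod (coeff l T))"
    by (simp add: mult_right_mono mult.assoc[symmetric])
  have sn: "0 \<le> torus_seminorm \<theta> \<alpha> T" for \<alpha> by (simp add: torus_seminorm_def)
  have "m \<in> insert 1 (range (\<lambda>j. \<bar>real_of_int (l $ j)\<bar>))" unfolding m_def by (rule Max_in) auto
  then have "m ^ N * cmod (coeff l T) \<le> decay_norm N T"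
  proof (elim insertE rangeE)
    assume "m = 1"
    then show ?thesis using cmod_coeff_le[of l T] sum_nonneg[of UNIV, OF sn, of "\<lambda>j i. if i = j then N else 0"]
      by (simp add: decay_norm_def)
  next
    fix j assume j: "m = \<bar>real_of_int (l $ j)\<bar>"
    let ?\<alpha> = "\<lambda>i. if i = j then N else 0"
    have "(\<Prod>i\<in>UNIV. (of_int (l $ i) :: complex) ^ ?\<alpha> i) = (\<Prod>i\<in>UNIV. if i = j then of_int (l $ j) ^ N else 1)"
      by (rule prod.cong) auto
    also have "\<dots> = of_int (l $ j) ^ N" by simp
    finally have "m ^ N * cmod (coeff l T) = cmod (coeff l (multi_iterate (torus_deriv \<theta>) ?\<alpha> T))"
      unfolding multi_iterate_smooth(2)[OF T] by (simp add: norm_mult norm_power j)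
    also have "\<dots> \<le> torus_seminorm \<theta> ?\<alpha> T"
      unfolding torus_seminorm_def by (rule cmod_coeff_le)
    also have "\<dots> \<le> (\<Sum>j\<in>UNIV. torus_seminorm \<theta> (\<lambda>i. if i = j then N else 0) T)"
      by (rule member_le_sum[of j UNIV "\<lambda>j. torus_seminorm \<theta> (\<lambda>i. if i = j then N else 0) T"]) (auto intro: sn)
    also have "\<dots> \<le> decay_norm N T" by (simp add: decay_norm_def)
    finally show ?thesis .
  qed
  then show ?thesis
    by (intro order_trans[OF step] mult_left_mono) auto
qed

end

section \<open>Integrals over the sphere\<close>

text \<open>Needed for integrands with values in a Banach space of operators, where the Fourier
  series of the symbol is integrated term by term. The filter is general because the partial sums
  are indexed by finite sets.\<close>

lemma uniform_limit_integral_on: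
  fixes f :: "'i \<Rightarrow> 'b::euclidean_space \<Rightarrow> 'c::banach"
  assumes S: "S \<subseteq> cbox a b" "(\<lambda>_. 1 :: real) integrable_on S" and ne: "F \<noteq> bot"
    and f: "\<And>i. f i integrable_on S"
    and unif: "\<And>\<epsilon>. 0 < \<epsilon> \<Longrightarrow> \<forall>\<^sub>F i in F. \<forall>x\<in>S. norm (f i x - g x) \<le> \<epsilon>"
  shows "g integrable_on S" and "((\<lambda>i. integral S (f i)) \<longlongrightarrow> integral S g) F"
proof -
  have SI: "S \<inter> cbox a b = S" using S(1) by blast
  have "(\<lambda>x. if x \<in> S then g x else 0) integrable_on cbox a b"
  proof (rule integrable_uniform_limit)
    fix \<epsilon> :: real assume "0 < \<epsilon>"
    from eventually_happens'[OF ne unif[OF this]] obtain i where i: "\<forall>x\<in>S. norm (f i x - g x) \<le> \<epsilon>"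
      by (rule exE)
    have "(\<lambda>x. if x \<in> S then f i x else 0) integrable_on cbox a b"
      unfolding integrable_restrict_Int SI by (rule f)
    then show "\<exists>h. (\<forall>x\<in>cbox a b. norm ((if x \<in> S then g x else 0) - h x) \<le> \<epsilon>) \<and> h integrable_on cbox a b"
      using i \<open>0 < \<epsilon>\<close> by (intro exI[of _ "\<lambda>x. if x \<in> S then f i x else 0"]) (auto simp: norm_minus_commute)
  qed
  then show g: "g integrable_on S"
    unfolding integrable_restrict_Int SI .
  define m where "m = integral S (\<lambda>_. 1 :: real) + 1"
  have "m > 0" using integral_nonneg[OF S(2)] by (simp add: m_def add_nonneg_pos)
  show "((\<lambda>i. integral S (f i)) \<longlongrightarrow> integral S g) F"
  proof (rule tendstoI)
    fix \<epsilon> :: real assume "0 < \<epsilon>"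
    then have e: "0 < \<epsilon> / (2 * m)" using \<open>m > 0\<close> by simp
    show "\<forall>\<^sub>F i in F. dist (integral S (f i)) (integral S g) < \<epsilon>"
    proof (rule eventually_mono[OF unif[OF e]])
      fix i assume i: "\<forall>x\<in>S. norm (f i x - g x) \<le> \<epsilon> / (2 * m)"
      have "dist (integral S (f i)) (integral S g) = norm (integral S (\<lambda>x. f i x - g x))"
        by (simp add: dist_norm Henstock_Kurzweil_Integration.integral_diff f g)
      also have "\<dots> \<le> integral S (\<lambda>x. \<epsilon> / (2 * m) * 1)"
        using i by (intro integral_norm_bound_integral Henstock_Kurzweil_Integration.integrable_diff
            f g integrable_on_mult_right S(2)) auto
      also have "\<dots> = \<epsilon> / (2 * m) * integral S (\<lambda>_. 1 :: real)"
        by (rule Henstock_Kurzweil_Integration.integral_mult_right)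
      also have "\<dots> \<le> \<epsilon> / (2 * m) * m"
        using e by (intro mult_left_mono) (auto simp: m_def)
      also have "\<dots> < \<epsilon>" using \<open>0 < \<epsilon>\<close> \<open>m > 0\<close> by simp
      finally show "dist (integral S (f i)) (integral S g) < \<epsilon>" .
    qed
  qed
qed

lemma bounded_on_sphere:
  fixes f :: "'n::finite rvec \<Rightarrow> real"
  assumes "continuous_on (sphere 0 1) f"
  shows "\<exists>B. \<forall>x. norm x = 1 \<longrightarrow> \<bar>f x\<bar> \<le> B"
proof -
  from compact_imp_bounded[OF compact_continuous_image[OF assms compact_sphere]]
  obtain B where B: "\<forall>y\<in>f ` sphere 0 1. norm y \<le> B" unfolding bounded_iff by (rule exE)
  show ?thesis by (intro exI[of _ B]) (use B in auto)
qed

text \<open>A constant above the bound of \<open>f\<close> makes it positive, so the integrand is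
  the difference of two integrands covered by \<open>has_integral_radial\<close>.\<close>

lemma integrable_direction_real:
  fixes f :: "'n::finite rvec \<Rightarrow> real"
  assumes "continuous_on (sphere 0 1) f"
  shows "(\<lambda>x. f (x /\<^sub>R norm x)) integrable_on cball 0 1"
proof -
  obtain B where B: "\<forall>x. norm x = 1 \<longrightarrow> \<bar>f x\<bar> \<le> B" using bounded_on_sphere[OF assms] by (rule exE)
  interpret p: positive_on_sphere "\<lambda>x. f x + (\<bar>B\<bar> + 1)"
  proof
    show "0 < f x + (\<bar>B\<bar> + 1)" if "norm x = 1" for x using spec[OF B, of x] that by linarith
  qed (intro continuous_intros assms)
  interpret q: positive_on_sphere "\<lambda>x. \<bar>B\<bar> + 1 :: real" by standard auto
  show ?thesis
    using Henstock_Kurzweil_Integration.integrable_diff[OF has_integral_integrable[OF p.has_integral_radial] has_integral_integrable[OF q.has_integral_radial]]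
    by simp
qed

lemma integral_complex_of_real':
  fixes f :: "'a::euclidean_space \<Rightarrow> real"
  assumes "f integrable_on S"
  shows "(\<lambda>x. complex_of_real (f x)) integrable_on S"
    and "integral S (\<lambda>x. complex_of_real (f x)) = of_real (integral S f)"
  using integrable_linear[OF assms bounded_linear_of_real] integral_linear[OF assms bounded_linear_of_real]
  by (simp_all add: comp_def)

lemma integrable_direction:
  fixes f :: "'n::finite rvec \<Rightarrow> complex"
  assumes "continuous_on (sphere 0 1) f"
  shows "(\<lambda>x. f (x /\<^sub>R norm x)) integrable_on cball 0 1"
proof -
  have "(\<lambda>x. Re (f (x /\<^sub>R norm x))) integrable_on cball 0 1" "(\<lambda>x. Im (f (x /\<^sub>R norm x))) integrable_on cball 0 1"
    by (intro integrable_direction_real[of "\<lambda>x. Re (f x)"] integrable_direction_real[of "\<lambda>x. Im (f x)"] continuous_intros assms)+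
  then have "(\<lambda>x. complex_of_real (Re (f (x /\<^sub>R norm x))) + \<i> * complex_of_real (Im (f (x /\<^sub>R norm x)))) integrable_on cball 0 1"
    by (intro Henstock_Kurzweil_Integration.integrable_add integrable_on_mult_right integral_complex_of_real'(1))
  then show ?thesis by (simp only: complex_eq[symmetric])
qed

section \<open>Traces of homogeneous Fourier multipliers\<close>

text \<open>Zero at the origin, unlike \<open>lattice_symbol\<close>, so that it is linear in
  \<open>f\<close>. The two differ in one diagonal entry, which has trace zero.\<close>

definition homogeneous_diag :: "('n::finite rvec \<Rightarrow> complex) \<Rightarrow> 'n ivec \<Rightarrow> complex" where
  "homogeneous_diag f k = (if k = 0 then 0 else f (lattice_vec k /\<^sub>R norm (lattice_vec k)) * of_real (weight k))"

locale multiplier_trace = onb e + nc_trace \<phi>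
  for e :: "'n::finite ivec \<Rightarrow> 'h::chilbert_space" and \<phi> :: "('h \<Rightarrow>\<^sub>L 'h) \<Rightarrow> complex"
begin

lemma onb_trace_bij: "bij \<sigma> \<Longrightarrow> onb_trace e \<phi> \<sigma>"
  by unfold_locales

lemma weak_ideal_le_weight:
  assumes "\<And>k. cmod (b k) \<le> C * weight k"
  shows "diag b \<in> weak_ideal" and "bounded (range b)"
proof -
  obtain \<sigma> D where \<sigma>: "bij \<sigma>" "\<And>j. weight (\<sigma> j :: 'n ivec) \<le> D / (real j + 1)"
    using ex_weight_decay by blast
  have "0 \<le> C * weight (0 :: 'n ivec)" using order_trans[OF norm_ge_zero assms[of 0]] .
  then have "0 \<le> C" by (simp add: weight_def)
  have "cmod (b (\<sigma> j)) \<le> C * D / (real j + 1)" for j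
    using order_trans[OF assms[of "\<sigma> j"] mult_left_mono[OF \<sigma>(2)[of j] \<open>0 \<le> C\<close>]] by simp
  then show "diag b \<in> weak_ideal" "bounded (range b)"
    using diag_weak_ideal[OF \<sigma>(1)] bounded_of_decay[OF \<sigma>(1)] by blast+
qed

text \<open>Along an enumeration with \<open>weight (\<sigma> j) \<le> D / (j + 1)\<close> the extra
  factor sends \<open>(j + 1) * b (\<sigma> j)\<close> to 0: balls contain finitely many lattice
  points, so the norm of \<open>lattice_vec (\<sigma> j)\<close> tends to infinity.\<close>

lemma tr_diag_lower_order:
  assumes "\<And>k. cmod (b k) \<le> C * (weight k / max 1 (norm (lattice_vec k)))"
  shows "\<phi> (diag b) = 0"
proof -
  obtain \<sigma> D where \<sigma>: "bij \<sigma>" "\<And>j. weight (\<sigma> j :: 'n ivec) \<le> D / (real j + 1)"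
    using ex_weight_decay by blast
  interpret onb_trace e \<phi> \<sigma> using \<sigma>(1) by (rule onb_trace_bij)
  have "0 \<le> C * (weight (0 :: 'n ivec) / max 1 (norm (lattice_vec (0 :: 'n ivec))))" using order_trans[OF norm_ge_zero assms[of 0]] .
  then have "0 \<le> C" by (simp add: weight_def)
  have lim: "filterlim (\<lambda>j. max 1 (norm (lattice_vec (\<sigma> j)))) at_top sequentially"
    unfolding filterlim_at_top
  proof (intro allI)
    fix Z :: real
    have "finite (\<sigma> -` {k. norm (lattice_vec k) \<le> Z})"
      using finite_lattice_ball \<sigma>(1) by (intro finite_vimageI bij_is_inj)
    from finite_nat_set_iff_bounded[THEN iffD1, OF this]
    obtain N where N: "\<forall>j\<in>\<sigma> -` {k. norm (lattice_vec k) \<le> Z}. j < N" by (rule exE)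
    have "Z \<le> max 1 (norm (lattice_vec (\<sigma> j)))" if "j \<ge> N" for j
      using N that by (cases "norm (lattice_vec (\<sigma> j)) \<le> Z") auto
    then show "\<forall>\<^sub>F j in sequentially. Z \<le> max 1 (norm (lattice_vec (\<sigma> j)))"
      unfolding eventually_sequentially by (intro exI[of _ N]) simp
  qed
  have "(\<lambda>j. C * D / max 1 (norm (lattice_vec (\<sigma> j)))) \<longlonglongrightarrow> 0"
    by (rule real_tendsto_divide_at_top[OF tendsto_const lim])
  then have "(\<lambda>j. (real j + 1) *\<^sub>R b (\<sigma> j)) \<longlonglongrightarrow> 0"
  proof (rule Lim_null_comparison[rotated], intro always_eventually allI)
    fix j
    have "norm ((real j + 1) *\<^sub>R b (\<sigma> j)) \<le> (real j + 1) * (C * (weight (\<sigma> j) / max 1 (norm (lattice_vec (\<sigma> j)))))"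
      using assms[of "\<sigma> j"] unfolding norm_scaleR by (intro mult_mono) auto
    also have "\<dots> = C * ((real j + 1) * weight (\<sigma> j)) / max 1 (norm (lattice_vec (\<sigma> j)))" by simp
    also have "\<dots> \<le> C * D / max 1 (norm (lattice_vec (\<sigma> j)))"
      using \<sigma>(2)[of j] \<open>0 \<le> C\<close> by (intro divide_right_mono mult_left_mono) (auto simp: field_simps)
    finally show "norm ((real j + 1) *\<^sub>R b (\<sigma> j)) \<le> C * D / max 1 (norm (lattice_vec (\<sigma> j)))" .
  qed
  from tr_diag_limit(1)[OF this] show ?thesis .
qed

lemma homogeneous_diag_le_weight:
  assumes "continuous_on (sphere 0 1) f"
  shows "\<exists>C. \<forall>k. cmod (homogeneous_diag f k) \<le> C * weight k"
proof -
  obtain B where B: "\<forall>x. norm x = 1 \<longrightarrow> \<bar>cmod (f x)\<bar> \<le> B"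
    using bounded_on_sphere[of "\<lambda>x. cmod (f x)"] assms continuous_on_norm by blast
  have "cmod (homogeneous_diag f k) \<le> \<bar>B\<bar> * weight k" for k
  proof (cases "k = 0")
    case False
    then have "norm (lattice_vec k /\<^sub>R norm (lattice_vec k)) = 1" by simp
    then have "cmod (f (lattice_vec k /\<^sub>R norm (lattice_vec k))) \<le> \<bar>B\<bar>" using B by fastforce
    then show ?thesis using False weight_pos[of k]
      by (simp add: homogeneous_diag_def norm_mult mult_right_mono)
  qed (simp add: homogeneous_diag_def weight_def)
  then show ?thesis by blast
qed

lemma
  assumes "continuous_on (sphere 0 1) f"
  shows weak_ideal_homogeneous_diag: "diag (homogeneous_diag f) \<in> weak_ideal"
    and bounded_homogeneous_diag: "bounded (range (homogeneous_diag f))"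
  using homogeneous_diag_le_weight[OF assms] weak_ideal_le_weight by blast+

lemma tr_homogeneous_diag_add:
  assumes "continuous_on (sphere 0 1) f" "continuous_on (sphere 0 1) g"
  shows "\<phi> (diag (homogeneous_diag (\<lambda>x. f x + c * g x))) = \<phi> (diag (homogeneous_diag f)) + c * \<phi> (diag (homogeneous_diag g))"
proof -
  have "homogeneous_diag (\<lambda>x. f x + c * g x) = (\<lambda>k. homogeneous_diag f k + c * homogeneous_diag g k)"
    by (auto simp: homogeneous_diag_def ring_distribs)
  then have "diag (homogeneous_diag (\<lambda>x. f x + c * g x)) = diag (homogeneous_diag f) + c *\<^sub>C diag (homogeneous_diag g)"
    using bounded_homogeneous_diag[OF assms(1)] bounded_homogeneous_diag[OF assms(2)]
    by (simp add: diag_scaleC diag_add bounded_range_cmult)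
  then show ?thesis
    using weak_ideal_homogeneous_diag[OF assms(1)] weak_ideal_homogeneous_diag[OF assms(2)]
    by (simp add: tr_add tr_scaleC weak_ideal_scaleC)
qed

text \<open>Weyl's law: enumerating the lattice by decreasing values of the multiplier, the \<open>j\<close>-th value
  times \<open>j\<close> tends to the volume of the star-shaped region of the multiplier.\<close>

lemma tr_homogeneous_diag_pos:
  assumes "continuous_on (sphere 0 1) f" "\<And>x. norm x = 1 \<Longrightarrow> 0 < f x"
  shows "\<phi> (diag (homogeneous_diag (\<lambda>x. complex_of_real (f x)))) = of_real (integral (cball 0 1) (\<lambda>x. f (x /\<^sub>R norm x)))"
proof -
  interpret p: positive_on_sphere f using assms by unfold_locales
  obtain \<sigma> where \<sigma>: "bij \<sigma>" "(\<lambda>j. (real j + 1) * p.lattice_symbol (\<sigma> j)) \<longlonglongrightarrow> measure lborel (star_region f)"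
    using p.ex_weyl_enumeration by blast
  interpret onb_trace e \<phi> \<sigma> using \<sigma>(1) by (rule onb_trace_bij)
  have "(\<lambda>j. (real j + 1) *\<^sub>R complex_of_real (p.lattice_symbol (\<sigma> j))) \<longlonglongrightarrow> of_real (measure lborel (star_region f))"
    using tendsto_of_real[OF \<sigma>(2), where 'a = complex] by (simp add: scaleR_conv_of_real)
  note lim = tr_diag_limit[OF this]
  define h where "h = homogeneous_diag (\<lambda>x. complex_of_real (f x))"
  have hc: "continuous_on (sphere 0 1) (\<lambda>x. complex_of_real (f x))" by (intro continuous_intros assms)
  \<comment> \<open>The enumerated symbol has the entry 1 at the origin, where the homogeneous
    multiplier has 0; this rank one difference is invisible to the trace.\<close>
  have "diag (\<lambda>k. complex_of_real (p.lattice_symbol k)) = diag h + diag (\<lambda>k. if k \<in> {0} then 1 else 0)"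
    unfolding h_def using bounded_homogeneous_diag[OF hc] bounded_range_if_finite[of "{0}" "\<lambda>_. 1"]
    by (subst diag_add) (auto simp: homogeneous_diag_def p.lattice_symbol_def weight_def intro!: arg_cong[of _ _ diag])
  moreover have "\<phi> (diag (\<lambda>k. if k \<in> {0} then 1 else 0)) = 0" "diag (\<lambda>k. if k \<in> {0} then 1 else 0) \<in> weak_ideal"
    by (intro tr_diag_finite_support weak_ideal_diag_finite_support; simp)+
  ultimately have "\<phi> (diag h) = of_real (measure lborel (star_region f))"
    using lim(1) weak_ideal_homogeneous_diag[OF hc] by (simp add: h_def tr_add)
  then show ?thesis
    using integral_unique[OF p.has_integral_radial] by (simp add: h_def)
qed

text \<open>A constant added to reach positivity is removed again by linearity of both the trace and
  the integral.\<close>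

lemma tr_homogeneous_diag_real:
  assumes "continuous_on (sphere 0 1) f"
  shows "\<phi> (diag (homogeneous_diag (\<lambda>x. complex_of_real (f x)))) = of_real (integral (cball 0 1) (\<lambda>x. f (x /\<^sub>R norm x)))"
proof -
  obtain B where B: "\<forall>x. norm x = 1 \<longrightarrow> \<bar>f x\<bar> \<le> B" using bounded_on_sphere[OF assms] by (rule exE)
  define c where "c = \<bar>B\<bar> + 1"
  have "c > 0" by (simp add: c_def add_nonneg_pos)
  have pos: "0 < f x + c" if "norm x = 1" for x
    using spec[OF B, of x] that unfolding c_def by linarith
  have cont: "continuous_on (sphere 0 1) (\<lambda>x. f x + c)" "continuous_on (sphere 0 1) (\<lambda>x :: 'n rvec. c)"
    by (intro continuous_intros assms)+
  have "\<phi> (diag (homogeneous_diag (\<lambda>x. complex_of_real (f x))))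
      = \<phi> (diag (homogeneous_diag (\<lambda>x. complex_of_real (f x + c) + (-1) * complex_of_real c)))"
    by simp
  also have "\<dots> = \<phi> (diag (homogeneous_diag (\<lambda>x. complex_of_real (f x + c)))) + (-1) * \<phi> (diag (homogeneous_diag (\<lambda>x :: 'n rvec. complex_of_real c)))"
    by (rule tr_homogeneous_diag_add) (intro continuous_intros assms)+
  also have "\<dots> = of_real (integral (cball 0 1) (\<lambda>x. f (x /\<^sub>R norm x) + c)) - of_real (integral (cball 0 1) (\<lambda>x :: 'n rvec. c))"
    using tr_homogeneous_diag_pos[OF cont(1) pos] tr_homogeneous_diag_pos[OF cont(2)] \<open>c > 0\<close> by simp
  also have "\<dots> = of_real (integral (cball 0 1) (\<lambda>x. f (x /\<^sub>R norm x)))"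
    using integrable_direction_real[OF assms] integrable_direction_real[OF cont(2)]
    by (simp add: Henstock_Kurzweil_Integration.integral_add)
  finally show ?thesis .
qed

lemma tr_homogeneous_diag:
  assumes "continuous_on (sphere 0 1) f"
  shows "\<phi> (diag (homogeneous_diag f)) = integral (cball 0 1) (\<lambda>x. f (x /\<^sub>R norm x))"
proof -
  have cont: "continuous_on (sphere 0 1) (\<lambda>x. Re (f x))" "continuous_on (sphere 0 1) (\<lambda>x. Im (f x))"
    by (intro continuous_intros assms)+
  note i = integrable_direction_real[OF cont(1)] integrable_direction_real[OF cont(2)]
  have "\<phi> (diag (homogeneous_diag f)) = \<phi> (diag (homogeneous_diag (\<lambda>x. complex_of_real (Re (f x)) + \<i> * complex_of_real (Im (f x)))))"
    by (simp only: complex_eq[symmetric])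
  also have "\<dots> = of_real (integral (cball 0 1) (\<lambda>x. Re (f (x /\<^sub>R norm x)))) + \<i> * of_real (integral (cball 0 1) (\<lambda>x. Im (f (x /\<^sub>R norm x))))"
    by (subst tr_homogeneous_diag_add) (auto intro!: continuous_intros assms simp: tr_homogeneous_diag_real[OF cont(1)] tr_homogeneous_diag_real[OF cont(2)])
  also have "\<dots> = integral (cball 0 1) (\<lambda>x. complex_of_real (Re (f (x /\<^sub>R norm x))) + \<i> * complex_of_real (Im (f (x /\<^sub>R norm x))))"
    using i by (simp add: Henstock_Kurzweil_Integration.integral_add integrable_on_mult_right integral_complex_of_real')
  also have "\<dots> = integral (cball 0 1) (\<lambda>x. f (x /\<^sub>R norm x))"
    by (simp only: complex_eq[symmetric])
  finally show ?thesis .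
qed

end

section \<open>The trace of a pseudodifferential operator of order \<open>-n\<close>\<close>

context gns
begin

lemma has_sum_iota:
  assumes "(f has_sum T) UNIV" "\<And>i. f i \<in> A"
  shows "((\<lambda>i. \<iota> (f i)) has_sum \<iota> T) UNIV"
proof -
  have "\<iota> 0 = 0" using iota_diff[of 0 0] by simp
  then have "\<iota> (sum f F) = (\<Sum>i\<in>F. \<iota> (f i))" for F
    by (induction F rule: infinite_finite_induct) (auto simp: iota_add A_sum assms(2))
  moreover have "((\<lambda>F. \<iota> (sum f F)) \<longlongrightarrow> \<iota> T) (finite_subsets_at_top UNIV)"
    using assms by (intro iota_tendsto) (auto simp: A_sum has_sum_def has_sum_in_A)
  ultimately show ?thesis by (simp add: has_sum_def)
qed

lemma trig_smooth: "T \<in> trig \<Longrightarrow> T \<in> smooth"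
proof (induction rule: trig.induct)
  case (monomial c m)
  show ?case
  proof (rule smooth_of_coeffs)
    show "((\<lambda>k. (if k = m then c else 0) *\<^sub>C U k) has_sum (c *\<^sub>C U m)) UNIV"
      by (rule has_sum_finite_neutralI[of "{m}"]) (auto simp: scaleC_blinfun.zero_left)
    show "rapidly_decaying (\<lambda>k. if k = m then c else 0)"
      unfolding rapidly_decaying_def
    proof
      fix N
      show "\<exists>C. \<forall>k. (1 + norm (lattice_vec k)) ^ N * cmod (if k = m then c else 0) \<le> C"
        by (intro exI[of _ "(1 + norm (lattice_vec m)) ^ N * cmod c"]) auto
    qed
  qed
qed (rule smooth_add)

text \<open>Makes the description in \<open>bounded_extension\<close> unique, since \<open>P\<close>
  is prescribed on smooth elements only.\<close>

lemma iota_smooth_dense: "closure (\<iota> ` smooth) = UNIV"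
proof -
  have "\<iota> u \<in> closure (\<iota> ` smooth)" if "u \<in> A" for u
  proof -
    have "u \<in> closure trig" using that by (simp add: nc_torus_eq)
    then obtain s where s: "\<And>n. s n \<in> trig" "s \<longlonglongrightarrow> u" by (rule closure_trigE) (rule that)
    have "(\<lambda>n. \<iota> (s n)) \<longlonglongrightarrow> \<iota> u"
      using s(1) trig_subset_A \<open>u \<in> A\<close> s(2) by (intro iota_tendsto) auto
    then show ?thesis
      unfolding closure_sequential using trig_smooth[OF s(1)] by (intro exI[of _ "\<lambda>n. \<iota> (s n)"]) auto
  qed
  then have "closure (\<iota> ` A) \<subseteq> closure (\<iota> ` smooth)"
    by (intro closure_minimal) auto
  then show ?thesis unfolding iota_dense by (intro antisym subset_UNIV)
qed

end

section \<open>Decay of the Fourier coefficients of a symbol of order -n\<close>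

locale order_minus_n = gns \<theta> \<iota>
  for \<theta> :: "('n::{finite,linorder}) rmat" and \<iota> :: "'n torus_op \<Rightarrow> 'h::chilbert_space" +
  fixes \<rho> :: "'n rvec \<Rightarrow> 'n torus_op" and r :: "nat \<Rightarrow> 'n rvec \<Rightarrow> 'n torus_op"
    and P :: "'n torus_op \<Rightarrow> 'n torus_op"
  assumes expansion: "symbol_expansion \<theta> (- of_nat CARD('n)) \<rho> r"
    and quantization: "is_quantization \<theta> \<rho> P"
begin

lemma symbol_smooth: "\<rho> \<xi> \<in> smooth"
proof -
  have "smooth_map \<theta> UNIV \<rho>" using expansion by (simp add: symbol_expansion_def)
  from this[unfolded smooth_map_def, THEN spec[of _ "[]"], THEN bspec[of _ _ \<xi>]] show ?thesis
    by (simp add: Let_def)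
qed

lemma
  assumes "\<xi> \<noteq> 0"
  shows leading_smooth: "r 0 \<xi> \<in> smooth"
    and leading_continuous: "frechet_tendsto \<theta> (r 0) (r 0 \<xi>) (at \<xi>)"
proof -
  have "r 0 \<in> homogeneous_symbols \<theta> (- of_nat CARD('n) - of_nat 0)"
    using expansion unfolding symbol_expansion_def by blast
  then have "smooth_map \<theta> (- {0}) (r 0)" by (simp add: homogeneous_symbols_def)
  from this[unfolded smooth_map_def, THEN spec[of _ "[]"], THEN bspec[of _ _ \<xi>]] assms
  show "r 0 \<xi> \<in> smooth" "frechet_tendsto \<theta> (r 0) (r 0 \<xi>) (at \<xi>)"
    by (auto simp: Let_def)
qed

lemma leading_homogeneous:
  assumes "k \<noteq> 0"
  shows "r 0 (lattice_vec k) = of_real (weight k) *\<^sub>C r 0 (lattice_vec k /\<^sub>R norm (lattice_vec k))"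
proof -
  let ?t = "norm (lattice_vec k)" and ?\<omega> = "lattice_vec k /\<^sub>R norm (lattice_vec k)"
  have t: "?t > 0" using assms by simp
  have "r 0 \<in> homogeneous_symbols \<theta> (- of_nat CARD('n) - of_nat 0)"
    using expansion unfolding symbol_expansion_def by blast
  then have "\<forall>t>0. \<forall>\<xi>. \<xi> \<noteq> 0 \<longrightarrow> r 0 (t *\<^sub>R \<xi>) = (complex_of_real t powr (- of_nat CARD('n) - of_nat 0)) *\<^sub>C r 0 \<xi>"
    unfolding homogeneous_symbols_def by blast
  moreover have "?\<omega> \<noteq> 0" using assms by simp
  ultimately have "r 0 (?t *\<^sub>R ?\<omega>) = (complex_of_real ?t powr (- of_nat CARD('n) - of_nat 0)) *\<^sub>C r 0 ?\<omega>"
    using t by blast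
  then have "r 0 (?t *\<^sub>R ?\<omega>) = (complex_of_real ?t powr (- of_nat CARD('n))) *\<^sub>C r 0 ?\<omega>"
    unfolding of_nat_0 diff_zero .
  moreover have "?t *\<^sub>R ?\<omega> = lattice_vec k" using t by simp
  moreover have "complex_of_real ?t powr (- of_nat CARD('n)) = of_real (weight k)"
    using t assms unfolding powr_minus by (subst powr_nat') (auto simp: weight_def divide_inverse)
  ultimately show ?thesis by simp
qed

lemma remainder_bound:
  "\<exists>C. \<forall>\<xi>. 1 \<le> norm \<xi> \<longrightarrow> torus_seminorm \<theta> \<alpha> (\<rho> \<xi> - r 0 \<xi>) \<le> C / norm \<xi> ^ Suc CARD('n)"
proof -
  have "\<forall>N \<alpha> \<beta>. \<exists>C. \<forall>\<xi>. 1 \<le> norm \<xi> \<longrightarrow>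
       torus_seminorm \<theta> \<alpha>
         (multi_iterate (partial_deriv \<theta>) \<beta> (\<lambda>\<eta>. \<rho> \<eta> - (\<Sum>j<N. r j \<eta>)) \<xi>)
       \<le> C * norm \<xi> powr (Re (- of_nat CARD('n)) - real N - real (\<Sum>i\<in>UNIV. \<beta> i))"
    using expansion unfolding symbol_expansion_def by blast
  \<comment> \<open>One term of the expansion and no derivative in \<xi>: only the leading symbol
    and a gain of one power are used.\<close>
  from this[THEN spec[of _ 1], THEN spec[of _ \<alpha>], THEN spec[of _ "\<lambda>_. 0"]]
  obtain C where C: "\<forall>\<xi>. 1 \<le> norm \<xi> \<longrightarrow>
       torus_seminorm \<theta> \<alpha> (multi_iterate (partial_deriv \<theta>) (\<lambda>_. 0) (\<lambda>\<eta>. \<rho> \<eta> - (\<Sum>j<1. r j \<eta>)) \<xi>)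
       \<le> C * norm \<xi> powr (Re (- of_nat CARD('n)) - real 1 - real (\<Sum>i\<in>(UNIV :: 'n set). 0))" by (rule exE)
  have m0: "multi_iterate (partial_deriv \<theta>) (\<lambda>_. 0) g = g" for g
  proof -
    have "foldr (\<lambda>j. partial_deriv \<theta> j ^^ 0) xs g = g" for xs by (induction xs) auto
    then show ?thesis by (simp add: multi_iterate_def)
  qed
  have "torus_seminorm \<theta> \<alpha> (\<rho> \<xi> - r 0 \<xi>) \<le> C / norm \<xi> ^ Suc CARD('n)" if "1 \<le> norm \<xi>" for \<xi>
  proof -
    have "norm \<xi> powr (Re (- of_nat CARD('n)) - real 1 - real (\<Sum>i\<in>(UNIV :: 'n set). 0)) = norm \<xi> powr (- real (Suc CARD('n)))"
      by (rule arg_cong[where f = "\<lambda>z. norm \<xi> powr z"]) simp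
    also have "\<dots> = 1 / norm \<xi> ^ Suc CARD('n)"
      using that by (subst powr_minus, subst powr_realpow) (auto simp: divide_inverse)
    finally have pw: "norm \<xi> powr (Re (- of_nat CARD('n)) - real 1 - real (\<Sum>i\<in>(UNIV :: 'n set). 0)) = 1 / norm \<xi> ^ Suc CARD('n)" .
    have "(\<Sum>j<1. r j \<xi>) = r 0 \<xi>" by simp
    then show ?thesis using C[rule_format, OF that] unfolding m0 pw by (simp only: times_divide_eq_right mult_1_right)
  qed
  then show ?thesis by blast
qed

lemma seminorm_leading_continuous: "continuous_on (sphere 0 1) (\<lambda>x. torus_seminorm \<theta> \<alpha> (r 0 x))"
  unfolding continuous_on_def
proof
  fix \<xi> :: "'n rvec" assume "\<xi> \<in> sphere 0 1"
  then have xi: "\<xi> \<noteq> 0" by auto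
  have "((\<lambda>x. torus_seminorm \<theta> \<alpha> (r 0 x - r 0 \<xi>)) \<longlongrightarrow> 0) (at \<xi>)"
    using leading_continuous[OF xi] by (simp add: frechet_tendsto_def)
  moreover have "\<forall>\<^sub>F x in at \<xi>. norm (torus_seminorm \<theta> \<alpha> (r 0 x) - torus_seminorm \<theta> \<alpha> (r 0 \<xi>)) \<le> torus_seminorm \<theta> \<alpha> (r 0 x - r 0 \<xi>)"
  proof (rule eventually_mono)
    have "((\<lambda>x. x) \<longlongrightarrow> \<xi>) (at \<xi>)" by (rule tendsto_ident_at)
    then show "\<forall>\<^sub>F x in at \<xi>. x \<noteq> 0" using xi by (rule tendsto_imp_eventually_ne)
    fix x :: "'n rvec" assume "x \<noteq> 0"
    note s = leading_smooth[OF this] leading_smooth[OF xi]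
    have "torus_seminorm \<theta> \<alpha> (r 0 \<xi> - r 0 x) = torus_seminorm \<theta> \<alpha> (r 0 x - r 0 \<xi>)"
      using seminorm_scaleC[OF smooth_diff[OF s], of \<alpha> "-1"] by (simp add: scaleC_blinfun_minus_one)
    then show "norm (torus_seminorm \<theta> \<alpha> (r 0 x) - torus_seminorm \<theta> \<alpha> (r 0 \<xi>)) \<le> torus_seminorm \<theta> \<alpha> (r 0 x - r 0 \<xi>)"
      using seminorm_add_le[OF smooth_diff[OF s] s(2), of \<alpha>] seminorm_add_le[OF smooth_diff[OF s(2) s(1)] s(1), of \<alpha>]
      by (simp add: abs_le_iff)
  qed
  ultimately have "((\<lambda>x. torus_seminorm \<theta> \<alpha> (r 0 x) - torus_seminorm \<theta> \<alpha> (r 0 \<xi>)) \<longlongrightarrow> 0) (at \<xi>)"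
    by (rule Lim_null_comparison[rotated])
  then have "((\<lambda>x. torus_seminorm \<theta> \<alpha> (r 0 x)) \<longlongrightarrow> torus_seminorm \<theta> \<alpha> (r 0 \<xi>)) (at \<xi>)"
    by (rule LIM_zero_cancel)
  then show "((\<lambda>x. torus_seminorm \<theta> \<alpha> (r 0 x)) \<longlongrightarrow> torus_seminorm \<theta> \<alpha> (r 0 \<xi>)) (at \<xi> within sphere 0 1)"
    by (rule tendsto_within_subset) simp
qed

lemma leading_norm_continuous: "continuous_on (sphere 0 1) (r 0)"
  unfolding continuous_on_def
proof
  fix \<xi> :: "'n rvec" assume "\<xi> \<in> sphere 0 1"
  then have "\<xi> \<noteq> 0" by auto
  have "((\<lambda>x. torus_seminorm \<theta> (\<lambda>_. 0) (r 0 x - r 0 \<xi>)) \<longlongrightarrow> 0) (at \<xi>)"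
    using leading_continuous[OF \<open>\<xi> \<noteq> 0\<close>] unfolding frechet_tendsto_def by (rule spec)
  then have "((\<lambda>x. norm (r 0 x - r 0 \<xi>)) \<longlongrightarrow> 0) (at \<xi>)"
    unfolding seminorm_0 .
  then have "(r 0 \<longlongrightarrow> r 0 \<xi>) (at \<xi>)"
    by (rule LIM_zero_cancel[OF tendsto_norm_zero_cancel])
  then show "(r 0 \<longlongrightarrow> r 0 \<xi>) (at \<xi> within sphere 0 1)"
    by (rule tendsto_within_subset) simp
qed

lemma coeff_leading_continuous: "continuous_on (sphere 0 1) (\<lambda>x. coeff l (r 0 x))"
  by (rule continuous_on_compose2[OF linear_continuous_on[OF bounded_linear_coeff] leading_norm_continuous, of UNIV]) simp

lemma decay_leading: "\<exists>B. \<forall>x. norm x = 1 \<longrightarrow> decay_norm N (r 0 x) \<le> B"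
proof -
  have "continuous_on (sphere 0 1) (\<lambda>x. decay_norm N (r 0 x))"
    unfolding decay_norm_def seminorm_0[symmetric] by (intro continuous_intros seminorm_leading_continuous)
  from bounded_on_sphere[OF this] show ?thesis by (meson abs_le_D1)
qed

lemma decay_remainder:
  "\<exists>C. 0 \<le> C \<and> (\<forall>\<xi>. 1 \<le> norm \<xi> \<longrightarrow> decay_norm N (\<rho> \<xi> - r 0 \<xi>) \<le> C / norm \<xi> ^ Suc CARD('n))"
proof -
  have "\<forall>\<alpha>. \<exists>C. \<forall>\<xi>. 1 \<le> norm \<xi> \<longrightarrow> torus_seminorm \<theta> \<alpha> (\<rho> \<xi> - r 0 \<xi>) \<le> C / norm \<xi> ^ Suc CARD('n)"
    using remainder_bound by blast
  then obtain C where C: "\<And>\<alpha> \<xi>. 1 \<le> norm \<xi> \<Longrightarrow> torus_seminorm \<theta> \<alpha> (\<rho> \<xi> - r 0 \<xi>) \<le> C \<alpha> / norm \<xi> ^ Suc CARD('n)"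
    by metis
  define D where "D = C (\<lambda>_. 0) + (\<Sum>j\<in>UNIV. C (\<lambda>i. if i = j then N else 0))"
  have "decay_norm N (\<rho> \<xi> - r 0 \<xi>) \<le> \<bar>D\<bar> / norm \<xi> ^ Suc CARD('n)" if "1 \<le> norm \<xi>" for \<xi>
  proof -
    have "decay_norm N (\<rho> \<xi> - r 0 \<xi>) \<le> C (\<lambda>_. 0) / norm \<xi> ^ Suc CARD('n) + (\<Sum>j\<in>UNIV. C (\<lambda>i. if i = j then N else 0) / norm \<xi> ^ Suc CARD('n))"
      unfolding decay_norm_def seminorm_0[symmetric] by (intro add_mono sum_mono C that)
    also have "\<dots> = D / norm \<xi> ^ Suc CARD('n)"
      by (simp only: D_def add_divide_distrib sum_divide_distrib)
    also have "\<dots> \<le> \<bar>D\<bar> / norm \<xi> ^ Suc CARD('n)" by (intro divide_right_mono) auto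
    finally show ?thesis .
  qed
  then show ?thesis by (intro exI[of _ "\<bar>D\<bar>"]) simp
qed

text \<open>Away from the origin the leading part is \<open>weight k\<close> times a value on the
  sphere, bounded by continuity, and the remainder is smaller by a further power. The value at
  \<open>k = 0\<close> enters through the maximum \<open>E\<close>.\<close>

lemma decay_symbol: "\<exists>C. \<forall>k. decay_norm N (\<rho> (lattice_vec k)) \<le> C * weight k"
proof -
  obtain B where B: "\<forall>x. norm x = 1 \<longrightarrow> decay_norm N (r 0 x) \<le> B" using decay_leading by (rule exE)
  obtain C where C: "0 \<le> C" "\<forall>\<xi>. 1 \<le> norm \<xi> \<longrightarrow> decay_norm N (\<rho> \<xi> - r 0 \<xi>) \<le> C / norm \<xi> ^ Suc CARD('n)"
    using decay_remainder[of N] by blast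
  define E where "E = max (decay_norm N (\<rho> 0)) (C + B)"
  have "decay_norm N (\<rho> (lattice_vec k)) \<le> E * weight k" for k
  proof (cases "k = 0")
    case True
    then show ?thesis by (simp add: E_def weight_def)
  next
    case False
    let ?k = "lattice_vec k"
    have k1: "1 \<le> norm ?k" by (rule norm_lattice_vec_ge_1[OF False])
    have nz: "?k \<noteq> 0" "?k /\<^sub>R norm ?k \<noteq> 0" using False by auto
    have "decay_norm N (\<rho> ?k) = decay_norm N ((\<rho> ?k - r 0 ?k) + r 0 ?k)" by simp
    also have "\<dots> \<le> decay_norm N (\<rho> ?k - r 0 ?k) + decay_norm N (r 0 ?k)"
      by (intro decay_norm_add_le smooth_diff symbol_smooth leading_smooth nz)
    also have "decay_norm N (r 0 ?k) = weight k * decay_norm N (r 0 (?k /\<^sub>R norm ?k))"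
      using weight_pos[of k] decay_norm_scaleC[OF leading_smooth[OF nz(2)], of N "of_real (weight k)"]
      by (simp add: leading_homogeneous[OF False])
    also have "\<dots> \<le> weight k * B"
      using spec[OF B, of "?k /\<^sub>R norm ?k"] False weight_pos[of k] by (intro mult_left_mono) auto
    also have "decay_norm N (\<rho> ?k - r 0 ?k) \<le> C * weight k"
    proof -
      have "C / norm ?k ^ Suc CARD('n) \<le> C / norm ?k ^ CARD('n)"
        using k1 C(1) by (intro divide_left_mono power_increasing) (auto intro!: mult_pos_pos zero_less_power)
      then show ?thesis using C(2) k1 False by (fastforce simp: weight_def)
    qed
    finally have "decay_norm N (\<rho> ?k) \<le> (C + B) * weight k" by (simp add: algebra_simps)
    also have "\<dots> \<le> E * weight k" using weight_pos[of k] by (intro mult_right_mono) (auto simp: E_def)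
    finally show ?thesis by simp
  qed
  then show ?thesis by blast
qed

text \<open>Division by the eigenvalue of \<open>D\<close> turns the Fourier coefficients of the
  symbol, of order -n, into bounded multipliers.\<close>

definition w :: "'n ivec \<Rightarrow> 'n ivec \<Rightarrow> complex" where
  "w l k = coeff l (\<rho> (lattice_vec k)) / of_real (weight k)"

lemma w_decay: "\<exists>C. \<forall>l k. (1 + norm (lattice_vec l)) ^ N * cmod (w l k) \<le> C"
proof -
  obtain C where C: "\<forall>k. decay_norm N (\<rho> (lattice_vec k)) \<le> C * weight k" using decay_symbol by (rule exE)
  have "(1 + norm (lattice_vec l)) ^ N * cmod (w l k) \<le> (2 * real CARD('n)) ^ N * C" for l k
  proof -
    have "(1 + norm (lattice_vec l)) ^ N * cmod (coeff l (\<rho> (lattice_vec k))) \<le> (2 * real CARD('n)) ^ N * (C * weight k)"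
      using coeff_decay[OF symbol_smooth[of "lattice_vec k"], of l N] spec[OF C, of k]
      by (rule order_trans[OF _ mult_left_mono]) simp
    then show ?thesis using weight_pos[of k]
      by (simp add: w_def norm_divide field_simps)
  qed
  then show ?thesis by blast
qed

section \<open>The operator as a norm convergent sum times \<open>D\<close>\<close>

definition D :: "'h \<Rightarrow>\<^sub>L 'h" where
  "D = diag (\<lambda>k. of_real (weight k))"

definition Q :: "'n ivec \<Rightarrow> 'h \<Rightarrow>\<^sub>L 'h" where
  "Q l = L (U l) o\<^sub>L diag (w l)"

lemma bounded_weight: "bounded (range (\<lambda>k :: 'n ivec. complex_of_real (weight k)))"
  by (auto simp: bounded_iff abs_of_pos[OF weight_pos] weight_le_1 intro!: exI[of _ 1])

lemma bounded_w: "bounded (range (w l))"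
proof -
  obtain C where "\<forall>l k. (1 + norm (lattice_vec l)) ^ 0 * cmod (w l k) \<le> C" using w_decay by (rule exE)
  then show ?thesis by (auto simp: bounded_iff)
qed

lemma Q_complex: "Q l \<in> complex_ops"
  unfolding Q_def by (intro complex_ops_compose left_mult_complex diag_complex bounded_w U_in_A)

lemma Q_abs_summable: "(\<lambda>l. norm (Q l)) summable_on UNIV"
proof -
  obtain C where C: "\<forall>l k. (1 + norm (lattice_vec l)) ^ (2 * CARD('n)) * cmod (w l k) \<le> C" using w_decay by (rule exE)
  show ?thesis
  proof (rule summable_on_decay)
    fix l :: "'n ivec"
    have p: "0 < (1 + norm (lattice_vec l)) ^ (2 * CARD('n))" by (simp add: add_pos_nonneg)
    have "cmod (w l k) \<le> C / (1 + norm (lattice_vec l)) ^ (2 * CARD('n))" for k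
      using C p by (simp add: pos_le_divide_eq mult.commute)
    then have "norm (diag (w l)) \<le> C / (1 + norm (lattice_vec l)) ^ (2 * CARD('n))"
      by (rule norm_diag_le)
    moreover have "norm (L (U l)) \<le> 1"
      using norm_left_mult_le[OF U_in_A, of l] norm_U_le[of l] by simp
    ultimately have "norm (Q l) \<le> 1 * (C / (1 + norm (lattice_vec l)) ^ (2 * CARD('n)))"
      unfolding Q_def by (intro order_trans[OF norm_blinfun_compose] mult_mono) auto
    then show "(1 + norm (lattice_vec l)) ^ (2 * CARD('n)) * norm (Q l) \<le> C"
      using p by (simp add: field_simps)
  qed
qed

definition B :: "'h \<Rightarrow>\<^sub>L 'h" where
  "B = infsum Q UNIV"

lemma Q_has_sum: "(Q has_sum B) UNIV"
  unfolding B_def by (rule has_sum_infsum, rule abs_summable_summable, rule Q_abs_summable)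

lemma B_complex: "B \<in> complex_ops"
  unfolding B_def by (rule complex_ops_infsum[OF Q_complex abs_summable_summable[OF Q_abs_summable]])

lemma BD_e: "blinfun_apply (B o\<^sub>L D) (e k) = \<iota> (\<rho> (lattice_vec k) o\<^sub>L U k)"
proof -
  have "blinfun_apply (Q l) (blinfun_apply D (e k)) = \<iota> ((coeff l (\<rho> (lattice_vec k)) *\<^sub>C U l) o\<^sub>L U k)" for l
    using weight_pos[of k]
    by (simp add: Q_def D_def diag_e[OF bounded_weight] diag_e[OF bounded_w]
        complex_opsD[OF diag_complex[OF bounded_w]] complex_opsD[OF left_mult_complex[OF U_in_A]] left_mult_iota scaleC_scaleC w_def scaleC_compose_left iota_scaleC A_compose)
  moreover have "((\<lambda>l. blinfun_apply (Q l) (blinfun_apply D (e k))) has_sum blinfun_apply B (blinfun_apply D (e k))) UNIV"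
    by (rule has_sum_bounded_linear[OF blinfun.bounded_linear_left Q_has_sum])
  moreover have "((\<lambda>l. \<iota> ((coeff l (\<rho> (lattice_vec k)) *\<^sub>C U l) o\<^sub>L U k)) has_sum \<iota> (\<rho> (lattice_vec k) o\<^sub>L U k)) UNIV"
    by (rule has_sum_iota[OF has_sum_bounded_linear[OF ocomp.bounded_linear_left smooth_has_sum[OF symbol_smooth]]])
      (intro A_compose A_scaleC U_in_A)
  ultimately show ?thesis
    using has_sum_unique by simp
qed

lemma norm_symbol_bound: "\<exists>C. \<forall>k. norm (\<rho> (lattice_vec k)) \<le> C"
proof -
  obtain C where C: "\<forall>k. decay_norm 0 (\<rho> (lattice_vec k)) \<le> C * weight k" using decay_symbol by (rule exE)
  have "norm (\<rho> (lattice_vec k)) \<le> \<bar>C\<bar>" for k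
  proof -
    have "norm (\<rho> (lattice_vec k)) \<le> decay_norm 0 (\<rho> (lattice_vec k))"
      by (simp add: decay_norm_def torus_seminorm_def sum_nonneg)
    also have "\<dots> \<le> \<bar>C\<bar> * weight k"
      using spec[OF C, of k] mult_right_mono[OF abs_ge_self[of C] less_imp_le[OF weight_pos[of k]]] by linarith
    also have "\<dots> \<le> \<bar>C\<bar>" using weight_le_1[of k] by (simp add: mult_left_le)
    finally show ?thesis .
  qed
  then show ?thesis by blast
qed

text \<open>By \<open>BD_e\<close> the operator \<open>B D\<close> acts on each \<open>e k\<close>
  as the quantization prescribes. A smooth \<open>u\<close> is the sum of its Fourier terms, and
  both \<open>B D\<close> and the quantization series pass through that sum.\<close>

lemma bounded_extension_eq: "bounded_extension \<theta> \<iota> P = B o\<^sub>L D"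
  unfolding bounded_extension_def
proof (rule the_equality)
  show BD: "\<forall>u\<in>smooth. blinfun_apply (B o\<^sub>L D) (\<iota> u) = \<iota> (P u)"
  proof
    fix u assume u: "u \<in> smooth"
    define f where "f k = coeff k u *\<^sub>C (\<rho> (lattice_vec k) o\<^sub>L U k)" for k
    have BDc: "B o\<^sub>L D \<in> complex_ops"
      unfolding D_def by (intro complex_ops_compose B_complex diag_complex bounded_weight)
    obtain C where C: "\<forall>k. norm (\<rho> (lattice_vec k)) \<le> C" using norm_symbol_bound by (rule exE)
    have fA: "f k \<in> A" for k
      unfolding f_def by (intro A_scaleC A_compose smooth_subset_A symbol_smooth U_in_A)
    \<comment> \<open>Absolute convergence: it guarantees that the \<open>infsum\<close> in
      \<open>is_quantization\<close> is a genuine sum and not the default value 0.\<close>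
    have "(\<lambda>k. norm (f k)) summable_on UNIV"
    proof (rule summable_on_comparison_test)
      show "(\<lambda>k. cmod (coeff k u) * C) summable_on UNIV"
        by (intro summable_on_cmult_left smooth_summable u)
      fix k :: "'n ivec"
      have "norm (\<rho> (lattice_vec k) o\<^sub>L U k) \<le> C * 1"
        using spec[OF C, of k] norm_U_le[of k]
        by (intro order_trans[OF norm_blinfun_compose] mult_mono) (auto intro: order_trans[OF norm_ge_zero])
      then show "norm (f k) \<le> cmod (coeff k u) * C"
        by (simp add: f_def norm_scaleC_blinfun mult_left_mono)
    qed simp
    then have fs: "(f has_sum infsum f UNIV) UNIV"
      by (rule has_sum_infsum[OF abs_summable_summable])
    have "P u = infsum f UNIV"
      using quantization[unfolded is_quantization_def, rule_format, OF smoothD(1)[OF u]]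
      unfolding smoothD(2)[OF u] f_def .
    then have "((\<lambda>k. \<iota> (f k)) has_sum \<iota> (P u)) UNIV"
      using has_sum_iota[OF fs fA] by simp
    moreover have "((\<lambda>k. \<iota> (coeff k u *\<^sub>C U k)) has_sum \<iota> u) UNIV"
      by (rule has_sum_iota[OF smooth_has_sum[OF u]]) (intro A_scaleC U_in_A)
    from has_sum_bounded_linear[OF blinfun.bounded_linear_right this, of "B o\<^sub>L D"]
    have "((\<lambda>k. blinfun_apply (B o\<^sub>L D) (\<iota> (coeff k u *\<^sub>C U k))) has_sum blinfun_apply (B o\<^sub>L D) (\<iota> u)) UNIV" .
    moreover have "blinfun_apply (B o\<^sub>L D) (\<iota> (coeff k u *\<^sub>C U k)) = \<iota> (f k)" for k
      unfolding iota_scaleC[OF U_in_A] complex_opsD[OF BDc] BD_e f_def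
      by (rule iota_scaleC[symmetric]) (intro A_compose smooth_subset_A symbol_smooth U_in_A)
    ultimately show "blinfun_apply (B o\<^sub>L D) (\<iota> u) = \<iota> (P u)"
      using has_sum_unique by simp
  qed
  show "T = B o\<^sub>L D" if "\<forall>u\<in>smooth. blinfun_apply T (\<iota> u) = \<iota> (P u)" for T
    by (rule blinfun_eq_dense[OF iota_smooth_dense]) (use that BD in auto)
qed

lemma D_positive: "positive_op D"
  unfolding D_def
  by (intro diag_positive bounded_weight) (simp add: complex_nonneg_Reals_iff less_imp_le[OF weight_pos])

lemma D_weak_ideal: "D \<in> weak_ideal"
proof -
  obtain \<sigma> C where \<sigma>: "bij \<sigma>" "\<And>j. weight (\<sigma> j :: 'n ivec) \<le> C / (real j + 1)"
    using ex_weight_decay by blast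
  show ?thesis
    unfolding D_def using \<sigma>(2) by (intro diag_weak_ideal[OF \<sigma>(1), of _ C]) (simp add: abs_of_pos[OF weight_pos])
qed

lemma operator_weak_trace_class:
  assumes "a \<in> A"
  shows "L a o\<^sub>L bounded_extension \<theta> \<iota> P \<in> weak_trace_class"
  unfolding bounded_extension_eq
  using weak_ideal_subset_weak_trace_class weak_ideal_compose_left[OF weak_ideal_compose_left[OF D_weak_ideal B_complex] left_mult_complex[OF assms]]
  by blast

text \<open>The \<open>l\<close>-th Fourier coefficient of \<open>sphere_integral (r 0)\<close>
  divided by the dimension, since the integral is taken over the ball. It will be the trace of the
  \<open>l\<close>-th multiplier.\<close>

definition I :: "'n ivec \<Rightarrow> complex" where
  "I l = integral (cball 0 1) (\<lambda>x. coeff l (r 0 (x /\<^sub>R norm x)))"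

lemma leading_coeff_decay:
  "\<exists>C. \<forall>l x. norm x = 1 \<longrightarrow> (1 + norm (lattice_vec l)) ^ N * cmod (coeff l (r 0 x)) \<le> C"
proof -
  obtain C where C: "\<forall>x. norm x = 1 \<longrightarrow> decay_norm N (r 0 x) \<le> C" using decay_leading by (rule exE)
  have "(1 + norm (lattice_vec l)) ^ N * cmod (coeff l (r 0 x)) \<le> (2 * real CARD('n)) ^ N * C" if "norm x = 1" for l x
  proof -
    have "x \<noteq> 0" using that by auto
    from coeff_decay[OF leading_smooth[OF this], of l N] spec[OF C, of x] that show ?thesis
      by (elim order_trans) (auto intro!: mult_left_mono)
  qed
  then show ?thesis by blast
qed

lemma one_integrable: "(\<lambda>_. 1 :: real) integrable_on cball (0 :: 'n rvec) 1"
  using integrable_direction_real[of "\<lambda>_ :: 'n rvec. 1 :: real"] by simp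

lemma radial_integral:
  fixes f :: "'n rvec \<Rightarrow> 'b::real_normed_vector"
  shows "integral (cball 0 1) (radial f) = integral (cball 0 1) (\<lambda>x. f (x /\<^sub>R norm x))"
    and "radial f integrable_on cball 0 1 \<longleftrightarrow> (\<lambda>x. f (x /\<^sub>R norm x)) integrable_on cball 0 1"
proof -
  have eq: "radial f x = f (x /\<^sub>R norm x)" if "x \<in> cball 0 1 - {0}" for x
    using that by (simp add: radial_def)
  show "integral (cball 0 1) (radial f) = integral (cball 0 1) (\<lambda>x. f (x /\<^sub>R norm x))"
    by (rule integral_spike[OF negligible_sing[of 0]]) (simp add: eq)
  show "radial f integrable_on cball 0 1 \<longleftrightarrow> (\<lambda>x. f (x /\<^sub>R norm x)) integrable_on cball 0 1"
    by (rule integrable_spike_finite_eq[of "{0}"]) (simp_all add: eq)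
qed

lemma I_rapidly_decaying: "rapidly_decaying I"
  unfolding rapidly_decaying_def
proof
  fix N
  obtain C where C: "\<forall>l x. norm x = 1 \<longrightarrow> (1 + norm (lattice_vec l)) ^ N * cmod (coeff l (r 0 x)) \<le> C"
    using leading_coeff_decay by (rule exE)
  have "0 \<le> C"
  proof -
    obtain x :: "'n rvec" where "norm x = 1" using norm_axis_1 by blast
    then show ?thesis using C by (fastforce intro: order_trans[rotated])
  qed
  have "(1 + norm (lattice_vec l)) ^ N * cmod (I l) \<le> C * integral (cball (0 :: 'n rvec) 1) (\<lambda>_. 1)" for l
  proof -
    have p: "0 < (1 + norm (lattice_vec l)) ^ N" by (simp add: add_pos_nonneg)
    have "cmod (I l) \<le> integral (cball (0 :: 'n rvec) 1) (\<lambda>_. C / (1 + norm (lattice_vec l)) ^ N * 1)"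
      unfolding I_def radial_integral(1)[of "\<lambda>x. coeff l (r 0 x)", symmetric]
    proof (rule integral_norm_bound_integral)
      show "radial (\<lambda>x. coeff l (r 0 x)) integrable_on cball 0 1"
        unfolding radial_integral(2) by (rule integrable_direction[OF coeff_leading_continuous])
      show "(\<lambda>_. C / (1 + norm (lattice_vec l)) ^ N * 1) integrable_on cball (0 :: 'n rvec) 1"
        by (intro integrable_on_mult_right one_integrable)
      show "norm (radial (\<lambda>x. coeff l (r 0 x)) x) \<le> C / (1 + norm (lattice_vec l)) ^ N * 1" for x
      proof (cases "x = 0")
        case False
        then have "norm (x /\<^sub>R norm x) = 1" by simp
        with C have "(1 + norm (lattice_vec l)) ^ N * cmod (coeff l (r 0 (x /\<^sub>R norm x))) \<le> C" by blast
        then show ?thesis using False p by (simp add: radial_def field_simps)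
      qed (use \<open>0 \<le> C\<close> p in \<open>simp add: radial_def\<close>)
    qed
    also have "\<dots> = C / (1 + norm (lattice_vec l)) ^ N * integral (cball (0 :: 'n rvec) 1) (\<lambda>_. 1)"
      by (rule Henstock_Kurzweil_Integration.integral_mult_right)
    finally show ?thesis using p by (simp add: field_simps)
  qed
  then show "\<exists>C. \<forall>k. (1 + norm (lattice_vec k)) ^ N * cmod (I k) \<le> C" by blast
qed

text \<open>The Fourier coefficients of \<open>r 0\<close> on the sphere have a summable majorant
  \<open>c\<close> that does not depend on the point. The Fourier series therefore converges
  uniformly in norm and may be integrated term by term.\<close>

lemma integral_leading: "integral (cball 0 1) (\<lambda>x. r 0 (x /\<^sub>R norm x)) = torus_series \<theta> I"
proof -
  obtain C where C: "\<forall>l x. norm x = 1 \<longrightarrow> (1 + norm (lattice_vec l)) ^ (2 * CARD('n)) * cmod (coeff l (r 0 x)) \<le> C"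
    using leading_coeff_decay by (rule exE)
  define c where "c l = C / (1 + norm (lattice_vec l)) ^ (2 * CARD('n))" for l :: "'n ivec"
  have p: "0 < (1 + norm (lattice_vec l)) ^ (2 * CARD('n))" for l :: "'n ivec" by (simp add: add_pos_nonneg)
  have "0 \<le> C"
  proof -
    obtain x :: "'n rvec" where "norm x = 1" using norm_axis_1 by blast
    then show ?thesis using C by (fastforce intro: order_trans[rotated])
  qed
  have c0: "0 \<le> c l" for l using \<open>0 \<le> C\<close> p[of l] by (simp add: c_def)
  have "(\<lambda>l. norm (c l)) summable_on UNIV"
    by (rule summable_on_decay[of c "C"]) (use p \<open>0 \<le> C\<close> in \<open>simp add: c_def less_imp_neq[symmetric]\<close>)
  then have c_sum: "c summable_on UNIV" using c0 by simp
  define f where "f F x = (\<Sum>l\<in>F. radial (\<lambda>x. coeff l (r 0 x)) x *\<^sub>C U l)" for F and x :: "'n rvec"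
  have term_int: "(\<lambda>x. radial (\<lambda>x. coeff l (r 0 x)) x *\<^sub>C U l) integrable_on cball 0 1"
    and term_integral: "integral (cball 0 1) (\<lambda>x. radial (\<lambda>x. coeff l (r 0 x)) x *\<^sub>C U l) = I l *\<^sub>C U l" for l
  proof -
    have i: "radial (\<lambda>x. coeff l (r 0 x)) integrable_on cball 0 1"
      unfolding radial_integral(2) by (rule integrable_direction[OF coeff_leading_continuous])
    show "(\<lambda>x. radial (\<lambda>x. coeff l (r 0 x)) x *\<^sub>C U l) integrable_on cball 0 1"
      using integrable_linear[OF i scaleC_blinfun.bounded_linear_left[of "U l"]] by (simp add: comp_def)
    show "integral (cball 0 1) (\<lambda>x. radial (\<lambda>x. coeff l (r 0 x)) x *\<^sub>C U l) = I l *\<^sub>C U l"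
      using integral_linear[OF i scaleC_blinfun.bounded_linear_left[of "U l"]]
      by (simp add: comp_def I_def radial_integral(1)[of "\<lambda>x. coeff l (r 0 x)"])
  qed
  have coeff_le: "cmod (radial (\<lambda>x. coeff l (r 0 x)) x) \<le> c l" for l x
  proof (cases "x = 0")
    case False
    then have "norm (x /\<^sub>R norm x) = 1" by simp
    with C have "(1 + norm (lattice_vec l)) ^ (2 * CARD('n)) * cmod (coeff l (r 0 (x /\<^sub>R norm x))) \<le> C" by blast
    then show ?thesis using False p[of l] by (simp add: radial_def c_def field_simps)
  qed (simp add: radial_def c0)
  have series: "((\<lambda>l. radial (\<lambda>x. coeff l (r 0 x)) x *\<^sub>C U l) has_sum radial (r 0) x) UNIV" for x
  proof (cases "x = 0")
    case False
    then have "x /\<^sub>R norm x \<noteq> 0" by simp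
    from smooth_has_sum[OF leading_smooth[OF this]] show ?thesis using False by (simp add: radial_def)
  qed (simp add: radial_def scaleC_blinfun.zero_left)
  \<comment> \<open>The remainder after the terms in \<open>F\<close> is bounded by the tail of the
    majorant, which is the same for all \<open>x\<close>.\<close>
  have rest: "norm (f F x - radial (r 0) x) \<le> infsum c UNIV - sum c F" if "finite F" for F x
  proof -
    let ?g = "\<lambda>l. radial (\<lambda>x. coeff l (r 0 x)) x *\<^sub>C U l"
    have nle: "norm (?g l) \<le> c l" for l
      using coeff_le[of l x] norm_U_le[of l] by (simp add: norm_scaleC_blinfun) (meson mult_left_le norm_ge_zero order_trans)
    have s1: "(?g has_sum (radial (r 0) x - f F x)) (UNIV - F)"
      using has_sum_Diff[OF series[of x] has_sum_finite[OF that, of ?g]] by (simp add: f_def)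
    have s2: "(c has_sum (infsum c UNIV - sum c F)) (UNIV - F)"
      using has_sum_Diff[OF has_sum_infsum[OF c_sum] has_sum_finite[OF that, of c]] by simp
    have "norm (radial (r 0) x - f F x) \<le> infsum c UNIV - sum c F"
    proof -
      have ns: "(\<lambda>l. norm (?g l)) summable_on (UNIV - F)"
        by (rule summable_on_comparison_test[OF has_sum_imp_summable[OF s2] nle]) simp
      have "norm (radial (r 0) x - f F x) \<le> infsum (\<lambda>l. norm (?g l)) (UNIV - F)"
        using norm_infsum_bound[OF ns] infsumI[OF s1] by simp
      also have "\<dots> \<le> infsum c (UNIV - F)"
        by (rule infsum_mono[OF ns has_sum_imp_summable[OF s2] nle])
      finally show ?thesis by (simp add: infsumI[OF s2])
    qed
    then show ?thesis by (simp add: norm_minus_commute)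
  qed
  have conv: "\<forall>\<^sub>F F in finite_subsets_at_top UNIV. \<forall>x\<in>cball 0 1. norm (f F x - radial (r 0) x) \<le> \<epsilon>" if "0 < \<epsilon>" for \<epsilon>
  proof -
    have "\<forall>\<^sub>F F in finite_subsets_at_top UNIV. dist (sum c F) (infsum c UNIV) < \<epsilon>"
      using tendstoD[OF infsum_tendsto[OF c_sum] that] .
    moreover have "\<forall>\<^sub>F F in finite_subsets_at_top (UNIV :: 'n ivec set). finite F"
      by (rule eventually_finite_subsets_at_top_weakI) simp
    ultimately show ?thesis
    proof eventually_elim
      fix F assume F: "dist (sum c F) (infsum c UNIV) < \<epsilon>" "finite F"
      then show "\<forall>x\<in>cball 0 1. norm (f F x - radial (r 0) x) \<le> \<epsilon>"
        using F(1) by (intro ballI order_trans[OF rest[OF F(2)]]) (simp add: dist_real_def)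
    qed
  qed
  have sub: "cball (0 :: 'n rvec) 1 \<subseteq> cbox (- (\<chi> i. 1)) (\<chi> i. 1)"
  proof
    fix x :: "'n rvec" assume x: "x \<in> cball 0 1"
    have "\<bar>x $ i\<bar> \<le> 1" for i using component_le_norm_cart[of x i] x by simp
    then show "x \<in> cbox (- (\<chi> i. 1)) (\<chi> i. 1)" by (simp add: mem_box_cart abs_le_iff minus_le_iff)
  qed
  have fint: "f F integrable_on cball 0 1" for F
    unfolding f_def[abs_def]
    by (cases "finite F") (auto intro!: integrable_sum term_int integrable_0)
  have fintegral: "integral (cball 0 1) (f F) = (\<Sum>l\<in>F. I l *\<^sub>C U l)" if "finite F" for F
    unfolding f_def[abs_def] using that
    by (simp add: Henstock_Kurzweil_Integration.integral_sum term_int term_integral)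
  have "((\<lambda>F. integral (cball 0 1) (f F)) \<longlongrightarrow> integral (cball 0 1) (radial (r 0))) (finite_subsets_at_top UNIV)"
    by (rule uniform_limit_integral_on(2)[OF sub one_integrable _ fint conv]) simp
  moreover have "\<forall>\<^sub>F F in finite_subsets_at_top UNIV. integral (cball 0 1) (f F) = (\<Sum>l\<in>F. I l *\<^sub>C U l)"
    by (rule eventually_finite_subsets_at_top_weakI) (rule fintegral)
  ultimately have "((\<lambda>F. \<Sum>l\<in>F. I l *\<^sub>C U l) \<longlongrightarrow> integral (cball 0 1) (radial (r 0))) (finite_subsets_at_top UNIV)"
    by (rule Lim_transform_eventually)
  then have "((\<lambda>l. I l *\<^sub>C U l) has_sum integral (cball 0 1) (radial (r 0))) UNIV"
    by (simp add: has_sum_def)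
  then have "integral (cball 0 1) (radial (r 0)) = torus_series \<theta> I"
    using series_has_sum[OF rapidly_decaying_summable[OF I_rapidly_decaying]] by (rule has_sum_unique)
  then show ?thesis by (simp add: radial_integral(1))
qed

lemma sphere_integral_leading:
  "sphere_integral (r 0) = of_real (real CARD('n)) *\<^sub>C torus_series \<theta> I"
  by (simp only: sphere_integral_def integral_leading scaleC_blinfun_of_real)

lemma sphere_integral_smooth: "sphere_integral (r 0) \<in> smooth"
  unfolding sphere_integral_leading by (intro smooth_scaleC smoothI I_rapidly_decaying)

text \<open>The diagonal unitary \<open>V\<close> implementing the character \<open>ch\<close> with \<open>ch(m) = -1\<close> anticommutes
  with \<open>U\<^sup>m\<close> and commutes with diagonal operators.\<close>

lemma trace_off_diagonal:
  assumes "nc_trace \<phi>" "m \<noteq> 0" "bounded (range b)" "diag b \<in> weak_ideal"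
  shows "\<phi> (L (U m) o\<^sub>L diag b) = 0"
proof -
  interpret nc_trace \<phi> by fact
  let ?s = "lattice_vec m \<bullet> lattice_vec m"
  define ch where "ch k = exp (\<i> * of_real (pi * (lattice_vec k \<bullet> lattice_vec m) / ?s))" for k
  have unit: "cmod (ch k) = 1" for k by (simp add: ch_def)
  have bc: "bounded (range ch)" "bounded (range (\<lambda>k. cnj (ch k)))" by (auto simp: bounded_iff unit)
  have mult: "ch (m + k) = - ch k" for k
  proof -
    have "pi * (lattice_vec (m + k) \<bullet> lattice_vec m) / ?s = pi + pi * (lattice_vec k \<bullet> lattice_vec m) / ?s"
      using \<open>m \<noteq> 0\<close> by (simp add: lattice_vec_add inner_add_left field_simps)
    then have "ch (m + k) = exp (\<i> * of_real pi + \<i> * of_real (pi * (lattice_vec k \<bullet> lattice_vec m) / ?s))"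
      unfolding ch_def by (simp only: of_real_add distrib_left)
    then show ?thesis unfolding exp_add ch_def by simp
  qed
  have inv: "ch k * cnj (ch k) = 1" for k using complex_norm_square[of "ch k"] by (simp add: unit)
  define V where "V = diag ch"
  define V' where "V' = diag (\<lambda>k. cnj (ch k))"
  define T where "T = L (U m) o\<^sub>L diag b"
  have VC: "V \<in> complex_ops" "V' \<in> complex_ops" using bc by (simp_all add: V_def V'_def diag_complex)
  have TC: "T \<in> complex_ops" unfolding T_def by (intro complex_ops_compose left_mult_complex diag_complex assms U_in_A)
  have TW: "T \<in> weak_ideal" unfolding T_def by (intro weak_ideal_compose_left left_mult_complex assms U_in_A)
  have V'V: "V' o\<^sub>L V = id_blinfun"
    using VC inv by (intro ops_eqI complex_ops_compose complex_ops_id)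
      (simp_all add: V_def V'_def diag_e bc complex_opsD[OF diag_complex] scaleC_scaleC)
  have "V o\<^sub>L (T o\<^sub>L V') = - T"
  proof (rule ops_eqI)
    fix k
    obtain c where c: "blinfun_apply (L (U m)) (e k) = c *\<^sub>C e (m + k)" using left_mult_U_e by blast
    show "blinfun_apply (V o\<^sub>L (T o\<^sub>L V')) (e k) = blinfun_apply (- T) (e k)"
      using inv[of k]
      by (simp add: V_def V'_def T_def diag_e bc assms c complex_opsD diag_complex left_mult_complex
          scaleC_scaleC mult blinfun.minus_left scaleC.minus_left[symmetric] mult.assoc mult.commute mult.left_commute)
  qed (use VC TC in auto)
  then have "- \<phi> T = \<phi> (V o\<^sub>L (T o\<^sub>L V'))" by (simp add: tr_uminus TW)
  also have "\<dots> = \<phi> ((T o\<^sub>L V') o\<^sub>L V)"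
    by (rule tr_comm[OF VC(1) weak_ideal_compose_right[OF TW VC(2)]])
  also have "\<dots> = \<phi> T" by (simp add: blinfun_compose_assoc' V'V)
  finally show ?thesis unfolding T_def by simp
qed

text \<open>Both sides are linear and norm continuous in \<open>a\<close>, the left one by
  \<open>tr_compose_bound\<close>, so monomials suffice. Off-diagonal ones have trace zero on both
  sides, and \<open>U 0\<close> is the identity.\<close>

lemma trace_left_mult_diag:
  assumes \<phi>: "nc_trace \<phi>" and b: "bounded (range b)" and a: "a \<in> A"
  shows "\<phi> ((L a o\<^sub>L diag b) o\<^sub>L D) = tau a * \<phi> (diag b o\<^sub>L D)"
proof -
  interpret nc_trace \<phi> by (rule \<phi>)
  have bD: "diag b o\<^sub>L D \<in> weak_ideal"
    by (rule weak_ideal_compose_left[OF D_weak_ideal diag_complex[OF b]])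
  have dia: "diag b o\<^sub>L D = diag (\<lambda>k. b k * of_real (weight k))"
    unfolding D_def by (rule diag_compose[OF b bounded_weight])
  define \<Phi> where "\<Phi> x = \<phi> ((L x o\<^sub>L diag b) o\<^sub>L D)" for x
  have W: "(L x o\<^sub>L diag b) o\<^sub>L D \<in> weak_ideal" if "x \<in> A" for x
    by (intro weak_ideal_compose_left D_weak_ideal complex_ops_compose left_mult_complex diag_complex b that)
  have add: "\<Phi> (x + y) = \<Phi> x + \<Phi> y" if "x \<in> A" "y \<in> A" for x y
    unfolding \<Phi>_def using that W by (simp add: left_mult_add ocomp.add_left tr_add)
  have scale: "\<Phi> (c *\<^sub>C x) = c * \<Phi> x" if "x \<in> A" for c x
    unfolding \<Phi>_def using that W by (simp add: left_mult_scaleC scaleC_compose_left tr_scaleC)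
  have diff: "\<Phi> (x - y) = \<Phi> x - \<Phi> y" if "x \<in> A" "y \<in> A" for x y
    unfolding \<Phi>_def using that W by (simp add: left_mult_diff ocomp.diff_left tr_diff)
  have bound: "cmod (\<Phi> x) \<le> norm x * (8 * norm (diag b) * Re (\<phi> D))" if "x \<in> A" for x
  proof -
    have "cmod (\<Phi> x) \<le> 8 * norm (L x o\<^sub>L diag b) * Re (\<phi> D)"
      unfolding \<Phi>_def
      by (intro tr_compose_bound D_weak_ideal D_positive complex_ops_compose left_mult_complex diag_complex b that)
    also have "\<dots> \<le> 8 * (norm x * norm (diag b)) * Re (\<phi> D)"
    proof (intro mult_right_mono mult_left_mono)
      show "norm (L x o\<^sub>L diag b) \<le> norm x * norm (diag b)"
        using norm_left_mult_le[OF that] by (intro order_trans[OF norm_blinfun_compose] mult_right_mono) auto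
      show "0 \<le> Re (\<phi> D)" using tr_nonneg[OF D_weak_ideal D_positive] by (simp add: complex_nonneg_Reals_iff)
    qed simp
    finally show ?thesis by (simp add: mult.assoc mult.left_commute)
  qed
  have mono: "\<Phi> (U k) = tau (U k) * \<phi> (diag b o\<^sub>L D)" for k
  proof (cases "k = 0")
    case True
    then show ?thesis using tau_U[of 0] by (simp add: \<Phi>_def left_mult_id)
  next
    case False
    have "\<phi> (L (U k) o\<^sub>L diag (\<lambda>k. b k * of_real (weight k))) = 0"
      using bD unfolding dia by (intro trace_off_diagonal \<phi> False bounded_range_mult b bounded_weight)
    then show ?thesis using False by (simp add: \<Phi>_def blinfun_compose_assoc' dia tau_U)
  qed
  have trig: "\<Phi> x = tau x * \<phi> (diag b o\<^sub>L D)" if "x \<in> trig" for x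
    using that
  proof induction
    case (monomial c k)
    then show ?case by (simp add: scale mono tau_scaleC)
  next
    case (add S T)
    then have "S \<in> A" "T \<in> A" using trig_subset_A by auto
    with add show ?case
      using linear_add[OF bounded_linear.linear[OF bounded_linear_tau], of S T]
      by (simp add: \<open>\<And>x y. x \<in> A \<Longrightarrow> y \<in> A \<Longrightarrow> \<Phi> (x + y) = \<Phi> x + \<Phi> y\<close> ring_distribs)
  qed
  have "a \<in> closure trig" using a by (simp add: nc_torus_eq)
  then obtain s where s: "\<And>n. s n \<in> trig" "s \<longlonglongrightarrow> a" by (rule closure_trigE) (rule that)
  have sA: "s n \<in> A" for n using s(1) trig_subset_A by auto
  have "(\<lambda>n. \<Phi> (s n) - \<Phi> a) \<longlonglongrightarrow> 0"
  proof (rule Lim_null_comparison)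
    show "\<forall>\<^sub>F n in sequentially. norm (\<Phi> (s n) - \<Phi> a) \<le> norm (s n - a) * (8 * norm (diag b) * Re (\<phi> D))"
      using bound[OF A_diff[OF sA a]] by (simp add: diff sA a)
    show "(\<lambda>n. norm (s n - a) * (8 * norm (diag b) * Re (\<phi> D))) \<longlonglongrightarrow> 0"
      using s(2) by (intro tendsto_mult_left_zero tendsto_norm_zero LIM_zero)
  qed
  then have "(\<lambda>n. \<Phi> (s n)) \<longlonglongrightarrow> \<Phi> a" by (rule LIM_zero_cancel)
  moreover have "(\<lambda>n. \<Phi> (s n)) \<longlonglongrightarrow> tau a * \<phi> (diag b o\<^sub>L D)"
    unfolding trig[OF s(1)]
    by (intro tendsto_mult tendsto_const bounded_linear.tendsto[OF bounded_linear_tau s(2)])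
  ultimately have "\<Phi> a = tau a * \<phi> (diag b o\<^sub>L D)" by (rule LIMSEQ_unique)
  then show ?thesis by (simp add: \<Phi>_def)
qed

lemma trace_diag_symbol:
  assumes \<phi>: "nc_trace \<phi>"
  shows "\<phi> (diag (w l) o\<^sub>L D) = I l"
proof -
  interpret nc_trace \<phi> by (rule \<phi>)
  interpret multiplier_trace e \<phi> by unfold_locales
  define f where "f = homogeneous_diag (\<lambda>x. coeff l (r 0 x))"
  define g where "g k = coeff l (\<rho> (lattice_vec k))" for k
  have "w l k * of_real (weight k) = g k" for k using weight_pos[of k] by (simp add: w_def g_def)
  then have dia: "diag (w l) o\<^sub>L D = diag g"
    unfolding D_def diag_compose[OF bounded_w bounded_weight] by simp
  have f: "bounded (range f)" "diag f \<in> weak_ideal"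
    unfolding f_def by (intro bounded_homogeneous_diag weak_ideal_homogeneous_diag coeff_leading_continuous)+
  obtain C where C: "0 \<le> C" "\<forall>\<xi>. 1 \<le> norm \<xi> \<longrightarrow> decay_norm 0 (\<rho> \<xi> - r 0 \<xi>) \<le> C / norm \<xi> ^ Suc CARD('n)"
    using decay_remainder[of 0] by blast
  \<comment> \<open>The second entry of the maximum covers \<open>k = 0\<close>, where the
    homogeneous multiplier vanishes and the difference is \<open>g 0\<close>.\<close>
  define E where "E = max C (cmod (g 0))"
  have small: "cmod (g k - f k) \<le> E * (weight k / max 1 (norm (lattice_vec k)))" for k
  proof (cases "k = 0")
    case True
    then show ?thesis by (simp add: E_def f_def homogeneous_diag_def weight_def)
  next
    case False
    let ?k = "lattice_vec k"
    have k1: "1 \<le> norm ?k" by (rule norm_lattice_vec_ge_1[OF False])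
    have "f k = coeff l (r 0 ?k)"
      using False by (simp add: f_def homogeneous_diag_def leading_homogeneous coeff_scaleC mult.commute)
    then have "g k - f k = coeff l (\<rho> ?k - r 0 ?k)" by (simp add: g_def coeff_diff)
    then have "cmod (g k - f k) \<le> norm (\<rho> ?k - r 0 ?k)" by (simp add: cmod_coeff_le)
    also have "\<dots> \<le> decay_norm 0 (\<rho> ?k - r 0 ?k)"
      by (simp add: decay_norm_def torus_seminorm_def sum_nonneg)
    also have "\<dots> \<le> C / norm ?k ^ Suc CARD('n)" using C(2) k1 by blast
    also have "\<dots> = C * (weight k / max 1 (norm ?k))" using False k1 by (simp add: weight_def)
    also have "\<dots> \<le> E * (weight k / max 1 (norm ?k))"
      using weight_pos[of k] by (intro mult_right_mono) (auto simp: E_def)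
    finally show ?thesis .
  qed
  \<comment> \<open>Forgetting the gain of one power leaves the bound that puts the difference in
    the ideal, so that additivity of the trace applies.\<close>
  have small': "cmod (g k - f k) \<le> E * weight k" for k
  proof (rule order_trans[OF small], rule mult_left_mono)
    show "weight k / max 1 (norm (lattice_vec k)) \<le> weight k"
      using weight_pos[of k] by (simp add: divide_le_eq max_def)
    show "0 \<le> E" using C(1) by (simp add: E_def le_max_iff_disj)
  qed
  note gf = weak_ideal_le_weight[of "\<lambda>k. g k - f k", OF small']
  have "diag g = diag f + diag (\<lambda>k. g k - f k)"
    by (subst diag_add[OF f(1) gf(2)]) simp
  then have "\<phi> (diag g) = \<phi> (diag f) + \<phi> (diag (\<lambda>k. g k - f k))"
    using f(2) gf(1) by (simp add: tr_add)
  also have "\<phi> (diag (\<lambda>k. g k - f k)) = 0" by (rule tr_diag_lower_order[OF small])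
  also have "\<phi> (diag f) = I l"
    unfolding f_def I_def by (rule tr_homogeneous_diag[OF coeff_leading_continuous])
  finally show ?thesis unfolding dia by simp
qed

text \<open>The sum over \<open>l\<close> converges in operator norm before multiplication by
  \<open>D\<close>. The trace after multiplication by \<open>D\<close> is continuous for that norm,
  hence may be taken term by term, and the terms add up to the Fourier series of the integrated
  symbol.\<close>

lemma trace_operator:
  assumes \<phi>: "nc_trace \<phi>" and a: "a \<in> A"
  shows "\<phi> (L a o\<^sub>L bounded_extension \<theta> \<iota> P) = tau (a o\<^sub>L torus_series \<theta> I)"
proof -
  interpret nc_trace \<phi> by (rule \<phi>)
  define \<Phi> where "\<Phi> X = \<phi> (X o\<^sub>L D)" for X
  have W: "X o\<^sub>L D \<in> weak_ideal" if "X \<in> complex_ops" for X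
    by (rule weak_ideal_compose_left[OF D_weak_ideal that])
  have LQ: "L a o\<^sub>L Q l \<in> complex_ops" for l by (intro complex_ops_compose left_mult_complex a Q_complex)
  have LB: "L a o\<^sub>L B \<in> complex_ops" by (intro complex_ops_compose left_mult_complex a B_complex)
  have sumC: "(\<Sum>l\<in>F. L a o\<^sub>L Q l) \<in> complex_ops" for F
    by (induction F rule: infinite_finite_induct) (auto intro: LQ)
  have "\<Phi> 0 = 0" using tr_diff[OF D_weak_ideal D_weak_ideal] by (simp add: \<Phi>_def ocomp.zero_left)
  then have sum: "\<Phi> (\<Sum>l\<in>F. L a o\<^sub>L Q l) = (\<Sum>l\<in>F. \<Phi> (L a o\<^sub>L Q l))" for F
  proof (induction F rule: infinite_finite_induct)
    case (insert l F)
    then show ?case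
      using tr_add[OF W[OF LQ[of l]] W[OF sumC[of F]]] by (simp add: \<Phi>_def ocomp.add_left)
  qed simp_all
  have term_eq: "\<Phi> (L a o\<^sub>L Q l) = tau (a o\<^sub>L (I l *\<^sub>C U l))" for l
  proof -
    have "L a o\<^sub>L Q l = L (a o\<^sub>L U l) o\<^sub>L diag (w l)"
      unfolding Q_def left_mult_compose[OF a U_in_A] by (rule blinfun_compose_assoc'[symmetric])
    then have "\<Phi> (L a o\<^sub>L Q l) = tau (a o\<^sub>L U l) * I l"
      unfolding \<Phi>_def using trace_left_mult_diag[OF \<phi> bounded_w A_compose[OF a U_in_A], of l l]
      by (simp add: trace_diag_symbol[OF \<phi>])
    then show ?thesis by (simp add: scaleC_compose_right[OF A_complex[OF a]] tau_scaleC mult.commute)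
  qed
  have LQs: "((\<lambda>l. L a o\<^sub>L Q l) has_sum (L a o\<^sub>L B)) UNIV"
    by (rule has_sum_bounded_linear[OF ocomp.bounded_linear_right Q_has_sum])
  have "((\<lambda>F. \<Phi> (\<Sum>l\<in>F. L a o\<^sub>L Q l) - \<Phi> (L a o\<^sub>L B)) \<longlongrightarrow> 0) (finite_subsets_at_top UNIV)"
  proof (rule Lim_null_comparison)
    show "\<forall>\<^sub>F F in finite_subsets_at_top UNIV. norm (\<Phi> (\<Sum>l\<in>F. L a o\<^sub>L Q l) - \<Phi> (L a o\<^sub>L B))
        \<le> norm ((\<Sum>l\<in>F. L a o\<^sub>L Q l) - (L a o\<^sub>L B)) * (8 * Re (\<phi> D))"
    proof (rule always_eventually, rule allI)
      fix F
      have "\<Phi> (\<Sum>l\<in>F. L a o\<^sub>L Q l) - \<Phi> (L a o\<^sub>L B) = \<phi> (((\<Sum>l\<in>F. L a o\<^sub>L Q l) - (L a o\<^sub>L B)) o\<^sub>L D)"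
        unfolding \<Phi>_def ocomp.diff_left by (rule tr_diff[symmetric]) (intro W sumC LB)+
      then show "norm (\<Phi> (\<Sum>l\<in>F. L a o\<^sub>L Q l) - \<Phi> (L a o\<^sub>L B))
        \<le> norm ((\<Sum>l\<in>F. L a o\<^sub>L Q l) - (L a o\<^sub>L B)) * (8 * Re (\<phi> D))"
        using tr_compose_bound[OF D_weak_ideal D_positive complex_ops_diff[OF sumC[of F] LB]]
        by (simp add: mult.commute mult.left_commute)
    qed
    show "((\<lambda>F. norm ((\<Sum>l\<in>F. L a o\<^sub>L Q l) - (L a o\<^sub>L B)) * (8 * Re (\<phi> D))) \<longlongrightarrow> 0) (finite_subsets_at_top UNIV)"
      using LQs unfolding has_sum_def by (intro tendsto_mult_left_zero tendsto_norm_zero LIM_zero)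
  qed
  then have "((\<lambda>F. \<Phi> (\<Sum>l\<in>F. L a o\<^sub>L Q l)) \<longlongrightarrow> \<Phi> (L a o\<^sub>L B)) (finite_subsets_at_top UNIV)"
    by (rule LIM_zero_cancel)
  then have "((\<lambda>l. tau (a o\<^sub>L (I l *\<^sub>C U l))) has_sum \<Phi> (L a o\<^sub>L B)) UNIV"
    unfolding has_sum_def sum term_eq .
  moreover have "((\<lambda>l. tau (a o\<^sub>L (I l *\<^sub>C U l))) has_sum tau (a o\<^sub>L torus_series \<theta> I)) UNIV"
    by (rule has_sum_bounded_linear[OF bounded_linear_compose[OF bounded_linear_tau ocomp.bounded_linear_right]
        series_has_sum[OF rapidly_decaying_summable[OF I_rapidly_decaying]]])
  ultimately have "\<Phi> (L a o\<^sub>L B) = tau (a o\<^sub>L torus_series \<theta> I)" by (rule has_sum_unique)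
  then show ?thesis
    unfolding \<Phi>_def bounded_extension_eq by (simp add: blinfun_compose_assoc')
qed

text \<open>The trace produces the integral over the unit ball. \<open>sphere_integral\<close> is
  \<open>CARD('n)\<close> times as large, which the factor \<open>1 / of_nat CARD('n)\<close>
  compensates.\<close>

lemma nc_integral:
  assumes a: "a \<in> A"
  shows "has_nc_integral (L a o\<^sub>L bounded_extension \<theta> \<iota> P) (1 / of_nat CARD('n) * tau (a o\<^sub>L sphere_integral (r 0)))"
  unfolding has_nc_integral_def
proof (intro conjI allI impI)
  show "L a o\<^sub>L bounded_extension \<theta> \<iota> P \<in> weak_trace_class" by (rule operator_weak_trace_class[OF a])
  fix \<phi> :: "('h \<Rightarrow>\<^sub>L 'h) \<Rightarrow> complex"
  assume "positive_trace \<phi> \<and> normalized_trace \<phi>"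
  then have "nc_trace \<phi>" by unfold_locales auto
  then have "\<phi> (L a o\<^sub>L bounded_extension \<theta> \<iota> P) = tau (a o\<^sub>L torus_series \<theta> I)"
    by (rule trace_operator[OF _ a])
  then show "\<phi> (L a o\<^sub>L bounded_extension \<theta> \<iota> P) = 1 / of_nat CARD('n) * tau (a o\<^sub>L sphere_integral (r 0))"
    unfolding sphere_integral_leading scaleC_compose_right[OF A_complex[OF a]] tau_scaleC by simp
qed

end

theorem corollary8p3:
  fixes \<theta> :: "('n::{finite,linorder}) rmat"
    and \<iota> :: "'n torus_op \<Rightarrow> 'h::chilbert_space"
    and P :: "'n torus_op \<Rightarrow> 'n torus_op"
    and r :: "nat \<Rightarrow> 'n rvec \<Rightarrow> 'n torus_op"
    and a :: "'n torus_op"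
  assumes "CARD('n) \<ge> 2"
    and "transpose \<theta> = - \<theta>"
    and "hilbert_completion \<theta> \<iota>"
    and "P \<in> psido \<theta> (- of_nat CARD('n))"
    and "psido_symbols \<theta> (- of_nat CARD('n)) P r"
    and "a \<in> nc_torus \<theta>"
  shows "let aP = left_mult \<theta> \<iota> a o\<^sub>L bounded_extension \<theta> \<iota> P;
             c\<^sub>P = sphere_integral (r 0)
         in strongly_measurable aP \<and>
            c\<^sub>P \<in> smooth_nc_torus \<theta> \<and>
            has_nc_integral aP (1 / of_nat CARD('n) * tau (a o\<^sub>L c\<^sub>P))"
proof -
  obtain \<rho> where \<rho>: "symbol_expansion \<theta> (- of_nat CARD('n)) \<rho> r" "is_quantization \<theta> \<rho> P"
    using assms(5) unfolding psido_symbols_def by (elim exE conjE)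
  interpret order_minus_n \<theta> \<iota> \<rho> r P
    by unfold_locales (use assms \<rho> in auto)
  show ?thesis
    unfolding Let_def strongly_measurable_def
    using nc_integral[OF assms(6)] sphere_integral_smooth by blast
qed

end
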